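(* Let $C$ be a general smooth projective complex curve of genus $4$, canonically embedded in $\mathbb{P}^3$, contained in its unique quadric $Q=Q_C$, which is smooth, and defined in $Q$ by a cubic equation $t\in H^0(Q,\mathcal{O}_Q(3))$. Then the infinitesimal invariant $\delta D_{\gamma_P}(C)\in I_1$ (well defined up to sign) belongs to the direct summand $I_1^3\subset I_1$. Consequently the datum of $\delta D_{\gamma_P}(C)$ is equivalent to that of the cubic $t$: under the isomorphism $I_1^3\cong H^0(Q,\mathcal{O}_Q(3))$ induced by the projection $\pi:I_1\to H^0(Q,\mathcal{O}_Q(3))$, the element $\delta D_{\gamma_P}(C)$ corresponds to a nonzero scalar multiple of $t$.
   Context: Everything is over $\mathbb{C}$. "General" means: for $[C]$ in a nonempty Zariski open subset of the moduli space $\mathcal{M}_4$ of genus $4$ curves. **The Griffiths-Pirola cycle.** A non-hyperelliptic genus $4$ curve, canonically embedded in $\mathbb{P}^3$, is the complete intersection of a unique quadric $Q_C$ and a cubic. Let $U\subset\mathcal{M}_4$ be an open subscheme parametrizing curves for which $Q_C$ is smooth, so $Q_C\cong\mathbb{P}^1\times\mathbb{P}^1$. Let $\widetilde U\to U$ be the étale double cover parametrizing orderings of the two rulings of $Q_C$. Let $\mathcal{C}\to U$ be the universal curve and $\widetilde{\mathcal{C}}=\mathcal{C}\times_U\widetilde U$. For a point of $\widetilde U$ over $[C]$, let $L_1,L_2$ be the restrictions to $C$ of $\mathcal{O}(1,0)$, $\mathcal{O}(0,1)$; both have degree $3$. The assignment $[C]\mapsto L_1-L_2\in\operatorname{Pic}^0(C)$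 is a section $\gamma_P$ of the relative Jacobian over $\widetilde U$. Using the natural identification $\operatorname{Pic}^0(C)=\operatorname{Pic}^0(C^{(2)})$ ($C^{(2)}$ is the symmetric square; $L$ corresponds to the class on $C^{(2)}$ whose pullback to $C\times C$ is $\mathrm{pr}_1^*L+\mathrm{pr}_2^*L$), $\gamma_P$ corresponds to a divisor class $D_{\gamma_P}\in \mathrm{CH}^1(\widetilde{\mathcal{C}}^{(2)/\widetilde U})$ on the relative symmetric square, homologically trivial on fibers. Exchanging the rulings changes $D_{\gamma_P}$ to $-D_{\gamma_P}$ on fibers. **Infinitesimal invariant.** For a smooth projective family $f:X\to B$ and $Z\in \mathrm{CH}^1(X)$ homologically trivial on fibers, $\delta Z(b)$ is the restriction of the Dolbeault class $[Z]\in H^1(X,\Omega_X)$ to $H^1(X_b,\Omega_{X}|_{X_b})$. It lies in $L^1H^1(\Omega_X|_{X_b}):=\ker(H^1(X_b,\Omega_X|_{X_b})\to H^1(X_b,\Omega_{X_b}))$, which equals $\dfrac{\Omega_{B,b}\otimes H^1(\mathcal{O}_{X_b})}{\overline\nabla(H^0(\Omega_{X_b}))}$, where $\overline\nabla$ is induced by the Gauss-Manin connection. **The space $I_1$.** Put $V=H^0(C,K_C)$ (so $V^*=H^1(\mathcal{O}_C)=H^1(\mathcal{O}_{C^{(2)}})$ and $\mathbb{P}^3=\mathbb{P}(V)$ with $H^0(\mathcal{O}_{\mathbb{P}^3}(1))=V$). Let $q\in\operatorname{Sym}^2V$ be the equation of $Q$, and $V_2=\operatorname{Sym}^2V/\mathbb{C}q\cong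 H^0(K_C^{\otimes 2})\cong\Omega_{\mathcal{M}_4,[C]}\cong H^0(\mathcal{O}_Q(2))$. Let $\mu:V\to V^*\otimes V_2=\operatorname{Hom}(V,V_2)$, $\mu(v)(w)=vw$. For the families $\widetilde{\mathcal C}^{(2)/\widetilde U}$ and $\widetilde{\mathcal C}$ the map $\overline\nabla$ is $\mu$, so $\delta D_{\gamma_P}(C)$ lies in $$I_1:=\frac{V^*\otimes V_2}{\mu(V)}.$$ The form $q$ gives an isomorphism $V\cong V^*$. **The projection $\pi$ and the summand $I_1^3$.** The multiplication map $V^*\otimes V_2\cong V\otimes V_2\to H^0(\mathcal{O}_Q(3))$ kills $\mu(V)$ and induces $\pi:I_1\to H^0(\mathcal{O}_Q(3))$. Let $\sigma:H^0(\mathcal{O}_Q(3))=\operatorname{Sym}^3V/(q\cdot V)\to I_1$ be the map sending the class of a cubic $t$ to the class of the linear map $V^*\to V_2$, $\partial\mapsto\partial t$ (elements of $V^*$ acting as constant-coefficient derivations on $\operatorname{Sym}^\bullet V$), viewed in $V\otimes V_2\cong V^*\otimes V_2$ via $q$. Then $I_1^3:=\operatorname{Im}\sigma$; it is a direct summand of $I_1$ mapped isomorphically to $H^0(\mathcal{O}_Q(3))$ by $\pi$. *)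

theory Defs
  imports "HOL-Analysis.Analysis"
begin

text \<open>
  Coordinates. \<open>C\<close> lies in \<open>P(V)\<close> with \<open>H\<^sup>0(O(1)) = V\<close>, so the affine space
  \<open>complex^4\<close> over the projective space is \<open>V\<^sup>*\<close>. Its vectors \<open>p\<close> are (homogeneous coordinates of)
  points, and also the constant-coefficient derivations \<open>u\<close>. A linear form, i.e. an element of
  \<open>V = H\<^sup>0(C, K\<^sub>C)\<close>, is given by its coefficient vector \<open>a\<close>. The elements of \<open>Sym\<^sup>d V\<close> are the
  polynomial functions on \<open>complex^4\<close> that are homogeneous of degree \<open>d\<close>.
\<close>

type_synonym vec4 = "complex^4"
type_synonym form = "vec4 \<Rightarrow> complex"

definition lf :: "vec4 \<Rightarrow> form" where
  "lf a p = (\<Sum>i\<in>UNIV. a $ i * p $ i)"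

definition exps :: "nat \<Rightarrow> (4 \<Rightarrow> nat) set" where
  "exps d = {\<alpha>. (\<Sum>i\<in>UNIV. \<alpha> i) = d}"

definition mon :: "(4 \<Rightarrow> nat) \<Rightarrow> form" where
  "mon \<alpha> p = (\<Prod>i\<in>UNIV. p $ i ^ \<alpha> i)"

definition Form :: "nat \<Rightarrow> form set" where
  "Form d = {f. \<exists>c. \<forall>p. f p = (\<Sum>\<alpha>\<in>exps d. c \<alpha> * mon \<alpha> p)}"

definition BiForm :: "nat \<Rightarrow> nat \<Rightarrow> (vec4 \<Rightarrow> vec4 \<Rightarrow> complex) set" where
  "BiForm m n = {f. \<exists>c. \<forall>p p'. f p p' = (\<Sum>\<alpha>\<in>exps m. \<Sum>\<beta>\<in>exps n. c \<alpha> \<beta> * mon \<alpha> p * mon \<beta> p')}"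

text \<open>\<open>ddir u f p\<close> is the value at \<open>p\<close> of the derivative of \<open>f\<close> in the direction \<open>u\<close>.\<close>

definition ddir :: "vec4 \<Rightarrow> form \<Rightarrow> form" where
  "ddir u f p = deriv (\<lambda>s. f (p + s *s u)) 0"

definition dlog :: "form \<Rightarrow> vec4 \<Rightarrow> vec4 \<Rightarrow> complex" where
  "dlog g p u = ddir u g p / g p"


section \<open>Canonical curves of genus 4 on a smooth quadric, and general curves\<close>

definition curve_cone :: "form \<Rightarrow> form \<Rightarrow> vec4 set" where
  "curve_cone q t = {p. p \<noteq> 0 \<and> q p = 0 \<and> t p = 0}"

definition smooth_quadric :: "form \<Rightarrow> bool" where
  "smooth_quadric q \<longleftrightarrow> q \<in> Form 2 \<and> (\<forall>p. p \<noteq> 0 \<longrightarrow> q p = 0 \<longrightarrow> (\<exists>u. ddir u q p \<noteq> 0))"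

text \<open>
  Pairs \<open>(q, t)\<close> such that \<open>q = 0\<close> is a smooth quadric and \<open>q = t = 0\<close> is a smooth complete
  intersection (Jacobian criterion). These curves are exactly the canonical models of the smooth
  curves of genus 4 with \<open>Q\<^sub>C\<close> smooth.
\<close>

definition canonical_pairs :: "(form \<times> form) set" where
  "canonical_pairs = {(q, t). smooth_quadric q \<and> t \<in> Form 3 \<and>
     (\<forall>p\<in>curve_cone q t. \<forall>a b. (\<forall>u. a * ddir u q p + b * ddir u t p = 0) \<longrightarrow> a = 0 \<and> b = 0)}"

text \<open>
  Polynomial functions on the vector space \<open>Sym\<^sup>2 V \<times> Sym\<^sup>3 V\<close>; evaluations at points span its dual.
\<close>

inductive_set param_polys :: "(form \<times> form \<Rightarrow> complex) set" where
  "(\<lambda>_. c) \<in> param_polys"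
| "(\<lambda>x. fst x p) \<in> param_polys"
| "(\<lambda>x. snd x p) \<in> param_polys"
| "\<lbrakk>\<Phi> \<in> param_polys; \<Psi> \<in> param_polys\<rbrakk> \<Longrightarrow> (\<lambda>x. \<Phi> x + \<Psi> x) \<in> param_polys"
| "\<lbrakk>\<Phi> \<in> param_polys; \<Psi> \<in> param_polys\<rbrakk> \<Longrightarrow> (\<lambda>x. \<Phi> x * \<Psi> x) \<in> param_polys"

text \<open>
  Nonempty Zariski open subsets of the part of the moduli space where \<open>Q\<^sub>C\<close> is smooth, given by
  their preimages under the open surjection from \<open>canonical_pairs\<close>: nonempty Zariski open sets of
  pairs that are saturated for isomorphism of curves. Isomorphic canonical curves are projectively
  equivalent.
\<close>

definition general_locus :: "(form \<times> form) set \<Rightarrow> bool" where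
  "general_locus U \<longleftrightarrow> U \<noteq> {} \<and>
     (\<exists>S \<subseteq> param_polys. U = {x \<in> canonical_pairs. \<exists>\<Phi>\<in>S. \<Phi> x \<noteq> 0}) \<and>
     (\<forall>x\<in>U. \<forall>y\<in>canonical_pairs.
        (\<exists>g :: complex^4^4. invertible g \<and> curve_cone (fst y) (snd y) = (\<lambda>p. g *v p) ` curve_cone (fst x) (snd x))
        \<longrightarrow> y \<in> U)"


section \<open>The space \<open>I\<^sub>1\<close>, the projection \<open>\<pi>\<close> and the summand \<open>I\<^sub>1\<^sup>3\<close>\<close>

definition HomVS2 :: "(vec4 \<Rightarrow> form) set" where
  "HomVS2 = {\<Delta>. (\<forall>a. \<Delta> a \<in> Form 2) \<and> (\<forall>a b p. \<Delta> (a + b) p = \<Delta> a p + \<Delta> b p) \<and>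
                 (\<forall>c a p. \<Delta> (c *s a) p = c * \<Delta> a p)}"

text \<open>
  \<open>I\<^sub>1 = Hom(V, Sym\<^sup>2 V / q) / \<mu>(V)\<close> is the quotient of \<open>Hom(V, Sym\<^sup>2 V)\<close> by the maps
  \<open>w \<mapsto> v w + s(w) q\<close>. Linearity of \<open>s\<close> is automatic.
\<close>

definition I1_rel :: "form \<Rightarrow> ((vec4 \<Rightarrow> form) \<times> (vec4 \<Rightarrow> form)) set" where
  "I1_rel q = {(\<Delta>, \<Delta>'). \<Delta> \<in> HomVS2 \<and> \<Delta>' \<in> HomVS2 \<and>
     (\<exists>v s. \<forall>a p. \<Delta> a p - \<Delta>' a p = lf v p * lf a p + s a * q p)}"

definition I1 :: "form \<Rightarrow> (vec4 \<Rightarrow> form) set set" where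
  "I1 q = HomVS2 // I1_rel q"

definition uminus_I1 :: "(vec4 \<Rightarrow> form) set \<Rightarrow> (vec4 \<Rightarrow> form) set" where
  "uminus_I1 X = (\<lambda>\<Delta> a p. - \<Delta> a p) ` X"

definition cubic_rel :: "form \<Rightarrow> (form \<times> form) set" where
  "cubic_rel q = {(t, t'). t \<in> Form 3 \<and> t' \<in> Form 3 \<and> (\<exists>v. \<forall>p. t p - t' p = lf v p * q p)}"

text \<open>\<open>H\<^sup>0(O\<^sub>Q(3)) = Sym\<^sup>3 V / (q V)\<close>\<close>

definition H0OQ3 :: "form \<Rightarrow> form set set" where
  "H0OQ3 q = Form 3 // cubic_rel q"

definition cubic_class :: "form \<Rightarrow> form \<Rightarrow> form set" where
  "cubic_class q t = cubic_rel q `` {t}"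

text \<open>
  The isomorphism \<open>V\<^sup>* \<rightarrow> V\<close> given by \<open>q\<close> is \<open>u \<mapsto> \<partial>\<^sub>u q\<close>, and \<open>sharp q\<close> is its inverse. The tensor of
  \<open>\<Delta>\<close> is the sum of \<open>e\<^sub>i \<otimes> \<Delta>(z\<^sub>i)\<close> over the standard bases, hence the formula for \<open>\<pi>\<close>; the tensor
  of \<open>\<partial> \<mapsto> \<partial>t\<close> is the sum of \<open>z\<^sub>i \<otimes> \<partial>\<^sub>i t\<close>, which becomes \<open>a \<mapsto> \<partial>t\<close> with \<open>\<partial> = sharp q a\<close>.
\<close>

definition sharp :: "form \<Rightarrow> vec4 \<Rightarrow> vec4" where
  "sharp q a = (THE u. \<forall>p. ddir u q p = lf a p)"

definition proj_pi :: "form \<Rightarrow> (vec4 \<Rightarrow> form) set \<Rightarrow> form set" where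
  "proj_pi q X = (\<Union>\<Delta>\<in>X. cubic_class q (\<lambda>p. \<Sum>i\<in>UNIV. ddir (axis i 1) q p * \<Delta> (axis i 1) p))"

definition sigma_map :: "form \<Rightarrow> form set \<Rightarrow> (vec4 \<Rightarrow> form) set" where
  "sigma_map q Y = (\<Union>t\<in>Y. I1_rel q `` {\<lambda>a. ddir (sharp q a) t})"

definition I13 :: "form \<Rightarrow> (vec4 \<Rightarrow> form) set set" where
  "I13 q = sigma_map q ` H0OQ3 q"


section \<open>The rulings, regular functions and differentials on \<open>C\<close>\<close>

text \<open>
  An ordering of the two rulings, together with coordinates: \<open>Z (i, j) = x\<^sub>i y\<^sub>j\<close> is the Segre
  isomorphism of \<open>Q\<close> with the product of two projective lines with coordinates \<open>x\<close> and \<open>y\<close>. The line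
  bundle \<open>O(1,0)\<close> has sections \<open>x\<^sub>i\<close> and \<open>O(0,1)\<close> has sections \<open>y\<^sub>j\<close>. Transposing \<open>Z\<close> exchanges the
  rulings.
\<close>

type_synonym chart = "2 \<times> 2"

definition ordered_rulings :: "form \<Rightarrow> (chart \<Rightarrow> vec4) \<Rightarrow> bool" where
  "ordered_rulings q Z \<longleftrightarrow>
     (\<forall>p. q p = lf (Z (0, 0)) p * lf (Z (1, 1)) p - lf (Z (0, 1)) p * lf (Z (1, 0)) p)"

text \<open>
  The four affine open sets \<open>U\<^sub>\<alpha> = {Z\<^sub>\<alpha> \<noteq> 0}\<close> cover \<open>Q\<close>. Coherent cohomology of \<open>C\<close> and of \<open>C \<times> C\<close> is
  Cech cohomology for the affine coverings of \<open>C\<close> by the \<open>U\<^sub>\<alpha>\<close> and of \<open>C \<times> C\<close> by the products.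
  Functions and forms are written on the affine cone, with their weight.
\<close>

definition overlap :: "form \<Rightarrow> form \<Rightarrow> (chart \<Rightarrow> vec4) \<Rightarrow> chart \<Rightarrow> chart \<Rightarrow> vec4 set" where
  "overlap q t Z \<alpha> \<beta> = {p \<in> curve_cone q t. lf (Z \<alpha>) p \<noteq> 0 \<and> lf (Z \<beta>) p \<noteq> 0}"

text \<open>Sections of \<open>O\<^sub>C(d)\<close> over the intersection of \<open>U\<^sub>\<alpha>\<close> and \<open>U\<^sub>\<beta>\<close>\<close>

definition regular ::
  "form \<Rightarrow> form \<Rightarrow> (chart \<Rightarrow> vec4) \<Rightarrow> int \<Rightarrow> chart \<Rightarrow> chart \<Rightarrow> form \<Rightarrow> bool" where
  "regular q t Z d \<alpha> \<beta> f \<longleftrightarrow> (\<exists>N m. \<exists>P\<in>Form m. int m = d + 2 * int N \<and>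
     (\<forall>p\<in>overlap q t Z \<alpha> \<beta>. f p = P p / (lf (Z \<alpha>) p * lf (Z \<beta>) p) ^ N))"

text \<open>Sections over \<open>U\<^sub>\<alpha> \<times> U\<^sub>\<alpha>\<^sub>'\<close> of the line bundle \<open>O(d, d')\<close> on \<open>C \<times> C\<close>\<close>

definition biregular ::
  "form \<Rightarrow> form \<Rightarrow> (chart \<Rightarrow> vec4) \<Rightarrow> int \<Rightarrow> int \<Rightarrow> chart \<Rightarrow> chart \<Rightarrow> (vec4 \<Rightarrow> vec4 \<Rightarrow> complex) \<Rightarrow> bool"
where
  "biregular q t Z d d' \<alpha> \<alpha>' f \<longleftrightarrow>
     (\<exists>N N' m m'. \<exists>P\<in>BiForm m m'. int m = d + int N \<and> int m' = d' + int N' \<and>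
       (\<forall>p\<in>overlap q t Z \<alpha> \<alpha>. \<forall>p'\<in>overlap q t Z \<alpha>' \<alpha>'.
          f p p' = P p p' / (lf (Z \<alpha>) p ^ N * lf (Z \<alpha>') p' ^ N')))"

definition tangent_cone :: "form \<Rightarrow> form \<Rightarrow> vec4 \<Rightarrow> vec4 set" where
  "tangent_cone q t p = {u. ddir u q p = 0 \<and> ddir u t p = 0}"

text \<open>
  Sections of \<open>\<Omega>\<^sub>C\<close> over \<open>U\<^sub>\<alpha>\<close>: \<open>\<theta> p\<close> is a linear form on the tangent space of the cone at \<open>p\<close>, killing
  the Euler vector \<open>p\<close> and invariant under scaling.
\<close>

definition one_form ::
  "form \<Rightarrow> form \<Rightarrow> (chart \<Rightarrow> vec4) \<Rightarrow> chart \<Rightarrow> (vec4 \<Rightarrow> vec4 \<Rightarrow> complex) \<Rightarrow> bool" where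
  "one_form q t Z \<alpha> \<theta> \<longleftrightarrow> (\<exists>a. (\<forall>i::4. regular q t Z (- 1) \<alpha> \<alpha> (a i)) \<and>
     (\<forall>p\<in>overlap q t Z \<alpha> \<alpha>. \<theta> p p = 0 \<and>
        (\<forall>u\<in>tangent_cone q t p. \<theta> p u = (\<Sum>i\<in>UNIV. a i p * u $ i))))"

text \<open>Equality of the classes in \<open>H\<^sup>1(C, K\<^sub>C)\<close> of two Cech cocycles\<close>

definition cohomologous_K ::
  "form \<Rightarrow> form \<Rightarrow> (chart \<Rightarrow> vec4) \<Rightarrow> (chart \<Rightarrow> chart \<Rightarrow> vec4 \<Rightarrow> vec4 \<Rightarrow> complex) \<Rightarrow>
    (chart \<Rightarrow> chart \<Rightarrow> vec4 \<Rightarrow> vec4 \<Rightarrow> complex) \<Rightarrow> bool" where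
  "cohomologous_K q t Z \<psi> \<psi>' \<longleftrightarrow> (\<exists>\<theta>. (\<forall>\<alpha>. one_form q t Z \<alpha> (\<theta> \<alpha>)) \<and>
     (\<forall>\<alpha> \<beta>. \<forall>p\<in>overlap q t Z \<alpha> \<beta>. \<forall>u\<in>tangent_cone q t p.
        \<psi> \<alpha> \<beta> p u - \<psi>' \<alpha> \<beta> p u = \<theta> \<beta> p u - \<theta> \<alpha> p u))"

text \<open>
  The Poincare residue of the form \<open>\<Omega> / (q t)\<close>, with \<open>\<Omega>\<close> the contraction of
  \<open>dz\<^sub>0 dz\<^sub>1 dz\<^sub>2 dz\<^sub>3\<close> with the Euler field. It has values in \<open>O\<^sub>C(-1)\<close> and trivializes \<open>K\<^sub>C(-1)\<close>.
  The identification of \<open>V\<close> with \<open>H\<^sup>0(C, K\<^sub>C)\<close> is \<open>a \<mapsto> lf a * residue\<close>, and that of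
  \<open>V\<^sub>2 = Sym\<^sup>2 V / q\<close> with the quadratic differentials is \<open>A \<mapsto> A * residue\<^sup>2\<close>.
\<close>

definition residue_form :: "form \<Rightarrow> form \<Rightarrow> vec4 \<Rightarrow> vec4 \<Rightarrow> complex" where
  "residue_form q t p u = (THE c. \<forall>a b.
     c * (ddir a q p * ddir b t p - ddir b q p * ddir a t p) = det (vector [p, u, a, b] :: complex^4^4))"


section \<open>The family of curves and the infinitesimal invariant\<close>

text \<open>
  The family is \<open>X = {(p, t). q p = t p = 0}\<close> over the space \<open>W\<close> of cubics \<open>t \<in> Sym\<^sup>3 V\<close> for which the
  curve is smooth, \<open>q\<close> being fixed. Together with \<open>Z\<close> it is the pullback of the universal curve by
  a smooth surjective map from \<open>W\<close> to the double cover of \<open>U\<close>, so that cotangent vectors (and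
  with them \<open>I\<^sub>1\<close>) inject under pullback to \<open>W\<close>. A tangent vector of \<open>W\<close> is a cubic \<open>G\<close>. Vectors
  tangent to (the cone over) \<open>X\<close> at \<open>(p, t)\<close> are the pairs \<open>(u, G)\<close> with
  \<open>\<partial>\<^sub>u q = 0\<close> and \<open>\<partial>\<^sub>u t + G = 0\<close> at \<open>p\<close>.

  A Kodaira-Spencer lift of \<open>G\<close> is a family of vector fields \<open>(v\<^sub>\<alpha>, G)\<close> tangent to \<open>X\<close> over \<open>U\<^sub>\<alpha>\<close>; the
  differences \<open>v\<^sub>\<beta> - v\<^sub>\<alpha>\<close> represent the Kodaira-Spencer class of \<open>G\<close> in \<open>H\<^sup>1(C, T\<^sub>C)\<close>.
\<close>

definition KS_lift ::
  "form \<Rightarrow> form \<Rightarrow> (chart \<Rightarrow> vec4) \<Rightarrow> form \<Rightarrow> (chart \<Rightarrow> vec4 \<Rightarrow> vec4) \<Rightarrow> bool" where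
  "KS_lift q t Z G v \<longleftrightarrow> (\<forall>\<alpha>. (\<forall>i. regular q t Z 1 \<alpha> \<alpha> (\<lambda>p. v \<alpha> p $ i)) \<and>
     (\<forall>p\<in>overlap q t Z \<alpha> \<alpha>. ddir (v \<alpha> p) q p = 0 \<and> ddir (v \<alpha> p) t p + G p = 0))"

text \<open>
  Transition functions on the intersection of \<open>U\<^sub>\<alpha>\<close> and \<open>U\<^sub>\<beta>\<close>, for \<open>\<alpha> = (i,j)\<close> and \<open>\<beta> = (k,l)\<close>:
  \<open>x\<^sub>i / x\<^sub>k\<close> for \<open>L\<^sub>1\<close> and \<open>y\<^sub>j / y\<^sub>l\<close> for \<open>L\<^sub>2\<close>.
\<close>

definition trans_L1 :: "(chart \<Rightarrow> vec4) \<Rightarrow> chart \<Rightarrow> chart \<Rightarrow> form" where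
  "trans_L1 Z \<alpha> \<beta> p = lf (Z (fst \<alpha>, snd \<alpha>)) p / lf (Z (fst \<beta>, snd \<alpha>)) p"

definition trans_L2 :: "(chart \<Rightarrow> vec4) \<Rightarrow> chart \<Rightarrow> chart \<Rightarrow> form" where
  "trans_L2 Z \<alpha> \<beta> p = lf (Z (fst \<alpha>, snd \<alpha>)) p / lf (Z (fst \<alpha>, snd \<beta>)) p"

definition trans_gamma :: "(chart \<Rightarrow> vec4) \<Rightarrow> chart \<Rightarrow> chart \<Rightarrow> form" where
  "trans_gamma Z \<alpha> \<beta> p = trans_L1 Z \<alpha> \<beta> p / trans_L2 Z \<alpha> \<beta> p"

text \<open>
  The pullback to the fibre square of \<open>X\<close> over \<open>W\<close> of the class \<open>D\<close> on the relative symmetric square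
  is \<open>pr\<^sub>1\<^sup>* L + pr\<^sub>2\<^sup>* L\<close> with \<open>L = L\<^sub>1 - L\<^sub>2\<close>. Its transition functions are defined
  on the products of two overlaps.
\<close>

definition trans_D :: "(chart \<Rightarrow> vec4) \<Rightarrow> chart \<times> chart \<Rightarrow> chart \<times> chart \<Rightarrow> vec4 \<Rightarrow> vec4 \<Rightarrow> complex"
where
  "trans_D Z \<kappa> \<nu> p p' = trans_gamma Z (fst \<kappa>) (fst \<nu>) p * trans_gamma Z (snd \<kappa>) (snd \<nu>) p'"

definition dlog2 :: "(vec4 \<Rightarrow> vec4 \<Rightarrow> complex) \<Rightarrow> vec4 \<Rightarrow> vec4 \<Rightarrow> vec4 \<Rightarrow> vec4 \<Rightarrow> complex" where
  "dlog2 g p p' u u' = deriv (\<lambda>s. g (p + s *s u) (p' + s *s u')) 0 / g p p'"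

definition tangent_sq :: "form \<Rightarrow> form \<Rightarrow> vec4 \<Rightarrow> vec4 \<Rightarrow> (vec4 \<times> vec4 \<times> form) set" where
  "tangent_sq q t p p' = {(u, u', G). G \<in> Form 3 \<and>
     ddir u q p = 0 \<and> ddir u t p + G p = 0 \<and> ddir u' q p' = 0 \<and> ddir u' t p' + G p' = 0}"

text \<open>
  Sections over \<open>U\<^sub>\<alpha> \<times> U\<^sub>\<alpha>\<^sub>'\<close> of the restriction to \<open>C \<times> C\<close> of the cotangent bundle of the fibre
  square of \<open>X\<close> over \<open>W\<close>
\<close>

definition section_sq ::
  "form \<Rightarrow> form \<Rightarrow> (chart \<Rightarrow> vec4) \<Rightarrow> chart \<times> chart \<Rightarrow>
    (vec4 \<Rightarrow> vec4 \<Rightarrow> vec4 \<times> vec4 \<times> form \<Rightarrow> complex) \<Rightarrow> bool" where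
  "section_sq q t Z \<kappa> \<omega> \<longleftrightarrow> (\<exists>a b c.
     (\<forall>i::4. biregular q t Z (- 1) 0 (fst \<kappa>) (snd \<kappa>) (a i)) \<and>
     (\<forall>i::4. biregular q t Z 0 (- 1) (fst \<kappa>) (snd \<kappa>) (b i)) \<and>
     (\<forall>G\<in>Form 3. biregular q t Z 0 0 (fst \<kappa>) (snd \<kappa>) (c G)) \<and>
     (\<forall>p\<in>overlap q t Z (fst \<kappa>) (fst \<kappa>). \<forall>p'\<in>overlap q t Z (snd \<kappa>) (snd \<kappa>).
        (\<forall>G\<in>Form 3. \<forall>H\<in>Form 3. c (\<lambda>x. G x + H x) p p' = c G p p' + c H p p') \<and>
        (\<forall>G\<in>Form 3. \<forall>r. c (\<lambda>x. r * G x) p p' = r * c G p p') \<and>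
        \<omega> p p' (p, 0, \<lambda>_. 0) = 0 \<and> \<omega> p p' (0, p', \<lambda>_. 0) = 0 \<and>
        (\<forall>(u, u', G)\<in>tangent_sq q t p p'. \<omega> p p' (u, u', G) =
           (\<Sum>i\<in>UNIV. a i p p' * u $ i) + (\<Sum>i\<in>UNIV. b i p p' * u' $ i) + c G p p')))"

text \<open>
  Cech cocycles representing elements of \<open>\<Omega>\<^sub>W \<otimes> H\<^sup>1(O\<^sub>C)\<close>: linear maps from tangent vectors \<open>G\<close> of
  \<open>W\<close> to 1-cocycles with values in \<open>O\<^sub>C\<close>
\<close>

definition cocycle_WO ::
  "form \<Rightarrow> form \<Rightarrow> (chart \<Rightarrow> vec4) \<Rightarrow> (form \<Rightarrow> chart \<Rightarrow> chart \<Rightarrow> form) \<Rightarrow> bool" where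
  "cocycle_WO q t Z e \<longleftrightarrow>
     (\<forall>G\<in>Form 3. \<forall>\<alpha> \<beta>. regular q t Z 0 \<alpha> \<beta> (e G \<alpha> \<beta>)) \<and>
     (\<forall>\<alpha> \<beta>. \<forall>p\<in>overlap q t Z \<alpha> \<beta>.
        (\<forall>G\<in>Form 3. \<forall>H\<in>Form 3. e (\<lambda>x. G x + H x) \<alpha> \<beta> p = e G \<alpha> \<beta> p + e H \<alpha> \<beta> p) \<and>
        (\<forall>G\<in>Form 3. \<forall>r. e (\<lambda>x. r * G x) \<alpha> \<beta> p = r * e G \<alpha> \<beta> p)) \<and>
     (\<forall>G\<in>Form 3. \<forall>\<alpha> \<beta> \<gamma>. \<forall>p\<in>overlap q t Z \<alpha> \<beta> \<inter> overlap q t Z \<beta> \<gamma>.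
        e G \<alpha> \<gamma> p = e G \<alpha> \<beta> p + e G \<beta> \<gamma> p)"

text \<open>
  The class \<open>dlog\<close> of \<open>D\<close> in \<open>H\<^sup>1\<close> of the restricted cotangent bundle is the image of \<open>e\<close>.
  Here \<open>H\<^sup>1(O\<^sub>C)\<close> is identified with \<open>H\<^sup>1\<close> of the structure sheaf of the symmetric square as for
  \<open>Pic\<^sup>0\<close>, by \<open>h \<mapsto> pr\<^sub>1\<^sup>* h + pr\<^sub>2\<^sup>* h\<close>. The equality is tested on \<open>C \<times> C\<close>: pullback by
  the quotient map from \<open>C \<times> C\<close> to the symmetric square identifies \<open>H\<^sup>1\<close> of the restricted cotangent
  bundle of the relative symmetric square with the invariants of \<open>H\<^sup>1\<close> upstairs.
\<close>

definition dolbeault_class_is ::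
  "form \<Rightarrow> form \<Rightarrow> (chart \<Rightarrow> vec4) \<Rightarrow> (form \<Rightarrow> chart \<Rightarrow> chart \<Rightarrow> form) \<Rightarrow> bool" where
  "dolbeault_class_is q t Z e \<longleftrightarrow> (\<exists>\<omega>. (\<forall>\<kappa>. section_sq q t Z \<kappa> (\<omega> \<kappa>)) \<and>
     (\<forall>\<kappa> \<nu>. \<forall>p\<in>overlap q t Z (fst \<kappa>) (fst \<nu>). \<forall>p'\<in>overlap q t Z (snd \<kappa>) (snd \<nu>).
        \<forall>(u, u', G)\<in>tangent_sq q t p p'.
          dlog2 (trans_D Z \<kappa> \<nu>) p p' u u' =
            e G (fst \<kappa>) (fst \<nu>) p + e G (snd \<kappa>) (snd \<nu>) p' +
            \<omega> \<nu> p p' (u, u', G) - \<omega> \<kappa> p p' (u, u', G)))"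

text \<open>
  \<open>\<Delta> \<in> V\<^sup>* \<otimes> V\<^sub>2\<close> corresponds to \<open>e\<close> under the Serre dualities
  \<open>V\<^sup>* = H\<^sup>1(O\<^sub>C)\<close> and \<open>V\<^sub>2 = H\<^sup>1(T\<^sub>C)\<^sup>*\<close> (the cotangent space of moduli): for all \<open>a \<in> V\<close>
  and all \<open>G\<close>, the cup product of \<open>e(G) \<in> H\<^sup>1(O\<^sub>C)\<close> with \<open>a \<in> H\<^sup>0(K\<^sub>C)\<close> equals that of
  \<open>\<Delta>(a) \<in> H\<^sup>0(K\<^sub>C\<^sup>2)\<close> with the Kodaira-Spencer class of \<open>G\<close>. Both lie in \<open>H\<^sup>1(K\<^sub>C)\<close>, so no
  choice of a trace map is needed.
\<close>

definition serre_matches ::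
  "form \<Rightarrow> form \<Rightarrow> (chart \<Rightarrow> vec4) \<Rightarrow> (form \<Rightarrow> chart \<Rightarrow> chart \<Rightarrow> form) \<Rightarrow> (vec4 \<Rightarrow> form) \<Rightarrow> bool" where
  "serre_matches q t Z e \<Delta> \<longleftrightarrow> (\<forall>a. \<forall>G\<in>Form 3. \<exists>v. KS_lift q t Z G v \<and>
     cohomologous_K q t Z
       (\<lambda>\<alpha> \<beta> p u. e G \<alpha> \<beta> p * (lf a p * residue_form q t p u))
       (\<lambda>\<alpha> \<beta> p u. \<Delta> a p * residue_form q t p (v \<beta> p - v \<alpha> p) * residue_form q t p u))"

text \<open>
  The infinitesimal invariant, as a subset of \<open>Hom(V, Sym\<^sup>2 V)\<close>: all representatives of the
  element of \<open>I\<^sub>1\<close>.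
\<close>

definition inf_invariant :: "form \<Rightarrow> form \<Rightarrow> (chart \<Rightarrow> vec4) \<Rightarrow> (vec4 \<Rightarrow> form) set" where
  "inf_invariant q t Z = {\<Delta> \<in> HomVS2. \<exists>e. cocycle_WO q t Z e \<and>
     dolbeault_class_is q t Z e \<and> serre_matches q t Z e \<Delta>}"

end

theory Submission
  imports
    Defs
    "HOL-Library.Poly_Mapping"
    "HOL-Computational_Algebra.Field_as_Ring"
    "HOL-Computational_Algebra.Polynomial_Factorial"
    "HOL-Computational_Algebra.Fundamental_Theorem_Algebra"
begin

text \<open>
  On \<open>C\<close> the logarithmic derivative of the transition function of \<open>L\<^sub>1 - L\<^sub>2\<close> from \<open>\<alpha>\<close> to \<open>\<beta>\<close> is
  \<open>\<phi>\<^sub>\<beta> - \<phi>\<^sub>\<alpha>\<close> times the residue form, where \<open>\<phi>\<^sub>\<alpha> = \<plusminus> \<partial>t / (D z\<^sub>\<alpha>)\<close>, \<open>\<partial>\<close> is the derivation dual to the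
  coordinate \<open>z\<close> of the chart opposite to \<open>\<alpha>\<close>, and \<open>1 / D\<close> is the determinant of the coordinates \<open>Z\<close>. The
  \<open>\<phi>\<^sub>\<alpha>\<close> are unique up to a common linear form \<open>v\<close>, as \<open>H\<^sup>0(O\<^sub>C(1)) = V\<close>. A cubic \<open>G\<close> lifts on \<open>U\<^sub>\<alpha>\<close> to the
  vector field \<open>- G w\<^sub>\<alpha>\<close>, where \<open>w\<^sub>\<alpha>\<close> is tangent to the quadric and \<open>t\<close> has derivative 1 along it; it exists by the
  Nullstellensatz. With these lifts the \<open>\<phi>\<^sub>\<alpha>\<close> give an explicit cocycle \<open>e(G)\<close>, and \<open>e(G) a\<close> is cohomologous
  to the product of \<open>\<partial>\<^sub>a t / D + v a\<close> with the Kodaira-Spencer class, for \<open>\<partial>\<^sub>a\<close> corresponding to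
  \<open>a\<close> under \<open>q\<close>. So the class of \<open>\<sigma>(t / D)\<close> lies in the infinitesimal invariant. It is all of it: a
  quadratic differential that pairs to zero with all \<open>G\<close> vanishes, which is a computation with the
  Laurent polynomials on the torus where all \<open>z\<^sub>\<alpha> \<noteq> 0\<close>. By Euler's formula \<open>\<pi> \<sigma>\<close> is multiplication by 3, and
  \<open>1 / D\<^sup>2\<close> is the Gram determinant of \<open>q\<close>, so another choice of \<open>Z\<close> changes only the sign.
\<close>

subsection \<open>Plane curves\<close>

text \<open>The objects are functions given by their values on the cone over the curve, whereas
  cohomology needs modules of sections. The bridge is a single ring: on the torus x y \<noteq> 0 all
  four charts overlap, a section over a chart becomes a Laurent polynomial modulo the equation T of
  the curve, and its regularity becomes a half-plane condition on exponents. Vanishing theorems on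
  the quadric turn into bookkeeping with exponents. Smoothness enters twice. It makes T squarefree
  and excludes lines of the rulings from the curve, so that a function vanishing at the torus points
  of the curve is a multiple of T. It also makes the Jacobian ideal the unit ideal, so that a
  direction transverse to the curve exists over a whole chart at once. The class itself lives on C x
  C; it is restricted to C by fixing the second point p0 and letting it move along with the family.
  Smoothness of the quadric and of the curve is the only genericity involved, so the open set is the
  whole of \<open>canonical_pairs\<close>, and a Fermat pair shows that it is nonempty.\<close>

definition poly2 :: "complex poly poly \<Rightarrow> complex \<Rightarrow> complex \<Rightarrow> complex" where
  "poly2 f x y = poly (poly f [:y:]) x"

text \<open>In \<open>complex poly poly\<close> the outer variable is y and the coefficients are
  polynomials in x. So \<open>degree\<close> and \<open>pderiv\<close> refer to y,
  \<open>spec x\<close> restricts to a vertical line, and \<open>dx\<close> differentiates the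
  coefficients.\<close>

definition spec :: "complex \<Rightarrow> complex poly poly \<Rightarrow> complex poly" where
  "spec x f = map_poly (\<lambda>c. poly c x) f"

definition dx :: "complex poly poly \<Rightarrow> complex poly poly" where
  "dx f = map_poly pderiv f"

lemma poly2_simps [simp]:
  "poly2 (f + g) x y = poly2 f x y + poly2 g x y"
  "poly2 (f - g) x y = poly2 f x y - poly2 g x y"
  "poly2 (f * g) x y = poly2 f x y * poly2 g x y"
  "poly2 (- f) x y = - poly2 f x y"
  "poly2 0 x y = 0" "poly2 1 x y = 1"
  "poly2 (f ^ n) x y = poly2 f x y ^ n"
  "poly2 [:c:] x y = poly c x"
  "poly2 (smult c f) x y = poly c x * poly2 f x y"
  "poly2 (pCons c f) x y = poly c x + y * poly2 f x y"
  by (simp_all add: poly2_def)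

lemma poly2_sum [simp]: "poly2 (\<Sum>i\<in>I. f i) x y = (\<Sum>i\<in>I. poly2 (f i) x y)"
  by (induction I rule: infinite_finite_induct) auto

lemma coeff_spec [simp]: "coeff (spec x f) b = poly (coeff f b) x"
  by (simp add: spec_def coeff_map_poly)

lemma spec_simps [simp]:
  "spec x (f + g) = spec x f + spec x g"
  "spec x (f - g) = spec x f - spec x g"
  "spec x (f * g) = spec x f * spec x g"
  "spec x 0 = 0" "spec x 1 = 1"
  by (simp_all add: poly_eq_iff coeff_mult poly_sum)

lemma poly2_spec: "poly2 f x y = poly (spec x f) y"
  by (induction f) (auto simp: spec_def map_poly_pCons)

lemma infinite_nonzero: "infinite {x::complex. x \<noteq> 0}"
proof -
  have "infinite (UNIV :: complex set)" by (simp add: infinite_UNIV_char_0)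
  then have "infinite (UNIV - {0::complex})" by simp
  then show ?thesis by (simp add: set_diff_eq)
qed

text \<open>Finiteness of roots is used twice: in y on each of the vertical lines, then in x for
  each coefficient.\<close>

lemma poly2_eq_0_generic:
  assumes "infinite X" "\<And>x. x \<in> X \<Longrightarrow> infinite {y. poly2 f x y = 0}"
  shows "f = 0"
proof (rule poly_eqI)
  fix b
  have "poly (coeff f b) x = 0" if "x \<in> X" for x
  proof -
    have "infinite {y. poly (spec x f) y = 0}" using assms(2)[OF that] by (simp add: poly2_spec)
    then have "spec x f = 0" using poly_roots_finite by blast
    then show ?thesis by (metis coeff_0 coeff_spec)
  qed
  then have "X \<subseteq> {x. poly (coeff f b) x = 0}" by auto
  with assms(1) have "infinite {x. poly (coeff f b) x = 0}" using finite_subset by blast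
  then show "coeff f b = coeff 0 b" using poly_roots_finite[of "coeff f b"] by auto
qed

lemma poly2_eqI:
  assumes "\<And>x y. x \<noteq> 0 \<Longrightarrow> y \<noteq> 0 \<Longrightarrow> poly2 f x y = poly2 g x y"
  shows "f = g"
proof -
  have "f - g = 0"
  proof (rule poly2_eq_0_generic[OF infinite_nonzero])
    fix x :: complex assume "x \<in> {x. x \<noteq> 0}"
    then have "{y. y \<noteq> 0} \<subseteq> {y. poly2 (f - g) x y = 0}" using assms by auto
    then show "infinite {y. poly2 (f - g) x y = 0}"
      using infinite_nonzero finite_subset by blast
  qed
  then show ?thesis by simp
qed

lemma coeff_dx [simp]: "coeff (dx f) b = pderiv (coeff f b)"
  by (simp add: dx_def coeff_map_poly)

lemma dx_pCons [simp]: "dx (pCons c f) = pCons (pderiv c) (dx f)"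
  by (simp add: dx_def map_poly_pCons)

lemma dx_mult: "dx (f * g) = dx f * g + f * dx g"
proof -
  have *: "pderiv (\<Sum>i\<in>A. h i) = (\<Sum>i\<in>A. pderiv (h i))" for A and h :: "nat \<Rightarrow> complex poly"
    by (induction A rule: infinite_finite_induct) (auto simp: pderiv_add)
  show ?thesis
    by (rule poly_eqI) (auto simp: coeff_mult * pderiv_mult sum.distrib[symmetric] intro!: sum.cong)
qed

lemma has_deriv_x: "((\<lambda>x. poly2 f x y) has_field_derivative poly2 (dx f) x y) (at x)"
proof (induction f)
  case 0
  then show ?case by (simp add: dx_def)
next
  case (pCons a p)
  show ?case using pCons by (auto intro!: derivative_eq_intros poly_DERIV)
qed

lemma has_deriv_y: "((\<lambda>y. poly2 f x y) has_field_derivative poly2 (pderiv f) x y) (at y)"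
proof -
  have "spec x (pderiv f) = pderiv (spec x f)"
    by (rule poly_eqI) (simp add: coeff_pderiv)
  then show ?thesis unfolding poly2_spec using poly_DERIV by metis
qed

lemma nonunit_root:
  assumes "\<not> is_unit (f :: complex poly)"
  shows "\<exists>x. poly f x = 0"
  using assms fundamental_theorem_of_algebra_alt[of f]
  by (metis is_unit_pCons_iff degree_pCons_0 is_unit_iff_degree pCons_eq_0_iff)

text \<open>If y occurs, x is chosen off the zeros of the leading coefficient; the restriction to
  that vertical line is then still nonconstant and has a root.\<close>

lemma nonunit_root2:
  assumes "\<not> is_unit (f :: complex poly poly)"
  shows "\<exists>x y. poly2 f x y = 0"
proof (cases "degree f = 0")
  case True
  then obtain c where c: "f = [:c:]" by (metis degree_eq_zeroE)
  with assms have "\<not> is_unit c" by (simp add: is_unit_const_poly_iff)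
  then show ?thesis using nonunit_root c by auto
next
  case False
  then have "lead_coeff f \<noteq> 0" by auto
  then obtain x where x: "poly (lead_coeff f) x \<noteq> 0" using poly_all_0_iff_0 by blast
  have "degree (spec x f) > 0"
    using le_degree[of "spec x f" "degree f"] x False by simp
  then have "\<exists>y. poly (spec x f) y = 0"
    by (metis constant_degree fundamental_theorem_of_algebra less_irrefl)
  then show ?thesis by (auto simp: poly2_spec)
qed

text \<open>Elimination of y. An element h of least y-degree in the ideal of f and g divides both up
  to factors c, c' from the coefficient ring, by pseudo-division. Since f and g are coprime, h
  divides c c' and so does not involve y.\<close>

lemma coprime_bezout_const:
  fixes f g :: "complex poly poly"
  assumes "coprime f g" "f \<noteq> 0"
  shows "\<exists>a b r. r \<noteq> 0 \<and> a * f + b * g = [:r:]"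
proof -
  define I where "I = {h. h \<noteq> 0 \<and> (\<exists>a b. h = a * f + b * g)}"
  have "f = 1 * f + 0 * g" by simp
  then have "f \<in> I" unfolding I_def using assms(2) by blast
  then obtain h where h: "h \<in> I" and hmin: "\<And>k. k \<in> I \<Longrightarrow> degree h \<le> degree k"
    using ex_has_least_nat[of "\<lambda>h. h \<in> I" f degree] by auto
  obtain a b where ab: "h = a * f + b * g" and h0: "h \<noteq> 0" using h by (auto simp: I_def)
  have red: "\<exists>c q. c \<noteq> 0 \<and> smult c k = h * q" if k: "k = a' * f + b' * g" for k a' b'
  proof -
    obtain c q where c: "c \<noteq> 0" "smult c k = h * q + pseudo_mod k h"
      using pseudo_mod(1)[OF h0, of k] by blast
    have "pseudo_mod k h = 0"
    proof (rule ccontr)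
      assume nz: "pseudo_mod k h \<noteq> 0"
      have "pseudo_mod k h = smult c k - h * q" using c by simp
      also have "\<dots> = ([:c:] * a' - q * a) * f + ([:c:] * b' - q * b) * g"
        by (simp add: k ab algebra_simps smult_add_right)
      finally have "pseudo_mod k h \<in> I" using nz by (auto simp: I_def)
      then have "degree h \<le> degree (pseudo_mod k h)" using hmin by blast
      with pseudo_mod(2)[OF h0, of k] nz have "degree h = 0" "degree (pseudo_mod k h) < degree h" by auto
      then show False by simp
    qed
    then show ?thesis using c by auto
  qed
  have "f = 1 * f + 0 * g" "g = 0 * f + 1 * g" by auto
  then obtain c q c' q' where c: "c \<noteq> 0" "smult c f = h * q" and c': "c' \<noteq> 0" "smult c' g = h * q'"
    using red by metis
  have "h dvd [:c:] * f" "h dvd [:c':] * g" using c c' by auto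
  then have "h dvd [:c':] * ([:c:] * f)" "h dvd [:c:] * ([:c':] * g)" using dvd_mult by blast+
  then have "h dvd [:c * c':] * f" "h dvd [:c * c':] * g"
    by (simp_all add: mult.commute)
  then have "h dvd gcd ([:c * c':] * f) ([:c * c':] * g)" by simp
  also have "gcd ([:c * c':] * f) ([:c * c':] * g) = normalize ([:c * c':] * gcd f g)"
    by (rule gcd_mult_left)
  finally have "h dvd [:c * c':]" using assms(1) by (simp add: coprime_iff_gcd_eq_1)
  moreover have "[:c * c':] \<noteq> 0" using c c' by simp
  ultimately have "degree h \<le> degree [:c * c':]" using dvd_imp_degree_le by blast
  then have "degree h = 0" by simp
  then obtain r where "h = [:r:]" by (metis degree_eq_zeroE)
  with h0 ab show ?thesis by (metis pCons_0_0)
qed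

section \<open>The ideal of a smooth affine plane curve\<close>

locale smooth_affine_curve =
  fixes T :: "complex poly poly"
  assumes smooth: "poly2 T x y = 0 \<Longrightarrow> poly2 (dx T) x y \<noteq> 0 \<or> poly2 (pderiv T) x y \<noteq> 0"
    and no_vertical: "\<exists>y. poly2 T x y \<noteq> 0"
begin

lemma T_nonzero: "T \<noteq> 0"
  using no_vertical[of 0] by auto

text \<open>At a zero of H the product H H K and both its partial derivatives vanish, so the curve
  would be singular there.\<close>

lemma square_factor_unit:
  assumes "H * H dvd T"
  shows "is_unit H"
proof (rule ccontr)
  assume "\<not> is_unit H"
  then obtain x y where xy: "poly2 H x y = 0" using nonunit_root2 by blast
  obtain K where K: "T = H * H * K" using assms by blast
  have "poly2 T x y = 0" "poly2 (dx T) x y = 0" "poly2 (pderiv T) x y = 0"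
    by (simp_all add: K xy dx_mult pderiv_mult)
  with smooth show False by blast
qed

lemma factor_degree_pos:
  assumes "H dvd T" "\<not> is_unit H"
  shows "degree H > 0"
proof (rule ccontr)
  assume "\<not> degree H > 0"
  then obtain c where c: "H = [:c:]" by (metis degree_eq_zeroE gr0I)
  with assms have "\<not> is_unit c" by (simp add: is_unit_const_poly_iff)
  then obtain x where "poly c x = 0" using nonunit_root by blast
  then have "poly2 T x y = 0" for y using assms(1) c by (auto elim!: dvdE)
  with no_vertical show False by blast
qed

text \<open>Let T = H K with H a common prime factor of T and its y-derivative. Then H divides K
  times the y-derivative of H, hence K because of degrees, and H would be a multiple factor of T.
  The absence of vertical lines guarantees that H involves y.\<close>

lemma coprime_T_dy: "coprime T (pderiv T)"
proof (rule ccontr)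
  assume "\<not> coprime T (pderiv T)"
  then have "\<not> is_unit (gcd T (pderiv T))" by (simp add: coprime_iff_gcd_eq_1 is_unit_gcd)
  moreover have "gcd T (pderiv T) \<noteq> 0" using T_nonzero by simp
  ultimately obtain H where H: "prime H" "H dvd gcd T (pderiv T)"
    using prime_divisor_exists by blast
  then obtain K where K: "T = H * K" by auto
  have deg: "degree H > 0" using factor_degree_pos[of H] H not_prime_unit by auto
  have "H dvd H * pderiv K + K * pderiv H" using H K by (auto simp: pderiv_mult)
  then have "H dvd K * pderiv H" by (simp add: dvd_add_right_iff)
  moreover have "\<not> H dvd pderiv H"
  proof
    assume d: "H dvd pderiv H"
    have "pderiv H \<noteq> 0" using deg by (simp add: pderiv_eq_0_iff)
    with d have "degree H \<le> degree (pderiv H)" by (rule dvd_imp_degree_le)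
    with deg show False by (simp add: degree_pderiv)
  qed
  ultimately have "H dvd K" using H(1) prime_dvd_mult_iff by blast
  then have "H * H dvd T" using K by simp
  with square_factor_unit H(1) show False using not_prime_unit by blast
qed

text \<open>On a vertical line the restrictions of T and its two partial derivatives have no common
  zero, so 1 is a combination of them in one variable. Lifting the coefficients leaves an error that
  is divisible by the equation of the line.\<close>

lemma bezout_at:
  "\<exists>u s. u \<in> {a * T + b * dx T + c * pderiv T | a b c. True} \<and> 1 = u + [:[:-x, 1:]:] * s"
proof -
  let ?p = "spec x T" and ?q = "spec x (dx T)" and ?r = "spec x (pderiv T)"
  define g where "g = gcd ?p (gcd ?q ?r)"
  have "is_unit g"
  proof (rule ccontr)
    assume "\<not> is_unit g"
    then obtain y where y: "poly g y = 0" using nonunit_root by blast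
    have "g dvd ?p" "g dvd ?q" "g dvd ?r" unfolding g_def
      by (meson dvd_trans gcd_dvd1 gcd_dvd2)+
    then have "poly ?p y = 0" "poly ?q y = 0" "poly ?r y = 0" using y by (auto elim!: dvdE)
    with smooth show False by (auto simp: poly2_spec)
  qed
  then have g1: "gcd ?p (gcd ?q ?r) = 1" unfolding g_def by (simp add: is_unit_gcd coprime_iff_gcd_eq_1)
  obtain a b where ab: "a * ?p + b * gcd ?q ?r = 1" using g1 bezout_coefficients_fst_snd[of ?p "gcd ?q ?r"] by metis
  obtain c d where cd: "c * ?q + d * ?r = gcd ?q ?r" using bezout_coefficients_fst_snd[of ?q ?r] by metis
  \<comment> \<open>The section of \<open>spec x\<close> that reads a polynomial in y as one that
    does not depend on x.\<close>
  define lift where "lift = map_poly (\<lambda>c::complex. [:c:])"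
  have lift: "spec x (lift p) = p" for p by (rule poly_eqI) (simp add: lift_def coeff_map_poly)
  let ?u = "lift a * T + lift (b * c) * dx T + lift (b * d) * pderiv T"
  have "spec x ?u = a * ?p + b * (c * ?q + d * ?r)"
    by (simp add: lift algebra_simps)
  then have "spec x ?u = 1" using ab cd by simp
  moreover have "\<exists>s. f = [:[:-x, 1:]:] * s" if f: "spec x f = 0" for f
  proof -
    have "[:-x, 1:] dvd coeff f n" for n
    proof -
      have "poly (coeff f n) x = 0" using f by (metis coeff_0 coeff_spec)
      then show ?thesis by (simp add: poly_eq_0_iff_dvd)
    qed
    then have "[:[:-x, 1:]:] dvd f" by (simp add: const_poly_dvd_iff)
    then show ?thesis by blast
  qed
  moreover have "spec x (1 - ?u) = spec x 1 - spec x ?u" by (rule spec_simps)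
  ultimately obtain s where "1 - ?u = [:[:-x, 1:]:] * s" by fastforce
  then have "1 = ?u + [:[:-x, 1:]:] * s" by (simp add: algebra_simps)
  then show ?thesis by blast
qed

text \<open>
  The weak Nullstellensatz for the ideal of \<open>T\<close> and its partial derivatives: the ideal contains a
  polynomial in \<open>x\<close> alone, and contains 1 modulo each linear factor of it.
\<close>

lemma jacobian_bezout: "\<exists>a b c. a * T + b * dx T + c * pderiv T = 1"
proof -
  define I where "I = {a * T + b * dx T + c * pderiv T | a b c. True}"
  have I_add: "u + v \<in> I" if "u \<in> I" "v \<in> I" for u v
  proof -
    obtain a b c a' b' c' where "u = a * T + b * dx T + c * pderiv T" "v = a' * T + b' * dx T + c' * pderiv T"
      using \<open>u \<in> I\<close> \<open>v \<in> I\<close> by (auto simp: I_def)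
    then have "u + v = (a + a') * T + (b + b') * dx T + (c + c') * pderiv T" by (simp add: algebra_simps)
    then show ?thesis unfolding I_def by blast
  qed
  have I_mult: "s * u \<in> I" if "u \<in> I" for u s
  proof -
    obtain a b c where "u = a * T + b * dx T + c * pderiv T" using \<open>u \<in> I\<close> by (auto simp: I_def)
    then have "s * u = (s * a) * T + (s * b) * dx T + (s * c) * pderiv T" by (simp add: algebra_simps)
    then show ?thesis unfolding I_def by blast
  qed
  obtain a b r where r: "r \<noteq> 0" "a * T + b * pderiv T = [:r:]"
    using coprime_bezout_const[OF coprime_T_dy T_nonzero] by blast
  have "[:r:] = a * T + 0 * dx T + b * pderiv T" using r by simp
  then have rI: "[:r:] \<in> I" unfolding I_def by blast
  have "r \<noteq> 0 \<Longrightarrow> \<exists>u s. u \<in> I \<and> 1 = u + [:r:] * s" for r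
  proof (induction "degree r" arbitrary: r)
    case 0
    then obtain c where c: "r = [:c:]" "c \<noteq> 0" by (metis degree_eq_zeroE pCons_0_0)
    have "0 \<in> I" using I_mult[OF rI, of 0] by simp
    moreover have "1 = 0 + [:r:] * [:[:1/c:]:]" using c by (simp add: one_pCons)
    ultimately show ?case by blast
  next
    case (Suc n)
    then obtain x where "poly r x = 0"
      using fundamental_theorem_of_algebra[of r] by (metis constant_degree nat.distinct(1))
    then obtain r' where r': "r = [:-x, 1:] * r'" by (metis poly_eq_0_iff_dvd dvdE)
    have "r' \<noteq> 0" using Suc.prems r' by auto
    then have "degree r = Suc (degree r')" unfolding r' by (subst degree_mult_eq) auto
    with Suc obtain u s where us: "u \<in> I" "1 = u + [:r':] * s" using \<open>r' \<noteq> 0\<close> by (metis Suc_inject)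
    obtain u' s' where us': "u' \<in> I" "1 = u' + [:[:-x, 1:]:] * s'"
      using bezout_at[of x] unfolding I_def by blast
    \<comment> \<open>The representations of 1 for a linear factor A and the cofactor B are
      multiplied. All terms lie in the ideal except the last, which carries A B = r.\<close>
    have gen: "(u' + A * s') * (u + B * s) = (u + B * s) * u' + (A * s') * u + (A * B) * (s' * s)" for A B
      by (simp add: algebra_simps)
    have "(1::complex poly poly) = (u' + [:[:-x, 1:]:] * s') * (u + [:r':] * s)" using us us' by simp
    also have "\<dots> = (u + [:r':] * s) * u' + ([:[:-x, 1:]:] * s') * u + ([:[:-x, 1:]:] * [:r':]) * (s' * s)"
      using gen .
    also have "[:[:-x, 1:]:] * [:r':] = [:r:]" by (simp add: r')
    finally show ?case using I_add I_mult us us' by blast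
  qed
  from this[OF r(1)] obtain u s where "u \<in> I" "1 = u + [:r:] * s" by blast
  then have "1 \<in> I" using I_add I_mult rI by (metis mult.commute)
  then show ?thesis unfolding I_def by auto
qed

text \<open>The Nullstellensatz for the part of the curve in the torus. T is squarefree, so it
  suffices that each prime factor H of T divides f. Otherwise a combination of H and f is a nonzero
  polynomial r in x alone, although H and f have common zeros over almost every x.\<close>

lemma dvd_of_vanishing:
  assumes no_axis: "\<exists>x. poly2 T x 0 \<noteq> 0"
    and van: "\<And>x y. x \<noteq> 0 \<Longrightarrow> y \<noteq> 0 \<Longrightarrow> poly2 T x y = 0 \<Longrightarrow> poly2 f x y = 0"
  shows "T dvd f"
proof (cases "f = 0")
  case False
  have prime_dvd: "H dvd f" if H: "prime H" "H dvd T" for H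
  proof (rule ccontr)
    assume "\<not> H dvd f"
    then have "coprime H f" using H(1) prime_imp_coprime by blast
    moreover have "H \<noteq> 0" using H(1) by auto
    ultimately obtain a b r where r: "r \<noteq> 0" "a * H + b * f = [:r:]"
      using coprime_bezout_const by blast
    have deg: "degree H > 0" using factor_degree_pos H not_prime_unit by blast
    have c0: "coeff H 0 \<noteq> 0"
    proof
      assume "coeff H 0 = 0"
      then have "poly2 H x 0 = 0" for x by (simp add: poly2_def poly_0_coeff_0)
      then have "poly2 T x 0 = 0" for x using H(2) by (auto elim!: dvdE)
      with no_axis show False by blast
    qed
    \<comment> \<open>The zeros of m are the values of x to avoid: x = 0, the zeros of r, those
      where H drops its degree in y, and those where H vanishes at y = 0.\<close>
    define m where "m = [:0, 1:] * r * lead_coeff H * coeff H 0"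
    have "m \<noteq> 0" using r(1) c0 \<open>H \<noteq> 0\<close> by (simp add: m_def)
    then obtain x where "poly m x \<noteq> 0" using poly_all_0_iff_0 by blast
    then have x: "x \<noteq> 0" "poly r x \<noteq> 0" "poly (lead_coeff H) x \<noteq> 0" "poly (coeff H 0) x \<noteq> 0"
      by (auto simp: m_def)
    have "degree (spec x H) > 0"
      using le_degree[of "spec x H" "degree H"] x deg by simp
    then obtain y where y: "poly2 H x y = 0"
      unfolding poly2_spec by (metis constant_degree fundamental_theorem_of_algebra less_irrefl)
    have "y \<noteq> 0" using y x(4) by (auto simp: poly2_def poly_0_coeff_0)
    moreover have "poly2 T x y = 0" using y H(2) by (auto elim!: dvdE)
    ultimately have "poly2 f x y = 0" using van x by blast
    with y have "poly2 (a * H + b * f) x y = 0" by simp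
    with r(2) x(2) show False by simp
  qed
  \<comment> \<open>No prime has multiplicity above 1 in T, so divisibility by the individual primes
    is enough.\<close>
  have "multiplicity p T \<le> multiplicity p f" if p: "prime p" for p
  proof (cases "p dvd T")
    case True
    have "\<not> p ^ 2 dvd T"
      using square_factor_unit[of p] p not_prime_unit by (auto simp: power2_eq_square)
    then have "multiplicity p T < 2" by (metis multiplicity_dvd' not_le)
    moreover have "multiplicity p f \<ge> 1"
      using prime_dvd[OF p True] False p by (metis multiplicity_geI not_prime_unit power_one_right)
    ultimately show ?thesis by linarith
  next
    case False
    then show ?thesis by (simp add: not_dvd_imp_multiplicity_0)
  qed
  then show ?thesis using T_nonzero multiplicity_le_imp_dvd by blast
qed simp

end

subsection \<open>Laurent polynomials\<close>

type_synonym laurent = "(int \<times> int) \<Rightarrow>\<^sub>0 complex"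

abbreviation lkeys :: "laurent \<Rightarrow> (int \<times> int) set" where "lkeys \<equiv> Poly_Mapping.keys"
abbreviation lcoeff :: "laurent \<Rightarrow> int \<times> int \<Rightarrow> complex" where "lcoeff \<equiv> Poly_Mapping.lookup"
abbreviation lmono :: "int \<Rightarrow> int \<Rightarrow> laurent" where "lmono a b \<equiv> Poly_Mapping.single (a, b) 1"

text \<open>Evaluation is multiplicative on the torus only, since negative powers of 0 evaluate to
  0. All later comparisons are therefore made at points with x and y nonzero.\<close>

definition lev :: "complex \<Rightarrow> complex \<Rightarrow> laurent \<Rightarrow> complex" where
  "lev x y f = (\<Sum>k\<in>lkeys f. lcoeff f k * (x powi fst k * y powi snd k))"

definition lrestrict :: "(int \<times> int) set \<Rightarrow> laurent \<Rightarrow> laurent" where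
  "lrestrict S f = Abs_poly_mapping (\<lambda>k. if k \<in> S then lcoeff f k else 0)"

lemma lookup_lrestrict [simp]:
  "lcoeff (lrestrict S f) k = (if k \<in> S then lcoeff f k else 0)"
proof -
  have "finite {k. (if k \<in> S then lcoeff f k else 0) \<noteq> 0}"
    by (rule finite_subset[OF _ finite_keys[of f]]) (auto simp: in_keys_iff)
  then show ?thesis by (simp add: lrestrict_def lookup_Abs_poly_mapping)
qed

lemma lev_superset:
  assumes "finite A" "lkeys f \<subseteq> A"
  shows "lev x y f = (\<Sum>k\<in>A. lcoeff f k * (x powi fst k * y powi snd k))"
  unfolding lev_def by (rule sum.mono_neutral_left) (use assms in \<open>auto simp: in_keys_iff\<close>)

lemma lev_add [simp]: "lev x y (f + g) = lev x y f + lev x y g"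
proof -
  let ?A = "lkeys f \<union> lkeys g"
  have "lkeys (f + g) \<subseteq> ?A" by (rule keys_add)
  then show ?thesis
    using lev_superset[of ?A f] lev_superset[of ?A g] lev_superset[of ?A "f + g"]
    by (simp add: lookup_add sum.distrib distrib_right)
qed

lemma lev_0 [simp]: "lev x y 0 = 0"
  by (simp add: lev_def)

lemma lev_single [simp]: "lev x y (Poly_Mapping.single k c) = c * (x powi fst k * y powi snd k)"
  by (subst lev_superset[of "{k}"]) auto

lemma lev_sum [simp]: "lev x y (\<Sum>i\<in>I. f i) = (\<Sum>i\<in>I. lev x y (f i))"
  by (induction I rule: infinite_finite_induct) auto

lemma lev_uminus [simp]: "lev x y (- f) = - lev x y f"
  using lev_add[of x y f "- f"] by (simp add: eq_neg_iff_add_eq_0 add.commute del: lev_add)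

lemma lev_diff [simp]: "lev x y (f - g) = lev x y f - lev x y g"
  using lev_add[of x y f "- g"] by simp

lemma laurent_sum_single: "f = (\<Sum>k\<in>lkeys f. Poly_Mapping.single k (lcoeff f k))"
proof (rule poly_mapping_eqI)
  fix k
  show "lcoeff f k = lcoeff (\<Sum>k\<in>lkeys f. Poly_Mapping.single k (lcoeff f k)) k"
    by (auto simp: lookup_sum lookup_single when_def in_keys_iff)
qed

lemma lev_mult [simp]:
  assumes "x \<noteq> 0" "y \<noteq> 0"
  shows "lev x y (f * g) = lev x y f * lev x y g"
proof -
  have "f * g = (\<Sum>k\<in>lkeys f. Poly_Mapping.single k (lcoeff f k)) * (\<Sum>m\<in>lkeys g. Poly_Mapping.single m (lcoeff g m))"
    using laurent_sum_single by metis
  also have "\<dots> = (\<Sum>k\<in>lkeys f. \<Sum>m\<in>lkeys g. Poly_Mapping.single (k + m) (lcoeff f k * lcoeff g m))"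
    by (simp add: sum_product mult_single)
  finally have "lev x y (f * g) = (\<Sum>k\<in>lkeys f. \<Sum>m\<in>lkeys g. (lcoeff f k * lcoeff g m) * (x powi fst (k+m) * y powi snd (k+m)))"
    by simp
  also have "\<dots> = lev x y f * lev x y g"
    unfolding lev_def sum_product using assms
    by (intro sum.cong refl) (simp add: power_int_add mult_ac)
  finally show ?thesis .
qed

text \<open>The substitution of x^s for x and y^r for y. With s and r equal to 1 or -1 it rewrites
  the affine coordinates of any chart in those of chart \<open>(0,0)\<close>.\<close>

definition laurent_of :: "int \<Rightarrow> int \<Rightarrow> complex poly poly \<Rightarrow> laurent" where
  "laurent_of s r g = (\<Sum>b\<le>degree g. \<Sum>a\<le>degree (coeff g b). Poly_Mapping.single (s * int a, r * int b) (coeff (coeff g b) a))"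

lemma poly2_altdef: "poly2 g x y = (\<Sum>b\<le>degree g. \<Sum>a\<le>degree (coeff g b). coeff (coeff g b) a * (x ^ a * y ^ b))"
proof -
  have "poly2 g x y = (\<Sum>b\<le>degree g. poly (coeff g b) x * y ^ b)"
    unfolding poly2_def poly_altdef[of g] by (simp add: poly_sum)
  then show ?thesis by (simp add: poly_altdef sum_distrib_right mult.assoc)
qed

lemma lev_laurent_of: "lev x y (laurent_of s r g) = poly2 g (x powi s) (y powi r)"
  unfolding laurent_of_def poly2_altdef
  by (simp add: power_int_mult)

lemma keys_laurent_of: "k \<in> lkeys (laurent_of s r g) \<Longrightarrow> \<exists>a b. k = (s * int a, r * int b) \<and> coeff (coeff g b) a \<noteq> 0"
proof -
  assume "k \<in> lkeys (laurent_of s r g)"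
  from subsetD[OF keys_sum this[unfolded laurent_of_def]]
  obtain b where "k \<in> lkeys (\<Sum>a\<le>degree (coeff g b). Poly_Mapping.single (s * int a, r * int b) (coeff (coeff g b) a))"
    by blast
  from subsetD[OF keys_sum this] obtain a where
    "k \<in> lkeys (Poly_Mapping.single (s * int a, r * int b) (coeff (coeff g b) a))"
    by blast
  then show ?thesis by (auto split: if_splits)
qed

lemma laurent_nonneg_poly:
  assumes "\<And>k. k \<in> lkeys f \<Longrightarrow> fst k \<ge> 0 \<and> snd k \<ge> 0"
  shows "\<exists>g. \<forall>x y. lev x y f = poly2 g x y"
proof -
  define g where "g = (\<Sum>k\<in>lkeys f. monom (monom (lcoeff f k) (nat (fst k))) (nat (snd k)))"
  have m: "poly2 (monom (monom c a) b) x y = c * (x ^ a * y ^ b)" for c a b x y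
    by (simp add: poly2_def poly_monom)
  have "lev x y f = poly2 g x y" for x y
    unfolding g_def lev_def poly2_sum m
    by (intro sum.cong refl) (use assms in \<open>auto simp: power_int_def\<close>)
  then show ?thesis by blast
qed

lemma laurent_poly:
  "\<exists>N g. \<forall>x y. x \<noteq> 0 \<longrightarrow> y \<noteq> 0 \<longrightarrow> lev x y f * (x * y) ^ N = poly2 g x y"
proof -
  define N where "N = (\<Sum>k\<in>lkeys f. nat \<bar>fst k\<bar> + nat \<bar>snd k\<bar>)"
  have N: "\<bar>fst k\<bar> \<le> int N \<and> \<bar>snd k\<bar> \<le> int N" if "k \<in> lkeys f" for k
  proof -
    have "nat \<bar>fst k\<bar> + nat \<bar>snd k\<bar> \<le> N" unfolding N_def
      by (rule member_le_sum) (use that in auto)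
    then show ?thesis by linarith
  qed
  let ?s = "Poly_Mapping.single (int N, int N) 1"
  have "\<exists>g. \<forall>x y. lev x y (?s * f) = poly2 g x y"
  proof (rule laurent_nonneg_poly)
    fix k assume "k \<in> lkeys (?s * f)"
    then obtain k' where "k' \<in> lkeys f" "k = (int N, int N) + k'"
      using keys_mult[of ?s f] by auto
    with N[of k'] show "fst k \<ge> 0 \<and> snd k \<ge> 0" by auto
  qed
  then obtain g where g: "lev x y (?s * f) = poly2 g x y" for x y by blast
  have "lev x y f * (x * y) ^ N = poly2 g x y" if "x \<noteq> 0" "y \<noteq> 0" for x y
    using g[of x y] that by (simp add: power_mult_distrib mult_ac)
  then show ?thesis by blast
qed

text \<open>Multiplication by (x y)^N with N at least every absolute value of an exponent gives an
  honest polynomial with the same values up to a unit, and does not merge monomials.\<close>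

lemma lev_eq_0:
  assumes "\<And>x y. x \<noteq> 0 \<Longrightarrow> y \<noteq> 0 \<Longrightarrow> lev x y f = 0"
  shows "f = 0"
proof -
  define N where "N = (\<Sum>k\<in>lkeys f. nat \<bar>fst k\<bar> + nat \<bar>snd k\<bar>)"
  have N: "\<bar>fst k\<bar> \<le> int N \<and> \<bar>snd k\<bar> \<le> int N" if "k \<in> lkeys f" for k
  proof -
    have "nat \<bar>fst k\<bar> + nat \<bar>snd k\<bar> \<le> N" unfolding N_def
      by (rule member_le_sum) (use that in auto)
    then show ?thesis by linarith
  qed
  define e where "e k = (nat (fst k + int N), nat (snd k + int N))" for k :: "int \<times> int"
  define g where "g = (\<Sum>k\<in>lkeys f. monom (monom (lcoeff f k) (fst (e k))) (snd (e k)))"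
  have m: "poly2 (monom (monom c a) b) x y = c * (x ^ a * y ^ b)" for c a b x y
    by (simp add: poly2_def poly_monom)
  have e: "x ^ fst (e k) * y ^ snd (e k) = (x powi fst k * y powi snd k) * (x ^ N * y ^ N)"
    if "k \<in> lkeys f" "x \<noteq> 0" "y \<noteq> 0" for x y :: complex and k
  proof -
    have ge: "fst k + int N \<ge> 0" "snd k + int N \<ge> 0" using N[OF that(1)] by linarith+
    have "x ^ fst (e k) = x powi (fst k + int N)" "y ^ snd (e k) = y powi (snd k + int N)"
      unfolding e_def fst_conv snd_conv power_int_def by (simp_all only: ge if_True)
    moreover have "x powi (fst k + int N) = x powi fst k * x ^ N" "y powi (snd k + int N) = y powi snd k * y ^ N"
      using that(2,3) power_int_add[of x "fst k" "int N"] power_int_add[of y "snd k" "int N"]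
      by (simp_all only: power_int_of_nat simp_thms)
    ultimately show ?thesis by (simp only: mult_ac)
  qed
  have "poly2 g x y = lev x y f * (x ^ N * y ^ N)" if "x \<noteq> 0" "y \<noteq> 0" for x y
    unfolding g_def lev_def poly2_sum m sum_distrib_right
    by (intro sum.cong refl) (use e that in auto)
  then have "g = 0" using assms by (intro poly2_eqI) auto
  show ?thesis
  proof (rule poly_mapping_eqI)
    fix k
    show "lcoeff f k = lcoeff 0 k"
    proof (rule ccontr)
      assume neq: "\<not> ?thesis"
      then have k: "k \<in> lkeys f" by (simp add: in_keys_iff)
      have "fst (e k') = fst (e k) \<and> snd (e k') = snd (e k) \<longleftrightarrow> k' = k" if "k' \<in> lkeys f" for k'
      proof -
        have "fst k + int N \<ge> 0" "snd k + int N \<ge> 0" "fst k' + int N \<ge> 0" "snd k' + int N \<ge> 0"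
          using N[OF k] N[OF that] by linarith+
        then show ?thesis by (simp add: e_def prod_eq_iff eq_nat_nat_iff)
      qed
      then have "coeff (coeff g (snd (e k))) (fst (e k)) = (\<Sum>k'\<in>lkeys f. if k' = k then lcoeff f k' else 0)"
        unfolding g_def coeff_sum
        by (intro sum.cong refl) (simp, metis)
      also have "\<dots> = lcoeff f k" using k by simp
      finally show False using \<open>g = 0\<close> neq by simp
    qed
  qed
qed

lemma lev_eqI:
  assumes "\<And>x y. x \<noteq> 0 \<Longrightarrow> y \<noteq> 0 \<Longrightarrow> lev x y f = lev x y g"
  shows "f = g"
  using lev_eq_0[of "f - g"] assms by simp

lemma laurent_no_zero_divisors:
  fixes f g :: laurent
  assumes "f * g = 0"
  shows "f = 0 \<or> g = 0"
proof -
  obtain N F where F: "\<And>x y. x \<noteq> 0 \<Longrightarrow> y \<noteq> 0 \<Longrightarrow> lev x y f * (x * y) ^ N = poly2 F x y"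
    using laurent_poly by blast
  obtain M G where G: "\<And>x y. x \<noteq> 0 \<Longrightarrow> y \<noteq> 0 \<Longrightarrow> lev x y g * (x * y) ^ M = poly2 G x y"
    using laurent_poly by blast
  have "F * G = 0"
  proof (rule poly2_eqI)
    fix x y :: complex assume xy: "x \<noteq> 0" "y \<noteq> 0"
    have "lev x y f * lev x y g = 0" using assms xy by (metis lev_0 lev_mult)
    then show "poly2 (F * G) x y = poly2 0 x y" by (auto simp flip: F[OF xy] G[OF xy])
  qed
  then consider "F = 0" | "G = 0" by auto
  then show ?thesis
  proof cases
    case 1
    have "lev x y f = 0" if "x \<noteq> 0" "y \<noteq> 0" for x y using F[OF that] 1 that by simp
    then show ?thesis using lev_eq_0 by blast
  next
    case 2
    have "lev x y g = 0" if "x \<noteq> 0" "y \<noteq> 0" for x y using G[OF that] 2 that by simp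
    then show ?thesis using lev_eq_0 by blast
  qed
qed

text \<open>Lowest weights are additive under multiplication, as the ring of Laurent polynomials is a domain.\<close>

lemma keys_factor_weight:
  fixes T h :: laurent and w :: "int \<times> int \<Rightarrow> int"
  assumes w: "\<And>k l. w (k + l) = w k + w l"
    and T: "\<And>k. k \<in> lkeys T \<Longrightarrow> w k \<ge> m" "\<exists>k\<in>lkeys T. w k = m"
    and Th: "\<And>k. k \<in> lkeys (T * h) \<Longrightarrow> w k \<ge> n"
    and k: "k \<in> lkeys h"
  shows "w k \<ge> n - m"
proof (rule ccontr)
  assume neg: "\<not> w k \<ge> n - m"
  define l where "l = Min (w ` lkeys h)"
  have l: "l \<le> w k" "l \<in> w ` lkeys h" "\<And>k. k \<in> lkeys h \<Longrightarrow> l \<le> w k"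
    unfolding l_def using k by (auto intro!: Min_le Min_in)
  \<comment> \<open>The parts of lowest weight of T and h. Their product is nonzero, and all other
    terms of T h have weight above m + l, so nothing can cancel it.\<close>
  define T1 where "T1 = lrestrict {k. w k = m} T"
  define h1 where "h1 = lrestrict {k. w k = l} h"
  obtain k1 where "k1 \<in> lkeys T" "w k1 = m" using T(2) by blast
  then have "lcoeff T1 k1 \<noteq> 0" by (simp add: T1_def in_keys_iff)
  then have "T1 \<noteq> 0" by auto
  moreover obtain k2 where "k2 \<in> lkeys h" "w k2 = l" using l(2) by blast
  then have "lcoeff h1 k2 \<noteq> 0" by (simp add: h1_def in_keys_iff)
  then have "h1 \<noteq> 0" by auto
  ultimately have "T1 * h1 \<noteq> 0" using laurent_no_zero_divisors by blast
  then obtain a where a: "a \<in> lkeys (T1 * h1)" using keys_eq_empty by blast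
  have kT1: "w k = m" if "k \<in> lkeys T1" for k using that by (auto simp: T1_def in_keys_iff split: if_splits)
  have kh1: "w k = l" if "k \<in> lkeys h1" for k using that by (auto simp: h1_def in_keys_iff split: if_splits)
  have kT2: "w k > m" if "k \<in> lkeys (T - T1)" for k
    using that T(1)[of k] by (auto simp: T1_def in_keys_iff lookup_minus split: if_splits)
  have kh2: "w k > l" if "k \<in> lkeys (h - h1)" for k
    using that l(3)[of k] by (auto simp: h1_def in_keys_iff lookup_minus split: if_splits)
  have kh: "w k \<ge> l" if "k \<in> lkeys h" for k using l that by auto
  have split: "\<exists>b c. a = b + c \<and> b \<in> lkeys f \<and> c \<in> lkeys g"
    if "a \<in> lkeys (f * g)" for f g :: laurent
    using that keys_mult[of f g] by blast
  have wa: "w a = m + l" using split[OF a] kT1 kh1 w by metis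
  have "T * h = T1 * h1 + T1 * (h - h1) + (T - T1) * h" by (simp add: algebra_simps)
  moreover have "a \<notin> lkeys (T1 * (h - h1))"
  proof
    assume "a \<in> lkeys (T1 * (h - h1))"
    then obtain b c where bc: "a = b + c" "b \<in> lkeys T1" "c \<in> lkeys (h - h1)" using split by blast
    then show False using kT1[of b] kh2[of c] w[of b c] wa by simp
  qed
  moreover have "a \<notin> lkeys ((T - T1) * h)"
  proof
    assume "a \<in> lkeys ((T - T1) * h)"
    then obtain b c where bc: "a = b + c" "b \<in> lkeys (T - T1)" "c \<in> lkeys h" using split by blast
    then show False using kT2[of b] kh[of c] w[of b c] wa by simp
  qed
  ultimately have "a \<in> lkeys (T * h)"
    using a by (simp add: in_keys_iff lookup_add)
  then have "w a \<ge> n" by (rule Th)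
  with wa l(1) neg show False by linarith
qed

subsection \<open>Curves of bidegree \<open>(3, 3)\<close>\<close>

text \<open>
  In the affine coordinates of the chart \<open>(0, 0)\<close>, sections of \<open>O(d, e)\<close> on the product of two
  projective lines over the open set \<open>x\<^sub>i y\<^sub>j \<noteq> 0\<close> are the Laurent polynomials with exponents in
  \<open>half_x i d \<inter> half_y j e\<close>.
\<close>

definition half_x :: "2 \<Rightarrow> int \<Rightarrow> (int \<times> int) set" where
  "half_x i d = (if i = 0 then {k. 0 \<le> fst k} else {k. fst k \<le> d})"

definition half_y :: "2 \<Rightarrow> int \<Rightarrow> (int \<times> int) set" where
  "half_y j e = (if j = 0 then {k. 0 \<le> snd k} else {k. snd k \<le> e})"

lemma two_cases:
  fixes i :: 2
  assumes "P 0" "P 1"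
  shows "P i"
proof -
  have "i = 0 \<or> i = 1" using exhaust_2[of i] by auto
  with assms show ?thesis by blast
qed

lemma keys_mult_half:
  "lkeys f \<subseteq> half_x i d \<Longrightarrow> lkeys g \<subseteq> half_x i d' \<Longrightarrow> lkeys (f * g) \<subseteq> half_x i (d + d')"
  "lkeys f \<subseteq> half_y i d \<Longrightarrow> lkeys g \<subseteq> half_y i d' \<Longrightarrow> lkeys (f * g) \<subseteq> half_y i (d + d')"
  using keys_mult[of f g] by (fastforce simp: half_x_def half_y_def split: if_splits)+

lemma keys_add_subset: "lkeys f \<subseteq> S \<Longrightarrow> lkeys g \<subseteq> S \<Longrightarrow> lkeys (f + g) \<subseteq> S"
  using keys_add[of f g] by blast

lemma keys_diff_subset: "lkeys f \<subseteq> S \<Longrightarrow> lkeys g \<subseteq> S \<Longrightarrow> lkeys (f - g) \<subseteq> S"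
  using keys_add_subset[of f S "- g"] by simp

lemma coeff_mono_mult: "lcoeff (lmono a b * f) k = lcoeff f (k - (a, b))"
proof -
  have "lcoeff (lmono a b * f) k = (\<Sum>q. lcoeff f q when k = (a, b) + q)"
    by (simp add: lookup_mult lookup_single when_mult)
  also have "\<dots> = (\<Sum>q. lcoeff f q when q = k - (a, b))"
    by (intro Sum_any.cong when_cong refl) (auto simp: prod_eq_iff)
  finally show ?thesis by simp
qed

lemma keys_subset_iff: "lkeys f \<subseteq> S \<longleftrightarrow> (\<forall>k. k \<notin> S \<longrightarrow> lcoeff f k = 0)"
  by (auto simp: in_keys_iff)

lemma coeff_outside: "lkeys f \<subseteq> S \<Longrightarrow> k \<notin> S \<Longrightarrow> lcoeff f k = 0"
  by (auto simp: in_keys_iff)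

text \<open>\<open>H\<^sup>1(O(d, e)) = 0\<close> for the covering by four charts, for negative \<open>d\<close> and \<open>e\<close>\<close>

lemma split_square_cocycle:
  assumes "d < 0" "e < 0"
    and P: "lkeys P \<subseteq> half_y 0 e" and P': "lkeys P' \<subseteq> half_x 1 d"
    and R: "lkeys R \<subseteq> half_x 0 d" and R': "lkeys R' \<subseteq> half_y 1 e"
    and eq: "P + P' = R + R'"
  shows "\<exists>h :: 2 \<times> 2 \<Rightarrow> laurent. (\<forall>\<alpha>. lkeys (h \<alpha>) \<subseteq> half_x (fst \<alpha>) d \<inter> half_y (snd \<alpha>) e) \<and>
    P = h (1, 0) - h (0, 0) \<and> P' = h (1, 1) - h (1, 0) \<and> R = h (0, 1) - h (0, 0) \<and> R' = h (1, 1) - h (0, 1)"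
proof -
  \<comment> \<open>As d and e are negative, the half planes of opposite charts are disjoint. P and
    R are split by the side on which an exponent lies. At an exponent strictly between the sides in
    the x direction, P' and R vanish, so P = R' there, and both vanish because they live on opposite
    sides in the y direction; R is treated in the same way.\<close>
  define h where "h \<alpha> = (if \<alpha> = (0, 0) then - lrestrict {k. 0 \<le> fst k} P
     else if \<alpha> = (1, 0) then lrestrict {k. fst k \<le> d} P
     else if \<alpha> = (0, 1) then lrestrict {k. snd k \<le> e} R
     else lrestrict {k. snd k \<le> e} P')" for \<alpha> :: "2 \<times> 2"
  have n2: "(0::2) \<noteq> 1" by simp
  have h: "h (0, 0) = - lrestrict {k. 0 \<le> fst k} P" "h (1, 0) = lrestrict {k. fst k \<le> d} P"
    "h (0, 1) = lrestrict {k. snd k \<le> e} R" "h (1, 1) = lrestrict {k. snd k \<le> e} P'"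
    by (simp_all add: h_def n2 n2[symmetric])
  have z: "lcoeff P k = 0" if "\<not> 0 \<le> snd k" for k using P that by (intro coeff_outside[OF P]) (auto simp: half_y_def)
  have z': "lcoeff P' k = 0" if "\<not> fst k \<le> d" for k using P' that by (intro coeff_outside[OF P']) (auto simp: half_x_def)
  have w: "lcoeff R k = 0" if "\<not> 0 \<le> fst k" for k using R that by (intro coeff_outside[OF R]) (auto simp: half_x_def)
  have w': "lcoeff R' k = 0" if "\<not> snd k \<le> e" for k using R' that by (intro coeff_outside[OF R']) (auto simp: half_y_def)
  have eqk: "lcoeff P k + lcoeff P' k = lcoeff R k + lcoeff R' k" for k
    using eq by (metis lookup_add)
  have ch: "\<alpha> = (0,0) \<or> \<alpha> = (1,0) \<or> \<alpha> = (0,1) \<or> \<alpha> = (1,1)" for \<alpha> :: "2 \<times> 2"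
  proof (cases \<alpha>)
    case (Pair i j)
    then show ?thesis using exhaust_2[of i] exhaust_2[of j] by auto
  qed
  have keys: "lkeys (h \<alpha>) \<subseteq> half_x (fst \<alpha>) d \<inter> half_y (snd \<alpha>) e" for \<alpha>
    unfolding keys_subset_iff
    using ch[of \<alpha>] z z' w w' by (auto simp: h half_x_def half_y_def simp del: split_paired_All)
  have diff: "lcoeff P k = lcoeff (h (1, 0)) k - lcoeff (h (0, 0)) k \<and> lcoeff P' k = lcoeff (h (1, 1)) k - lcoeff (h (1, 0)) k \<and>
      lcoeff R k = lcoeff (h (0, 1)) k - lcoeff (h (0, 0)) k \<and> lcoeff R' k = lcoeff (h (1, 1)) k - lcoeff (h (0, 1)) k" for k
    using z[of k] z'[of k] w[of k] w'[of k] eqk[of k] assms(1,2)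
    by (cases "0 \<le> snd k"; cases "snd k \<le> e"; cases "fst k \<le> d"; cases "0 \<le> fst k")
       (auto simp: h eq_neg_iff_add_eq_0 add.commute)
  have "P = h (1, 0) - h (0, 0)" "P' = h (1, 1) - h (1, 0)" "R = h (0, 1) - h (0, 0)" "R' = h (1, 1) - h (0, 1)"
    using diff by (simp_all add: poly_mapping_eq_iff fun_eq_iff lookup_minus)
  with keys show ?thesis by blast
qed

text \<open>The monomials with exponents strictly between d and 0 and between e and 0 span
  \<open>H\<^sup>2(O(d, e))\<close>. Every other monomial is regular along one of the four edges of
  the square of charts, and is assigned to one such edge.\<close>

lemma split_outside_box:
  assumes "\<And>a b. d < a \<Longrightarrow> a < 0 \<Longrightarrow> e < b \<Longrightarrow> b < 0 \<Longrightarrow> lcoeff K (a, b) = 0"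
  shows "\<exists>P P' R R'. K = P + P' - R - R' \<and> lkeys P \<subseteq> half_y 0 e \<and> lkeys P' \<subseteq> half_x 1 d \<and>
     lkeys R \<subseteq> half_x 0 d \<and> lkeys R' \<subseteq> half_y 1 e"
proof -
  let ?P = "lrestrict {k. 0 \<le> snd k} K"
  let ?P' = "lrestrict {k. snd k < 0 \<and> fst k \<le> d} K"
  let ?R = "- lrestrict {k. snd k < 0 \<and> d < fst k \<and> 0 \<le> fst k} K"
  let ?R' = "- lrestrict {k. snd k < 0 \<and> d < fst k \<and> fst k < 0 \<and> snd k \<le> e} K"
  have "K = ?P + ?P' - ?R - ?R'"
  proof (rule poly_mapping_eqI)
    fix k
    show "lcoeff K k = lcoeff (?P + ?P' - ?R - ?R') k"
      using assms[of "fst k" "snd k"] by (auto simp: lookup_minus lookup_add)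
  qed
  moreover have "lkeys ?P \<subseteq> half_y 0 e" "lkeys ?P' \<subseteq> half_x 1 d" "lkeys ?R \<subseteq> half_x 0 d" "lkeys ?R' \<subseteq> half_y 1 e"
    by (auto simp: keys_subset_iff half_x_def half_y_def simp del: split_paired_All)
  ultimately show ?thesis by blast
qed

text \<open>
  \<open>T\<close> is the equation of the curve, of bidegree \<open>(3, 3)\<close>; the edge conditions say that the curve
  contains none of the four coordinate lines.
\<close>

locale laurent_curve =
  fixes T :: laurent
  assumes T_x: "lkeys T \<subseteq> half_x i 3" and T_y: "lkeys T \<subseteq> half_y i 3"
    and edge_x: "\<exists>k\<in>lkeys T. fst k = (if i = 0 then 0 else 3)"
    and edge_y: "\<exists>k\<in>lkeys T. snd k = (if i = 0 then 0 else 3)"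
begin

text \<open>The edge condition says that the extremal x-exponent of T is attained, so by additivity
  of lowest weights the extremal exponents of T h and of h differ by exactly that amount.\<close>

lemma factor_x:
  assumes "lkeys (T * h) \<subseteq> half_x i d"
  shows "lkeys h \<subseteq> half_x i (d - 3)"
proof
  fix k assume k: "k \<in> lkeys h"
  show "k \<in> half_x i (d - 3)"
  proof (cases "i = 0")
    case True
    have "0 - 0 \<le> fst k"
      by (rule keys_factor_weight[where T = T and h = h and w = fst])
         (use assms T_x[of i] edge_x[of i] True k in \<open>auto simp: half_x_def\<close>)
    then show ?thesis using True by (simp add: half_x_def)
  next
    case False
    have "- d - (- 3) \<le> - fst k"
      by (rule keys_factor_weight[where T = T and h = h and w = "\<lambda>k. - fst k"])
         (use assms T_x[of i] edge_x[of i] False k in \<open>auto simp: half_x_def\<close>)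
    then show ?thesis using False by (simp add: half_x_def)
  qed
qed

lemma factor_y:
  assumes "lkeys (T * h) \<subseteq> half_y i d"
  shows "lkeys h \<subseteq> half_y i (d - 3)"
proof
  fix k assume k: "k \<in> lkeys h"
  show "k \<in> half_y i (d - 3)"
  proof (cases "i = 0")
    case True
    have "0 - 0 \<le> snd k"
      by (rule keys_factor_weight[where T = T and h = h and w = snd])
         (use assms T_y[of i] edge_y[of i] True k in \<open>auto simp: half_y_def\<close>)
    then show ?thesis using True by (simp add: half_y_def)
  next
    case False
    have "- d - (- 3) \<le> - snd k"
      by (rule keys_factor_weight[where T = T and h = h and w = "\<lambda>k. - snd k"])
         (use assms T_y[of i] edge_y[of i] False k in \<open>auto simp: half_y_def\<close>)
    then show ?thesis using False by (simp add: half_y_def)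
  qed
qed

lemma T_cancel: "T * f = T * g \<Longrightarrow> f = g"
proof -
  assume "T * f = T * g"
  then have "T * (f - g) = 0" by (simp add: algebra_simps)
  moreover have "T \<noteq> 0" using edge_x[of 0] by auto
  ultimately show ?thesis using laurent_no_zero_divisors[of T "f - g"] by auto
qed

text \<open>
  \<open>H\<^sup>0\<close> of the curve with values in \<open>O(d, e)\<close> comes from the quadric if \<open>d, e < 3\<close>.
\<close>

lemma global_section:
  fixes F :: "2 \<times> 2 \<Rightarrow> laurent"
  assumes "d < 3" "e < 3"
    and F: "\<And>\<alpha>. lkeys (F \<alpha>) \<subseteq> half_x (fst \<alpha>) d \<inter> half_y (snd \<alpha>) e"
    and eq: "\<And>i. T dvd F (1, i) - F (0, i)" "\<And>i. T dvd F (i, 1) - F (i, 0)"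
  shows "\<exists>g. (\<forall>\<alpha>. lkeys g \<subseteq> half_x (fst \<alpha>) d \<inter> half_y (snd \<alpha>) e) \<and> (\<forall>\<alpha>. T dvd F \<alpha> - g)"
proof -
  obtain P R' R P' where
    P: "F (1, 0) - F (0, 0) = T * P" and R': "F (1, 1) - F (0, 1) = T * R'" and
    R: "F (0, 1) - F (0, 0) = T * R" and P': "F (1, 1) - F (1, 0) = T * P'"
    using eq(1)[of 0] eq(1)[of 1] eq(2)[of 0] eq(2)[of 1] by (elim dvdE) blast
  have "T * (P + P') = T * (R + R')"
    unfolding distrib_left P[symmetric] P'[symmetric] R[symmetric] R'[symmetric] by simp
  then have sq: "P + P' = R + R'" by (rule T_cancel)
  have Fx: "lkeys (F (i, j)) \<subseteq> half_x i d" and Fy: "lkeys (F (i, j)) \<subseteq> half_y j e" for i j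
    using F[of "(i, j)"] by auto
  have "lkeys P \<subseteq> half_y 0 (e - 3)" by (rule factor_y) (simp only: P[symmetric] keys_diff_subset Fy)
  moreover have "lkeys R' \<subseteq> half_y 1 (e - 3)" by (rule factor_y) (simp only: R'[symmetric] keys_diff_subset Fy)
  moreover have "lkeys R \<subseteq> half_x 0 (d - 3)" by (rule factor_x) (simp only: R[symmetric] keys_diff_subset Fx)
  moreover have "lkeys P' \<subseteq> half_x 1 (d - 3)" by (rule factor_x) (simp only: P'[symmetric] keys_diff_subset Fx)
  ultimately have "\<exists>h :: 2 \<times> 2 \<Rightarrow> laurent. (\<forall>\<alpha>. lkeys (h \<alpha>) \<subseteq> half_x (fst \<alpha>) (d - 3) \<inter> half_y (snd \<alpha>) (e - 3)) \<and>
    P = h (1, 0) - h (0, 0) \<and> P' = h (1, 1) - h (1, 0) \<and> R = h (0, 1) - h (0, 0) \<and> R' = h (1, 1) - h (0, 1)"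
    using split_square_cocycle[of "d - 3" "e - 3" P P' R R'] assms(1,2) sq by simp
  then obtain h :: "2 \<times> 2 \<Rightarrow> laurent" where
    h: "\<And>\<alpha>. lkeys (h \<alpha>) \<subseteq> half_x (fst \<alpha>) (d - 3) \<inter> half_y (snd \<alpha>) (e - 3)"
    and hP: "P = h (1, 0) - h (0, 0)" and hP': "P' = h (1, 1) - h (1, 0)"
    and hR: "R = h (0, 1) - h (0, 0)" and hR': "R' = h (1, 1) - h (0, 1)"
    by blast
  \<comment> \<open>The local sections agree only modulo T. Subtracting T h, with h from the
    vanishing of \<open>H\<^sup>1(O(d - 3, e - 3))\<close>, makes them equal as Laurent
    polynomials.\<close>
  define g where "g = F (0, 0) - T * h (0, 0)"
  have g10: "g = F (1, 0) - T * h (1, 0)"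
    using P unfolding hP g_def by (simp add: algebra_simps)
  have g01: "g = F (0, 1) - T * h (0, 1)"
    using R unfolding hR g_def by (simp add: algebra_simps)
  have g11: "g = F (1, 1) - T * h (1, 1)"
  proof -
    have "F (1, 1) = F (1, 0) + T * P'" unfolding P'[symmetric] by simp
    then show ?thesis unfolding g10 hP' by (simp add: algebra_simps)
  qed
  have c2: "i = 0 \<or> i = 1" for i :: 2 using exhaust_2[of i] by auto
  have g: "g = F \<alpha> - T * h \<alpha>" for \<alpha>
    using c2[of "fst \<alpha>"] c2[of "snd \<alpha>"] g_def g10 g01 g11 by (metis prod.collapse)
  have Thx: "lkeys (T * h \<alpha>) \<subseteq> half_x (fst \<alpha>) d" for \<alpha>
    using keys_mult_half(1)[OF T_x, of "h \<alpha>" "fst \<alpha>" "d - 3"] h[of \<alpha>] by simp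
  have Thy: "lkeys (T * h \<alpha>) \<subseteq> half_y (snd \<alpha>) e" for \<alpha>
    using keys_mult_half(2)[OF T_y, of "h \<alpha>" "snd \<alpha>" "e - 3"] h[of \<alpha>] by simp
  have "lkeys g \<subseteq> half_x (fst \<alpha>) d \<inter> half_y (snd \<alpha>) e" for \<alpha>
    unfolding g[of \<alpha>] using F[of \<alpha>] Thx[of \<alpha>] Thy[of \<alpha>] by (intro keys_diff_subset) auto
  moreover have "T dvd F \<alpha> - g" for \<alpha> unfolding g[of \<alpha>] by simp
  ultimately show ?thesis by blast
qed

text \<open>
  \<open>(X \<alpha>, Y \<alpha>)\<close> are local liftings to the tangent bundle of the quadric of the generator of the normal
  bundle, and \<open>X \<beta> * Y \<alpha> - X \<alpha> * Y \<beta>\<close> is the resulting cocycle \<open>r\<close> with values in the tangent bundle of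
  the curve. Serre duality: if \<open>E G r\<close> is trivial for all cubics \<open>G\<close>, so is \<open>E r\<close>, since the
  class of \<open>G E r\<close> is read off at the exponent \<open>(-1, -1)\<close> of \<open>G E K\<close>, for \<open>K\<close> as below. Then \<open>E\<close> times
  the generator lifts globally, and vanishes because \<open>O(1, -1)\<close> and \<open>O(-1, 1)\<close> have no sections.
\<close>

lemma cubic_pairing_nondegenerate:
  fixes X Y :: "2 \<times> 2 \<Rightarrow> laurent" and Tx Ty E :: laurent
  assumes X: "\<And>\<alpha>. lkeys (X \<alpha>) \<subseteq> half_x (fst \<alpha>) (-1) \<inter> half_y (snd \<alpha>) (-3)"
    and Y: "\<And>\<alpha>. lkeys (Y \<alpha>) \<subseteq> half_x (fst \<alpha>) (-3) \<inter> half_y (snd \<alpha>) (-1)"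
    and unit: "\<And>\<alpha>. T dvd 1 - Tx * X \<alpha> - Ty * Y \<alpha>"
    and Bx: "\<And>j. \<exists>B. T dvd B - Tx \<and> (\<forall>i. lkeys B \<subseteq> half_y i 3) \<and> lkeys B \<subseteq> half_x j 1"
    and By: "\<And>j. \<exists>B. T dvd B - Ty \<and> (\<forall>i. lkeys B \<subseteq> half_x i 3) \<and> lkeys B \<subseteq> half_y j 1"
    and E: "\<And>i. lkeys E \<subseteq> half_x i 2" "\<And>i. lkeys E \<subseteq> half_y i 2"
    and triv: "\<And>a b. 0 \<le> a \<Longrightarrow> a \<le> 3 \<Longrightarrow> 0 \<le> b \<Longrightarrow> b \<le> 3 \<Longrightarrow>
      \<exists>c. (\<forall>\<alpha>. lkeys (c \<alpha>) \<subseteq> half_x (fst \<alpha>) 1 \<inter> half_y (snd \<alpha>) 1) \<and>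
        (\<forall>\<alpha> \<beta>. fst \<alpha> = fst \<beta> \<or> snd \<alpha> = snd \<beta> \<longrightarrow>
           T dvd lmono a b * E * (X \<beta> * Y \<alpha> - X \<alpha> * Y \<beta>) - (c \<beta> - c \<alpha>))"
  shows "E = 0"
proof -
  define r where "r \<alpha> \<beta> = X \<beta> * Y \<alpha> - X \<alpha> * Y \<beta>" for \<alpha> \<beta>
  define u where "u \<alpha> = 1 - Tx * X \<alpha> - Ty * Y \<alpha>" for \<alpha>
  have u: "T dvd u \<alpha>" for \<alpha> using unit by (simp add: u_def)
  have cocycle: "T dvd r \<alpha> \<beta> + r \<beta> \<gamma> - r \<alpha> \<gamma>" for \<alpha> \<beta> \<gamma>
  proof -
    \<comment> \<open>The Pluecker relation: for three vectors (X, Y), the determinants of pairs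
      weighted by the value of the functional (Tx, Ty) at the remaining vector sum to zero. The
      functional is 1 - u.\<close>
    have "r \<alpha> \<beta> + r \<beta> \<gamma> - r \<alpha> \<gamma> = r \<alpha> \<beta> * u \<gamma> + r \<beta> \<gamma> * u \<alpha> - r \<alpha> \<gamma> * u \<beta>"
      unfolding r_def u_def by (simp add: algebra_simps)
    then show ?thesis using u by simp
  qed
  have r_x: "lkeys (r \<alpha> \<beta>) \<subseteq> half_x i (-4)" if "fst \<alpha> = i" "fst \<beta> = i" for \<alpha> \<beta> i
    using keys_mult_half(1)[of "X \<beta>" i "-1" "Y \<alpha>" "-3"] keys_mult_half(1)[of "X \<alpha>" i "-1" "Y \<beta>" "-3"]
      X[of \<alpha>] X[of \<beta>] Y[of \<alpha>] Y[of \<beta>] that unfolding r_def by (intro keys_diff_subset) auto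
  have r_y: "lkeys (r \<alpha> \<beta>) \<subseteq> half_y i (-4)" if "snd \<alpha> = i" "snd \<beta> = i" for \<alpha> \<beta> i
    using keys_mult_half(2)[of "X \<beta>" i "-3" "Y \<alpha>" "-1"] keys_mult_half(2)[of "X \<alpha>" i "-3" "Y \<beta>" "-1"]
      X[of \<alpha>] X[of \<beta>] Y[of \<alpha>] Y[of \<beta>] that unfolding r_def by (intro keys_diff_subset) auto
  have "T dvd (r (0,0) (1,0) + r (1,0) (1,1) - r (0,0) (1,1)) - (r (0,0) (0,1) + r (0,1) (1,1) - r (0,0) (1,1))"
    by (intro dvd_diff cocycle)
  then have "T dvd r (0,0) (1,0) + r (1,0) (1,1) - r (0,0) (0,1) - r (0,1) (1,1)"
    by (simp add: diff_diff_eq)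
  \<comment> \<open>The two paths from chart \<open>(0,0)\<close> to chart \<open>(1,1)\<close>
    differ by T K. So K represents the image of the class of r under the connecting map to
    \<open>H\<^sup>2(O(-7, -7))\<close>.\<close>
  then obtain K where K: "r (0,0) (1,0) + r (1,0) (1,1) - r (0,0) (0,1) - r (0,1) (1,1) = T * K"
    by (rule dvdE)
  \<comment> \<open>E K has type O(-5, -5). Its \<open>H\<^sup>2\<close> has exponents from -4 to -1
    in each direction, matching the monomials of bidegree at most (3, 3) by which E may be
    multiplied.\<close>
  have EK: "lcoeff (E * K) (a, b) = 0" if ab: "-5 < a" "a < 0" "-5 < b" "b < 0" for a b
  proof -
    \<comment> \<open>The monomial moves the exponent (a, b) to (-1, -1), the only one in
      \<open>H\<^sup>2(O(-2, -2))\<close>.\<close>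
    define F where "F = lmono (-1 - a) (-1 - b) * E"
    have m: "lkeys (lmono (-1 - a) (-1 - b)) \<subseteq> half_x i 3" "lkeys (lmono (-1 - a) (-1 - b)) \<subseteq> half_y i 3" for i
      using ab by (auto simp: half_x_def half_y_def)
    have F_x: "lkeys F \<subseteq> half_x i 5" and F_y: "lkeys F \<subseteq> half_y i 5" for i
      using keys_mult_half(1)[OF m(1) E(1)] keys_mult_half(2)[OF m(2) E(2)] by (simp_all add: F_def)
    obtain c where c: "\<And>\<alpha>. lkeys (c \<alpha>) \<subseteq> half_x (fst \<alpha>) 1 \<inter> half_y (snd \<alpha>) 1"
      and ceq: "\<And>\<alpha> \<beta>. fst \<alpha> = fst \<beta> \<or> snd \<alpha> = snd \<beta> \<Longrightarrow> T dvd F * r \<alpha> \<beta> - (c \<beta> - c \<alpha>)"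
    proof -
      have "0 \<le> -1 - a" "-1 - a \<le> 3" "0 \<le> -1 - b" "-1 - b \<le> 3" using ab by auto
      from triv[OF this] that show ?thesis unfolding r_def F_def by blast
    qed
    have cx: "lkeys (c (i, j)) \<subseteq> half_x i 1" and cy: "lkeys (c (i, j)) \<subseteq> half_y j 1" for i j
      using c[of "(i, j)"] by auto
    \<comment> \<open>Along an edge of the square of charts both F r and its trivialization are
      regular across the common open set, so their quotient by T is too; it lies in O(-2,
      -2).\<close>
    have edge_y: "\<exists>h. F * r (0, i) (1, i) - (c (1, i) - c (0, i)) = T * h \<and> lkeys h \<subseteq> half_y i (-2)" for i
    proof -
      obtain h where h: "F * r (0, i) (1, i) - (c (1, i) - c (0, i)) = T * h" using ceq[of "(0,i)" "(1,i)"] by (auto elim: dvdE)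
      have "lkeys (F * r (0, i) (1, i)) \<subseteq> half_y i 1"
        using keys_mult_half(2)[OF F_y r_y, of "(0,i)" i "(1,i)"] by simp
      then have "lkeys (T * h) \<subseteq> half_y i 1" unfolding h[symmetric] by (intro keys_diff_subset cy)
      then show ?thesis using h factor_y by fastforce
    qed
    have edge_x: "\<exists>h. F * r (i, 0) (i, 1) - (c (i, 1) - c (i, 0)) = T * h \<and> lkeys h \<subseteq> half_x i (-2)" for i
    proof -
      obtain h where h: "F * r (i, 0) (i, 1) - (c (i, 1) - c (i, 0)) = T * h" using ceq[of "(i,0)" "(i,1)"] by (auto elim: dvdE)
      have "lkeys (F * r (i, 0) (i, 1)) \<subseteq> half_x i 1"
        using keys_mult_half(1)[OF F_x r_x, of "(i,0)" i "(i,1)"] by simp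
      then have "lkeys (T * h) \<subseteq> half_x i 1" unfolding h[symmetric] by (intro keys_diff_subset cx)
      then show ?thesis using h factor_x by fastforce
    qed
    obtain P R' where P: "F * r (0, 0) (1, 0) - (c (1, 0) - c (0, 0)) = T * P" "lkeys P \<subseteq> half_y 0 (-2)"
      and R': "F * r (0, 1) (1, 1) - (c (1, 1) - c (0, 1)) = T * R'" "lkeys R' \<subseteq> half_y 1 (-2)"
      using edge_y[of 0] edge_y[of 1] by blast
    obtain R P' where R: "F * r (0, 0) (0, 1) - (c (0, 1) - c (0, 0)) = T * R" "lkeys R \<subseteq> half_x 0 (-2)"
      and P': "F * r (1, 0) (1, 1) - (c (1, 1) - c (1, 0)) = T * P'" "lkeys P' \<subseteq> half_x 1 (-2)"
      using edge_x[of 0] edge_x[of 1] by blast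
    have "T * (F * K) = F * (T * K)" by (simp add: mult_ac)
    also have "\<dots> = T * P + T * P' - T * R - T * R'"
      unfolding K[symmetric] P(1)[symmetric] P'(1)[symmetric] R(1)[symmetric] R'(1)[symmetric]
      by (simp add: algebra_simps)
    also have "\<dots> = T * (P + P' - R - R')" by (simp add: algebra_simps)
    finally have FK: "F * K = P + P' - R - R'" by (rule T_cancel)
    \<comment> \<open>None of the four half planes contains (-1, -1).\<close>
    have "lcoeff (F * K) (-1, -1) = 0"
      unfolding FK using coeff_outside[OF P(2), of "(-1,-1)"] coeff_outside[OF P'(2), of "(-1,-1)"]
        coeff_outside[OF R(2), of "(-1,-1)"] coeff_outside[OF R'(2), of "(-1,-1)"]
      by (simp add: half_x_def half_y_def lookup_minus lookup_add)
    then show ?thesis unfolding F_def mult.assoc coeff_mono_mult by simp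
  qed
  obtain P P' R R' where PR: "E * K = P + P' - R - R'" and P: "lkeys P \<subseteq> half_y 0 (-5)" and P': "lkeys P' \<subseteq> half_x 1 (-5)"
    and R: "lkeys R \<subseteq> half_x 0 (-5)" and R': "lkeys R' \<subseteq> half_y 1 (-5)"
    using split_outside_box[of "-5" "-5" "E * K"] EK by blast
  \<comment> \<open>Removing the multiples of T turns E r into a cocycle on the quadric itself, with
    values in O(-2, -2), where \<open>H\<^sup>1\<close> vanishes. So E r is the coboundary of H
    modulo T.\<close>
  define Q where "Q = E * r (0,0) (1,0) - T * P"
  define Q' where "Q' = E * r (1,0) (1,1) - T * P'"
  define S where "S = E * r (0,0) (0,1) - T * R"
  define S' where "S' = E * r (0,1) (1,1) - T * R'"
  have sq: "Q + Q' = S + S'"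
  proof -
    have "Q + Q' - (S + S') = E * (r (0,0) (1,0) + r (1,0) (1,1) - r (0,0) (0,1) - r (0,1) (1,1)) - T * (P + P' - R - R')"
      unfolding Q_def Q'_def S_def S'_def by (simp add: algebra_simps)
    also have "\<dots> = 0" unfolding K PR[symmetric] by (simp add: mult_ac)
    finally show ?thesis by simp
  qed
  have "lkeys Q \<subseteq> half_y 0 (-2)" unfolding Q_def
    using keys_mult_half(2)[OF E(2) r_y, of "(0,0)" 0 "(1,0)"] keys_mult_half(2)[OF T_y P]
    by (intro keys_diff_subset) auto
  moreover have "lkeys Q' \<subseteq> half_x 1 (-2)" unfolding Q'_def
    using keys_mult_half(1)[OF E(1) r_x, of "(1,0)" 1 "(1,1)"] keys_mult_half(1)[OF T_x P']
    by (intro keys_diff_subset) auto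
  moreover have "lkeys S \<subseteq> half_x 0 (-2)" unfolding S_def
    using keys_mult_half(1)[OF E(1) r_x, of "(0,0)" 0 "(0,1)"] keys_mult_half(1)[OF T_x R]
    by (intro keys_diff_subset) auto
  moreover have "lkeys S' \<subseteq> half_y 1 (-2)" unfolding S'_def
    using keys_mult_half(2)[OF E(2) r_y, of "(0,1)" 1 "(1,1)"] keys_mult_half(2)[OF T_y R']
    by (intro keys_diff_subset) auto
  ultimately obtain H :: "2 \<times> 2 \<Rightarrow> laurent" where
    H: "\<And>\<alpha>. lkeys (H \<alpha>) \<subseteq> half_x (fst \<alpha>) (-2) \<inter> half_y (snd \<alpha>) (-2)"
    and HQ: "Q = H (1, 0) - H (0, 0)" and HQ': "Q' = H (1, 1) - H (1, 0)"
    and HS: "S = H (0, 1) - H (0, 0)" and HS': "S' = H (1, 1) - H (0, 1)"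
    using split_square_cocycle[of "-2" "-2" Q Q' S S'] sq by (smt (verit) neg_less_0_iff_less zero_less_numeral)
  have "E * r (0,0) (1,0) - (H (1,0) - H (0,0)) = T * P" "E * r (0,1) (1,1) - (H (1,1) - H (0,1)) = T * R'"
    "E * r (1,0) (1,1) - (H (1,1) - H (1,0)) = T * P'" "E * r (0,0) (0,1) - (H (0,1) - H (0,0)) = T * R"
    unfolding HQ[symmetric] HS'[symmetric] HQ'[symmetric] HS[symmetric]
    by (simp_all add: Q_def Q'_def S_def S'_def)
  then have "T dvd E * r (0,0) (1,0) - (H (1,0) - H (0,0))" "T dvd E * r (0,1) (1,1) - (H (1,1) - H (0,1))"
    "T dvd E * r (1,0) (1,1) - (H (1,1) - H (1,0))" "T dvd E * r (0,0) (0,1) - (H (0,1) - H (0,0))"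
    by simp_all
  then have H_y: "T dvd E * r (0, i) (1, i) - (H (1, i) - H (0, i))"
    and H_x: "T dvd E * r (i, 0) (i, 1) - (H (i, 1) - H (i, 0))" for i
    by (induct i rule: two_cases) simp_all
  have "\<exists>B. \<forall>j. T dvd B j - Ty \<and> (\<forall>i. lkeys (B j) \<subseteq> half_x i 3) \<and> lkeys (B j) \<subseteq> half_y j 1"
    by (intro choice allI By)
  then obtain By' where By': "\<And>j. T dvd By' j - Ty" "\<And>i j. lkeys (By' j) \<subseteq> half_x i 3" "\<And>j. lkeys (By' j) \<subseteq> half_y j 1"
    by blast
  have "\<exists>B. \<forall>j. T dvd B j - Tx \<and> (\<forall>i. lkeys (B j) \<subseteq> half_y i 3) \<and> lkeys (B j) \<subseteq> half_x j 1"
    by (intro choice allI Bx)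
  then obtain Bx' where Bx': "\<And>j. T dvd Bx' j - Tx" "\<And>i j. lkeys (Bx' j) \<subseteq> half_y i 3" "\<And>j. lkeys (Bx' j) \<subseteq> half_x j 1"
    by blast
  \<comment> \<open>The lift E (X, Y) is corrected by H times the tangent direction (Ty, -Tx) of the
    curve and so becomes independent of the chart modulo T. The representatives of Tx and Ty modulo
    T are those with the right regularity in the chart. The components of the result are sections of
    O(1, -1) and O(-1, 1) on the curve.\<close>
  define M where "M \<alpha> = E * X \<alpha> - H \<alpha> * By' (snd \<alpha>)" for \<alpha>
  define N where "N \<alpha> = E * Y \<alpha> + H \<alpha> * Bx' (fst \<alpha>)" for \<alpha>
  have Xx: "lkeys (X \<alpha>) \<subseteq> half_x (fst \<alpha>) (-1)" and Xy: "lkeys (X \<alpha>) \<subseteq> half_y (snd \<alpha>) (-3)"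
    and Yx: "lkeys (Y \<alpha>) \<subseteq> half_x (fst \<alpha>) (-3)" and Yy: "lkeys (Y \<alpha>) \<subseteq> half_y (snd \<alpha>) (-1)"
    and Hx: "lkeys (H \<alpha>) \<subseteq> half_x (fst \<alpha>) (-2)" and Hy: "lkeys (H \<alpha>) \<subseteq> half_y (snd \<alpha>) (-2)" for \<alpha>
    using X[of \<alpha>] Y[of \<alpha>] H[of \<alpha>] by auto
  have MN: "T dvd M \<beta> - M \<alpha>" "T dvd N \<beta> - N \<alpha>" if "T dvd E * r \<alpha> \<beta> - (H \<beta> - H \<alpha>)" for \<alpha> \<beta>
  proof -
    have "M \<beta> - M \<alpha> = E * (X \<beta> * u \<alpha> - X \<alpha> * u \<beta>) + Ty * (E * r \<alpha> \<beta> - (H \<beta> - H \<alpha>))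
        - H \<beta> * (By' (snd \<beta>) - Ty) + H \<alpha> * (By' (snd \<alpha>) - Ty)"
      unfolding M_def r_def u_def by (simp add: algebra_simps)
    then show "T dvd M \<beta> - M \<alpha>" using u that By'(1) by simp
    have "N \<beta> - N \<alpha> = E * (Y \<beta> * u \<alpha> - Y \<alpha> * u \<beta>) - Tx * (E * r \<alpha> \<beta> - (H \<beta> - H \<alpha>))
        + H \<beta> * (Bx' (fst \<beta>) - Tx) - H \<alpha> * (Bx' (fst \<alpha>) - Tx)"
      unfolding N_def r_def u_def by (simp add: algebra_simps)
    then show "T dvd N \<beta> - N \<alpha>" using u that Bx'(1) by simp
  qed
  have "\<exists>g. (\<forall>\<alpha>. lkeys g \<subseteq> half_x (fst \<alpha>) 1 \<inter> half_y (snd \<alpha>) (-1)) \<and> (\<forall>\<alpha>. T dvd M \<alpha> - g)"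
  proof (rule global_section)
    fix \<alpha>
    have "lkeys (M \<alpha>) \<subseteq> half_x (fst \<alpha>) 1" unfolding M_def
      using keys_mult_half(1)[OF E(1) Xx, of \<alpha>] keys_mult_half(1)[OF Hx By'(2), of \<alpha> "snd \<alpha>"]
      by (intro keys_diff_subset) auto
    moreover have "lkeys (M \<alpha>) \<subseteq> half_y (snd \<alpha>) (-1)" unfolding M_def
      using keys_mult_half(2)[OF E(2) Xy, of \<alpha>] keys_mult_half(2)[OF Hy By'(3), of \<alpha>]
      by (intro keys_diff_subset) auto
    ultimately show "lkeys (M \<alpha>) \<subseteq> half_x (fst \<alpha>) 1 \<inter> half_y (snd \<alpha>) (-1)" by blast
  qed (use MN H_x H_y in auto)
  then obtain g where g: "\<And>\<alpha>. lkeys g \<subseteq> half_x (fst \<alpha>) 1 \<inter> half_y (snd \<alpha>) (-1)" and "T dvd M (0,0) - g" by blast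
  moreover have "g = 0"
  proof (rule poly_mapping_eqI)
    fix k
    have "k \<notin> half_y 0 (-1) \<or> k \<notin> half_y 1 (-1)" by (auto simp: half_y_def)
    then show "lcoeff g k = lcoeff 0 k" using coeff_outside[of g _ k] g[of "(0,0)"] g[of "(0,1)"] by auto
  qed
  ultimately have M0: "T dvd M (0,0)" by simp
  have "\<exists>g. (\<forall>\<alpha>. lkeys g \<subseteq> half_x (fst \<alpha>) (-1) \<inter> half_y (snd \<alpha>) 1) \<and> (\<forall>\<alpha>. T dvd N \<alpha> - g)"
  proof (rule global_section)
    fix \<alpha>
    have "lkeys (N \<alpha>) \<subseteq> half_x (fst \<alpha>) (-1)" unfolding N_def
      using keys_mult_half(1)[OF E(1) Yx, of \<alpha>] keys_mult_half(1)[OF Hx Bx'(3), of \<alpha>]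
      by (intro keys_add_subset) auto
    moreover have "lkeys (N \<alpha>) \<subseteq> half_y (snd \<alpha>) 1" unfolding N_def
      using keys_mult_half(2)[OF E(2) Yy, of \<alpha>] keys_mult_half(2)[OF Hy Bx'(2), of \<alpha> "fst \<alpha>"]
      by (intro keys_add_subset) auto
    ultimately show "lkeys (N \<alpha>) \<subseteq> half_x (fst \<alpha>) (-1) \<inter> half_y (snd \<alpha>) 1" by blast
  qed (use MN H_x H_y in auto)
  then obtain g' where g': "\<And>\<alpha>. lkeys g' \<subseteq> half_x (fst \<alpha>) (-1) \<inter> half_y (snd \<alpha>) 1" and "T dvd N (0,0) - g'" by blast
  moreover have "g' = 0"
  proof (rule poly_mapping_eqI)
    fix k
    have "k \<notin> half_x 0 (-1) \<or> k \<notin> half_x 1 (-1)" by (auto simp: half_x_def)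
    then show "lcoeff g' k = lcoeff 0 k" using coeff_outside[of g' _ k] g'[of "(0,0)"] g'[of "(1,0)"] by auto
  qed
  ultimately have N0: "T dvd N (0,0)" by simp
  \<comment> \<open>Applying (Tx, Ty) to the corrected lift recovers E, because the correction is
    tangent to the curve. So T divides E, which is impossible for a nonzero E of bidegree at most
    (2, 2).\<close>
  have "E = E * u (0,0) + Tx * M (0,0) + Ty * N (0,0)
      + H (0,0) * (Tx * (By' 0 - Ty) - Ty * (Bx' 0 - Tx))"
    unfolding u_def M_def N_def by (simp add: algebra_simps)
  moreover have "T dvd \<dots>" using u M0 N0 By'(1)[of 0] Bx'(1)[of 0] by simp
  ultimately obtain h where h: "E = T * h" by (metis dvdE)
  have "lkeys h \<subseteq> half_x i (-1)" for i using factor_x[of h i 2] E(1)[of i] h by simp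
  from this[of 0] this[of 1] have "lkeys h \<subseteq> {k. 0 \<le> fst k} \<inter> {k. fst k \<le> -1}" by (simp add: half_x_def)
  also have "\<dots> = {}" by auto
  finally have "h = 0" by (simp only: subset_empty keys_eq_empty)
  then show "E = 0" using h by simp
qed

end

subsection \<open>Homogeneous forms\<close>

lemma finite_exps [simp]: "finite (exps d)"
proof (rule finite_subset)
  show "exps d \<subseteq> Pi\<^sub>E UNIV (\<lambda>_. {..d})"
  proof
    fix \<alpha> assume "\<alpha> \<in> exps d"
    then have "\<alpha> i \<le> d" for i using member_le_sum[of i UNIV \<alpha>] by (simp add: exps_def)
    then show "\<alpha> \<in> Pi\<^sub>E UNIV (\<lambda>_. {..d})" by (simp add: PiE_UNIV_domain)
  qed
qed (simp add: finite_PiE)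

lemma Form_add: "f \<in> Form d \<Longrightarrow> g \<in> Form d \<Longrightarrow> (\<lambda>p. f p + g p) \<in> Form d"
proof -
  assume "f \<in> Form d" "g \<in> Form d"
  then obtain c c' where "\<And>p. f p = (\<Sum>\<alpha>\<in>exps d. c \<alpha> * mon \<alpha> p)" "\<And>p. g p = (\<Sum>\<alpha>\<in>exps d. c' \<alpha> * mon \<alpha> p)"
    by (auto simp: Form_def)
  then have "f p + g p = (\<Sum>\<alpha>\<in>exps d. (c \<alpha> + c' \<alpha>) * mon \<alpha> p)" for p
    by (simp add: sum.distrib distrib_right)
  then show ?thesis unfolding Form_def mem_Collect_eq by (intro exI[of _ "\<lambda>\<alpha>. c \<alpha> + c' \<alpha>"]) simp
qed

lemma Form_scale: "f \<in> Form d \<Longrightarrow> (\<lambda>p. r * f p) \<in> Form d"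
proof -
  assume "f \<in> Form d"
  then obtain c where "\<And>p. f p = (\<Sum>\<alpha>\<in>exps d. c \<alpha> * mon \<alpha> p)" by (auto simp: Form_def)
  then have "r * f p = (\<Sum>\<alpha>\<in>exps d. (r * c \<alpha>) * mon \<alpha> p)" for p
    by (simp add: sum_distrib_left mult.assoc)
  then show ?thesis unfolding Form_def mem_Collect_eq by (intro exI[of _ "\<lambda>\<alpha>. r * c \<alpha>"]) simp
qed

lemma Form_zero [simp]: "(\<lambda>p. 0) \<in> Form d"
  unfolding Form_def mem_Collect_eq by (intro exI[of _ "\<lambda>\<alpha>. 0"]) simp

lemma Form_uminus: "f \<in> Form d \<Longrightarrow> (\<lambda>p. - f p) \<in> Form d"
  using Form_scale[of f d "-1"] by simp

lemma Form_diff: "f \<in> Form d \<Longrightarrow> g \<in> Form d \<Longrightarrow> (\<lambda>p. f p - g p) \<in> Form d"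
  using Form_add[of f d "\<lambda>p. - g p"] Form_uminus by simp

lemma Form_sum: "(\<And>i. i \<in> I \<Longrightarrow> f i \<in> Form d) \<Longrightarrow> (\<lambda>p. \<Sum>i\<in>I. f i p) \<in> Form d"
  by (induction I rule: infinite_finite_induct) (auto intro: Form_add)

lemma mon_Form: "\<alpha> \<in> exps d \<Longrightarrow> mon \<alpha> \<in> Form d"
  unfolding Form_def mem_Collect_eq
  by (intro exI[of _ "\<lambda>\<beta>. if \<beta> = \<alpha> then 1 else 0"]) (simp add: if_distrib[of "\<lambda>x. x * _"] cong: if_cong)

lemma mon_Suc: "mon (\<alpha>(i := Suc (\<alpha> i))) p = p $ i * mon \<alpha> p"
proof -
  have "mon (\<alpha>(i := Suc (\<alpha> i))) p = p $ i ^ Suc (\<alpha> i) * (\<Prod>j\<in>UNIV - {i}. p $ j ^ \<alpha> j)"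
    unfolding mon_def by (subst prod.remove[of _ i]) auto
  moreover have "mon \<alpha> p = p $ i ^ \<alpha> i * (\<Prod>j\<in>UNIV - {i}. p $ j ^ \<alpha> j)"
    unfolding mon_def by (subst prod.remove[of _ i]) auto
  ultimately show ?thesis by simp
qed

lemma exps_Suc: "\<alpha>(i := Suc (\<alpha> i)) \<in> exps (Suc d) \<longleftrightarrow> \<alpha> \<in> exps d"
proof -
  have "(\<Sum>j\<in>UNIV. (\<alpha>(i := Suc (\<alpha> i))) j) = Suc (\<alpha> i) + (\<Sum>j\<in>UNIV - {i}. \<alpha> j)"
    by (subst sum.remove[of _ i]) auto
  moreover have "(\<Sum>j\<in>UNIV. \<alpha> j) = \<alpha> i + (\<Sum>j\<in>UNIV - {i}. \<alpha> j)"
    by (subst sum.remove[of _ i]) auto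
  ultimately show ?thesis by (simp add: exps_def)
qed

lemma Form_coord_mult:
  assumes "f \<in> Form d"
  shows "(\<lambda>p. p $ i * f p) \<in> Form (Suc d)"
proof -
  obtain c where c: "\<And>p. f p = (\<Sum>\<alpha>\<in>exps d. c \<alpha> * mon \<alpha> p)" using assms by (auto simp: Form_def)
  have "(\<lambda>p. \<Sum>\<alpha>\<in>exps d. c \<alpha> * mon (\<alpha>(i := Suc (\<alpha> i))) p) \<in> Form (Suc d)"
    by (intro Form_sum Form_scale mon_Form) (simp add: exps_Suc del: fun_upd_apply)
  then show ?thesis by (simp add: c mon_Suc sum_distrib_left mult_ac)
qed

lemma Form_SucE:
  assumes "f \<in> Form (Suc d)"
  obtains g where "\<And>i. g i \<in> Form d" "\<And>p. f p = (\<Sum>i\<in>UNIV. p $ i * g i p)"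
proof -
  obtain c where c: "\<And>p. f p = (\<Sum>\<alpha>\<in>exps (Suc d). c \<alpha> * mon \<alpha> p)" using assms by (auto simp: Form_def)
  have "\<exists>i \<beta>. \<alpha> = \<beta>(i := Suc (\<beta> i)) \<and> \<beta> \<in> exps d" if "\<alpha> \<in> exps (Suc d)" for \<alpha>
  proof -
    have "\<exists>i. \<alpha> i \<noteq> 0"
    proof (rule ccontr)
      assume "\<not> ?thesis"
      then show False using that by (simp add: exps_def)
    qed
    then obtain i where i: "\<alpha> i \<noteq> 0" by blast
    define \<beta> where "\<beta> = \<alpha>(i := \<alpha> i - 1)"
    have "\<alpha> = \<beta>(i := Suc (\<beta> i))" using i by (auto simp: \<beta>_def)
    moreover from this have "\<beta> \<in> exps d" using that exps_Suc by metis
    ultimately show ?thesis by blast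
  qed
  then obtain I B where IB: "\<And>\<alpha>. \<alpha> \<in> exps (Suc d) \<Longrightarrow> \<alpha> = (B \<alpha>)(I \<alpha> := Suc (B \<alpha> (I \<alpha>))) \<and> B \<alpha> \<in> exps d"
    by metis
  define g where "g i p = (\<Sum>\<alpha>\<in>exps (Suc d). (if I \<alpha> = i then c \<alpha> else 0) * mon (B \<alpha>) p)" for i p
  have "g i \<in> Form d" for i
    unfolding g_def by (intro Form_sum Form_scale mon_Form) (simp add: IB)
  moreover have "f p = (\<Sum>i\<in>UNIV. p $ i * g i p)" for p
  proof -
    have "(\<Sum>i\<in>UNIV. p $ i * g i p) = (\<Sum>\<alpha>\<in>exps (Suc d). \<Sum>i\<in>UNIV. p $ i * ((if I \<alpha> = i then c \<alpha> else 0) * mon (B \<alpha>) p))"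
      unfolding g_def sum_distrib_left by (rule sum.swap)
    also have "\<dots> = (\<Sum>\<alpha>\<in>exps (Suc d). \<Sum>i\<in>UNIV. if I \<alpha> = i then p $ i * (c \<alpha> * mon (B \<alpha>) p) else 0)"
      by (intro sum.cong refl) auto
    also have "\<dots> = (\<Sum>\<alpha>\<in>exps (Suc d). p $ I \<alpha> * (c \<alpha> * mon (B \<alpha>) p))"
      by simp
    also have "\<dots> = f p" unfolding c
    proof (intro sum.cong refl)
      fix \<alpha> assume "\<alpha> \<in> exps (Suc d)"
      from IB[OF this] have "mon \<alpha> p = p $ I \<alpha> * mon (B \<alpha>) p" using mon_Suc by metis
      then show "p $ I \<alpha> * (c \<alpha> * mon (B \<alpha>) p) = c \<alpha> * mon \<alpha> p" by simp
    qed
    finally show ?thesis by simp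
  qed
  ultimately show ?thesis by (rule that)
qed

lemma exps_0: "exps 0 = {\<lambda>_. 0}"
  by (auto simp: exps_def)

lemma Form_0_iff: "f \<in> Form 0 \<longleftrightarrow> (\<exists>c. f = (\<lambda>_. c))"
proof
  assume "f \<in> Form 0"
  then show "\<exists>c. f = (\<lambda>_. c)" by (auto simp: Form_def exps_0 mon_def)
next
  assume "\<exists>c. f = (\<lambda>_. c)"
  then obtain c where "f = (\<lambda>_. c)" by blast
  then have "\<forall>p. f p = (\<Sum>\<alpha>\<in>exps 0. c * mon \<alpha> p)" by (simp add: exps_0 mon_def)
  then show "f \<in> Form 0" unfolding Form_def mem_Collect_eq by (rule exI[of _ "\<lambda>_. c"])
qed

lemma Form_const [simp]: "(\<lambda>_. c) \<in> Form 0"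
  by (auto simp: Form_0_iff)

text \<open>A form of positive degree is a combination of the coordinates with forms of degree one
  less. This induction replaces computations with multi-indices.\<close>

lemma Form_induct [consumes 1, case_names const step]:
  assumes "f \<in> Form d"
    and const: "\<And>c. P 0 (\<lambda>_. c)"
    and step: "\<And>d g. (\<And>i. g i \<in> Form d) \<Longrightarrow> (\<And>i. P d (g i)) \<Longrightarrow> P (Suc d) (\<lambda>p. \<Sum>i\<in>UNIV. p $ i * g i p)"
  shows "P d f"
  using assms(1)
proof (induction d arbitrary: f)
  case 0
  then show ?case using const by (auto simp: Form_0_iff)
next
  case (Suc d)
  obtain g where g: "\<And>i. g i \<in> Form d" "\<And>p. f p = (\<Sum>i\<in>UNIV. p $ i * g i p)" using Form_SucE[OF Suc.prems] by blast
  then have "f = (\<lambda>p. \<Sum>i\<in>UNIV. p $ i * g i p)" by auto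
  moreover have "P (Suc d) (\<lambda>p. \<Sum>i\<in>UNIV. p $ i * g i p)" by (rule step) (use g(1) Suc.IH in auto)
  ultimately show ?case by simp
qed

lemma Form_mult: 
  assumes "f \<in> Form d" "g \<in> Form e"
  shows "(\<lambda>p. f p * g p) \<in> Form (d + e)"
  using assms(1)
proof (induction rule: Form_induct)
  case (const c)
  then show ?case using Form_scale[OF assms(2)] by simp
next
  case (step d h)
  have "(\<lambda>p. \<Sum>i\<in>UNIV. p $ i * (h i p * g p)) \<in> Form (Suc (d + e))"
    by (intro Form_sum Form_coord_mult step.IH)
  then show ?case by (simp add: sum_distrib_right mult.assoc)
qed

lemma Form_power: "f \<in> Form d \<Longrightarrow> (\<lambda>p. f p ^ n) \<in> Form (n * d)"
proof (induction n)
  case (Suc n)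
  then show ?case using Form_mult[of f d "\<lambda>p. f p ^ n" "n * d"] by (simp add: add.commute)
qed simp

lemma Form_cast: "f \<in> Form d \<Longrightarrow> d = e \<Longrightarrow> f \<in> Form e" by simp

lemma Form_coord: "(\<lambda>p. p $ i) \<in> Form 1"
  using Form_coord_mult[OF Form_const[of 1], of i] by simp

lemma lf_Form [simp]: "lf a \<in> Form 1"
  unfolding lf_def[abs_def] by (intro Form_sum Form_scale Form_coord)

lemma Form_1_lf:
  assumes "f \<in> Form 1"
  shows "\<exists>a. \<forall>p. f p = lf a p"
proof -
  have "f \<in> Form (Suc 0)" using assms by simp
  then obtain g where g: "\<And>i. g i \<in> Form 0" "\<And>p. f p = (\<Sum>i\<in>UNIV. p $ i * g i p)" using Form_SucE by blast
  have "g i p = g i 0" for i p using g(1)[of i] unfolding Form_0_iff by force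
  then have "f p = lf (\<chi> i. g i 0) p" for p unfolding g(2) lf_def by (metis (no_types, lifting) mult.commute sum.cong vec_lambda_beta)
  then show ?thesis by blast
qed

lemma lf_simps [simp]:
  "lf a (p + p') = lf a p + lf a p'" "lf a (p - p') = lf a p - lf a p'" "lf a (c *s p) = c * lf a p"
  "lf a 0 = 0" "lf (a + b) p = lf a p + lf b p" "lf (c *s a) p = c * lf a p" "lf 0 p = 0" "lf a (- p) = - lf a p"
  "lf (- a) p = - lf a p" "lf (a - b) p = lf a p - lf b p"
  by (simp_all add: lf_def sum.distrib sum_distrib_left sum_subtractf sum_negf algebra_simps)

lemma lf_sum [simp]: "lf a (\<Sum>i\<in>I. p i) = (\<Sum>i\<in>I. lf a (p i))"
  by (induction I rule: infinite_finite_induct) auto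

lemma lf_sum' [simp]: "lf (\<Sum>i\<in>I. a i) p = (\<Sum>i\<in>I. lf (a i) p)"
  by (induction I rule: infinite_finite_induct) auto

lemma lf_axis [simp]: "lf (axis i 1) p = p $ i" "lf a (axis i 1) = a $ i"
  by (simp_all add: lf_def axis_def if_distrib[of "\<lambda>x. _ * x"] if_distrib[of "\<lambda>x. x * _"] cong: if_cong)

lemma Form_homogeneous: "f \<in> Form d \<Longrightarrow> f (c *s p) = c ^ d * f p"
proof (induction rule: Form_induct)
  case (step d g)
  then show ?case by (simp add: sum_distrib_left mult_ac)
qed simp

text \<open>Subtraction is truncated, so for d = 0 the bound \<open>d - 1\<close> would allow
  nonzero constants. The clause for d = 0 is what keeps the product of a coordinate with a
  derivative in \<open>Form d\<close> in the induction step.\<close>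

lemma Form_derivative_exists:
  assumes "f \<in> Form d"
  shows "\<exists>D. (\<forall>i. D i \<in> Form (d - 1)) \<and> (d = 0 \<longrightarrow> (\<forall>i. D i = (\<lambda>_. 0))) \<and>
     (\<forall>p u. ((\<lambda>s. f (p + s *s u)) has_field_derivative (\<Sum>i\<in>UNIV. u $ i * D i p)) (at 0))"
  using assms
proof (induction rule: Form_induct)
  case (const c)
  then show ?case by (intro exI[of _ "\<lambda>i p. 0"]) auto
next
  case (step d g)
  then have "\<forall>i. \<exists>D. (\<forall>j. D j \<in> Form (d - 1)) \<and> (d = 0 \<longrightarrow> (\<forall>j. D j = (\<lambda>_. 0))) \<and>
     (\<forall>p u. ((\<lambda>s. g i (p + s *s u)) has_field_derivative (\<Sum>j\<in>UNIV. u $ j * D j p)) (at 0))" by blast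
  from choice[OF this] obtain D where "\<forall>i. (\<forall>j. D i j \<in> Form (d - 1)) \<and> (d = 0 \<longrightarrow> (\<forall>j. D i j = (\<lambda>_. 0))) \<and>
     (\<forall>p u. ((\<lambda>s. g i (p + s *s u)) has_field_derivative (\<Sum>j\<in>UNIV. u $ j * D i j p)) (at 0))" by blast
  then have D: "\<And>i j. D i j \<in> Form (d - 1)" "\<And>i j. d = 0 \<Longrightarrow> D i j = (\<lambda>_. 0)"
    "\<And>i p u. ((\<lambda>s. g i (p + s *s u)) has_field_derivative (\<Sum>j\<in>UNIV. u $ j * D i j p)) (at 0)"
    by auto
  define E where "E j p = g j p + (\<Sum>i\<in>UNIV. p $ i * D i j p)" for j p
  have "E j \<in> Form d" for j
  proof -
    have "(\<lambda>p. p $ i * D i j p) \<in> Form d" for i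
    proof (cases "d = 0")
      case True
      then show ?thesis by (simp add: D(2))
    next
      case False
      then show ?thesis using Form_coord_mult[OF D(1)[of i j], of i] by simp
    qed
    then show ?thesis unfolding E_def by (intro Form_add Form_sum step.hyps)
  qed
  moreover have "((\<lambda>s. \<Sum>i\<in>UNIV. (p + s *s u) $ i * g i (p + s *s u)) has_field_derivative (\<Sum>j\<in>UNIV. u $ j * E j p)) (at 0)" for p u
  proof -
    have "((\<lambda>s. \<Sum>i\<in>UNIV. (p + s *s u) $ i * g i (p + s *s u)) has_field_derivative
       (\<Sum>i\<in>UNIV. u $ i * g i p + (\<Sum>j\<in>UNIV. u $ j * D i j p) * p $ i)) (at 0)"
      by (intro DERIV_sum) (auto intro!: derivative_eq_intros D(3))
    moreover have "(\<Sum>i\<in>UNIV. u $ i * g i p + (\<Sum>j\<in>UNIV. u $ j * D i j p) * p $ i) = (\<Sum>j\<in>UNIV. u $ j * E j p)"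
    proof -
      have "(\<Sum>i\<in>UNIV. (\<Sum>j\<in>UNIV. u $ j * D i j p) * p $ i) = (\<Sum>i\<in>UNIV. \<Sum>j\<in>UNIV. u $ j * (p $ i * D i j p))"
        unfolding sum_distrib_right by (intro sum.cong refl) (simp add: mult_ac)
      also have "\<dots> = (\<Sum>j\<in>UNIV. u $ j * (\<Sum>i\<in>UNIV. p $ i * D i j p))"
        unfolding sum_distrib_left by (rule sum.swap)
      finally show ?thesis by (simp add: E_def distrib_left sum.distrib)
    qed
    ultimately show ?thesis by simp
  qed
  ultimately show ?case by (intro exI[of _ E]) auto
qed

lemma ddir_expand:
  assumes "f \<in> Form d"
  shows "ddir u f p = (\<Sum>i\<in>UNIV. u $ i * ddir (axis i 1) f p)"
    and "ddir (axis i 1) f \<in> Form (d - 1)"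
    and ddir_has_derivative: "((\<lambda>s. f (p + s *s u)) has_field_derivative ddir u f p) (at 0)"
proof -
  obtain D where D: "\<And>i. D i \<in> Form (d - 1)"
    "\<And>p u. ((\<lambda>s. f (p + s *s u)) has_field_derivative (\<Sum>i\<in>UNIV. u $ i * D i p)) (at 0)"
    using Form_derivative_exists[OF assms] by blast
  have dd: "ddir u f p = (\<Sum>i\<in>UNIV. u $ i * D i p)" for u p
    unfolding ddir_def using D(2) by (rule DERIV_imp_deriv)
  have a: "ddir (axis i 1) f p = D i p" for i p
    unfolding dd by (simp add: axis_def if_distrib[of "\<lambda>x. x * _"] cong: if_cong)
  show "ddir u f p = (\<Sum>i\<in>UNIV. u $ i * ddir (axis i 1) f p)" unfolding a by (rule dd)
  have "ddir (axis i 1) f = D i" using a by auto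
  then show "ddir (axis i 1) f \<in> Form (d - 1)" using D by simp
  show "((\<lambda>s. f (p + s *s u)) has_field_derivative ddir u f p) (at 0)" unfolding dd by (rule D)
qed

lemma ddir_Form: "f \<in> Form d \<Longrightarrow> ddir u f \<in> Form (d - 1)"
proof -
  assume f: "f \<in> Form d"
  have "(\<lambda>p. \<Sum>i\<in>UNIV. u $ i * ddir (axis i 1) f p) \<in> Form (d - 1)"
    by (intro Form_sum Form_scale ddir_expand(2)[OF f])
  then show ?thesis by (simp add: ddir_expand(1)[OF f, symmetric, abs_def])
qed

lemma ddir_linear:
  assumes "f \<in> Form d"
  shows "ddir (u + v) f p = ddir u f p + ddir v f p"
    "ddir (u - v) f p = ddir u f p - ddir v f p"
    "ddir (c *s u) f p = c * ddir u f p" "ddir 0 f p = 0" "ddir (- u) f p = - ddir u f p"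
  unfolding ddir_expand(1)[OF assms, of "u + v"] ddir_expand(1)[OF assms, of "u - v"] ddir_expand(1)[OF assms, of "c *s u"]
    ddir_expand(1)[OF assms, of u] ddir_expand(1)[OF assms, of v] ddir_expand(1)[OF assms, of 0] ddir_expand(1)[OF assms, of "- u"]
  by (simp_all add: sum.distrib sum_subtractf sum_distrib_left sum_negf algebra_simps)

lemma ddir_sum: "f \<in> Form d \<Longrightarrow> ddir (\<Sum>i\<in>I. u i) f p = (\<Sum>i\<in>I. ddir (u i) f p)"
  by (induction I rule: infinite_finite_induct) (auto simp: ddir_linear)

lemma ddir_mult:
  assumes "f \<in> Form d" "g \<in> Form e"
  shows "ddir u (\<lambda>p. f p * g p) p = ddir u f p * g p + f p * ddir u g p"
proof -
  have "((\<lambda>s. f (p + s *s u) * g (p + s *s u)) has_field_derivative (ddir u f p * g p + f p * ddir u g p)) (at 0)"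
    by (auto intro!: derivative_eq_intros ddir_has_derivative[OF assms(1)] ddir_has_derivative[OF assms(2)])
  then show ?thesis unfolding ddir_def[of u "\<lambda>p. f p * g p"] by (rule DERIV_imp_deriv)
qed

lemma ddir_add:
  assumes "f \<in> Form d" "g \<in> Form e"
  shows "ddir u (\<lambda>p. f p + g p) p = ddir u f p + ddir u g p"
proof -
  have "((\<lambda>s. f (p + s *s u) + g (p + s *s u)) has_field_derivative (ddir u f p + ddir u g p)) (at 0)"
    by (auto intro!: derivative_eq_intros ddir_has_derivative[OF assms(1)] ddir_has_derivative[OF assms(2)])
  then show ?thesis unfolding ddir_def[of u "\<lambda>p. f p + g p"] by (rule DERIV_imp_deriv)
qed

lemma ddir_scale:
  assumes "f \<in> Form d"
  shows "ddir u (\<lambda>p. c * f p) p = c * ddir u f p"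
proof -
  have "((\<lambda>s. c * f (p + s *s u)) has_field_derivative (c * ddir u f p)) (at 0)"
    by (auto intro!: derivative_eq_intros ddir_has_derivative[OF assms(1)])
  then show ?thesis unfolding ddir_def[of u "\<lambda>p. c * f p"] by (rule DERIV_imp_deriv)
qed

lemma ddir_lf [simp]: "ddir u (lf a) p = lf a u"
  unfolding ddir_def by (rule DERIV_imp_deriv) (auto intro!: derivative_eq_intros)

lemma ddir_euler:
  assumes "f \<in> Form d"
  shows "ddir p f p = of_nat d * f p"
proof -
  have "f (p + s *s p) = (1 + s) ^ d * f p" for s
    using Form_homogeneous[OF assms, of "1 + s" p] by (simp add: vector_sadd_rdistrib)
  moreover have "((\<lambda>s. (1 + s) ^ d * f p) has_field_derivative (of_nat d * f p)) (at 0)"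
    by (auto intro!: derivative_eq_intros)
  ultimately show ?thesis unfolding ddir_def by (simp add: DERIV_imp_deriv)
qed

subsection \<open>The polarity of a smooth quadric\<close>

text \<open>The derivative in a fixed direction is a linear form. By Euler's formula 2 E(v) is the
  derivative of E at v in the direction v; expanding this at p + s u and comparing the terms linear
  in s gives the symmetry.\<close>

lemma Form2_bilinear:
  assumes E: "E \<in> Form 2"
  shows "ddir u E (a + b) = ddir u E a + ddir u E b" "ddir u E (c *s a) = c * ddir u E a"
    and Form2_symmetric: "ddir u E p = ddir p E u"
proof -
  have lin: "\<exists>w. \<forall>p. ddir u E p = lf w p" for u
    using Form_1_lf[of "ddir u E"] ddir_Form[OF E, of u] by simp
  then show l1: "ddir u E (a + b) = ddir u E a + ddir u E b" for u a b
    by (metis lf_simps(1))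
  show l2: "ddir u E (c *s a) = c * ddir u E a" for u a c
    using lin by (metis lf_simps(3))
  have "E (p + s *s u) = (ddir p E p + s * (ddir p E u + ddir u E p) + s * s * ddir u E u) / 2" for s
  proof -
    have "2 * E (p + s *s u) = ddir p E p + s * (ddir p E u + ddir u E p) + s * s * ddir u E u"
      using ddir_euler[OF E, of "p + s *s u"] by (simp add: ddir_linear[OF E] l1 l2 algebra_simps)
    then show ?thesis by (simp add: mult.commute)
  qed
  then have "(\<lambda>s. E (p + s *s u)) = (\<lambda>s. (ddir p E p + s * (ddir p E u + ddir u E p) + s * s * ddir u E u) / 2)" by blast
  then have "((\<lambda>s. (ddir p E p + s * (ddir p E u + ddir u E p) + s * s * ddir u E u) / 2) has_field_derivative ddir u E p) (at 0)"
    using ddir_has_derivative[OF E, of p u] by (simp only:)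
  moreover have "((\<lambda>s. (ddir p E p + s * (ddir p E u + ddir u E p) + s * s * ddir u E u) / 2) has_field_derivative (ddir p E u + ddir u E p) / 2) (at 0)"
    by (auto intro!: derivative_eq_intros)
  ultimately have "ddir u E p = (ddir p E u + ddir u E p) / 2" by (rule DERIV_unique)
  then show "ddir u E p = ddir p E u" by simp
qed

section \<open>The quotients I1 and cubics modulo q, and the maps between them\<close>

lemma I1_relI:
  assumes "\<Delta> \<in> HomVS2" "\<Delta>' \<in> HomVS2" "\<And>a p. \<Delta> a p - \<Delta>' a p = lf v p * lf a p + s a * q p"
  shows "(\<Delta>, \<Delta>') \<in> I1_rel q"
  using assms unfolding I1_rel_def by blast

lemma I1_rel_HomVS2: "(\<Delta>, \<Delta>') \<in> I1_rel q \<Longrightarrow> \<Delta> \<in> HomVS2" "(\<Delta>, \<Delta>') \<in> I1_rel q \<Longrightarrow> \<Delta>' \<in> HomVS2"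
  by (simp_all add: I1_rel_def)

lemma cubic_relI:
  assumes "t \<in> Form 3" "t' \<in> Form 3" "\<And>p. t p - t' p = lf v p * q p"
  shows "(t, t') \<in> cubic_rel q"
  using assms unfolding cubic_rel_def by blast

lemma cubic_rel_Form: "(t, t') \<in> cubic_rel q \<Longrightarrow> t \<in> Form 3" "(t, t') \<in> cubic_rel q \<Longrightarrow> t' \<in> Form 3"
  by (simp_all add: cubic_rel_def)

locale quadric =
  fixes q :: form
  assumes smooth: "smooth_quadric q"
begin

lemma q_Form: "q \<in> Form 2"
  using smooth by (simp add: smooth_quadric_def)

text \<open>A vector in the kernel of the polar form lies on the quadric by Euler's formula, and
  would be a singular point of it.\<close>

lemma polar_nondegenerate:
  assumes "\<And>p. ddir u q p = 0"
  shows "u = 0"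
proof (rule ccontr)
  assume "u \<noteq> 0"
  moreover have "q u = 0" using ddir_euler[OF q_Form, of u] assms by simp
  ultimately obtain w where "ddir w q u \<noteq> 0" using smooth by (auto simp: smooth_quadric_def)
  then show False using assms[of w] Form2_symmetric[OF q_Form] by metis
qed

lemma polar_surjective: "\<exists>u. \<forall>p. ddir u q p = lf a p"
proof -
  have "\<forall>i. \<exists>m. \<forall>p. ddir (axis i 1) q p = lf m p"
    using Form_1_lf ddir_Form[OF q_Form] by fastforce
  from choice[OF this] obtain m where m: "\<And>i p. ddir (axis i 1) q p = lf (m i) p" by blast
  define M :: "complex^4^4" where "M = (\<chi> i j. m j $ i)"
  have M: "ddir u q p = lf (M *v u) p" for u p
  proof -
    have "M *v u = (\<Sum>i\<in>UNIV. u $ i *s m i)"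
      by (simp add: vec_eq_iff M_def matrix_vector_mult_def mult.commute)
    then show ?thesis by (simp add: ddir_expand(1)[OF q_Form, of u] m)
  qed
  have "u = 0" if "M *v u = 0" for u
    by (rule polar_nondegenerate) (simp add: M that)
  then have "invertible M" by (simp add: invertible_left_inverse matrix_left_invertible_ker)
  then obtain M' where "M ** M' = mat 1" by (auto simp: invertible_def)
  then have "M *v (M' *v a) = a" by (simp add: matrix_vector_mul_assoc)
  then show ?thesis using M by metis
qed

lemma polar_inject:
  assumes "\<And>p. ddir u q p = ddir u' q p"
  shows "u = u'"
  using polar_nondegenerate[of "u - u'"] assms by (simp add: ddir_linear[OF q_Form])

lemma polar_sharp: "ddir (sharp q a) q p = lf a p"
proof -
  obtain u where u: "\<forall>p. ddir u q p = lf a p" using polar_surjective by blast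
  have "\<forall>p. ddir (sharp q a) q p = lf a p" unfolding sharp_def
    by (rule theI[of _ u]) (use u in \<open>auto intro!: polar_inject\<close>)
  then show ?thesis by blast
qed

lemma sharp_unique: "(\<And>p. ddir u q p = lf a p) \<Longrightarrow> sharp q a = u"
  by (rule polar_inject) (simp add: polar_sharp)

lemma sharp_linear: "sharp q (a + b) = sharp q a + sharp q b" "sharp q (c *s a) = c *s sharp q a"
  by (rule sharp_unique, simp add: ddir_linear[OF q_Form] polar_sharp)+

text \<open>\<open>sig\<close> and \<open>pr\<close> are the maps \<sigma> and \<pi> on
  representatives, before passing to equivalence classes.\<close>

definition sig :: "form \<Rightarrow> vec4 \<Rightarrow> form" where "sig t a = ddir (sharp q a) t"

definition pr :: "(vec4 \<Rightarrow> form) \<Rightarrow> form" where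
  "pr \<Delta> p = (\<Sum>i\<in>UNIV. ddir (axis i 1) q p * \<Delta> (axis i 1) p)"

lemma sig_HomVS2: "t \<in> Form 3 \<Longrightarrow> sig t \<in> HomVS2"
  using ddir_Form[of t 3] by (auto simp: HomVS2_def sig_def sharp_linear ddir_linear)

lemma equiv_I1: "equiv HomVS2 (I1_rel q)"
proof (rule equivI)
  show "I1_rel q \<subseteq> HomVS2 \<times> HomVS2" by (auto simp: I1_rel_def)
  have "\<Delta> a p - \<Delta> a p = lf 0 p * lf a p + 0 * q p" for \<Delta> :: "vec4 \<Rightarrow> form" and a p by simp
  then show "refl_on HomVS2 (I1_rel q)" 
    unfolding refl_on_def I1_rel_def by (auto intro!: exI[of _ "0 :: vec4"] exI[of _ "\<lambda>_. 0 :: complex"])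
  show "sym (I1_rel q)"
  proof (rule symI)
    fix \<Delta> \<Delta>' assume r: "(\<Delta>, \<Delta>') \<in> I1_rel q"
    then obtain v s where "\<And>a p. \<Delta> a p - \<Delta>' a p = lf v p * lf a p + s a * q p" by (auto simp: I1_rel_def)
    then have "\<Delta>' a p - \<Delta> a p = lf (- v) p * lf a p + (- s a) * q p" for a p
      by (metis (no_types, lifting) lf_simps(9) minus_add_distrib minus_diff_eq mult_minus_left)
    then show "(\<Delta>', \<Delta>) \<in> I1_rel q" by (intro I1_relI[where s="\<lambda>a. - s a"] I1_rel_HomVS2[OF r])
  qed
  show "trans (I1_rel q)"
  proof (rule transI)
    fix \<Delta> \<Delta>' \<Delta>'' assume r: "(\<Delta>, \<Delta>') \<in> I1_rel q" "(\<Delta>', \<Delta>'') \<in> I1_rel q"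
    then obtain v s v' s' where e: "\<And>a p. \<Delta> a p - \<Delta>' a p = lf v p * lf a p + s a * q p"
       "\<And>a p. \<Delta>' a p - \<Delta>'' a p = lf v' p * lf a p + s' a * q p" by (auto simp: I1_rel_def)
    have "\<Delta> a p - \<Delta>'' a p = lf (v + v') p * lf a p + (s a + s' a) * q p" for a p
      using e[of a p] by (simp add: algebra_simps)
    then show "(\<Delta>, \<Delta>'') \<in> I1_rel q"
      by (intro I1_relI[where s="\<lambda>a. s a + s' a"] I1_rel_HomVS2(1)[OF r(1)] I1_rel_HomVS2(2)[OF r(2)])
  qed
qed

lemma equiv_cubic: "equiv (Form 3) (cubic_rel q)"
proof (rule equivI)
  show "cubic_rel q \<subseteq> Form 3 \<times> Form 3" by (auto simp: cubic_rel_def)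
  have "t p - t p = lf 0 p * q p" for t :: form and p by simp
  then show "refl_on (Form 3) (cubic_rel q)" unfolding refl_on_def cubic_rel_def by blast
  show "sym (cubic_rel q)"
  proof (rule symI)
    fix t t' assume r: "(t, t') \<in> cubic_rel q"
    then obtain v where "\<And>p. t p - t' p = lf v p * q p" by (auto simp: cubic_rel_def)
    then have "t' p - t p = lf (- v) p * q p" for p by (metis lf_simps(9) minus_diff_eq mult_minus_left)
    then show "(t', t) \<in> cubic_rel q" using cubic_relI cubic_rel_Form r by blast
  qed
  show "trans (cubic_rel q)"
  proof (rule transI)
    fix t t' t'' assume r: "(t, t') \<in> cubic_rel q" "(t', t'') \<in> cubic_rel q"
    then obtain v v' where e: "\<And>p. t p - t' p = lf v p * q p" "\<And>p. t' p - t'' p = lf v' p * q p"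
      by (auto simp: cubic_rel_def)
    have "t p - t'' p = lf (v + v') p * q p" for p using e[of p] by (simp add: algebra_simps)
    then show "(t, t'') \<in> cubic_rel q" using cubic_relI cubic_rel_Form r by blast
  qed
qed

text \<open>By the product rule the derivative of v q in the direction u is v(u) q + v times the
  derivative of q. For u dual to a the latter is a itself, so the second term is \<mu>(v)(a) and the
  first a multiple of q.\<close>

lemma sig_respects:
  assumes "(t, t') \<in> cubic_rel q"
  shows "(sig t, sig t') \<in> I1_rel q"
proof -
  have F: "t \<in> Form 3" "t' \<in> Form 3" using assms by (auto simp: cubic_rel_def)
  obtain v where v: "\<And>p. t p - t' p = lf v p * q p" using assms by (auto simp: cubic_rel_def)
  have "t = (\<lambda>p. t' p + lf v p * q p)" using v by (auto simp: algebra_simps)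
  moreover have vq: "(\<lambda>p. lf v p * q p) \<in> Form 3" by (rule Form_cast[OF Form_mult[OF lf_Form q_Form]]) simp
  ultimately have "ddir u t p = ddir u t' p + (lf v u * q p + lf v p * ddir u q p)" for u p
    using ddir_add[OF F(2) vq] ddir_mult[OF lf_Form q_Form] by simp
  then have "sig t a p - sig t' a p = lf v p * lf a p + lf v (sharp q a) * q p" for a p
    by (simp add: sig_def polar_sharp)
  moreover have "sig t \<in> HomVS2" "sig t' \<in> HomVS2" using F sig_HomVS2 by auto
  ultimately show ?thesis by (intro I1_relI[where s="\<lambda>a. lf v (sharp q a)"]) auto
qed

lemma sigma_map_class:
  assumes "t \<in> Form 3"
  shows "sigma_map q (cubic_class q t) = I1_rel q `` {sig t}"
proof -
  have "(\<lambda>t. I1_rel q `` {sig t}) respects cubic_rel q"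
    by (intro congruentI equiv_class_eq[OF equiv_I1] sig_respects)
  from UN_equiv_class[OF equiv_cubic this assms] show ?thesis
    by (simp add: sigma_map_def cubic_class_def sig_def[abs_def])
qed

lemma pr_Form: "\<Delta> \<in> HomVS2 \<Longrightarrow> pr \<Delta> \<in> Form 3"
proof -
  assume D: "\<Delta> \<in> HomVS2"
  have "(\<lambda>p. ddir (axis i 1) q p * \<Delta> (axis i 1) p) \<in> Form 3" for i
    by (rule Form_cast[OF Form_mult[OF ddir_Form[OF q_Form]]]) (use D in \<open>auto simp: HomVS2_def\<close>)
  then show ?thesis unfolding pr_def[abs_def] by (intro Form_sum)
qed

lemma pr_respects:
  assumes "(\<Delta>, \<Delta>') \<in> I1_rel q"
  shows "(pr \<Delta>, pr \<Delta>') \<in> cubic_rel q"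
proof -
  have F: "\<Delta> \<in> HomVS2" "\<Delta>' \<in> HomVS2" using assms by (auto simp: I1_rel_def)
  obtain v s where v: "\<And>a p. \<Delta> a p - \<Delta>' a p = lf v p * lf a p + s a * q p" using assms by (auto simp: I1_rel_def)
  have "\<forall>i. \<exists>m. \<forall>p. ddir (axis i 1) q p = lf m p"
    using Form_1_lf ddir_Form[OF q_Form] by fastforce
  from choice[OF this] obtain m where m: "\<And>i p. ddir (axis i 1) q p = lf (m i) p" by blast
  \<comment> \<open>By Euler's formula \<pi> sends \<mu>(v) to 2 v q; the multiples of q in the
    values of \<Delta> contribute the remaining sum.\<close>
  define b where "b = 2 *s v + (\<Sum>i\<in>UNIV. s (axis i 1) *s m i)"
  have "pr \<Delta> p - pr \<Delta>' p = lf b p * q p" for p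
  proof -
    have "pr \<Delta> p - pr \<Delta>' p = (\<Sum>i\<in>UNIV. ddir (axis i 1) q p * (lf v p * lf (axis i 1) p + s (axis i 1) * q p))"
      unfolding pr_def v[symmetric] by (simp add: right_diff_distrib sum_subtractf)
    also have "\<dots> = lf v p * (\<Sum>i\<in>UNIV. p $ i * ddir (axis i 1) q p) + (\<Sum>i\<in>UNIV. s (axis i 1) * lf (m i) p) * q p"
      unfolding sum_distrib_left sum_distrib_right sum.distrib[symmetric] m by (intro sum.cong refl) (simp add: algebra_simps)
    also have "(\<Sum>i\<in>UNIV. p $ i * ddir (axis i 1) q p) = 2 * q p"
      using ddir_expand(1)[OF q_Form, of p p] ddir_euler[OF q_Form, of p] by simp
    finally show ?thesis by (simp add: b_def algebra_simps)
  qed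
  then show ?thesis using F pr_Form cubic_relI by blast
qed

lemma proj_pi_class:
  assumes "\<Delta> \<in> HomVS2"
  shows "proj_pi q (I1_rel q `` {\<Delta>}) = cubic_class q (pr \<Delta>)"
proof -
  have "(\<lambda>\<Delta>. cubic_class q (pr \<Delta>)) respects I1_rel q"
    unfolding cubic_class_def by (intro congruentI equiv_class_eq[OF equiv_cubic] pr_respects)
  from UN_equiv_class[OF equiv_I1 this assms] show ?thesis
    by (simp add: proj_pi_def pr_def[abs_def])
qed

text \<open>By symmetry of the polar form, the linear form whose coefficients are the partial
  derivatives of q at p is dual to p itself. So contracting with these derivatives differentiates t
  in the direction p, which by Euler's formula gives 3 t.\<close>

lemma pr_sig:
  assumes "t \<in> Form 3"
  shows "pr (sig t) = (\<lambda>p. 3 * t p)"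
proof
  fix p
  let ?b = "\<Sum>i\<in>UNIV. ddir (axis i 1) q p *s axis i (1::complex)"
  have "sharp q ?b = p"
  proof (rule sharp_unique)
    fix p'
    have "lf ?b p' = ddir p' q p" by (simp add: ddir_expand(1)[OF q_Form, of p'] mult.commute)
    then show "ddir p q p' = lf ?b p'" using Form2_symmetric[OF q_Form] by metis
  qed
  moreover have "pr (sig t) p = ddir (sharp q ?b) t p"
  proof -
    have "sharp q (\<Sum>i\<in>I. c i *s a i) = (\<Sum>i\<in>I. c i *s sharp q (a i))" for I c and a :: "4 \<Rightarrow> vec4"
      by (rule sharp_unique) (simp add: ddir_sum[OF q_Form] ddir_linear[OF q_Form] polar_sharp)
    then show ?thesis by (simp add: pr_def sig_def ddir_sum[OF assms] ddir_linear[OF assms])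
  qed
  ultimately show "pr (sig t) p = 3 * t p" using ddir_euler[OF assms, of p] by simp
qed

lemma cubic_class_eq_iff: "t \<in> Form 3 \<Longrightarrow> t' \<in> Form 3 \<Longrightarrow> cubic_class q t = cubic_class q t' \<longleftrightarrow> (t, t') \<in> cubic_rel q"
  unfolding cubic_class_def by (rule eq_equiv_class_iff[OF equiv_cubic])

lemma cubic_rel_scale: "(t, t') \<in> cubic_rel q \<Longrightarrow> ((\<lambda>p. c * t p), (\<lambda>p. c * t' p)) \<in> cubic_rel q"
proof -
  assume r: "(t, t') \<in> cubic_rel q"
  then obtain v where "\<And>p. t p - t' p = lf v p * q p" by (auto simp: cubic_rel_def)
  then have "c * t p - c * t' p = lf (c *s v) p * q p" for p
    by (metis lf_simps(6) mult.assoc right_diff_distrib)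
  then show ?thesis using cubic_relI[OF Form_scale Form_scale] cubic_rel_Form r by blast
qed

lemma H0OQ3_E: "Y \<in> H0OQ3 q \<Longrightarrow> \<exists>t\<in>Form 3. Y = cubic_class q t"
  by (auto simp: H0OQ3_def cubic_class_def quotient_def)

lemma H0OQ3_I: "t \<in> Form 3 \<Longrightarrow> cubic_class q t \<in> H0OQ3 q"
  by (auto simp: H0OQ3_def cubic_class_def quotient_def)

lemma proj_sigma: "t \<in> Form 3 \<Longrightarrow> proj_pi q (sigma_map q (cubic_class q t)) = cubic_class q (\<lambda>p. 3 * t p)"
  by (simp add: sigma_map_class proj_pi_class sig_HomVS2 pr_sig)

lemma bij_proj_pi: "bij_betw (proj_pi q) (I13 q) (H0OQ3 q)"
  unfolding bij_betw_def
proof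
  show "inj_on (proj_pi q) (I13 q)"
  proof (rule inj_onI)
    fix X X' assume "X \<in> I13 q" "X' \<in> I13 q" and eq: "proj_pi q X = proj_pi q X'"
    then obtain t t' where t: "t \<in> Form 3" "X = sigma_map q (cubic_class q t)" "t' \<in> Form 3" "X' = sigma_map q (cubic_class q t')"
      unfolding I13_def using H0OQ3_E by blast
    have "((\<lambda>p. 3 * t p), (\<lambda>p. 3 * t' p)) \<in> cubic_rel q"
      using eq t by (simp add: proj_sigma cubic_class_eq_iff Form_scale)
    from cubic_rel_scale[OF this, of "1 / 3"] have "(t, t') \<in> cubic_rel q" by simp
    then have "cubic_class q t = cubic_class q t'" using t cubic_class_eq_iff by blast
      then show "X = X'" using t by simp
  qed
  show "proj_pi q ` I13 q = H0OQ3 q"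
  proof
    show "proj_pi q ` I13 q \<subseteq> H0OQ3 q"
    proof
      fix Y assume "Y \<in> proj_pi q ` I13 q"
      then obtain t where "t \<in> Form 3" "Y = proj_pi q (sigma_map q (cubic_class q t))"
        unfolding I13_def using H0OQ3_E by blast
      then show "Y \<in> H0OQ3 q" by (simp add: proj_sigma H0OQ3_I Form_scale)
    qed
    show "H0OQ3 q \<subseteq> proj_pi q ` I13 q"
    proof
      fix Y assume "Y \<in> H0OQ3 q"
      then obtain t where t: "t \<in> Form 3" "Y = cubic_class q t" using H0OQ3_E by blast
      have t3: "(\<lambda>p. (1 / 3) * t p) \<in> Form 3" by (rule Form_scale[OF t(1)])
      have "proj_pi q (sigma_map q (cubic_class q (\<lambda>p. (1 / 3) * t p))) = Y"
        unfolding proj_sigma[OF t3] t(2) by simp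
      then show "Y \<in> proj_pi q ` I13 q" unfolding I13_def using H0OQ3_I[OF t3] by blast
    qed
  qed
qed

lemma uminus_class:
  assumes "\<Delta> \<in> HomVS2"
  shows "uminus_I1 (I1_rel q `` {\<Delta>}) = I1_rel q `` {\<lambda>a p. - \<Delta> a p}"
proof -
  have neg: "((\<lambda>a p. - \<Delta> a p), (\<lambda>a p. - \<Delta>' a p)) \<in> I1_rel q" if r: "(\<Delta>, \<Delta>') \<in> I1_rel q" for \<Delta> \<Delta>'
  proof -
    obtain v s where e: "\<And>a p. \<Delta> a p - \<Delta>' a p = lf v p * lf a p + s a * q p" using r by (auto simp: I1_rel_def)
    have "- \<Delta> a p - - \<Delta>' a p = lf (- v) p * lf a p + (- s a) * q p" for a p
      using e[of a p] by (simp add: algebra_simps)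
    moreover have "(\<lambda>a p. - \<Delta> a p) \<in> HomVS2" "(\<lambda>a p. - \<Delta>' a p) \<in> HomVS2"
      using I1_rel_HomVS2[OF r] by (auto simp: HomVS2_def Form_uminus)
    ultimately show ?thesis by (intro I1_relI[where s="\<lambda>a. - s a"])
  qed
  show ?thesis
  proof
    show "uminus_I1 (I1_rel q `` {\<Delta>}) \<subseteq> I1_rel q `` {\<lambda>a p. - \<Delta> a p}"
      using neg by (auto simp: uminus_I1_def)
    show "I1_rel q `` {\<lambda>a p. - \<Delta> a p} \<subseteq> uminus_I1 (I1_rel q `` {\<Delta>})"
    proof
      fix \<Delta>' assume "\<Delta>' \<in> I1_rel q `` {\<lambda>a p. - \<Delta> a p}"
      then have "(\<Delta>, (\<lambda>a p. - \<Delta>' a p)) \<in> I1_rel q" using neg[of "\<lambda>a p. - \<Delta> a p" \<Delta>'] by simp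
      then show "\<Delta>' \<in> uminus_I1 (I1_rel q `` {\<Delta>})"
        unfolding uminus_I1_def by (intro image_eqI[of _ _ "\<lambda>a p. - \<Delta>' a p"]) auto
    qed
  qed
qed

end

subsection \<open>Coordinates adapted to the rulings\<close>

definition bidegree_le :: "nat \<Rightarrow> complex poly poly \<Rightarrow> bool" where
  "bidegree_le d F \<longleftrightarrow> degree F \<le> d \<and> (\<forall>b. degree (coeff F b) \<le> d)"

lemma bidegree_le_add: "bidegree_le d F \<Longrightarrow> bidegree_le d G \<Longrightarrow> bidegree_le d (F + G)"
  by (auto simp: bidegree_le_def intro: degree_add_le)

lemma bidegree_le_0 [simp]: "bidegree_le d 0"
  by (simp add: bidegree_le_def)

lemma bidegree_le_sum: "(\<And>i. i \<in> I \<Longrightarrow> bidegree_le d (F i)) \<Longrightarrow> bidegree_le d (\<Sum>i\<in>I. F i)"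
  by (induction I rule: infinite_finite_induct) (auto intro: bidegree_le_add)

lemma bidegree_le_mult:
  assumes "bidegree_le d F" "bidegree_le e G"
  shows "bidegree_le (d + e) (F * G)"
proof -
  have "degree (coeff (F * G) b) \<le> d + e" for b
    unfolding coeff_mult
  proof (rule degree_sum_le)
    fix i
    show "degree (coeff F i * coeff G (b - i)) \<le> d + e"
      using assms degree_mult_le[of "coeff F i" "coeff G (b - i)"]
      by (meson add_mono bidegree_le_def le_trans)
  qed simp
  moreover have "degree (F * G) \<le> d + e"
    using assms degree_mult_le[of F G] by (auto simp: bidegree_le_def)
  ultimately show ?thesis by (simp add: bidegree_le_def)
qed

text \<open>On the Segre parametrization every coordinate is a polynomial of bidegree at most (1,
  1), so the bound grows by one with each degree.\<close>

lemma Form_bilinear_poly: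
  assumes "f \<in> Form d"
  shows "\<exists>F. bidegree_le d F \<and> (\<forall>x y. f (w0 + x *s w1 + y *s w2 + (x * y) *s w3) = poly2 F x y)"
  using assms
proof (induction rule: Form_induct)
  case (const c)
  show ?case by (intro exI[of _ "[:[:c:]:]"]) (auto simp: bidegree_le_def coeff_pCons split: nat.splits)
next
  case (step d g)
  then have "\<forall>i. \<exists>F. bidegree_le d F \<and> (\<forall>x y. g i (w0 + x *s w1 + y *s w2 + (x * y) *s w3) = poly2 F x y)" by blast
  from choice[OF this] obtain F where "\<forall>i. bidegree_le d (F i) \<and> (\<forall>x y. g i (w0 + x *s w1 + y *s w2 + (x * y) *s w3) = poly2 (F i) x y)" by blast
  then have F: "\<And>i. bidegree_le d (F i)" "\<And>i x y. g i (w0 + x *s w1 + y *s w2 + (x * y) *s w3) = poly2 (F i) x y"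
    by auto
  define L where "L i = [:[:w0 $ i, w1 $ i:], [:w2 $ i, w3 $ i:]:]" for i
  have "bidegree_le 1 (L i)" for i by (auto simp: bidegree_le_def L_def coeff_pCons split: nat.splits)
  then have "bidegree_le (Suc d) (\<Sum>i\<in>UNIV. L i * F i)"
    using bidegree_le_mult[OF _ F(1)] by (intro bidegree_le_sum) fastforce
  moreover have "poly2 (L i) x y = (w0 + x *s w1 + y *s w2 + (x * y) *s w3) $ i" for i x y
    by (simp add: L_def algebra_simps)
  ultimately show ?case by (intro exI[of _ "\<Sum>i\<in>UNIV. L i * F i"]) (simp add: F(2))
qed

lemma BiForm_product:
  assumes "f \<in> Form m" "g \<in> Form n"
  shows "(\<lambda>p p'. f p * g p') \<in> BiForm m n"
proof -
  obtain c c' where c: "\<And>p. f p = (\<Sum>\<alpha>\<in>exps m. c \<alpha> * mon \<alpha> p)" "\<And>p. g p = (\<Sum>\<alpha>\<in>exps n. c' \<alpha> * mon \<alpha> p)"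
    using assms by (auto simp: Form_def)
  have "f p * g p' = (\<Sum>\<alpha>\<in>exps m. \<Sum>\<beta>\<in>exps n. (c \<alpha> * c' \<beta>) * mon \<alpha> p * mon \<beta> p')" for p p'
    unfolding c sum_product by (intro sum.cong refl) (simp add: mult_ac)
  then show ?thesis unfolding BiForm_def mem_Collect_eq by (intro exI[of _ "\<lambda>\<alpha> \<beta>. c \<alpha> * c' \<beta>"]) simp
qed

lemma BiForm_add:
  assumes "f \<in> BiForm m n" "g \<in> BiForm m n"
  shows "(\<lambda>p p'. f p p' + g p p') \<in> BiForm m n"
proof -
  obtain c c' where "\<And>p p'. f p p' = (\<Sum>\<alpha>\<in>exps m. \<Sum>\<beta>\<in>exps n. c \<alpha> \<beta> * mon \<alpha> p * mon \<beta> p')"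
     "\<And>p p'. g p p' = (\<Sum>\<alpha>\<in>exps m. \<Sum>\<beta>\<in>exps n. c' \<alpha> \<beta> * mon \<alpha> p * mon \<beta> p')"
    using assms by (auto simp: BiForm_def)
  then have "f p p' + g p p' = (\<Sum>\<alpha>\<in>exps m. \<Sum>\<beta>\<in>exps n. (c \<alpha> \<beta> + c' \<alpha> \<beta>) * mon \<alpha> p * mon \<beta> p')" for p p'
    by (simp add: sum.distrib distrib_right)
  then show ?thesis unfolding BiForm_def mem_Collect_eq by (intro exI[of _ "\<lambda>\<alpha> \<beta>. c \<alpha> \<beta> + c' \<alpha> \<beta>"]) simp
qed

lemma BiForm_fix:
  assumes "f \<in> BiForm m n"
  shows "(\<lambda>p. f p p') \<in> Form m"
proof -
  obtain c where c: "\<And>p p'. f p p' = (\<Sum>\<alpha>\<in>exps m. \<Sum>\<beta>\<in>exps n. c \<alpha> \<beta> * mon \<alpha> p * mon \<beta> p')"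
    using assms by (auto simp: BiForm_def)
  have "f p p' = (\<Sum>\<alpha>\<in>exps m. (\<Sum>\<beta>\<in>exps n. c \<alpha> \<beta> * mon \<beta> p') * mon \<alpha> p)" for p
    unfolding c sum_distrib_right by (intro sum.cong refl) (simp add: mult_ac)
  then show ?thesis unfolding Form_def mem_Collect_eq by (intro exI[of _ "\<lambda>\<alpha>. \<Sum>\<beta>\<in>exps n. c \<alpha> \<beta> * mon \<beta> p'"]) simp
qed

lemma det_4:
  "det (A::'a::comm_ring_1^4^4) =
    A$1$1 * (A$2$2 * (A$3$3 * A$4$4 - A$3$4 * A$4$3) - A$2$3 * (A$3$2 * A$4$4 - A$3$4 * A$4$2) + A$2$4 * (A$3$2 * A$4$3 - A$3$3 * A$4$2))
  - A$1$2 * (A$2$1 * (A$3$3 * A$4$4 - A$3$4 * A$4$3) - A$2$3 * (A$3$1 * A$4$4 - A$3$4 * A$4$1) + A$2$4 * (A$3$1 * A$4$3 - A$3$3 * A$4$1))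
  + A$1$3 * (A$2$1 * (A$3$2 * A$4$4 - A$3$4 * A$4$2) - A$2$2 * (A$3$1 * A$4$4 - A$3$4 * A$4$1) + A$2$4 * (A$3$1 * A$4$2 - A$3$2 * A$4$1))
  - A$1$4 * (A$2$1 * (A$3$2 * A$4$3 - A$3$3 * A$4$2) - A$2$2 * (A$3$1 * A$4$3 - A$3$3 * A$4$1) + A$2$3 * (A$3$1 * A$4$2 - A$3$2 * A$4$1))"
proof -
  have f1234: "finite {2::4, 3, 4}" "1 \<notin> {2::4, 3, 4}" by auto
  have f234: "finite {3::4, 4}" "2 \<notin> {3::4, 4}" by auto
  have f34: "finite {4::4}" "3 \<notin> {4::4}" by auto
  show ?thesis
    unfolding det_def UNIV_4
    unfolding sum_over_permutations_insert[OF f1234]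
    unfolding sum_over_permutations_insert[OF f234]
    unfolding sum_over_permutations_insert[OF f34]
    unfolding permutes_sing
    by (simp add: sign_swap_id permutation_swap_id sign_compose sign_id swap_id_eq permutation_compose algebra_simps)
qed

text \<open>Addition in type \<open>2\<close> flips an index: \<open>hh\<close> and
  \<open>vv\<close> are the neighbours in the x and in the y direction, \<open>dd\<close> is the
  opposite chart. Computations are done once, relative to a chart \<alpha>, and hold in all
  four.\<close>

definition hh :: "chart \<Rightarrow> chart" where "hh \<alpha> = (fst \<alpha> + 1, snd \<alpha>)"
definition vv :: "chart \<Rightarrow> chart" where "vv \<alpha> = (fst \<alpha>, snd \<alpha> + 1)"
definition dd :: "chart \<Rightarrow> chart" where "dd \<alpha> = (fst \<alpha> + 1, snd \<alpha> + 1)"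
text \<open>The sign that makes the equation of the quadric look the same from every chart.\<close>

definition sg :: "chart \<Rightarrow> complex" where "sg \<alpha> = (if fst \<alpha> = snd \<alpha> then 1 else - 1)"

lemma two_simps [simp]: "(1::2) + 1 = 0" "(2::2) = 0" "i + 1 \<noteq> (i::2)" "i \<noteq> i + (1::2)" "i + 1 + 1 = (i::2)" "(0::2) \<noteq> 1" "(1::2) \<noteq> 0"
proof -
  show "(1::2) + 1 = 0" "(2::2) = 0" by simp_all
  then show "i + 1 + 1 = (i::2)" by (simp add: add.assoc)
  show "i + 1 \<noteq> (i::2)" "i \<noteq> i + (1::2)" by simp_all
qed simp_all

lemma chart_cases:
  assumes "P (0,0)" "P (0,1)" "P (1,0)" "P (1,1)"
  shows "P (\<alpha> :: chart)"
proof (cases \<alpha>)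
  case (Pair i j)
  have "\<forall>j. P (i, j)" by (induct i rule: two_cases) (auto intro: two_cases[of "\<lambda>j. P (0, j)"] two_cases[of "\<lambda>j. P (1, j)"] assms)
  then show ?thesis using Pair by simp
qed

lemma chart_simps [simp]:
  "hh (hh \<alpha>) = \<alpha>" "vv (vv \<alpha>) = \<alpha>" "dd (dd \<alpha>) = \<alpha>" "hh (vv \<alpha>) = dd \<alpha>" "vv (hh \<alpha>) = dd \<alpha>"
  "hh (dd \<alpha>) = vv \<alpha>" "vv (dd \<alpha>) = hh \<alpha>" "dd (hh \<alpha>) = vv \<alpha>" "dd (vv \<alpha>) = hh \<alpha>"
  "hh \<alpha> \<noteq> \<alpha>" "vv \<alpha> \<noteq> \<alpha>" "dd \<alpha> \<noteq> \<alpha>" "\<alpha> \<noteq> hh \<alpha>" "\<alpha> \<noteq> vv \<alpha>" "\<alpha> \<noteq> dd \<alpha>"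
  "hh \<alpha> \<noteq> vv \<alpha>" "vv \<alpha> \<noteq> hh \<alpha>" "hh \<alpha> \<noteq> dd \<alpha>" "dd \<alpha> \<noteq> hh \<alpha>" "vv \<alpha> \<noteq> dd \<alpha>" "dd \<alpha> \<noteq> vv \<alpha>"
  "sg (hh \<alpha>) = - sg \<alpha>" "sg (vv \<alpha>) = - sg \<alpha>" "sg (dd \<alpha>) = sg \<alpha>" "sg \<alpha> * sg \<alpha> = 1" "sg \<alpha> \<noteq> 0"
  by (induct \<alpha> rule: chart_cases) (simp_all add: hh_def vv_def dd_def sg_def)

lemma sum_chart: "(\<Sum>\<beta>\<in>UNIV. f \<beta>) = f \<alpha> + f (hh \<alpha>) + f (vv \<alpha>) + (f (dd \<alpha>) :: 'a :: comm_monoid_add)"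
proof -
  have "\<beta> \<in> {\<alpha>, hh \<alpha>, vv \<alpha>, dd \<alpha>}" for \<beta>
    by (induct \<alpha> rule: chart_cases; induct \<beta> rule: chart_cases) (simp_all add: hh_def vv_def dd_def)
  then have U: "UNIV = {\<alpha>, hh \<alpha>, vv \<alpha>, dd \<alpha>}" by blast
  show ?thesis unfolding U by (simp add: add.assoc)
qed

lemma all_chart: "(\<forall>\<beta>. P \<beta>) \<longleftrightarrow> P \<alpha> \<and> P (hh \<alpha>) \<and> P (vv \<alpha>) \<and> P (dd \<alpha>)"
proof -
  have "\<beta> \<in> {\<alpha>, hh \<alpha>, vv \<alpha>, dd \<alpha>}" for \<beta>
    by (induct \<alpha> rule: chart_cases; induct \<beta> rule: chart_cases) (simp_all add: hh_def vv_def dd_def)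
  then have "\<beta> = \<alpha> \<or> \<beta> = hh \<alpha> \<or> \<beta> = vv \<alpha> \<or> \<beta> = dd \<alpha>" for \<beta> by simp
  then show ?thesis by metis
qed

lemma vector_4 [simp]:
  "(vector [w, x, y, z] :: ('a::zero)^4) $ 1 = w" "(vector [w, x, y, z] :: ('a::zero)^4) $ 2 = x"
  "(vector [w, x, y, z] :: ('a::zero)^4) $ 3 = y" "(vector [w, x, y, z] :: ('a::zero)^4) $ 4 = z"
  unfolding vector_def by simp_all

definition chart_matrix :: "(chart \<Rightarrow> vec4) \<Rightarrow> complex^4^4" where
  "chart_matrix Z = vector [Z (0,0), Z (0,1), Z (1,0), Z (1,1)]"

section \<open>The curve in the coordinates given by the rulings\<close>

locale ruled_curve =
  fixes q t :: form and Z :: "chart \<Rightarrow> vec4"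
  assumes pair: "(q, t) \<in> canonical_pairs" and rulings: "ordered_rulings q Z"
begin

sublocale quadric q
  using pair by unfold_locales (simp add: canonical_pairs_def)

abbreviation z :: "chart \<Rightarrow> form" where "z \<alpha> \<equiv> lf (Z \<alpha>)"

lemma t_Form: "t \<in> Form 3"
  using pair by (simp add: canonical_pairs_def)

lemma q_eq: "q p = sg \<alpha> * (z \<alpha> p * z (dd \<alpha>) p - z (hh \<alpha>) p * z (vv \<alpha>) p)"
  using rulings unfolding ordered_rulings_def
  by (induct \<alpha> rule: chart_cases) (simp_all add: hh_def vv_def dd_def sg_def)

lemma ddir_q: "ddir u q p = sg \<alpha> * (z \<alpha> u * z (dd \<alpha>) p + z \<alpha> p * z (dd \<alpha>) u - z (hh \<alpha>) u * z (vv \<alpha>) p - z (hh \<alpha>) p * z (vv \<alpha>) u)"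
proof -
  have q: "q = (\<lambda>p. sg \<alpha> * (z \<alpha> p * z (dd \<alpha>) p + - 1 * (z (hh \<alpha>) p * z (vv \<alpha>) p)))"
    using q_eq by auto
  have F: "(\<lambda>p. lf a p * lf b p) \<in> Form 2" for a b
    by (rule Form_cast[OF Form_mult[OF lf_Form lf_Form]]) simp
  show ?thesis unfolding q ddir_scale[OF Form_add[OF F Form_scale[OF F]]] ddir_add[OF F Form_scale[OF F]]
      ddir_scale[OF F] ddir_mult[OF lf_Form lf_Form] ddir_lf
    by (simp add: algebra_simps)
qed

text \<open>A nonzero common zero of the four coordinates would be a singular point, since q is
  quadratic in them. Hence \<open>Z\<close> is a basis of V.\<close>

lemma z_eq_0_imp: "(\<And>\<alpha>. z \<alpha> p = 0) \<Longrightarrow> p = 0"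
proof (rule ccontr)
  assume z0: "\<And>\<alpha>. z \<alpha> p = 0" and "p \<noteq> 0"
  moreover have "q p = 0" using q_eq[of p "(0,0)"] z0 by simp
  ultimately obtain u where "ddir u q p \<noteq> 0"
    using pair by (auto simp: canonical_pairs_def smooth_quadric_def)
  then show False using ddir_q[of u p "(0,0)"] z0 by simp
qed

lemma chart_matrix_mult:
  "(chart_matrix Z *v p) $ 1 = z (0,0) p" "(chart_matrix Z *v p) $ 2 = z (0,1) p"
  "(chart_matrix Z *v p) $ 3 = z (1,0) p" "(chart_matrix Z *v p) $ 4 = z (1,1) p"
  by (simp_all add: chart_matrix_def matrix_vector_mult_def lf_def)

lemma chart_matrix_invertible: "invertible (chart_matrix Z)"
proof -
  have "p = 0" if "chart_matrix Z *v p = 0" for p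
  proof (rule z_eq_0_imp)
    fix \<alpha> show "z \<alpha> p = 0"
      using chart_matrix_mult[of p] that by (induct \<alpha> rule: chart_cases) simp_all
  qed
  then show ?thesis
    by (simp add: invertible_left_inverse matrix_left_invertible_ker)
qed

text \<open>The basis dual to \<open>Z\<close>, as columns of the inverse matrix.\<close>

definition W :: "chart \<Rightarrow> vec4" where
  "W \<alpha> = matrix_inv (chart_matrix Z) *v axis (if \<alpha> = (0,0) then 1 else if \<alpha> = (0,1) then 2 else if \<alpha> = (1,0) then 3 else 4) 1"

lemma z_W: "z \<beta> (W \<alpha>) = (if \<alpha> = \<beta> then 1 else 0)"
proof -
  have *: "chart_matrix Z *v W \<alpha> = axis (if \<alpha> = (0,0) then 1 else if \<alpha> = (0,1) then 2 else if \<alpha> = (1,0) then 3 else 4) 1"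
  proof -
    have "chart_matrix Z ** matrix_inv (chart_matrix Z) = mat 1"
      using chart_matrix_invertible unfolding invertible_def matrix_inv_def by (rule someI2_ex) simp
    then show ?thesis by (simp add: W_def matrix_vector_mul_assoc)
  qed
  show ?thesis
    using chart_matrix_mult[of "W \<alpha>"] unfolding *
    by (induct \<alpha> rule: chart_cases; induct \<beta> rule: chart_cases) (simp_all add: axis_def)
qed

lemma W_expand: "p = (\<Sum>\<alpha>\<in>UNIV. z \<alpha> p *s W \<alpha>)"
proof -
  have "p - (\<Sum>\<alpha>\<in>UNIV. z \<alpha> p *s W \<alpha>) = 0"
    by (rule z_eq_0_imp) (simp add: z_W if_distrib[of "\<lambda>x. _ * x"] cong: if_cong)
  then show ?thesis by simp
qed

lemma vec_eqI: "(\<And>\<alpha>. z \<alpha> p = z \<alpha> p') \<Longrightarrow> p = p'"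
  using z_eq_0_imp[of "p - p'"] by simp

definition tt :: "chart \<Rightarrow> form" where "tt \<alpha> = ddir (W \<alpha>) t"

lemma tt_Form: "tt \<alpha> \<in> Form 2"
  using ddir_Form[OF t_Form, of "W \<alpha>"] by (simp add: tt_def)

lemma ddir_t: "ddir u t p = z \<alpha> u * tt \<alpha> p + z (hh \<alpha>) u * tt (hh \<alpha>) p + z (vv \<alpha>) u * tt (vv \<alpha>) p + z (dd \<alpha>) u * tt (dd \<alpha>) p"
proof -
  have "ddir u t p = ddir (\<Sum>\<beta>\<in>UNIV. z \<beta> u *s W \<beta>) t p" using W_expand[of u] by simp
  also have "\<dots> = (\<Sum>\<beta>\<in>UNIV. z \<beta> u * tt \<beta> p)" by (simp add: ddir_sum[OF t_Form] ddir_linear[OF t_Form] tt_def)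
  finally show ?thesis by (simp add: sum_chart[of _ \<alpha>])
qed

lemma euler_t: "z \<alpha> p * tt \<alpha> p + z (hh \<alpha>) p * tt (hh \<alpha>) p + z (vv \<alpha>) p * tt (vv \<alpha>) p + z (dd \<alpha>) p * tt (dd \<alpha>) p = 3 * t p"
  using ddir_t[of p p \<alpha>] ddir_euler[OF t_Form, of p] by simp

lemma cone_q: "p \<in> curve_cone q t \<Longrightarrow> z \<alpha> p * z (dd \<alpha>) p = z (hh \<alpha>) p * z (vv \<alpha>) p"
  using q_eq[of p \<alpha>] by (simp add: curve_cone_def)

lemma cone_t: "p \<in> curve_cone q t \<Longrightarrow>
  z \<alpha> p * tt \<alpha> p + z (hh \<alpha>) p * tt (hh \<alpha>) p + z (vv \<alpha>) p * tt (vv \<alpha>) p + z (dd \<alpha>) p * tt (dd \<alpha>) p = 0"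
  using euler_t[of \<alpha> p] by (simp add: curve_cone_def)

text \<open>\<open>xi1\<close> and \<open>xi2\<close> are the coordinate vector fields of the affine
  coordinates x and y of the chart, lifted to the cone with weight 1. \<open>f1\<close> and
  \<open>f2\<close> are the derivatives of t along them, the affine partial derivatives with weight
  3.\<close>

definition xi1 :: "chart \<Rightarrow> vec4 \<Rightarrow> vec4" where "xi1 \<alpha> p = z \<alpha> p *s W (hh \<alpha>) + z (vv \<alpha>) p *s W (dd \<alpha>)"
definition xi2 :: "chart \<Rightarrow> vec4 \<Rightarrow> vec4" where "xi2 \<alpha> p = z \<alpha> p *s W (vv \<alpha>) + z (hh \<alpha>) p *s W (dd \<alpha>)"
definition f1 :: "chart \<Rightarrow> form" where "f1 \<alpha> p = z \<alpha> p * tt (hh \<alpha>) p + z (vv \<alpha>) p * tt (dd \<alpha>) p"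
definition f2 :: "chart \<Rightarrow> form" where "f2 \<alpha> p = z \<alpha> p * tt (vv \<alpha>) p + z (hh \<alpha>) p * tt (dd \<alpha>) p"

lemma z_xi [simp]:
  "z \<alpha> (xi1 \<alpha> p) = 0" "z (hh \<alpha>) (xi1 \<alpha> p) = z \<alpha> p" "z (vv \<alpha>) (xi1 \<alpha> p) = 0" "z (dd \<alpha>) (xi1 \<alpha> p) = z (vv \<alpha>) p"
  "z \<alpha> (xi2 \<alpha> p) = 0" "z (hh \<alpha>) (xi2 \<alpha> p) = 0" "z (vv \<alpha>) (xi2 \<alpha> p) = z \<alpha> p" "z (dd \<alpha>) (xi2 \<alpha> p) = z (hh \<alpha>) p"
  by (simp_all add: xi1_def xi2_def z_W)

lemma ddir_xi:
  "ddir (xi1 \<alpha> p) t p = f1 \<alpha> p" "ddir (xi2 \<alpha> p) t p = f2 \<alpha> p" "ddir (xi1 \<alpha> p) q p = 0" "ddir (xi2 \<alpha> p) q p = 0"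
  using ddir_t[of "xi1 \<alpha> p" p \<alpha>] ddir_t[of "xi2 \<alpha> p" p \<alpha>] ddir_q[of "xi1 \<alpha> p" p \<alpha>] ddir_q[of "xi2 \<alpha> p" p \<alpha>]
  by (simp_all add: f1_def f2_def)

lemma f_Form: "f1 \<alpha> \<in> Form 3" "f2 \<alpha> \<in> Form 3"
proof -
  have "(\<lambda>p. lf a p * tt \<beta> p) \<in> Form 3" for a \<beta> by (rule Form_cast[OF Form_mult[OF lf_Form tt_Form]]) simp
  then show "f1 \<alpha> \<in> Form 3" "f2 \<alpha> \<in> Form 3"
    unfolding f1_def[abs_def] f2_def[abs_def] by (intro Form_add; assumption)+
qed

lemma f_adjacent: "f1 (vv \<alpha>) p = f1 \<alpha> p" "f2 (hh \<alpha>) p = f2 \<alpha> p"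
  by (simp_all add: f1_def f2_def)

text \<open>If both affine partial derivatives vanish, they together with Euler's relation determine
  all four partial derivatives of t at p, and the differential of t is a multiple of that of q. This
  contradicts the Jacobian criterion.\<close>

lemma nonsingular:
  assumes p: "p \<in> curve_cone q t" and "z \<alpha> p \<noteq> 0"
  shows "f1 \<alpha> p \<noteq> 0 \<or> f2 \<alpha> p \<noteq> 0"
proof (rule ccontr)
  assume "\<not> ?thesis"
  then have f: "f1 \<alpha> p = 0" "f2 \<alpha> p = 0" by auto
  \<comment> \<open>The Lagrange multiplier up to the sign \<open>sg \<alpha>\<close>, read off in
    the direction \<open>W (dd \<alpha>)\<close>, along which q has derivative
    \<open>sg \<alpha> * z \<alpha> p\<close>.\<close>
  let ?l = "tt (dd \<alpha>) p / z \<alpha> p"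
  have th: "tt (hh \<alpha>) p = - z (vv \<alpha>) p * ?l" and tv: "tt (vv \<alpha>) p = - z (hh \<alpha>) p * ?l"
    using f assms(2) by (simp_all add: f1_def f2_def field_simps add_eq_0_iff)
  have zd: "z (dd \<alpha>) p = z (hh \<alpha>) p * z (vv \<alpha>) p / z \<alpha> p"
    using cone_q[OF p, of \<alpha>] assms(2) by (simp add: field_simps)
  have "z \<alpha> p * tt \<alpha> p = 2 * z (hh \<alpha>) p * z (vv \<alpha>) p * ?l - z (dd \<alpha>) p * tt (dd \<alpha>) p"
    using cone_t[OF p, of \<alpha>] unfolding th tv by (simp add: algebra_simps)
  also have "\<dots> = z (dd \<alpha>) p * tt (dd \<alpha>) p" unfolding zd by (simp add: field_simps)
  finally have ta: "tt \<alpha> p = z (dd \<alpha>) p * ?l" using assms(2) by (simp add: field_simps)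
  have td: "tt (dd \<alpha>) p = z \<alpha> p * ?l" using assms(2) by simp
  have "ddir u t p = sg \<alpha> * ?l * ddir u q p" for u
  proof -
    have "sg \<alpha> * ?l * ddir u q p = (sg \<alpha> * sg \<alpha>) * ?l * (z \<alpha> u * z (dd \<alpha>) p + z \<alpha> p * z (dd \<alpha>) u - z (hh \<alpha>) u * z (vv \<alpha>) p - z (hh \<alpha>) p * z (vv \<alpha>) u)"
      unfolding ddir_q[of u p \<alpha>] by (simp only: mult_ac)
    also have "\<dots> = z \<alpha> u * (z (dd \<alpha>) p * ?l) + z (hh \<alpha>) u * (- z (vv \<alpha>) p * ?l) + z (vv \<alpha>) u * (- z (hh \<alpha>) p * ?l) + z (dd \<alpha>) u * (z \<alpha> p * ?l)"
      by (simp only: chart_simps) (simp add: algebra_simps)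
    also have "\<dots> = ddir u t p" unfolding ddir_t[of u p \<alpha>] ta[symmetric] th[symmetric] tv[symmetric] td[symmetric] ..
    finally show ?thesis by simp
  qed
  then have "\<forall>u. sg \<alpha> * ?l * ddir u q p + (- 1) * ddir u t p = 0" by simp
  then have "(- 1 :: complex) = 0" using pair p unfolding canonical_pairs_def by blast
  then show False by simp
qed

section \<open>Affine equations of the curve in the four charts\<close>

definition ch :: "chart \<Rightarrow> complex \<Rightarrow> complex \<Rightarrow> vec4" where
  "ch \<alpha> x y = W \<alpha> + x *s W (hh \<alpha>) + y *s W (vv \<alpha>) + (x * y) *s W (dd \<alpha>)"

lemma z_ch [simp]: "z \<alpha> (ch \<alpha> x y) = 1" "z (hh \<alpha>) (ch \<alpha> x y) = x" "z (vv \<alpha>) (ch \<alpha> x y) = y" "z (dd \<alpha>) (ch \<alpha> x y) = x * y"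
  by (simp_all add: ch_def z_W)

lemma q_ch [simp]: "q (ch \<alpha> x y) = 0"
  by (simp add: q_eq[of _ \<alpha>])

lemma ch_cone: "ch \<alpha> x y \<in> curve_cone q t \<longleftrightarrow> t (ch \<alpha> x y) = 0"
proof -
  have "ch \<alpha> x y \<noteq> 0"
  proof
    assume "ch \<alpha> x y = 0"
    then have "z \<alpha> (ch \<alpha> x y) = 0" by simp
    then show False by simp
  qed
  then show ?thesis by (simp add: curve_cone_def)
qed

lemma vec_eqI4:
  assumes "z \<alpha> p = z \<alpha> p'" "z (hh \<alpha>) p = z (hh \<alpha>) p'" "z (vv \<alpha>) p = z (vv \<alpha>) p'" "z (dd \<alpha>) p = z (dd \<alpha>) p'"
  shows "p = p'"
proof (rule vec_eqI)
  have "\<forall>\<beta>. z \<beta> p = z \<beta> p'" using assms by (subst all_chart[of _ \<alpha>]) simp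
  then show "z \<beta> p = z \<beta> p'" for \<beta> by blast
qed

lemma quadric_chart:
  assumes "q p = 0" "z \<alpha> p \<noteq> 0"
  shows "p = z \<alpha> p *s ch \<alpha> (z (hh \<alpha>) p / z \<alpha> p) (z (vv \<alpha>) p / z \<alpha> p)"
  by (rule vec_eqI4[of \<alpha>]) (use assms q_eq[of p \<alpha>] in \<open>simp_all add: field_simps\<close>)

lemma ch_vv: "y \<noteq> 0 \<Longrightarrow> ch (vv \<alpha>) x y = y *s ch \<alpha> x (1 / y)"
  using z_ch[of "vv \<alpha>" x y] by (intro vec_eqI4[of \<alpha>]) simp_all

lemma ch_hh: "x \<noteq> 0 \<Longrightarrow> ch (hh \<alpha>) x y = x *s ch \<alpha> (1 / x) y"
  using z_ch[of "hh \<alpha>" x y] by (intro vec_eqI4[of \<alpha>]) simp_all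

definition TP :: "chart \<Rightarrow> complex poly poly" where
  "TP \<alpha> = (SOME F. bidegree_le 3 F \<and> (\<forall>x y. t (ch \<alpha> x y) = poly2 F x y))"

lemma TP: "bidegree_le 3 (TP \<alpha>)" "poly2 (TP \<alpha>) x y = t (ch \<alpha> x y)"
proof -
  have "\<exists>F. bidegree_le 3 F \<and> (\<forall>x y. t (ch \<alpha> x y) = poly2 F x y)"
    unfolding ch_def by (rule Form_bilinear_poly[OF t_Form])
  then have "bidegree_le 3 (TP \<alpha>) \<and> (\<forall>x y. t (ch \<alpha> x y) = poly2 (TP \<alpha>) x y)"
    unfolding TP_def by (rule someI_ex)
  then show "bidegree_le 3 (TP \<alpha>)" "poly2 (TP \<alpha>) x y = t (ch \<alpha> x y)" by auto
qed

lemma DERIV_shift_0: "((\<lambda>s. f (x + s)) has_field_derivative D) (at 0) \<Longrightarrow> (f has_field_derivative D) (at (x::complex))"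
  using DERIV_shift[of f D 0 x] by (simp add: add.commute)

lemma dx_TP: "poly2 (dx (TP \<alpha>)) x y = f1 \<alpha> (ch \<alpha> x y)"
proof -
  have "ch \<alpha> (x + s) y = ch \<alpha> x y + s *s xi1 \<alpha> (ch \<alpha> x y)" for s
    by (rule vec_eqI4[of \<alpha>]) (simp_all add: algebra_simps)
  then have "((\<lambda>s. t (ch \<alpha> (x + s) y)) has_field_derivative f1 \<alpha> (ch \<alpha> x y)) (at 0)"
    using ddir_has_derivative[OF t_Form, of "ch \<alpha> x y" "xi1 \<alpha> (ch \<alpha> x y)"] by (simp add: ddir_xi)
  then have "((\<lambda>x. t (ch \<alpha> x y)) has_field_derivative f1 \<alpha> (ch \<alpha> x y)) (at x)"
    by (rule DERIV_shift_0)
  moreover have "((\<lambda>x. t (ch \<alpha> x y)) has_field_derivative poly2 (dx (TP \<alpha>)) x y) (at x)"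
    using has_deriv_x[of "TP \<alpha>" y x] by (simp add: TP)
  ultimately show ?thesis by (metis DERIV_unique)
qed

lemma dy_TP: "poly2 (pderiv (TP \<alpha>)) x y = f2 \<alpha> (ch \<alpha> x y)"
proof -
  have "ch \<alpha> x (y + s) = ch \<alpha> x y + s *s xi2 \<alpha> (ch \<alpha> x y)" for s
    by (rule vec_eqI4[of \<alpha>]) (simp_all add: algebra_simps)
  then have "((\<lambda>s. t (ch \<alpha> x (y + s))) has_field_derivative f2 \<alpha> (ch \<alpha> x y)) (at 0)"
    using ddir_has_derivative[OF t_Form, of "ch \<alpha> x y" "xi2 \<alpha> (ch \<alpha> x y)"] by (simp add: ddir_xi)
  then have "((\<lambda>y. t (ch \<alpha> x y)) has_field_derivative f2 \<alpha> (ch \<alpha> x y)) (at y)"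
    by (rule DERIV_shift_0)
  moreover have "((\<lambda>y. t (ch \<alpha> x y)) has_field_derivative poly2 (pderiv (TP \<alpha>)) x y) (at y)"
    using has_deriv_y[of "TP \<alpha>" x y] by (simp add: TP)
  ultimately show ?thesis by (metis DERIV_unique)
qed

lemma TP_smooth: "poly2 (TP \<alpha>) x y = 0 \<Longrightarrow> poly2 (dx (TP \<alpha>)) x y \<noteq> 0 \<or> poly2 (pderiv (TP \<alpha>)) x y \<noteq> 0"
  using nonsingular[of "ch \<alpha> x y" \<alpha>] by (simp add: TP dx_TP dy_TP ch_cone)

text \<open>g and g' are the two dehomogenizations of a binary cubic. If g is a constant c, then g'
  is c y^3 and vanishes at 0; so there is always a zero on the projective line.\<close>

lemma binary_cubic_zero:
  fixes g g' :: "complex poly"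
  assumes "\<And>y. y \<noteq> 0 \<Longrightarrow> poly g' y = y ^ 3 * poly g (1 / y)"
  shows "(\<exists>y. poly g y = 0) \<or> poly g' 0 = 0"
proof (cases "constant (poly g)")
  case True
  define c where "c = poly g 0"
  have "poly g y = c" for y using True by (simp add: constant_def c_def)
  then have "poly (g' - monom c 3) y = 0" if "y \<noteq> 0" for y using assms[OF that] by (simp add: poly_monom)
  then have "{y. y \<noteq> 0} \<subseteq> {y. poly (g' - monom c 3) y = 0}" by blast
  then have "infinite {y. poly (g' - monom c 3) y = 0}" using infinite_nonzero finite_subset by blast
  then have "g' - monom c 3 = 0" using poly_roots_finite by blast
  then show ?thesis by (simp add: poly_monom)
next
  case False
  then show ?thesis using fundamental_theorem_of_algebra by blast
qed

text \<open>Along a line contained in the curve, t and its derivative along the line vanish in both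
  charts that cover the line. The transverse derivative restricts to a binary cubic on it and has a
  zero, which would be a singular point.\<close>

lemma no_vertical_line: "\<exists>y. poly2 (TP \<alpha>) x y \<noteq> 0"
proof (rule ccontr)
  assume "\<not> ?thesis"
  then have t0: "t (ch \<alpha> x y) = 0" for y by (simp add: TP)
  have spec0: "spec x (TP \<beta>) = 0 \<Longrightarrow> poly2 (TP \<beta>) x y = 0 \<and> poly2 (pderiv (TP \<beta>)) x y = 0" for \<beta> y
  proof -
    assume s: "spec x (TP \<beta>) = 0"
    have "spec x (pderiv (TP \<beta>)) = pderiv (spec x (TP \<beta>))" by (rule poly_eqI) (simp add: coeff_pderiv)
    with s show ?thesis by (simp add: poly2_spec)
  qed
  have a: "spec x (TP \<alpha>) = 0"
    using t0 by (metis TP(2) poly2_spec poly_all_0_iff_0)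
  have "{y. y \<noteq> 0} \<subseteq> {y. poly (spec x (TP (vv \<alpha>))) y = 0}"
    using t0 by (auto simp: poly2_spec[symmetric] TP ch_vv Form_homogeneous[OF t_Form])
  then have v: "spec x (TP (vv \<alpha>)) = 0"
    using infinite_nonzero finite_subset poly_roots_finite by blast
  have "poly (spec x (dx (TP (vv \<alpha>)))) y = y ^ 3 * poly (spec x (dx (TP \<alpha>))) (1 / y)" if "y \<noteq> 0" for y
    using that by (simp add: poly2_spec[symmetric] dx_TP f_adjacent ch_vv Form_homogeneous[OF f_Form(1)])
  then have "(\<exists>y. poly2 (dx (TP \<alpha>)) x y = 0) \<or> poly2 (dx (TP (vv \<alpha>))) x 0 = 0"
    using binary_cubic_zero by (simp add: poly2_spec)
  then show False using TP_smooth spec0[OF a] spec0[OF v] by blast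
qed

text \<open>The same argument with the rulings exchanged, on the line y = 0.\<close>

lemma no_horizontal_axis: "\<exists>x. poly2 (TP \<alpha>) x 0 \<noteq> 0"
proof (rule ccontr)
  assume "\<not> ?thesis"
  then have t0: "t (ch \<alpha> x 0) = 0" for x by (simp add: TP)
  have p0: "poly2 F x 0 = poly (coeff F 0) x" for F x by (simp add: poly2_def poly_0_coeff_0)
  have spec0: "coeff (TP \<beta>) 0 = 0 \<Longrightarrow> poly2 (TP \<beta>) x 0 = 0 \<and> poly2 (dx (TP \<beta>)) x 0 = 0" for \<beta> x
    by (simp add: p0)
  have a: "coeff (TP \<alpha>) 0 = 0"
    using t0 by (metis TP(2) p0 poly_all_0_iff_0)
  have "{x. x \<noteq> 0} \<subseteq> {x. poly (coeff (TP (hh \<alpha>)) 0) x = 0}"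
    using t0 by (auto simp: p0[symmetric] TP ch_hh Form_homogeneous[OF t_Form])
  then have v: "coeff (TP (hh \<alpha>)) 0 = 0"
    using infinite_nonzero finite_subset poly_roots_finite by blast
  have "poly (coeff (pderiv (TP (hh \<alpha>))) 0) x = x ^ 3 * poly (coeff (pderiv (TP \<alpha>)) 0) (1 / x)" if "x \<noteq> 0" for x
    using that by (simp add: p0[symmetric] dy_TP f_adjacent ch_hh Form_homogeneous[OF f_Form(2)])
  then have "(\<exists>x. poly2 (pderiv (TP \<alpha>)) x 0 = 0) \<or> poly2 (pderiv (TP (hh \<alpha>))) 0 0 = 0"
    using binary_cubic_zero by (simp add: p0)
  then show False using TP_smooth spec0[OF a] spec0[OF v] by blast
qed

sublocale affine: smooth_affine_curve "TP \<alpha>" for \<alpha>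
  by unfold_locales (use TP_smooth no_vertical_line in auto)

lemma chart_function_zero:
  assumes "\<And>x y. x \<noteq> 0 \<Longrightarrow> y \<noteq> 0 \<Longrightarrow> t (ch \<alpha> x y) = 0 \<Longrightarrow> poly2 g x y = 0"
  shows "TP \<alpha> dvd g"
  by (rule affine.dvd_of_vanishing) (use no_horizontal_axis assms in \<open>auto simp: TP\<close>)

end

section \<open>Passage between the charts and Laurent polynomials\<close>

lemma lookup_laurent_of:
  assumes "s \<in> {1, -1}" "r \<in> {1, -1}"
  shows "lcoeff (laurent_of s r g) (s * int a, r * int b) = coeff (coeff g b) a"
proof -
  have "lcoeff (laurent_of s r g) (s * int a, r * int b)
    = (\<Sum>b'\<le>degree g. \<Sum>a'\<le>degree (coeff g b'). coeff (coeff g b') a' when (s * int a', r * int b') = (s * int a, r * int b))"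
    by (simp add: laurent_of_def lookup_sum lookup_single)
  also have "\<dots> = (\<Sum>b'\<le>degree g. \<Sum>a'\<le>degree (coeff g b'). if b' = b then (if a' = a then coeff (coeff g b') a' else 0) else 0)"
    using assms by (intro sum.cong refl) (auto simp: when_def)
  also have "\<dots> = (\<Sum>b'\<le>degree g. if b' = b then coeff (coeff g b') a else 0)"
    by (intro sum.cong refl) (auto simp: coeff_eq_0)
  also have "\<dots> = coeff (coeff g b) a"
    by (auto simp: coeff_eq_0)
  finally show ?thesis .
qed

definition sx :: "2 \<Rightarrow> int" where "sx i = (if i = 0 then 1 else - 1)"

lemma sx_simps [simp]: "sx 0 = 1" "sx 1 = - 1" "sx i \<in> {1, -1}"
  by (auto simp: sx_def)

text \<open>The section of \<open>O(d, e)\<close> given by a polynomial in the affine coordinates of a chart\<close>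

definition chart_laurent :: "chart \<Rightarrow> int \<Rightarrow> int \<Rightarrow> complex poly poly \<Rightarrow> laurent" where
  "chart_laurent \<alpha> d e g =
     lmono (if fst \<alpha> = 0 then 0 else d) (if snd \<alpha> = 0 then 0 else e) * laurent_of (sx (fst \<alpha>)) (sx (snd \<alpha>)) g"

lemma keys_chart_laurent: "lkeys (chart_laurent \<alpha> d e g) \<subseteq> half_x (fst \<alpha>) d \<inter> half_y (snd \<alpha>) e"
proof
  fix k assume "k \<in> lkeys (chart_laurent \<alpha> d e g)"
  then obtain k' where k': "k' \<in> lkeys (laurent_of (sx (fst \<alpha>)) (sx (snd \<alpha>)) g)"
     "k = (if fst \<alpha> = 0 then 0 else d, if snd \<alpha> = 0 then 0 else e) + k'"
    using keys_mult[of "lmono (if fst \<alpha> = 0 then 0 else d) (if snd \<alpha> = 0 then 0 else e)" "laurent_of (sx (fst \<alpha>)) (sx (snd \<alpha>)) g"]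
    unfolding chart_laurent_def by auto
  from keys_laurent_of[OF k'(1)] show "k \<in> half_x (fst \<alpha>) d \<inter> half_y (snd \<alpha>) e"
    using k'(2) by (auto simp: half_x_def half_y_def sx_def)
qed

lemma coeff_chart_laurent:
  "lcoeff (chart_laurent \<alpha> d e g) ((if fst \<alpha> = 0 then 0 else d) + sx (fst \<alpha>) * int a, (if snd \<alpha> = 0 then 0 else e) + sx (snd \<alpha>) * int b)
     = coeff (coeff g b) a"
  using lookup_laurent_of[OF sx_simps(3) sx_simps(3), of "fst \<alpha>" "snd \<alpha>" g a b] by (simp add: chart_laurent_def coeff_mono_mult)

lemma lev_chart_laurent:
  "x \<noteq> 0 \<Longrightarrow> y \<noteq> 0 \<Longrightarrow> lev x y (chart_laurent \<alpha> d e g) =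
     (if fst \<alpha> = 0 then 1 else x powi d) * (if snd \<alpha> = 0 then 1 else y powi e) * poly2 g (x powi sx (fst \<alpha>)) (y powi sx (snd \<alpha>))"
  by (simp add: chart_laurent_def lev_laurent_of)

context ruled_curve
begin

lemma ch_transition:
  assumes "x \<noteq> 0" "y \<noteq> 0"
  shows "ch (0,0) x y = ((if fst \<alpha> = 0 then 1 else x) * (if snd \<alpha> = 0 then 1 else y)) *s ch \<alpha> (x powi sx (fst \<alpha>)) (y powi sx (snd \<alpha>))"
    and "ch \<alpha> x y = ((if fst \<alpha> = 0 then 1 else x) * (if snd \<alpha> = 0 then 1 else y)) *s ch (0,0) (x powi sx (fst \<alpha>)) (y powi sx (snd \<alpha>))"
proof -
  show "ch (0,0) x y = ((if fst \<alpha> = 0 then 1 else x) * (if snd \<alpha> = 0 then 1 else y)) *s ch \<alpha> (x powi sx (fst \<alpha>)) (y powi sx (snd \<alpha>))"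
    using assms
    by (induct \<alpha> rule: chart_cases) (simp_all add: ch_def hh_def vv_def dd_def vec.scale_right_distrib vector_smult_assoc power_int_minus field_simps)
  show "ch \<alpha> x y = ((if fst \<alpha> = 0 then 1 else x) * (if snd \<alpha> = 0 then 1 else y)) *s ch (0,0) (x powi sx (fst \<alpha>)) (y powi sx (snd \<alpha>))"
    using assms
    by (induct \<alpha> rule: chart_cases) (simp_all add: ch_def hh_def vv_def dd_def vec.scale_right_distrib vector_smult_assoc power_int_minus field_simps)
qed

definition TL :: laurent where "TL = laurent_of 1 1 (TP (0,0))"

lemma lev_TL: "lev x y TL = t (ch (0,0) x y)"
  by (simp add: TL_def lev_laurent_of TP)

text \<open>The four affine equations are one Laurent polynomial, up to the twist by O(3, 3). So
  divisibility by the equation has the same meaning in all charts.\<close>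

lemma TL_chart: "TL = chart_laurent \<alpha> 3 3 (TP \<alpha>)"
proof (rule lev_eqI)
  fix x y :: complex assume xy: "x \<noteq> 0" "y \<noteq> 0"
  show "lev x y TL = lev x y (chart_laurent \<alpha> 3 3 (TP \<alpha>))"
    unfolding lev_TL ch_transition(1)[OF xy, of \<alpha>] lev_chart_laurent[OF xy] TP Form_homogeneous[OF t_Form]
    by (simp add: power_mult_distrib)
qed

sublocale laurent: laurent_curve TL
proof
  show "lkeys TL \<subseteq> half_x i 3" for i using keys_chart_laurent[of "(i, 0)" 3 3 "TP (i, 0)"] by (simp flip: TL_chart)
  show "lkeys TL \<subseteq> half_y i 3" for i using keys_chart_laurent[of "(0, i)" 3 3 "TP (0, i)"] by (simp flip: TL_chart)
  \<comment> \<open>In chart \<open>(i, 0)\<close> the curve does not contain the line x = 0, so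
    some monomial is free of x there; in the coordinates of chart \<open>(0,0)\<close> its
    x-exponent is 0 or 3.\<close>
  show "\<exists>k\<in>lkeys TL. fst k = (if i = 0 then 0 else 3)" for i :: 2
  proof -
    obtain y where y: "poly2 (TP (i, 0)) 0 y \<noteq> 0" using no_vertical_line by blast
    then have "spec 0 (TP (i, 0)) \<noteq> 0" by (auto simp: poly2_spec)
    then obtain b where "coeff (spec 0 (TP (i, 0))) b \<noteq> 0" by (metis leading_coeff_0_iff)
    then have "coeff (coeff (TP (i, 0)) b) 0 \<noteq> 0" by (simp add: poly_0_coeff_0)
    then show ?thesis using coeff_chart_laurent[of "(i, 0)" 3 3 "TP (i, 0)" 0 b]
      by (intro bexI[of _ "(if i = 0 then 0 else 3, int b)"]) (simp_all add: in_keys_iff flip: TL_chart)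
  qed
  show "\<exists>k\<in>lkeys TL. snd k = (if i = 0 then 0 else 3)" for i :: 2
  proof -
    obtain x where x: "poly2 (TP (0, i)) x 0 \<noteq> 0" using no_horizontal_axis by blast
    then have "coeff (TP (0, i)) 0 \<noteq> 0" by (auto simp: poly2_def poly_0_coeff_0)
    then obtain a where "coeff (coeff (TP (0, i)) 0) a \<noteq> 0" by (metis leading_coeff_0_iff)
    then show ?thesis using coeff_chart_laurent[of "(0, i)" 3 3 "TP (0, i)" a 0]
      by (intro bexI[of _ "(int a, if i = 0 then 0 else 3)"]) (simp_all add: in_keys_iff flip: TL_chart)
  qed
qed

text \<open>This transfers identities between functions on the curve to congruences of Laurent
  polynomials. Denominators are cleared by a power of x y, a unit on the torus.\<close>

lemma TL_dvd:
  assumes "\<And>x y. x \<noteq> 0 \<Longrightarrow> y \<noteq> 0 \<Longrightarrow> t (ch (0,0) x y) = 0 \<Longrightarrow> lev x y f = 0"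
  shows "TL dvd f"
proof -
  obtain N g where g: "\<And>x y. x \<noteq> 0 \<Longrightarrow> y \<noteq> 0 \<Longrightarrow> lev x y f * (x * y) ^ N = poly2 g x y"
    using laurent_poly[of f] by blast
  have "poly2 g x y = 0" if "x \<noteq> 0" "y \<noteq> 0" "t (ch (0,0) x y) = 0" for x y
    using assms[OF that] by (simp flip: g[OF that(1,2)])
  then have "TP (0,0) dvd g" by (rule chart_function_zero)
  then obtain k where k: "g = TP (0,0) * k" by blast
  have "f = TL * (laurent_of 1 1 k * lmono (- int N) (- int N))"
  proof (rule lev_eqI)
    fix x y :: complex assume xy: "x \<noteq> 0" "y \<noteq> 0"
    have "lev x y f = poly2 g x y / (x * y) ^ N" using xy g[OF xy] by (simp add: field_simps)
    then show "lev x y f = lev x y (TL * (laurent_of 1 1 k * lmono (- int N) (- int N)))"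
      using xy by (simp add: k TP lev_TL lev_laurent_of power_int_minus power_mult_distrib field_simps)
  qed
  then show ?thesis by simp
qed

subsection \<open>Regular functions\<close>

abbreviation reg where "reg \<equiv> regular q t Z"
abbreviation ov where "ov \<equiv> overlap q t Z"

lemma ov_simps: "p \<in> ov \<alpha> \<beta> \<longleftrightarrow> p \<in> curve_cone q t \<and> z \<alpha> p \<noteq> 0 \<and> z \<beta> p \<noteq> 0"
  by (simp add: overlap_def)

lemma regularI:
  assumes "P \<in> Form m" "int m = d + 2 * int N" "\<forall>p\<in>ov \<alpha> \<beta>. f p = P p / (z \<alpha> p * z \<beta> p) ^ N"
  shows "reg d \<alpha> \<beta> f"
  unfolding regular_def by (intro exI[of _ N] exI[of _ m] bexI[of _ P] conjI assms)

lemma regular_cong: "reg d \<alpha> \<beta> f \<Longrightarrow> (\<And>p. p \<in> ov \<alpha> \<beta> \<Longrightarrow> g p = f p) \<Longrightarrow> reg d \<alpha> \<beta> g"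
proof -
  assume f: "reg d \<alpha> \<beta> f" and eq: "\<And>p. p \<in> ov \<alpha> \<beta> \<Longrightarrow> g p = f p"
  from f obtain N m P where "P \<in> Form m" "int m = d + 2 * int N" "\<And>p. p \<in> ov \<alpha> \<beta> \<Longrightarrow> f p = P p / (z \<alpha> p * z \<beta> p) ^ N"
    unfolding regular_def by blast
  with eq show ?thesis unfolding regular_def by (intro exI[of _ N] exI[of _ m] bexI[of _ P]) auto
qed

lemma regular_Form: "P \<in> Form m \<Longrightarrow> reg (int m) \<alpha> \<beta> P"
  unfolding regular_def by (intro exI[of _ 0] exI[of _ m] bexI[of _ P]) auto

lemma zz_power_Form: "(\<lambda>p. (z \<alpha> p * z \<beta> p) ^ N) \<in> Form (2 * N)"
  by (rule Form_cast[OF Form_power[OF Form_mult[OF lf_Form lf_Form]]]) simp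

lemma regular_add:
  assumes "reg d \<alpha> \<beta> f" "reg d \<alpha> \<beta> g"
  shows "reg d \<alpha> \<beta> (\<lambda>p. f p + g p)"
proof -
  obtain N m P where P: "P \<in> Form m" "int m = d + 2 * int N" "\<And>p. p \<in> ov \<alpha> \<beta> \<Longrightarrow> f p = P p / (z \<alpha> p * z \<beta> p) ^ N"
    using assms(1) unfolding regular_def by blast
  obtain N' m' P' where P': "P' \<in> Form m'" "int m' = d + 2 * int N'" "\<And>p. p \<in> ov \<alpha> \<beta> \<Longrightarrow> g p = P' p / (z \<alpha> p * z \<beta> p) ^ N'"
    using assms(2) unfolding regular_def by blast
  have "m' + 2 * N = m + 2 * N'" using P(2) P'(2) by linarith
  then have "(\<lambda>p. P' p * (z \<alpha> p * z \<beta> p) ^ N) \<in> Form (m + 2 * N')"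
    using Form_cast[OF Form_mult[OF P'(1) zz_power_Form]] by blast
  then have "(\<lambda>p. P p * (z \<alpha> p * z \<beta> p) ^ N' + P' p * (z \<alpha> p * z \<beta> p) ^ N) \<in> Form (m + 2 * N')"
    by (intro Form_add Form_mult[OF P(1) zz_power_Form])
  moreover have "int (m + 2 * N') = d + 2 * int (N + N')" using P(2) by simp
  moreover have "\<forall>p\<in>ov \<alpha> \<beta>. f p + g p = (P p * (z \<alpha> p * z \<beta> p) ^ N' + P' p * (z \<alpha> p * z \<beta> p) ^ N) / (z \<alpha> p * z \<beta> p) ^ (N + N')"
    by (auto simp: P(3) P'(3) ov_simps power_add add_frac_eq)
  ultimately show ?thesis by (rule regularI)
qed

lemma regular_mult:
  assumes "reg d \<alpha> \<beta> f" "reg e \<alpha> \<beta> g"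
  shows "reg (d + e) \<alpha> \<beta> (\<lambda>p. f p * g p)"
proof -
  obtain N m P where P: "P \<in> Form m" "int m = d + 2 * int N" "\<And>p. p \<in> ov \<alpha> \<beta> \<Longrightarrow> f p = P p / (z \<alpha> p * z \<beta> p) ^ N"
    using assms(1) unfolding regular_def by blast
  obtain N' m' P' where P': "P' \<in> Form m'" "int m' = e + 2 * int N'" "\<And>p. p \<in> ov \<alpha> \<beta> \<Longrightarrow> g p = P' p / (z \<alpha> p * z \<beta> p) ^ N'"
    using assms(2) unfolding regular_def by blast
  have "(\<lambda>p. P p * P' p) \<in> Form (m + m')" by (rule Form_mult[OF P(1) P'(1)])
  moreover have "int (m + m') = (d + e) + 2 * int (N + N')" using P(2) P'(2) by simp
  moreover have "\<forall>p\<in>ov \<alpha> \<beta>. f p * g p = (P p * P' p) / (z \<alpha> p * z \<beta> p) ^ (N + N')"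
    by (auto simp: P(3) P'(3) power_add)
  ultimately show ?thesis by (rule regularI)
qed

lemma regular_cast: "reg d \<alpha> \<beta> f \<Longrightarrow> d = e \<Longrightarrow> reg e \<alpha> \<beta> f" by simp

lemma regular_zero: "reg d \<alpha> \<beta> (\<lambda>_. 0)"
proof -
  have "int (nat (d + 2 * int (nat \<bar>d\<bar>))) = d + 2 * int (nat \<bar>d\<bar>)" by simp
  then show ?thesis unfolding regular_def
    by (intro exI[of _ "nat \<bar>d\<bar>"] exI[of _ "nat (d + 2 * int (nat \<bar>d\<bar>))"] bexI[of _ "\<lambda>_. 0"]) simp_all
qed

lemma regular_const: "reg 0 \<alpha> \<beta> (\<lambda>_. c)"
  using regular_Form[of "\<lambda>_. c" 0] by simp

lemma regular_scale: "reg d \<alpha> \<beta> f \<Longrightarrow> reg d \<alpha> \<beta> (\<lambda>p. c * f p)"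
  using regular_mult[OF regular_const] by fastforce

lemma regular_uminus: "reg d \<alpha> \<beta> f \<Longrightarrow> reg d \<alpha> \<beta> (\<lambda>p. - f p)"
  using regular_scale[of d \<alpha> \<beta> f "-1"] by simp

lemma regular_diff: "reg d \<alpha> \<beta> f \<Longrightarrow> reg d \<alpha> \<beta> g \<Longrightarrow> reg d \<alpha> \<beta> (\<lambda>p. f p - g p)"
  using regular_add[of d \<alpha> \<beta> f "\<lambda>p. - g p"] regular_uminus by simp

lemma regular_sum: "(\<And>i. i \<in> I \<Longrightarrow> reg d \<alpha> \<beta> (f i)) \<Longrightarrow> reg d \<alpha> \<beta> (\<lambda>p. \<Sum>i\<in>I. f i p)"
  by (induction I rule: infinite_finite_induct) (auto intro: regular_add regular_zero)

lemma regular_lf: "reg 1 \<alpha> \<beta> (lf a)"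
  using regular_Form[OF lf_Form] by simp

lemma regular_inverse: "reg (-1) \<alpha> \<beta> (\<lambda>p. 1 / z \<alpha> p)" "reg (-1) \<beta> \<alpha> (\<lambda>p. 1 / z \<alpha> p)"
  by (rule regularI[where N = 1, OF lf_Form[of "Z \<beta>"]]; simp add: ov_simps)+

lemma regular_restrict: 
  assumes "reg d \<alpha> \<alpha> f"
  shows "reg d \<alpha> \<beta> f" "reg d \<beta> \<alpha> f"
proof -
  obtain N m P where P: "P \<in> Form m" "int m = d + 2 * int N" "\<And>p. p \<in> ov \<alpha> \<alpha> \<Longrightarrow> f p = P p / (z \<alpha> p * z \<alpha> p) ^ N"
    using assms(1) unfolding regular_def by blast
  have F: "(\<lambda>p. P p * (z \<beta> p * z \<beta> p) ^ N) \<in> Form (m + 2 * N)" by (rule Form_mult[OF P(1) zz_power_Form])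
  have i: "int (m + 2 * N) = d + 2 * int (2 * N)" using P(2) by simp
  have e: "(a * b) ^ (2 * N) = (a * a) ^ N * (b * b) ^ N" for a b :: complex
    by (simp add: power_mult power2_eq_square power_mult_distrib mult_ac)
  have "\<forall>p\<in>ov \<alpha> \<beta>. f p = P p * (z \<beta> p * z \<beta> p) ^ N / (z \<alpha> p * z \<beta> p) ^ (2 * N)"
    unfolding e by (auto simp: P(3) ov_simps)
  with F i show "reg d \<alpha> \<beta> f" by (rule regularI)
  have "\<forall>p\<in>ov \<beta> \<alpha>. f p = P p * (z \<beta> p * z \<beta> p) ^ N / (z \<beta> p * z \<alpha> p) ^ (2 * N)"
    unfolding e by (auto simp: P(3) ov_simps)
  with F i show "reg d \<beta> \<alpha> f" by (rule regularI)
qed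

abbreviation cx where "cx \<alpha> p \<equiv> z (hh \<alpha>) p / z \<alpha> p"
abbreviation cy where "cy \<alpha> p \<equiv> z (vv \<alpha>) p / z \<alpha> p"

lemma regular_chart_poly: "reg 0 \<alpha> \<alpha> (\<lambda>p. poly2 g (cx \<alpha> p) (cy \<alpha> p))"
proof -
  have xy: "reg 0 \<alpha> \<alpha> (\<lambda>p. z \<beta> p / z \<alpha> p)" for \<beta>
    using regular_mult[OF regular_lf[of _ _ "Z \<beta>"] regular_inverse(1), of \<alpha>] by simp
  have p1: "reg 0 \<alpha> \<alpha> (\<lambda>p. poly c (cx \<alpha> p))" for c
  proof (induction c)
    case (pCons a c)
    then show ?case using regular_add[OF regular_const regular_mult[OF xy pCons(2), simplified]] by simp
  qed (simp add: regular_zero)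
  show ?thesis
  proof (induction g)
    case (pCons a c)
    then show ?case using regular_add[OF p1 regular_mult[OF xy pCons(2), simplified]] by simp
  qed (simp add: regular_zero)
qed

lemma cone_chart:
  assumes "p \<in> ov \<alpha> \<alpha>"
  shows "p = z \<alpha> p *s ch \<alpha> (cx \<alpha> p) (cy \<alpha> p)" "t (ch \<alpha> (cx \<alpha> p) (cy \<alpha> p)) = 0"
proof -
  have p: "p \<in> curve_cone q t" "z \<alpha> p \<noteq> 0" using assms by (auto simp: ov_simps)
  then show *: "p = z \<alpha> p *s ch \<alpha> (cx \<alpha> p) (cy \<alpha> p)" by (intro quadric_chart) (auto simp: curve_cone_def)
  have "t p = z \<alpha> p ^ 3 * t (ch \<alpha> (cx \<alpha> p) (cy \<alpha> p))"
    using Form_homogeneous[OF t_Form, of "z \<alpha> p" "ch \<alpha> (cx \<alpha> p) (cy \<alpha> p)"] by (simp flip: *)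
  then show "t (ch \<alpha> (cx \<alpha> p) (cy \<alpha> p)) = 0" using p by (auto simp: curve_cone_def)
qed

lemma regular_chart:
  assumes "reg d \<alpha> \<alpha> f"
  shows "\<exists>g. \<forall>p\<in>ov \<alpha> \<alpha>. f p = z \<alpha> p powi d * poly2 g (cx \<alpha> p) (cy \<alpha> p)"
proof -
  obtain N m P where P: "P \<in> Form m" "int m = d + 2 * int N" "\<And>p. p \<in> ov \<alpha> \<alpha> \<Longrightarrow> f p = P p / (z \<alpha> p * z \<alpha> p) ^ N"
    using assms(1) unfolding regular_def by blast
  obtain g where g: "\<And>x y. P (ch \<alpha> x y) = poly2 g x y"
    using Form_bilinear_poly[OF P(1)] unfolding ch_def by metis
  have "f p = z \<alpha> p powi d * poly2 g (cx \<alpha> p) (cy \<alpha> p)" if p: "p \<in> ov \<alpha> \<alpha>" for p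
  proof -
    have nz: "z \<alpha> p \<noteq> 0" using p by (simp add: ov_simps)
    have "P p = z \<alpha> p ^ m * P (ch \<alpha> (cx \<alpha> p) (cy \<alpha> p))"
      using Form_homogeneous[OF P(1), of "z \<alpha> p" "ch \<alpha> (cx \<alpha> p) (cy \<alpha> p)"] cone_chart(1)[OF p] by simp
    moreover have "z \<alpha> p ^ m = z \<alpha> p powi d * (z \<alpha> p * z \<alpha> p) ^ N"
    proof -
      have "z \<alpha> p ^ m = z \<alpha> p powi (d + 2 * int N)" by (simp flip: P(2))
      also have "\<dots> = z \<alpha> p powi d * (z \<alpha> p powi int (2 * N))" using nz by (simp add: power_int_add)
      also have "z \<alpha> p powi int (2 * N) = (z \<alpha> p * z \<alpha> p) ^ N"
        unfolding power_int_of_nat by (simp add: power_mult power2_eq_square)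
      finally show ?thesis .
    qed
    ultimately show ?thesis using P(3)[OF p] nz g by simp
  qed
  then show ?thesis by blast
qed

lemma ch_overlap: "t (ch \<alpha> x y) = 0 \<Longrightarrow> ch \<alpha> x y \<in> ov \<alpha> \<alpha>"
  by (simp add: ov_simps ch_cone)

lemma ch0_overlap:
  assumes "x \<noteq> 0" "y \<noteq> 0" "t (ch (0,0) x y) = 0"
  shows "ch (0,0) x y \<in> ov \<alpha> \<beta>"
proof -
  have "z \<alpha> (ch (0,0) x y) \<noteq> 0" for \<alpha>
    unfolding ch_transition(1)[OF assms(1,2), of \<alpha>] using assms by simp
  then show ?thesis using assms by (simp add: ov_simps ch_cone)
qed

lemma lev_chart_function:
  assumes g: "\<And>p. p \<in> ov \<alpha> \<alpha> \<Longrightarrow> f p = z \<alpha> p powi d * poly2 g (cx \<alpha> p) (cy \<alpha> p)"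
    and xy: "x \<noteq> 0" "y \<noteq> 0" "t (ch (0,0) x y) = 0"
  shows "lev x y (chart_laurent \<alpha> d d g) = f (ch (0,0) x y)"
proof -
  let ?p = "ch (0,0) x y"
  have "z \<alpha> ?p = (if fst \<alpha> = 0 then 1 else x) * (if snd \<alpha> = 0 then 1 else y)"
    unfolding ch_transition(1)[OF xy(1,2), of \<alpha>] by simp
  moreover have "cx \<alpha> ?p = x powi sx (fst \<alpha>)" "cy \<alpha> ?p = y powi sx (snd \<alpha>)"
    unfolding ch_transition(1)[OF xy(1,2), of \<alpha>] using xy by simp_all
  ultimately show ?thesis
    unfolding lev_chart_laurent[OF xy(1,2)] g[OF ch0_overlap[OF xy]] by (simp add: power_int_mult_distrib)
qed

text \<open>The torus points are dense in the curve: vanishing there already makes the polynomial of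
  f in the chart a multiple of \<open>TP \<alpha>\<close>.\<close>

lemma regular_zero_extend:
  assumes f: "reg d \<alpha> \<alpha> f" and van: "\<And>x y. x \<noteq> 0 \<Longrightarrow> y \<noteq> 0 \<Longrightarrow> t (ch (0,0) x y) = 0 \<Longrightarrow> f (ch (0,0) x y) = 0"
    and p: "p \<in> ov \<alpha> \<alpha>"
  shows "f p = 0"
proof -
  obtain g where g: "\<And>p. p \<in> ov \<alpha> \<alpha> \<Longrightarrow> f p = z \<alpha> p powi d * poly2 g (cx \<alpha> p) (cy \<alpha> p)"
    using regular_chart[OF f] by blast
  have "TP \<alpha> dvd g"
  proof (rule chart_function_zero)
    fix x y assume xy: "x \<noteq> 0" "y \<noteq> 0" "t (ch \<alpha> x y) = 0"
    let ?x = "x powi sx (fst \<alpha>)" and ?y = "y powi sx (snd \<alpha>)"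
    have nz: "?x \<noteq> 0" "?y \<noteq> 0" using xy by simp_all
    have t0: "t (ch (0,0) ?x ?y) = 0"
      using xy(3) unfolding ch_transition(2)[OF xy(1,2), of \<alpha>] Form_homogeneous[OF t_Form] using xy by (simp split: if_splits)
    have "f (ch (0,0) ?x ?y) = 0" by (rule van[OF nz t0])
    then have "lev ?x ?y (chart_laurent \<alpha> d d g) = 0" using lev_chart_function[OF g nz t0] by simp
    moreover have "?x powi sx (fst \<alpha>) = x" "?y powi sx (snd \<alpha>) = y"
      by (simp_all add: sx_def power_int_minus)
    ultimately show "poly2 g x y = 0" using nz unfolding lev_chart_laurent[OF nz] by (auto split: if_splits)
  qed
  then have "poly2 g (cx \<alpha> p) (cy \<alpha> p) = 0"
    using cone_chart(2)[OF p] by (auto simp: TP elim!: dvdE)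
  then show ?thesis using g[OF p] by simp
qed

text \<open>\<open>H\<^sup>0(O\<^sub>C(1)) = V\<close>\<close>

lemma global_linear_form:
  assumes reg: "\<And>\<alpha>. reg 1 \<alpha> \<alpha> (l \<alpha>)"
    and eq: "\<And>\<alpha> \<beta> p. p \<in> ov \<alpha> \<beta> \<Longrightarrow> l \<alpha> p = l \<beta> p"
  shows "\<exists>v. \<forall>\<alpha>. \<forall>p\<in>ov \<alpha> \<alpha>. l \<alpha> p = lf v p"
proof -
  have "\<forall>\<alpha>. \<exists>g. \<forall>p\<in>ov \<alpha> \<alpha>. l \<alpha> p = z \<alpha> p powi 1 * poly2 g (cx \<alpha> p) (cy \<alpha> p)"
    using regular_chart[OF reg] by blast
  from choice[OF this] obtain g where "\<forall>\<alpha>. \<forall>p\<in>ov \<alpha> \<alpha>. l \<alpha> p = z \<alpha> p powi 1 * poly2 (g \<alpha>) (cx \<alpha> p) (cy \<alpha> p)" by blast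
  then have g: "\<And>\<alpha> p. p \<in> ov \<alpha> \<alpha> \<Longrightarrow> l \<alpha> p = z \<alpha> p powi 1 * poly2 (g \<alpha>) (cx \<alpha> p) (cy \<alpha> p)" by blast
  define F where "F \<alpha> = chart_laurent \<alpha> 1 1 (g \<alpha>)" for \<alpha>
  have F: "lev x y (F \<alpha>) = l \<alpha> (ch (0,0) x y)" if "x \<noteq> 0" "y \<noteq> 0" "t (ch (0,0) x y) = 0" for \<alpha> x y
    unfolding F_def by (rule lev_chart_function[OF g that])
  have dvd: "TL dvd F \<beta> - F \<alpha>" for \<alpha> \<beta>
  proof (rule TL_dvd)
    fix x y assume xy: "x \<noteq> 0" "y \<noteq> 0" "t (ch (0,0) x y) = 0"
    show "lev x y (F \<beta> - F \<alpha>) = 0" using F[OF xy] eq[OF ch0_overlap[OF xy]] by simp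
  qed
  have "\<exists>G. (\<forall>\<alpha>. lkeys G \<subseteq> half_x (fst \<alpha>) 1 \<inter> half_y (snd \<alpha>) 1) \<and> (\<forall>\<alpha>. TL dvd F \<alpha> - G)"
    by (rule laurent.global_section) (use keys_chart_laurent dvd in \<open>simp_all add: F_def\<close>)
  then obtain G where G: "\<And>\<alpha>. lkeys G \<subseteq> half_x (fst \<alpha>) 1 \<inter> half_y (snd \<alpha>) 1" and GF: "\<And>\<alpha>. TL dvd F \<alpha> - G" by blast
  have "lkeys G \<subseteq> {(0,0), (1,0), (0,1), (1,1)}"
  proof
    fix k assume k: "k \<in> lkeys G"
    have "0 \<le> fst k" "fst k \<le> 1" "0 \<le> snd k" "snd k \<le> 1"
      using subsetD[OF G[of "(0,0)"] k] subsetD[OF G[of "(1,1)"] k] by (auto simp: half_x_def half_y_def)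
    then have "fst k \<in> {0, 1}" "snd k \<in> {0, 1}" by auto
    then show "k \<in> {(0,0), (1,0), (0,1), (1,1)}" by (cases k) auto
  qed
  then have lG: "lev x y G = lcoeff G (0,0) + lcoeff G (1,0) * x + lcoeff G (0,1) * y + lcoeff G (1,1) * (x * y)" for x y
    by (subst lev_superset[of "{(0,0), (1,0), (0,1), (1,1)}"]) auto
  \<comment> \<open>The four exponents of O(1, 1) correspond to the four coordinates 1, x, y and x y
    of the Segre chart.\<close>
  define v where "v = lcoeff G (0,0) *s Z (0,0) + lcoeff G (1,0) *s Z (1,0) + lcoeff G (0,1) *s Z (0,1) + lcoeff G (1,1) *s Z (1,1)"
  have v: "lf v (ch (0,0) x y) = lev x y G" for x y
    using z_ch[of "(0,0)" x y] by (simp add: v_def lG hh_def vv_def dd_def)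
  have "l \<alpha> p - lf v p = 0" if p: "p \<in> ov \<alpha> \<alpha>" for \<alpha> p
  proof (rule regular_zero_extend[OF regular_diff[OF reg regular_lf] _ p])
    fix x y assume xy: "x \<noteq> 0" "y \<noteq> 0" "t (ch (0,0) x y) = 0"
    obtain h where "F \<alpha> - G = TL * h" using GF[of \<alpha>] by blast
    then have "lev x y (F \<alpha> - G) = 0" using xy by (simp add: lev_TL)
    then show "l \<alpha> (ch (0,0) x y) - lf v (ch (0,0) x y) = 0" using F[OF xy] v by simp
  qed
  then show ?thesis by (intro exI[of _ v]) auto
qed

text \<open>On the Segre parametrization E becomes a polynomial of bidegree at most (2, 2), and
  evaluations at 0, 1 and -1 isolate its coefficients. Only x y arises from two products of
  coordinates; there the two matrix entries must be opposite, which is the shape of q.\<close>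

lemma Form2_vanishing:
  assumes E: "E \<in> Form 2" and van: "\<And>x y. E (ch (0,0) x y) = 0"
  shows "\<exists>c. \<forall>p. E p = c * q p"
proof -
  define e where "e \<beta> \<gamma> = ddir (W \<beta>) E (W \<gamma>)" for \<beta> \<gamma>
  note lin = Form2_bilinear[OF E]
  let ?\<alpha> = "(0,0) :: chart"
  have sym: "e \<beta> \<gamma> = e \<gamma> \<beta>" for \<beta> \<gamma>
    unfolding e_def by (rule Form2_symmetric[OF E])
  let ?h = "hh ?\<alpha>" and ?v = "vv ?\<alpha>" and ?d = "dd ?\<alpha>"
  have expand: "2 * E (a *s W ?\<alpha> + b *s W ?h + c *s W ?v + d *s W ?d) =
      a\<^sup>2 * e ?\<alpha> ?\<alpha> + b\<^sup>2 * e ?h ?h + c\<^sup>2 * e ?v ?v + d\<^sup>2 * e ?d ?d + 2 * (a * b * e ?\<alpha> ?h + a * c * e ?\<alpha> ?v + a * d * e ?\<alpha> ?d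
      + b * c * e ?h ?v + b * d * e ?h ?d + c * d * e ?v ?d)" for a b c d
    using ddir_euler[OF E, of "a *s W ?\<alpha> + b *s W ?h + c *s W ?v + d *s W ?d"]
    by (simp add: ddir_linear[OF E] lin sym[of ?h ?\<alpha>] sym[of ?v ?\<alpha>] sym[of ?d ?\<alpha>] sym[of ?v ?h] sym[of ?d ?h] sym[of ?d ?v] flip: e_def)
       (simp add: algebra_simps power2_eq_square)
  have van2: "e ?\<alpha> ?\<alpha> + x\<^sup>2 * e ?h ?h + y\<^sup>2 * e ?v ?v + (x * y)\<^sup>2 * e ?d ?d + 2 * (x * e ?\<alpha> ?h + y * e ?\<alpha> ?v + (x * y) * e ?\<alpha> ?d
      + x * y * e ?h ?v + x * (x * y) * e ?h ?d + y * (x * y) * e ?v ?d) = 0" for x y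
    using expand[of 1 x y "x * y"] van[of x y] by (simp add: ch_def)
  have z: "e ?\<alpha> ?\<alpha> = 0" using van2[of 0 0] by simp
  have hz: "e ?h ?h = 0" "e ?\<alpha> ?h = 0" using van2[of 1 0] van2[of "-1" 0] z by (simp_all add: algebra_simps)
  have vz: "e ?v ?v = 0" "e ?\<alpha> ?v = 0" using van2[of 0 1] van2[of 0 "-1"] z by (simp_all add: algebra_simps)
  let ?m = "e ?\<alpha> ?d + e ?h ?v"
  have r: "x * y * e ?d ?d + 2 * (?m + x * e ?h ?d + y * e ?v ?d) = 0" if "x \<noteq> 0" "y \<noteq> 0" for x y
  proof -
    have "x * y * (x * y * e ?d ?d + 2 * (?m + x * e ?h ?d + y * e ?v ?d)) = 0"
      using van2[of x y] z hz vz by (simp add: algebra_simps power2_eq_square)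
    then show ?thesis using that by simp
  qed
  have r4: "e ?d ?d + 2 * (?m + e ?h ?d + e ?v ?d) = 0" "- e ?d ?d + 2 * (?m + e ?h ?d - e ?v ?d) = 0"
    "- e ?d ?d + 2 * (?m - e ?h ?d + e ?v ?d) = 0" "e ?d ?d + 2 * (?m - e ?h ?d - e ?v ?d) = 0"
    using r[of 1 1] r[of 1 "-1"] r[of "-1" 1] r[of "-1" "-1"] by simp_all
  have lin4: "M = 0 \<and> A = 0 \<and> H = 0 \<and> V = 0"
    if eqs: "A + 2 * (M + H + V) = 0" "- A + 2 * (M + H - V) = 0" "- A + 2 * (M - H + V) = 0" "A + 2 * (M - H - V) = 0"
    for A M H V :: complex
  proof -
    have "8 * M = 0" "4 * A = 0" "8 * H = 0" "8 * V = 0" using eqs by algebra+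
    then show ?thesis by simp
  qed
  have m: "?m = 0" and dz: "e ?d ?d = 0" "e ?h ?d = 0" "e ?v ?d = 0" using lin4[OF r4] by auto
  have "E p = e ?\<alpha> ?d * q p" for p
  proof -
    have "p = z ?\<alpha> p *s W ?\<alpha> + z ?h p *s W ?h + z ?v p *s W ?v + z ?d p *s W ?d"
      using W_expand[of p] by (simp add: sum_chart[of _ ?\<alpha>])
    then have "2 * E p = 2 * (z ?\<alpha> p * z ?d p * e ?\<alpha> ?d + z ?h p * z ?v p * e ?h ?v)"
      using expand[of "z ?\<alpha> p" "z ?h p" "z ?v p" "z ?d p"] by (simp add: z hz vz dz)
    also have "e ?h ?v = - e ?\<alpha> ?d" using m by (simp add: add_eq_0_iff)
    finally have "2 * E p = 2 * (e ?\<alpha> ?d * q p)"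
      unfolding q_eq[of p ?\<alpha>] by (simp add: sg_def algebra_simps)
    then show ?thesis by simp
  qed
  then show ?thesis by blast
qed

section \<open>Local lifts of the normal section to the quadric\<close>

lemma unit_exists:
  "\<exists>K. \<forall>x y. t (ch \<alpha> x y) = 0 \<longrightarrow> poly2 (fst K) x y * f1 \<alpha> (ch \<alpha> x y) + poly2 (snd K) x y * f2 \<alpha> (ch \<alpha> x y) = 1"
proof -
  obtain a b c where abc: "a * TP \<alpha> + b * dx (TP \<alpha>) + c * pderiv (TP \<alpha>) = 1"
    using affine.jacobian_bezout by blast
  have "poly2 b x y * f1 \<alpha> (ch \<alpha> x y) + poly2 c x y * f2 \<alpha> (ch \<alpha> x y) = 1" if "t (ch \<alpha> x y) = 0" for x y
  proof -
    have "poly2 (a * TP \<alpha> + b * dx (TP \<alpha>) + c * pderiv (TP \<alpha>)) x y = 1" unfolding abc by simp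
    then show ?thesis using that by (simp add: TP dx_TP dy_TP)
  qed
  then show ?thesis by (intro exI[of _ "(b, c)"]) simp
qed

definition K :: "chart \<Rightarrow> complex poly poly \<times> complex poly poly" where
  "K \<alpha> = (SOME K. \<forall>x y. t (ch \<alpha> x y) = 0 \<longrightarrow> poly2 (fst K) x y * f1 \<alpha> (ch \<alpha> x y) + poly2 (snd K) x y * f2 \<alpha> (ch \<alpha> x y) = 1)"

text \<open>The weight -3 compensates the degree 3 of \<open>f1\<close> and \<open>f2\<close>, so
  that k1 f1 + k2 f2 = 1 on the cone over the chart.\<close>

definition k1 :: "chart \<Rightarrow> form" where "k1 \<alpha> p = poly2 (fst (K \<alpha>)) (cx \<alpha> p) (cy \<alpha> p) / z \<alpha> p ^ 3"
definition k2 :: "chart \<Rightarrow> form" where "k2 \<alpha> p = poly2 (snd (K \<alpha>)) (cx \<alpha> p) (cy \<alpha> p) / z \<alpha> p ^ 3"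

lemma K_unit: "t (ch \<alpha> x y) = 0 \<Longrightarrow> poly2 (fst (K \<alpha>)) x y * f1 \<alpha> (ch \<alpha> x y) + poly2 (snd (K \<alpha>)) x y * f2 \<alpha> (ch \<alpha> x y) = 1"
  using someI_ex[OF unit_exists[of \<alpha>]] unfolding K_def by blast

lemma ov_nz: "p \<in> ov \<alpha> \<beta> \<Longrightarrow> z \<alpha> p \<noteq> 0" "p \<in> ov \<alpha> \<beta> \<Longrightarrow> z \<beta> p \<noteq> 0" "p \<in> ov \<alpha> \<beta> \<Longrightarrow> p \<in> curve_cone q t"
  "p \<in> ov \<alpha> \<beta> \<Longrightarrow> p \<in> ov \<alpha> \<alpha>" "p \<in> ov \<alpha> \<beta> \<Longrightarrow> p \<in> ov \<beta> \<beta>" "p \<in> ov \<alpha> \<beta> \<Longrightarrow> p \<in> ov \<beta> \<alpha>"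
  by (auto simp: ov_simps)

lemma k_unit:
  assumes "p \<in> ov \<alpha> \<alpha>"
  shows "k1 \<alpha> p * f1 \<alpha> p + k2 \<alpha> p * f2 \<alpha> p = 1"
proof -
  let ?p = "ch \<alpha> (cx \<alpha> p) (cy \<alpha> p)"
  have p: "p = z \<alpha> p *s ?p" "t ?p = 0" using cone_chart[OF assms] by auto
  have f: "f1 \<alpha> p = z \<alpha> p ^ 3 * f1 \<alpha> ?p" "f2 \<alpha> p = z \<alpha> p ^ 3 * f2 \<alpha> ?p"
    using Form_homogeneous[OF f_Form(1), of \<alpha> "z \<alpha> p" ?p] Form_homogeneous[OF f_Form(2), of \<alpha> "z \<alpha> p" ?p] p(1) by simp_all
  show ?thesis using K_unit[OF p(2)] ov_nz(1)[OF assms] unfolding f k1_def k2_def by simp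
qed

lemma regular_inverse_power: "reg (- int n) \<alpha> \<beta> (\<lambda>p. 1 / z \<alpha> p ^ n)"
proof (induction n)
  case 0
  then show ?case using regular_const[of \<alpha> \<beta> 1] by simp
next
  case (Suc n)
  have "reg (-1 + (- int n)) \<alpha> \<beta> (\<lambda>p. (1 / z \<alpha> p) * (1 / z \<alpha> p ^ n))"
    by (intro regular_mult regular_inverse Suc)
  then show ?case by simp
qed

lemma k_regular: "reg (-3) \<alpha> \<alpha> (k1 \<alpha>)" "reg (-3) \<alpha> \<alpha> (k2 \<alpha>)"
  using regular_mult[OF regular_chart_poly[of \<alpha> "fst (K \<alpha>)"] regular_inverse_power[of 3]]
    regular_mult[OF regular_chart_poly[of \<alpha> "snd (K \<alpha>)"] regular_inverse_power[of 3]]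
  unfolding k1_def[abs_def] k2_def[abs_def] by simp_all

text \<open>\<open>w \<alpha>\<close> is a lifting of the section 1 of the normal bundle (twisted by \<open>O(-3)\<close>) to the tangent bundle of the quadric.\<close>

definition w :: "chart \<Rightarrow> vec4 \<Rightarrow> vec4" where "w \<alpha> p = k1 \<alpha> p *s xi1 \<alpha> p + k2 \<alpha> p *s xi2 \<alpha> p"

lemma ddir_w: "ddir (w \<alpha> p) q p = 0" "p \<in> ov \<alpha> \<alpha> \<Longrightarrow> ddir (w \<alpha> p) t p = 1"
  using k_unit by (simp_all add: w_def ddir_linear[OF q_Form] ddir_linear[OF t_Form] ddir_xi)

lemma z_w: "z \<alpha> (w \<alpha> p) = 0" "z (hh \<alpha>) (w \<alpha> p) = k1 \<alpha> p * z \<alpha> p" "z (vv \<alpha>) (w \<alpha> p) = k2 \<alpha> p * z \<alpha> p"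
  by (simp_all add: w_def)

lemma xi_regular: "reg 1 \<alpha> \<alpha> (\<lambda>p. xi1 \<alpha> p $ i)" "reg 1 \<alpha> \<alpha> (\<lambda>p. xi2 \<alpha> p $ i)"
proof -
  have "reg 1 \<alpha> \<alpha> (\<lambda>p. z \<beta> p * c + z \<gamma> p * d)" for \<beta> \<gamma> c d
    using regular_add[OF regular_scale[OF regular_lf, of \<alpha> \<alpha> c "Z \<beta>"] regular_scale[OF regular_lf, of \<alpha> \<alpha> d "Z \<gamma>"]]
    by (simp add: mult.commute)
  then show "reg 1 \<alpha> \<alpha> (\<lambda>p. xi1 \<alpha> p $ i)" "reg 1 \<alpha> \<alpha> (\<lambda>p. xi2 \<alpha> p $ i)"
    by (simp_all add: xi1_def xi2_def)
qed

lemma w_regular: "reg (-2) \<alpha> \<alpha> (\<lambda>p. w \<alpha> p $ i)"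
  using regular_add[OF regular_mult[OF k_regular(1) xi_regular(1), of \<alpha> i] regular_mult[OF k_regular(2) xi_regular(2), of \<alpha> i]]
  by (simp add: w_def)

subsection \<open>The Poincare residue in a chart\<close>

text \<open>\<open>m1\<close> and \<open>m2\<close> are the differentials of the affine coordinates
  x and y, evaluated at u.\<close>

definition m1 :: "chart \<Rightarrow> vec4 \<Rightarrow> vec4 \<Rightarrow> complex" where
  "m1 \<alpha> p u = (z (hh \<alpha>) u * z \<alpha> p - z \<alpha> u * z (hh \<alpha>) p) / (z \<alpha> p)\<^sup>2"
definition m2 :: "chart \<Rightarrow> vec4 \<Rightarrow> vec4 \<Rightarrow> complex" where
  "m2 \<alpha> p u = (z (vv \<alpha>) u * z \<alpha> p - z \<alpha> u * z (vv \<alpha>) p) / (z \<alpha> p)\<^sup>2"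
text \<open>On the curve this is dx / f2 = - dy / f1, the affine residue. Written with
  \<open>k1\<close> and \<open>k2\<close> it needs no division and is regular where f1 or f2
  vanishes.\<close>

definition ss :: "chart \<Rightarrow> vec4 \<Rightarrow> vec4 \<Rightarrow> complex" where
  "ss \<alpha> p u = m1 \<alpha> p u * k2 \<alpha> p - m2 \<alpha> p u * k1 \<alpha> p"
definition dW :: complex where "dW = 1 / det (chart_matrix Z)"
text \<open>The residue form in a chart. Unlike \<open>residue_form\<close>, this expression is
  linear in all vectors u, tangent or not, so it has regular coefficients.\<close>

definition rs :: "chart \<Rightarrow> vec4 \<Rightarrow> vec4 \<Rightarrow> complex" where
  "rs \<alpha> p u = sg \<alpha> * dW * (z \<alpha> p)\<^sup>2 * ss \<alpha> p u"

lemma det_nz: "det (chart_matrix Z) \<noteq> 0" "dW \<noteq> 0"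
  using chart_matrix_invertible by (simp_all add: dW_def invertible_det_nz)

lemma rs_expand: "p \<in> ov \<alpha> \<alpha> \<Longrightarrow> rs \<alpha> p u = sg \<alpha> * dW * ((z (hh \<alpha>) u * z \<alpha> p - z \<alpha> u * z (hh \<alpha>) p) * k2 \<alpha> p - (z (vv \<alpha>) u * z \<alpha> p - z \<alpha> u * z (vv \<alpha>) p) * k1 \<alpha> p)"
  using ov_nz(1)[of p \<alpha> \<alpha>] by (simp add: rs_def ss_def m1_def m2_def field_simps power2_eq_square)

lemma m_linear:
  "m1 \<alpha> p (u + v) = m1 \<alpha> p u + m1 \<alpha> p v" "m2 \<alpha> p (u + v) = m2 \<alpha> p u + m2 \<alpha> p v"
  "m1 \<alpha> p (u - v) = m1 \<alpha> p u - m1 \<alpha> p v" "m2 \<alpha> p (u - v) = m2 \<alpha> p u - m2 \<alpha> p v"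
  "m1 \<alpha> p (c *s u) = c * m1 \<alpha> p u" "m2 \<alpha> p (c *s u) = c * m2 \<alpha> p u"
  "m1 \<alpha> p 0 = 0" "m2 \<alpha> p 0 = 0" "m1 \<alpha> p p = 0" "m2 \<alpha> p p = 0"
  by (simp_all add: m1_def m2_def add_divide_distrib[symmetric] diff_divide_distrib[symmetric] algebra_simps)

lemma rs_linear:
  "rs \<alpha> p (u + v) = rs \<alpha> p u + rs \<alpha> p v" "rs \<alpha> p (u - v) = rs \<alpha> p u - rs \<alpha> p v"
  "rs \<alpha> p (c *s u) = c * rs \<alpha> p u" "rs \<alpha> p 0 = 0" "rs \<alpha> p p = 0"
  by (simp_all add: rs_def ss_def m_linear algebra_simps)

lemma rs_sum: "rs \<alpha> p (\<Sum>i\<in>I. u i) = (\<Sum>i\<in>I. rs \<alpha> p (u i))"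
  by (induction I rule: infinite_finite_induct) (auto simp: rs_linear)

lemma vec_expand_axis: "u = (\<Sum>i\<in>UNIV. u $ i *s axis i (1 :: complex))"
  by (simp add: vec_eq_iff axis_def if_distrib[of "\<lambda>x. _ * x"] cong: if_cong)

lemma rs_coeffs: "rs \<alpha> p u = (\<Sum>i\<in>UNIV. rs \<alpha> p (axis i 1) * u $ i)"
proof -
  have "rs \<alpha> p u = rs \<alpha> p (\<Sum>i\<in>UNIV. u $ i *s axis i 1)" using vec_expand_axis[of u] by simp
  then show ?thesis by (simp add: rs_sum rs_linear mult.commute)
qed

lemma rs_regular: "reg d \<alpha> \<alpha> (\<lambda>p. z (hh \<alpha>) (u p)) \<Longrightarrow> reg d \<alpha> \<alpha> (\<lambda>p. z (vv \<alpha>) (u p)) \<Longrightarrow> reg d \<alpha> \<alpha> (\<lambda>p. z \<alpha> (u p)) \<Longrightarrow>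
  reg (d - 2) \<alpha> \<alpha> (\<lambda>p. rs \<alpha> p (u p))"
proof -
  assume u: "reg d \<alpha> \<alpha> (\<lambda>p. z (hh \<alpha>) (u p))" "reg d \<alpha> \<alpha> (\<lambda>p. z (vv \<alpha>) (u p))" "reg d \<alpha> \<alpha> (\<lambda>p. z \<alpha> (u p))"
  have "reg (d + 1 + (-3)) \<alpha> \<alpha> (\<lambda>p. (sg \<alpha> * dW) * ((z (hh \<alpha>) (u p) * z \<alpha> p - z \<alpha> (u p) * z (hh \<alpha>) p) * k2 \<alpha> p - (z (vv \<alpha>) (u p) * z \<alpha> p - z \<alpha> (u p) * z (vv \<alpha>) p) * k1 \<alpha> p))"
    by (intro regular_scale regular_diff regular_mult u regular_lf k_regular)
  then have "reg (d - 2) \<alpha> \<alpha> (\<lambda>p. (sg \<alpha> * dW) * ((z (hh \<alpha>) (u p) * z \<alpha> p - z \<alpha> (u p) * z (hh \<alpha>) p) * k2 \<alpha> p - (z (vv \<alpha>) (u p) * z \<alpha> p - z \<alpha> (u p) * z (vv \<alpha>) p) * k1 \<alpha> p))"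
    by (rule regular_cast) simp
  then show ?thesis by (rule regular_cong) (simp add: rs_expand)
qed

lemma lf_regular_vec:
  assumes "\<And>i. reg d \<alpha> \<beta> (\<lambda>p. u p $ i)"
  shows "reg d \<alpha> \<beta> (\<lambda>p. lf a (u p))"
  unfolding lf_def by (intro regular_sum regular_scale assms)

lemma rs_coeff_regular: "reg (-2) \<alpha> \<alpha> (\<lambda>p. rs \<alpha> p (axis i 1))"
  by (rule regular_cast[OF rs_regular[where d = 0]]) (simp_all add: regular_const)

text \<open>The tangent space of the cone over the quadric is spanned by the Euler vector and the
  two coordinate fields; its coordinates are read off from the three independent components.\<close>

lemma tangent_quadric:
  assumes p: "q p = 0" "z \<alpha> p \<noteq> 0" and u: "ddir u q p = 0"
  shows "u = (z \<alpha> u / z \<alpha> p) *s p + m1 \<alpha> p u *s xi1 \<alpha> p + m2 \<alpha> p u *s xi2 \<alpha> p"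
proof (rule vec_eqI4[of \<alpha>])
  have zd: "z (dd \<alpha>) p = z (hh \<alpha>) p * z (vv \<alpha>) p / z \<alpha> p"
    using q_eq[of p \<alpha>] p by (simp add: field_simps)
  have "z \<alpha> u * z (dd \<alpha>) p + z \<alpha> p * z (dd \<alpha>) u - z (hh \<alpha>) u * z (vv \<alpha>) p - z (hh \<alpha>) p * z (vv \<alpha>) u = 0"
    using u ddir_q[of u p \<alpha>] by simp
  then have "z (dd \<alpha>) u = (z (hh \<alpha>) u * z (vv \<alpha>) p + z (hh \<alpha>) p * z (vv \<alpha>) u - z \<alpha> u * z (dd \<alpha>) p) / z \<alpha> p"
    using p(2) by (simp add: field_simps)
  then show "z (dd \<alpha>) u = z (dd \<alpha>) ((z \<alpha> u / z \<alpha> p) *s p + m1 \<alpha> p u *s xi1 \<alpha> p + m2 \<alpha> p u *s xi2 \<alpha> p)"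
    using p(2) by (simp add: zd m1_def m2_def field_simps power2_eq_square)
qed (use p(2) in \<open>simp_all add: m1_def m2_def field_simps power2_eq_square\<close>)

text \<open>The vector (m1, m2) is annihilated by (f1, f2), hence proportional to (f2, -f1); the
  relation k1 f1 + k2 f2 = 1 gives the factor.\<close>

lemma tangent_curve:
  assumes p: "p \<in> ov \<alpha> \<alpha>" and u: "u \<in> tangent_cone q t p"
  shows "m1 \<alpha> p u = ss \<alpha> p u * f2 \<alpha> p" "m2 \<alpha> p u = - ss \<alpha> p u * f1 \<alpha> p"
proof -
  have pc: "q p = 0" "t p = 0" "z \<alpha> p \<noteq> 0" using p by (auto simp: ov_simps curve_cone_def)
  have uq: "ddir u q p = 0" and ut: "ddir u t p = 0" using u by (auto simp: tangent_cone_def)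
  have "ddir ((z \<alpha> u / z \<alpha> p) *s p + m1 \<alpha> p u *s xi1 \<alpha> p + m2 \<alpha> p u *s xi2 \<alpha> p) t p = 0"
    using tangent_quadric[OF pc(1,3) uq] ut by simp
  then have m: "m1 \<alpha> p u * f1 \<alpha> p + m2 \<alpha> p u * f2 \<alpha> p = 0"
    using ddir_euler[OF t_Form, of p] pc(2) by (simp add: ddir_linear[OF t_Form] ddir_xi)
  show "m1 \<alpha> p u = ss \<alpha> p u * f2 \<alpha> p" "m2 \<alpha> p u = - ss \<alpha> p u * f1 \<alpha> p"
    using k_unit[OF p] m unfolding ss_def by algebra+
qed

lemma det_rows:
  "det (vector [p, u, a, b] :: complex^4^4) = dW * (let
     x = (\<lambda>v i. (chart_matrix Z *v v) $ i) in
    det (\<chi> i j. (if i = 1 then x p j else if i = 2 then x u j else if i = 3 then x a j else x b j) :: complex^4^4))"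
proof -
  let ?M = "vector [p, u, a, b] :: complex^4^4"
  have "?M ** transpose (chart_matrix Z) = (\<chi> i j. (if i = 1 then (chart_matrix Z *v p) $ j else if i = 2 then (chart_matrix Z *v u) $ j else if i = 3 then (chart_matrix Z *v a) $ j else (chart_matrix Z *v b) $ j))"
    by (simp add: vec_eq_iff forall_4 matrix_matrix_mult_def matrix_vector_mult_def transpose_def mult.commute)
  then have "det ?M * det (chart_matrix Z) = det (\<chi> i j. (if i = 1 then (chart_matrix Z *v p) $ j else if i = 2 then (chart_matrix Z *v u) $ j else if i = 3 then (chart_matrix Z *v a) $ j else (chart_matrix Z *v b) $ j))"
    using det_mul[of ?M "transpose (chart_matrix Z)"] by (simp add: det_transpose)
  then show ?thesis using det_nz(1) by (simp add: dW_def Let_def field_simps)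
qed

text \<open>Passing to another chart permutes the four coordinates by a double transposition, which
  is even.\<close>

lemma det_4_permute:
  fixes x :: "vec4 \<Rightarrow> chart \<Rightarrow> complex"
  shows "det (vector [vector [x p (0,0), x p (0,1), x p (1,0), x p (1,1)], vector [x u (0,0), x u (0,1), x u (1,0), x u (1,1)],
     vector [x a (0,0), x a (0,1), x a (1,0), x a (1,1)], vector [x b (0,0), x b (0,1), x b (1,0), x b (1,1)]] :: complex^4^4)
   = det (vector [vector [x p \<alpha>, x p (vv \<alpha>), x p (hh \<alpha>), x p (dd \<alpha>)], vector [x u \<alpha>, x u (vv \<alpha>), x u (hh \<alpha>), x u (dd \<alpha>)],
     vector [x a \<alpha>, x a (vv \<alpha>), x a (hh \<alpha>), x a (dd \<alpha>)], vector [x b \<alpha>, x b (vv \<alpha>), x b (hh \<alpha>), x b (dd \<alpha>)]] :: complex^4^4)"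
  unfolding det_4 vector_4
  by (induct \<alpha> rule: chart_cases; simp only: hh_def vv_def dd_def fst_conv snd_conv two_simps add_0; algebra)

lemma det_chart:
  "det (vector [p, u, a, b] :: complex^4^4) = dW *
     det (vector [vector [z \<alpha> p, z (vv \<alpha>) p, z (hh \<alpha>) p, z (dd \<alpha>) p], vector [z \<alpha> u, z (vv \<alpha>) u, z (hh \<alpha>) u, z (dd \<alpha>) u],
     vector [z \<alpha> a, z (vv \<alpha>) a, z (hh \<alpha>) a, z (dd \<alpha>) a], vector [z \<alpha> b, z (vv \<alpha>) b, z (hh \<alpha>) b, z (dd \<alpha>) b]] :: complex^4^4)"
proof -
  have "(\<chi> i j. (if i = 1 then (chart_matrix Z *v p) $ j else if i = 2 then (chart_matrix Z *v u) $ j else if i = 3 then (chart_matrix Z *v a) $ j else (chart_matrix Z *v b) $ j) :: complex^4^4)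
    = vector [vector [z (0,0) p, z (0,1) p, z (1,0) p, z (1,1) p], vector [z (0,0) u, z (0,1) u, z (1,0) u, z (1,1) u],
     vector [z (0,0) a, z (0,1) a, z (1,0) a, z (1,1) a], vector [z (0,0) b, z (0,1) b, z (1,0) b, z (1,1) b]]"
    by (simp add: vec_eq_iff forall_4 chart_matrix_mult)
  then show ?thesis unfolding det_rows[of p u a b] Let_def
    by (simp only: det_4_permute[of "\<lambda>v \<beta>. z \<beta> v" p u a b \<alpha>])
qed

text \<open>The residue formula at a point of the curve, in coordinates ordered as \<alpha>,
  \<open>vv \<alpha>\<close>, \<open>hh \<alpha>\<close>, \<open>dd \<alpha>\<close>. Here u is l
  times the Euler vector plus s times the tangent direction of the curve, dq and dt are the
  differentials up to the sign \<open>sg\<close>, and Euler's relation has eliminated one partial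
  derivative of t.\<close>

lemma residue_identity:
  fixes c x y l s th tv td a0 a1 a2 a3 b0 b1 b2 b3 :: complex
  defines "p \<equiv> vector [c, c * y, c * x, c * x * y] :: vec4"
    and "u \<equiv> vector [l * c, l * (c * y) - s * (c * (th + y * td)) * c, l * (c * x) + s * (c * (tv + x * td)) * c,
        l * (c * x * y) + s * (c * (tv + x * td)) * (c * y) - s * (c * (th + y * td)) * (c * x)] :: vec4"
    and "dq \<equiv> \<lambda>a0 a1 a2 a3. a0 * (c * x * y) + c * a3 - a1 * (c * x) - c * y * a2"
    and "dt \<equiv> \<lambda>a0 a1 a2 a3. - a0 * (x * th + y * tv + x * y * td) + a1 * tv + a2 * th + a3 * td"
  shows "det (vector [p, u, vector [a0, a1, a2, a3], vector [b0, b1, b2, b3]] :: complex^4^4) =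
    c\<^sup>2 * s * (dq a0 a1 a2 a3 * dt b0 b1 b2 b3 - dq b0 b1 b2 b3 * dt a0 a1 a2 a3)"
  unfolding det_4 vector_4 assms by (simp add: algebra_simps power2_eq_square)

lemma chart_coords:
  assumes p: "p \<in> ov \<alpha> \<alpha>"
  shows "z (hh \<alpha>) p = z \<alpha> p * cx \<alpha> p" "z (vv \<alpha>) p = z \<alpha> p * cy \<alpha> p" "z (dd \<alpha>) p = z \<alpha> p * cx \<alpha> p * cy \<alpha> p"
    "tt \<alpha> p = - (cx \<alpha> p * tt (hh \<alpha>) p + cy \<alpha> p * tt (vv \<alpha>) p + cx \<alpha> p * cy \<alpha> p * tt (dd \<alpha>) p)"
    "f1 \<alpha> p = z \<alpha> p * (tt (hh \<alpha>) p + cy \<alpha> p * tt (dd \<alpha>) p)" "f2 \<alpha> p = z \<alpha> p * (tt (vv \<alpha>) p + cx \<alpha> p * tt (dd \<alpha>) p)"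
proof -
  have nz: "z \<alpha> p \<noteq> 0" using ov_nz(1)[OF p] .
  show h: "z (hh \<alpha>) p = z \<alpha> p * cx \<alpha> p" and v: "z (vv \<alpha>) p = z \<alpha> p * cy \<alpha> p" using nz by simp_all
  show d: "z (dd \<alpha>) p = z \<alpha> p * cx \<alpha> p * cy \<alpha> p"
    using cone_q[OF ov_nz(3)[OF p], of \<alpha>] nz by (simp add: field_simps)
  have "z \<alpha> p * (tt \<alpha> p + (cx \<alpha> p * tt (hh \<alpha>) p + cy \<alpha> p * tt (vv \<alpha>) p + cx \<alpha> p * cy \<alpha> p * tt (dd \<alpha>) p)) = 0"
    using cone_t[OF ov_nz(3)[OF p], of \<alpha>] unfolding d using nz by (simp add: algebra_simps)
  then show "tt \<alpha> p = - (cx \<alpha> p * tt (hh \<alpha>) p + cy \<alpha> p * tt (vv \<alpha>) p + cx \<alpha> p * cy \<alpha> p * tt (dd \<alpha>) p)"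
    using nz by (simp add: add_eq_0_iff)
  show "f1 \<alpha> p = z \<alpha> p * (tt (hh \<alpha>) p + cy \<alpha> p * tt (dd \<alpha>) p)" "f2 \<alpha> p = z \<alpha> p * (tt (vv \<alpha>) p + cx \<alpha> p * tt (dd \<alpha>) p)"
    using nz by (simp_all add: f1_def f2_def distrib_left)
qed

lemma tangent_coords:
  assumes p: "p \<in> ov \<alpha> \<alpha>" and u: "ddir u q p = 0"
  defines "l \<equiv> z \<alpha> u / z \<alpha> p"
  shows "z \<alpha> u = l * z \<alpha> p" "z (hh \<alpha>) u = l * z (hh \<alpha>) p + m1 \<alpha> p u * z \<alpha> p" "z (vv \<alpha>) u = l * z (vv \<alpha>) p + m2 \<alpha> p u * z \<alpha> p"
    "z (dd \<alpha>) u = l * z (dd \<alpha>) p + m1 \<alpha> p u * z (vv \<alpha>) p + m2 \<alpha> p u * z (hh \<alpha>) p"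
proof -
  have "q p = 0" "z \<alpha> p \<noteq> 0" using p by (auto simp: ov_simps curve_cone_def)
  from tangent_quadric[OF this u] have "z \<beta> u = z \<beta> (l *s p + m1 \<alpha> p u *s xi1 \<alpha> p + m2 \<alpha> p u *s xi2 \<alpha> p)" for \<beta>
    by (simp add: l_def)
  then show "z \<alpha> u = l * z \<alpha> p" "z (hh \<alpha>) u = l * z (hh \<alpha>) p + m1 \<alpha> p u * z \<alpha> p" "z (vv \<alpha>) u = l * z (vv \<alpha>) p + m2 \<alpha> p u * z \<alpha> p"
    "z (dd \<alpha>) u = l * z (dd \<alpha>) p + m1 \<alpha> p u * z (vv \<alpha>) p + m2 \<alpha> p u * z (hh \<alpha>) p"
    by simp_all
qed

lemma residue_property:
  assumes p: "p \<in> ov \<alpha> \<alpha>" and u: "u \<in> tangent_cone q t p"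
  shows "rs \<alpha> p u * (ddir a q p * ddir b t p - ddir b q p * ddir a t p) = det (vector [p, u, a, b] :: complex^4^4)"
proof -
  define c x y where "c = z \<alpha> p" and "x = cx \<alpha> p" and "y = cy \<alpha> p"
  define th tv td where "th = tt (hh \<alpha>) p" and "tv = tt (vv \<alpha>) p" and "td = tt (dd \<alpha>) p"
  define l s where "l = z \<alpha> u / z \<alpha> p" and "s = ss \<alpha> p u"
  have zp: "z \<alpha> p = c" "z (hh \<alpha>) p = c * x" "z (vv \<alpha>) p = c * y" "z (dd \<alpha>) p = c * x * y"
    using chart_coords[OF p] by (simp_all add: c_def x_def y_def)
  have ta: "tt \<alpha> p = - (x * th + y * tv + x * y * td)" 
    using chart_coords(4)[OF p] by (simp add: x_def y_def th_def tv_def td_def)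
  have m: "m1 \<alpha> p u = s * (c * (tv + x * td))" "m2 \<alpha> p u = - s * (c * (th + y * td))"
    using tangent_curve[OF p u] chart_coords(5,6)[OF p] by (simp_all add: s_def c_def x_def y_def th_def tv_def td_def)
  have "ddir u q p = 0" using u by (simp add: tangent_cone_def)
  from tangent_coords[OF p this, folded l_def, unfolded zp m]
  have zu: "z \<alpha> u = l * c" "z (vv \<alpha>) u = l * (c * y) - s * (c * (th + y * td)) * c"
    "z (hh \<alpha>) u = l * (c * x) + s * (c * (tv + x * td)) * c"
    "z (dd \<alpha>) u = l * (c * x * y) + s * (c * (tv + x * td)) * (c * y) - s * (c * (th + y * td)) * (c * x)"
    by (simp_all add: algebra_simps)
  have dq: "ddir a q p = sg \<alpha> * (z \<alpha> a * (c * x * y) + c * z (dd \<alpha>) a - z (vv \<alpha>) a * (c * x) - c * y * z (hh \<alpha>) a)" for a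
    unfolding ddir_q[of a p \<alpha>] zp by (simp add: algebra_simps)
  have dt: "ddir a t p = - z \<alpha> a * (x * th + y * tv + x * y * td) + z (vv \<alpha>) a * tv + z (hh \<alpha>) a * th + z (dd \<alpha>) a * td" for a
    unfolding ddir_t[of a p \<alpha>] ta by (simp add: th_def tv_def td_def algebra_simps)
  have rs: "rs \<alpha> p u = sg \<alpha> * dW * c\<^sup>2 * s" by (simp add: rs_def s_def c_def)
  have "det (vector [p, u, a, b] :: complex^4^4) = dW * (c\<^sup>2 * s * (
      (z \<alpha> a * (c * x * y) + c * z (dd \<alpha>) a - z (vv \<alpha>) a * (c * x) - c * y * z (hh \<alpha>) a) * ddir b t p
    - (z \<alpha> b * (c * x * y) + c * z (dd \<alpha>) b - z (vv \<alpha>) b * (c * x) - c * y * z (hh \<alpha>) b) * ddir a t p))"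
    unfolding det_chart[of p u a b \<alpha>] zp zu residue_identity dt ..
  also have "\<dots> = (sg \<alpha> * sg \<alpha>) * dW * c\<^sup>2 * s * (
      (z \<alpha> a * (c * x * y) + c * z (dd \<alpha>) a - z (vv \<alpha>) a * (c * x) - c * y * z (hh \<alpha>) a) * ddir b t p
    - (z \<alpha> b * (c * x * y) + c * z (dd \<alpha>) b - z (vv \<alpha>) b * (c * x) - c * y * z (hh \<alpha>) b) * ddir a t p)"
    by (simp add: mult.assoc)
  also have "\<dots> = rs \<alpha> p u * (ddir a q p * ddir b t p - ddir b q p * ddir a t p)"
    unfolding rs dq by (simp only: right_diff_distrib mult_ac)
  finally show ?thesis by simp
qed

text \<open>Existence in the definite description is the determinant identity. For uniqueness, the
  minors at \<open>W (dd \<alpha>)\<close> together with \<open>xi1\<close> or \<open>xi2\<close>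
  are unit multiples of f1 and f2, which do not both vanish.\<close>

lemma residue_chart:
  assumes p: "p \<in> ov \<alpha> \<alpha>" and u: "u \<in> tangent_cone q t p"
  shows "residue_form q t p u = rs \<alpha> p u"
  unfolding residue_form_def
proof (rule the_equality)
  show "\<forall>a b. rs \<alpha> p u * (ddir a q p * ddir b t p - ddir b q p * ddir a t p) = det (vector [p, u, a, b] :: complex^4^4)"
    using residue_property[OF p u] by blast
next
  fix c assume c: "\<forall>a b. c * (ddir a q p * ddir b t p - ddir b q p * ddir a t p) = det (vector [p, u, a, b] :: complex^4^4)"
  have *: "(c - rs \<alpha> p u) * (ddir a q p * ddir b t p - ddir b q p * ddir a t p) = 0" for a b
    using c residue_property[OF p u, of a b] by (simp add: algebra_simps)
  have "ddir (W (dd \<alpha>)) q p = sg \<alpha> * z \<alpha> p" using ddir_q[of "W (dd \<alpha>)" p \<alpha>] by (simp add: z_W)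
  then have "(c - rs \<alpha> p u) * (sg \<alpha> * z \<alpha> p * f1 \<alpha> p) = 0" "(c - rs \<alpha> p u) * (sg \<alpha> * z \<alpha> p * f2 \<alpha> p) = 0"
    using *[of "W (dd \<alpha>)" "xi1 \<alpha> p"] *[of "W (dd \<alpha>)" "xi2 \<alpha> p"] by (simp_all add: ddir_xi)
  then show "c = rs \<alpha> p u" using nonsingular[of p \<alpha>] p by (auto simp: ov_simps)
qed

lemma rs_overlap: "p \<in> ov \<alpha> \<beta> \<Longrightarrow> u \<in> tangent_cone q t p \<Longrightarrow> rs \<alpha> p u = rs \<beta> p u"
  using residue_chart ov_nz by metis

lemma tangent_cone_linear:
  "u \<in> tangent_cone q t p \<Longrightarrow> v \<in> tangent_cone q t p \<Longrightarrow> u + v \<in> tangent_cone q t p"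
  "u \<in> tangent_cone q t p \<Longrightarrow> v \<in> tangent_cone q t p \<Longrightarrow> u - v \<in> tangent_cone q t p"
  "u \<in> tangent_cone q t p \<Longrightarrow> c *s u \<in> tangent_cone q t p"
  "0 \<in> tangent_cone q t p" "p \<in> curve_cone q t \<Longrightarrow> p \<in> tangent_cone q t p"
  using ddir_euler[OF q_Form, of p] ddir_euler[OF t_Form, of p]
  by (simp_all add: tangent_cone_def ddir_linear[OF q_Form] ddir_linear[OF t_Form] curve_cone_def)

subsection \<open>The logarithmic derivative of the transition functions\<close>

text \<open>For \<alpha> = (i, j) and \<beta> = (k, l) the transition functions of L1 and L2 have
  the same numerator. In their quotient it cancels, leaving the coordinate at (i, l) over that at
  (k, j), whose logarithmic derivative this is.\<close>

definition dg :: "chart \<Rightarrow> chart \<Rightarrow> vec4 \<Rightarrow> vec4 \<Rightarrow> complex" where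
  "dg \<alpha> \<beta> p u = z (fst \<alpha>, snd \<beta>) u / z (fst \<alpha>, snd \<beta>) p - z (fst \<beta>, snd \<alpha>) u / z (fst \<beta>, snd \<alpha>) p"

lemma chart_rel: "\<beta> = \<alpha> \<or> \<beta> = hh \<alpha> \<or> \<beta> = vv \<alpha> \<or> \<beta> = dd \<alpha>"
  by (induct \<alpha> rule: chart_cases; induct \<beta> rule: chart_cases) (simp_all add: hh_def vv_def dd_def)

lemma fst_snd_rel [simp]:
  "(fst \<alpha>, snd (hh \<alpha>)) = \<alpha>" "(fst (hh \<alpha>), snd \<alpha>) = hh \<alpha>" "(fst \<alpha>, snd (vv \<alpha>)) = vv \<alpha>" "(fst (vv \<alpha>), snd \<alpha>) = \<alpha>"
  "(fst \<alpha>, snd (dd \<alpha>)) = vv \<alpha>" "(fst (dd \<alpha>), snd \<alpha>) = hh \<alpha>"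
  "(fst (hh \<alpha>), snd (vv \<alpha>)) = dd \<alpha>" "(fst (vv \<alpha>), snd (hh \<alpha>)) = \<alpha>"
  "(fst (hh \<alpha>), snd (dd \<alpha>)) = dd \<alpha>" "(fst (dd \<alpha>), snd (hh \<alpha>)) = hh \<alpha>"
  "(fst (vv \<alpha>), snd (dd \<alpha>)) = vv \<alpha>" "(fst (dd \<alpha>), snd (vv \<alpha>)) = dd \<alpha>"
  "fst (hh \<alpha>) \<noteq> fst \<alpha>" "fst (dd \<alpha>) \<noteq> fst \<alpha>" "fst (vv \<alpha>) = fst \<alpha>" "snd (hh \<alpha>) = snd \<alpha>" "snd (vv \<alpha>) \<noteq> snd \<alpha>" "snd (dd \<alpha>) \<noteq> snd \<alpha>"
  "fst \<alpha> \<noteq> fst (hh \<alpha>)" "fst \<alpha> \<noteq> fst (dd \<alpha>)" "snd \<alpha> \<noteq> snd (vv \<alpha>)" "snd \<alpha> \<noteq> snd (dd \<alpha>)"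
  "fst (dd \<alpha>) = fst (hh \<alpha>)" "snd (dd \<alpha>) = snd (vv \<alpha>)"
  by (simp_all add: hh_def vv_def dd_def)

lemma dg_linear: "dg \<alpha> \<beta> p (u + v) = dg \<alpha> \<beta> p u + dg \<alpha> \<beta> p v" "dg \<alpha> \<beta> p (u - v) = dg \<alpha> \<beta> p u - dg \<alpha> \<beta> p v"
  "dg \<alpha> \<beta> p (c *s u) = c * dg \<alpha> \<beta> p u"
  by (simp_all add: dg_def add_divide_distrib diff_divide_distrib right_diff_distrib)

lemma cross_nonzero:
  assumes "p \<in> ov \<alpha> \<beta>"
  shows "z (fst \<alpha>, snd \<beta>) p \<noteq> 0" "z (fst \<beta>, snd \<alpha>) p \<noteq> 0"
proof -
  have "z (fst \<alpha>, snd \<beta>) p * z (fst \<beta>, snd \<alpha>) p = z \<alpha> p * z \<beta> p"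
    using chart_rel[of \<beta> \<alpha>] cone_q[OF ov_nz(3)[OF assms], of \<alpha>] by (auto simp: mult.commute)
  then show "z (fst \<alpha>, snd \<beta>) p \<noteq> 0" "z (fst \<beta>, snd \<alpha>) p \<noteq> 0" using ov_nz(1,2)[OF assms] by auto
qed

text \<open>In the affine coordinates of \<alpha> the transition function is 1, 1/x, y or
  y/x.\<close>

lemma dg_rel:
  assumes p: "p \<in> ov \<alpha> \<beta>" and u: "ddir u q p = 0"
  shows "\<beta> = \<alpha> \<Longrightarrow> dg \<alpha> \<beta> p u = 0" "\<beta> = hh \<alpha> \<Longrightarrow> dg \<alpha> \<beta> p u = - m1 \<alpha> p u / cx \<alpha> p"
    "\<beta> = vv \<alpha> \<Longrightarrow> dg \<alpha> \<beta> p u = m2 \<alpha> p u / cy \<alpha> p" "\<beta> = dd \<alpha> \<Longrightarrow> dg \<alpha> \<beta> p u = m2 \<alpha> p u / cy \<alpha> p - m1 \<alpha> p u / cx \<alpha> p"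
proof -
  have pa: "p \<in> ov \<alpha> \<alpha>" using ov_nz(4)[OF p] .
  have nz: "z \<alpha> p \<noteq> 0" "z \<beta> p \<noteq> 0" "z (fst \<alpha>, snd \<beta>) p \<noteq> 0" "z (fst \<beta>, snd \<alpha>) p \<noteq> 0"
    using ov_nz(1,2)[OF p] cross_nonzero[OF p] by auto
  define c x y l where "c = z \<alpha> p" and "x = cx \<alpha> p" and "y = cy \<alpha> p" and "l = z \<alpha> u / z \<alpha> p"
  have zp: "z \<alpha> p = c" "z (hh \<alpha>) p = c * x" "z (vv \<alpha>) p = c * y" "z (dd \<alpha>) p = c * x * y"
    using chart_coords[OF pa] by (simp_all add: c_def x_def y_def)
  have xy: "cx \<alpha> p = x" "cy \<alpha> p = y" by (simp_all add: x_def y_def)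
  define n1 n2 where "n1 = m1 \<alpha> p u" and "n2 = m2 \<alpha> p u"
  note zu = tangent_coords[OF pa u, folded l_def n1_def n2_def, unfolded zp]
  show "\<beta> = \<alpha> \<Longrightarrow> dg \<alpha> \<beta> p u = 0" by (simp add: dg_def)
  show "dg \<alpha> \<beta> p u = - m1 \<alpha> p u / cx \<alpha> p" if "\<beta> = hh \<alpha>"
    using nz unfolding xy n1_def[symmetric] unfolding that dg_def fst_snd_rel prod.collapse zp zu by (simp add: field_simps)
  show "dg \<alpha> \<beta> p u = m2 \<alpha> p u / cy \<alpha> p" if "\<beta> = vv \<alpha>"
    using nz unfolding xy n2_def[symmetric] unfolding that dg_def fst_snd_rel prod.collapse zp zu by (simp add: field_simps)
  show "dg \<alpha> \<beta> p u = m2 \<alpha> p u / cy \<alpha> p - m1 \<alpha> p u / cx \<alpha> p" if "\<beta> = dd \<alpha>"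
    using nz unfolding xy n1_def[symmetric] n2_def[symmetric] unfolding that dg_def fst_snd_rel prod.collapse zp zu by (simp add: field_simps)
qed

text \<open>The cocycle relation holds on the quadric only. Where all four coordinates are nonzero
  it amounts to the logarithmic derivative of the equation of q, taken in a direction tangent to
  q.\<close>

lemma dg_cocycle:
  assumes p: "p \<in> ov \<alpha> \<beta>" "p \<in> ov \<beta> \<gamma>" and u: "ddir u q p = 0"
  shows "dg \<alpha> \<gamma> p u = dg \<alpha> \<beta> p u + dg \<beta> \<gamma> p u"
proof -
  define L where "L \<delta> = z \<delta> u / z \<delta> p" for \<delta>
  have nz: "z \<alpha> p \<noteq> 0" "z \<beta> p \<noteq> 0" "z \<gamma> p \<noteq> 0" using p by (auto simp: ov_simps)
  have pc: "p \<in> curve_cone q t" using p by (auto simp: ov_simps)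
  have R: "L \<beta> + L (dd \<beta>) = L (hh \<beta>) + L (vv \<beta>)" if "z (hh \<beta>) p \<noteq> 0" "z (vv \<beta>) p \<noteq> 0"
  proof -
    have pb: "p \<in> ov \<beta> \<beta>" using ov_nz(5)[OF p(1)] .
    define c x y l where "c = z \<beta> p" and "x = cx \<beta> p" and "y = cy \<beta> p" and "l = z \<beta> u / z \<beta> p"
    have zp: "z \<beta> p = c" "z (hh \<beta>) p = c * x" "z (vv \<beta>) p = c * y" "z (dd \<beta>) p = c * x * y"
      using chart_coords[OF pb] by (simp_all add: c_def x_def y_def)
    define n1 n2 where "n1 = m1 \<beta> p u" and "n2 = m2 \<beta> p u"
    note zu = tangent_coords[OF pb u, folded l_def n1_def n2_def, unfolded zp]
    show ?thesis using that nz unfolding L_def zp zu by (simp add: field_simps)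
  qed
  have dd: "z (hh \<beta>) p \<noteq> 0 \<and> z (vv \<beta>) p \<noteq> 0" if "z (dd \<beta>) p \<noteq> 0"
    using cone_q[OF pc, of \<beta>] that nz(2) by auto
  have dgL: "dg \<delta> \<epsilon> p u = L (fst \<delta>, snd \<epsilon>) - L (fst \<epsilon>, snd \<delta>)" for \<delta> \<epsilon>
    by (simp add: dg_def L_def)
  have "\<alpha> = \<beta> \<or> \<alpha> = hh \<beta> \<or> \<alpha> = vv \<beta> \<or> \<alpha> = dd \<beta>" "\<gamma> = \<beta> \<or> \<gamma> = hh \<beta> \<or> \<gamma> = vv \<beta> \<or> \<gamma> = dd \<beta>" by (rule chart_rel)+
  then show ?thesis unfolding dgL using R dd nz
    by (elim disjE) (simp_all add: algebra_simps)
qed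

text \<open>Along the curve dx / x is f2 / x times the affine residue. Up to the factor
  \<open>(z \<alpha>)\<^sup>2\<close> absorbed in \<open>rs\<close>, f2 / x is a sum of two terms,
  one with denominator \<open>z (hh \<alpha>)\<close> and one with \<open>z \<alpha>\<close>. These
  belong to the two charts and dictate the formula.\<close>

definition phi :: "vec4 \<Rightarrow> chart \<Rightarrow> form" where
  "phi v \<alpha> p = sg \<alpha> * tt (dd \<alpha>) p / (dW * z \<alpha> p) + lf v p"

lemma phi_regular: "reg 1 \<alpha> \<alpha> (phi v \<alpha>)"
proof -
  have "reg (int 2 + -1) \<alpha> \<alpha> (\<lambda>p. (sg \<alpha> / dW) * (tt (dd \<alpha>) p * (1 / z \<alpha> p)))"
    by (intro regular_scale regular_mult regular_Form tt_Form regular_inverse)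
  then have "reg 1 \<alpha> \<alpha> (\<lambda>p. (sg \<alpha> / dW) * (tt (dd \<alpha>) p * (1 / z \<alpha> p)))" by simp
  from regular_add[OF this regular_lf[of \<alpha> \<alpha> v]] show ?thesis by (simp add: phi_def[abs_def])
qed

lemma dg_phi:
  assumes p: "p \<in> ov \<alpha> \<beta>" and u: "u \<in> tangent_cone q t p"
  shows "dg \<alpha> \<beta> p u = (phi v \<beta> p - phi v \<alpha> p) * rs \<alpha> p u"
proof -
  define c x y where "c = z \<alpha> p" and "x = cx \<alpha> p" and "y = cy \<alpha> p"
  define th tv td where "th = tt (hh \<alpha>) p" and "tv = tt (vv \<alpha>) p" and "td = tt (dd \<alpha>) p"
  define s where "s = ss \<alpha> p u"
  have pa: "p \<in> ov \<alpha> \<alpha>" using ov_nz(4)[OF p] .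
  have nz: "c \<noteq> 0" "z \<beta> p \<noteq> 0" using ov_nz(1,2)[OF p] by (auto simp: c_def)
  have zp: "z \<alpha> p = c" "z (hh \<alpha>) p = c * x" "z (vv \<alpha>) p = c * y" "z (dd \<alpha>) p = c * x * y"
    using chart_coords[OF pa] by (simp_all add: c_def x_def y_def)
  have ta: "tt \<alpha> p = - (x * th + y * tv + x * y * td)" 
    using chart_coords(4)[OF pa] by (simp add: x_def y_def th_def tv_def td_def)
  have m: "m1 \<alpha> p u = s * (c * (tv + x * td))" "m2 \<alpha> p u = - s * (c * (th + y * td))"
    using tangent_curve[OF pa u] chart_coords(5,6)[OF pa] by (simp_all add: s_def c_def x_def y_def th_def tv_def td_def)
  have uq: "ddir u q p = 0" using u by (simp add: tangent_cone_def)
  have rs: "rs \<alpha> p u = dW * c\<^sup>2 * s * sg \<alpha>" by (simp add: rs_def s_def c_def mult_ac)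
  have sg: "sg \<alpha> * (sg \<alpha> * X) = X" for X by (simp add: mult.assoc[symmetric])
  note dgr = dg_rel[OF p uq, unfolded m, folded x_def y_def]
  consider "\<beta> = \<alpha>" | "\<beta> = hh \<alpha>" | "\<beta> = vv \<alpha>" | "\<beta> = dd \<alpha>" using chart_rel[of \<beta> \<alpha>] by blast
  then show ?thesis
  proof cases
    case 1
    then show ?thesis using dgr(1) by simp
  next
    case 2
    then have "x \<noteq> 0" using nz zp by auto
    have "(phi v \<beta> p - phi v \<alpha> p) * rs \<alpha> p u = - (sg \<alpha> * sg \<alpha>) * (tv / (c * x) + td / c) * (c\<^sup>2 * s)"
      using det_nz(2) nz(1) \<open>x \<noteq> 0\<close> unfolding 2 phi_def zp rs by (simp add: zp tv_def td_def field_simps sg)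
    also have "\<dots> = - (s * (c * (tv + x * td))) / x" using nz(1) \<open>x \<noteq> 0\<close> by (simp add: field_simps power2_eq_square)
    finally show ?thesis using dgr(2)[OF 2] by simp
  next
    case 3
    then have "y \<noteq> 0" using nz zp by auto
    have "(phi v \<beta> p - phi v \<alpha> p) * rs \<alpha> p u = - (sg \<alpha> * sg \<alpha>) * (th / (c * y) + td / c) * (c\<^sup>2 * s)"
      using det_nz(2) nz(1) \<open>y \<noteq> 0\<close> unfolding 3 phi_def zp rs by (simp add: zp th_def td_def field_simps sg)
    also have "\<dots> = (- s * (c * (th + y * td))) / y" using nz(1) \<open>y \<noteq> 0\<close> by (simp add: field_simps power2_eq_square)
    finally show ?thesis using dgr(3)[OF 3] by simp
  next
    case 4
    then have xy: "x \<noteq> 0" "y \<noteq> 0" using nz zp by auto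
    have "(phi v \<beta> p - phi v \<alpha> p) * rs \<alpha> p u = (sg \<alpha> * sg \<alpha>) * (tt \<alpha> p / (c * x * y) - td / c) * (c\<^sup>2 * s)"
      using det_nz(2) nz(1) xy unfolding 4 phi_def zp rs by (simp add: zp td_def field_simps sg)
    also have "\<dots> = (- s * (c * (th + y * td))) / y - (s * (c * (tv + x * td))) / x"
      unfolding ta using nz(1) xy by (simp add: field_simps power2_eq_square)
    finally show ?thesis using dgr(4)[OF 4] by simp
  qed
qed

text \<open>
  \<open>tau \<gamma> \<alpha>\<close> is \<open>z\<^sub>\<gamma>\<close> times the logarithmic derivative of the transition function from \<open>\<gamma>\<close> to \<open>\<alpha>\<close>; unlike the
  latter it is regular on the whole chart \<open>\<alpha>\<close>.
\<close>

definition tau :: "chart \<Rightarrow> chart \<Rightarrow> vec4 \<Rightarrow> vec4 \<Rightarrow> complex" where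
  "tau \<gamma> \<alpha> p u = (if fst \<gamma> \<noteq> fst \<alpha> then m1 \<alpha> p u * z (fst \<alpha>, snd \<gamma>) p else 0)
     - (if snd \<gamma> \<noteq> snd \<alpha> then m2 \<alpha> p u * z (fst \<gamma>, snd \<alpha>) p else 0)"

lemma tau_rel:
  "tau \<alpha> \<alpha> p u = 0" "tau (hh \<alpha>) \<alpha> p u = m1 \<alpha> p u * z \<alpha> p" "tau (vv \<alpha>) \<alpha> p u = - m2 \<alpha> p u * z \<alpha> p"
  "tau (dd \<alpha>) \<alpha> p u = m1 \<alpha> p u * z (vv \<alpha>) p - m2 \<alpha> p u * z (hh \<alpha>) p"
  by (simp_all add: tau_def)

text \<open>The rule d(1/x) = - dx / x^2 for the coordinate that is inverted; the other coordinate
  is unchanged.\<close>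

lemma m_adjacent:
  assumes p: "p \<in> ov \<alpha> \<beta>" and u: "ddir u q p = 0"
  shows "\<beta> = hh \<alpha> \<Longrightarrow> m1 \<beta> p u = - m1 \<alpha> p u / (cx \<alpha> p)\<^sup>2 \<and> m2 \<beta> p u = m2 \<alpha> p u"
    "\<beta> = vv \<alpha> \<Longrightarrow> m1 \<beta> p u = m1 \<alpha> p u \<and> m2 \<beta> p u = - m2 \<alpha> p u / (cy \<alpha> p)\<^sup>2"
    "\<beta> = dd \<alpha> \<Longrightarrow> m1 \<beta> p u = - m1 \<alpha> p u / (cx \<alpha> p)\<^sup>2 \<and> m2 \<beta> p u = - m2 \<alpha> p u / (cy \<alpha> p)\<^sup>2"
proof -
  define c x y l where "c = z \<alpha> p" and "x = cx \<alpha> p" and "y = cy \<alpha> p" and "l = z \<alpha> u / z \<alpha> p"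
  have pa: "p \<in> ov \<alpha> \<alpha>" using ov_nz(4)[OF p] .
  have nz: "c \<noteq> 0" "z \<beta> p \<noteq> 0" using ov_nz(1,2)[OF p] by (auto simp: c_def)
  have zp: "z \<alpha> p = c" "z (hh \<alpha>) p = c * x" "z (vv \<alpha>) p = c * y" "z (dd \<alpha>) p = c * x * y"
    using chart_coords[OF pa] by (simp_all add: c_def x_def y_def)
  define n1 n2 where "n1 = m1 \<alpha> p u" and "n2 = m2 \<alpha> p u"
  note zu = tangent_coords[OF pa u, folded l_def n1_def n2_def, unfolded zp]
  have xy: "cx \<alpha> p = x" "cy \<alpha> p = y" by (simp_all add: x_def y_def)
  show "m1 \<beta> p u = - m1 \<alpha> p u / (cx \<alpha> p)\<^sup>2 \<and> m2 \<beta> p u = m2 \<alpha> p u" if "\<beta> = hh \<alpha>"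
  proof -
    have "x \<noteq> 0" using that nz zp by auto
    then show ?thesis using nz(1) unfolding xy n1_def[symmetric] n2_def[symmetric] unfolding that m1_def m2_def chart_simps zp zu
      by (simp add: field_simps power2_eq_square)
  qed
  show "m1 \<beta> p u = m1 \<alpha> p u \<and> m2 \<beta> p u = - m2 \<alpha> p u / (cy \<alpha> p)\<^sup>2" if "\<beta> = vv \<alpha>"
  proof -
    have "y \<noteq> 0" using that nz zp by auto
    then show ?thesis using nz(1) unfolding xy n1_def[symmetric] n2_def[symmetric] unfolding that m1_def m2_def chart_simps zp zu
      by (simp add: field_simps power2_eq_square)
  qed
  show "m1 \<beta> p u = - m1 \<alpha> p u / (cx \<alpha> p)\<^sup>2 \<and> m2 \<beta> p u = - m2 \<alpha> p u / (cy \<alpha> p)\<^sup>2" if "\<beta> = dd \<alpha>"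
  proof -
    have "x \<noteq> 0" "y \<noteq> 0" using that nz zp by auto
    then show ?thesis using nz(1) unfolding xy n1_def[symmetric] n2_def[symmetric] unfolding that m1_def m2_def chart_simps zp zu
      by (simp add: field_simps power2_eq_square)
  qed
qed

text \<open>Where the coordinate of \<gamma> is nonzero this is the cocycle relation for
  \<open>dg\<close>. The computation in coordinates also covers its zeros, where the logarithmic
  derivative has a pole.\<close>

lemma tau_difference:
  assumes p: "p \<in> ov \<alpha> \<beta>" and u: "ddir u q p = 0"
  shows "tau \<gamma> \<beta> p u - tau \<gamma> \<alpha> p u = z \<gamma> p * dg \<alpha> \<beta> p u"
proof -
  define c x y where "c = z \<alpha> p" and "x = cx \<alpha> p" and "y = cy \<alpha> p"
  have pa: "p \<in> ov \<alpha> \<alpha>" using ov_nz(4)[OF p] .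
  have nz: "c \<noteq> 0" "z \<beta> p \<noteq> 0" using ov_nz(1,2)[OF p] by (auto simp: c_def)
  have zp: "z \<alpha> p = c" "z (hh \<alpha>) p = c * x" "z (vv \<alpha>) p = c * y" "z (dd \<alpha>) p = c * x * y"
    using chart_coords[OF pa] by (simp_all add: c_def x_def y_def)
  have xy: "cx \<alpha> p = x" "cy \<alpha> p = y" by (simp_all add: x_def y_def)
  note dgr = dg_rel[OF p u, unfolded xy] and mad = m_adjacent[OF p u, unfolded xy]
  have \<gamma>: "\<gamma> = \<alpha> \<or> \<gamma> = hh \<alpha> \<or> \<gamma> = vv \<alpha> \<or> \<gamma> = dd \<alpha>" by (rule chart_rel)
  consider "\<beta> = \<alpha>" | "\<beta> = hh \<alpha>" | "\<beta> = vv \<alpha>" | "\<beta> = dd \<alpha>" using chart_rel[of \<beta> \<alpha>] by blast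
  then show ?thesis
  proof cases
    case 1
    then show ?thesis using dgr(1) by simp
  next
    case 2
    then have "x \<noteq> 0" using nz zp by auto
    then show ?thesis using \<gamma> nz(1) unfolding dgr(2)[OF 2] tau_def[of _ \<beta>] conjunct1[OF mad(1)[OF 2]] conjunct2[OF mad(1)[OF 2]]
      unfolding 2 by (elim disjE) (simp_all add: tau_rel zp field_simps power2_eq_square)
  next
    case 3
    then have "y \<noteq> 0" using nz zp by auto
    then show ?thesis using \<gamma> nz(1) unfolding dgr(3)[OF 3] tau_def[of _ \<beta>] conjunct1[OF mad(2)[OF 3]] conjunct2[OF mad(2)[OF 3]]
      unfolding 3 by (elim disjE) (simp_all add: tau_rel zp field_simps power2_eq_square)
  next
    case 4
    then have "x \<noteq> 0" "y \<noteq> 0" using nz zp by auto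
    then show ?thesis using \<gamma> nz(1) unfolding dgr(4)[OF 4] tau_def[of _ \<beta>] conjunct1[OF mad(3)[OF 4]] conjunct2[OF mad(3)[OF 4]]
      unfolding 4 by (elim disjE) (simp_all add: tau_rel zp field_simps power2_eq_square)
  qed
qed

text \<open>\<open>sg \<gamma> * tt (dd \<gamma>)\<close> is the derivative of t in the direction
  dual to the coordinate of \<gamma> under q. This is the point where the polarity of the quadric,
  and with it \<sigma>, appears.\<close>

lemma tau_tangent:
  assumes p: "p \<in> ov \<alpha> \<alpha>" and u: "u \<in> tangent_cone q t p"
  shows "tau \<gamma> \<alpha> p u = (- (sg \<gamma> * tt (dd \<gamma>) p / dW) + z \<gamma> p * phi 0 \<alpha> p) * rs \<alpha> p u"
proof -
  define c x y where "c = z \<alpha> p" and "x = cx \<alpha> p" and "y = cy \<alpha> p"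
  define th tv td where "th = tt (hh \<alpha>) p" and "tv = tt (vv \<alpha>) p" and "td = tt (dd \<alpha>) p"
  define s where "s = ss \<alpha> p u"
  have nz: "c \<noteq> 0" using ov_nz(1)[OF p] by (auto simp: c_def)
  have zp: "z \<alpha> p = c" "z (hh \<alpha>) p = c * x" "z (vv \<alpha>) p = c * y" "z (dd \<alpha>) p = c * x * y"
    using chart_coords[OF p] by (simp_all add: c_def x_def y_def)
  have tp: "tt \<alpha> p = - (x * th + y * tv + x * y * td)" "tt (hh \<alpha>) p = th" "tt (vv \<alpha>) p = tv" "tt (dd \<alpha>) p = td"
    using chart_coords(4)[OF p] by (simp_all add: x_def y_def th_def tv_def td_def)
  have m: "m1 \<alpha> p u = s * (c * (tv + x * td))" "m2 \<alpha> p u = - s * (c * (th + y * td))"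
    using tangent_curve[OF p u] chart_coords(5,6)[OF p] by (simp_all add: s_def c_def x_def y_def th_def tv_def td_def)
  have rs: "rs \<alpha> p u = dW * c\<^sup>2 * s * sg \<alpha>" by (simp add: rs_def s_def c_def mult_ac)
  have alg: "(- (g * T / D) + Y * (a * td / (D * c))) * (D * c\<^sup>2 * s * a) = (- ((a * g) * T) + (a * a) * Y * td / c) * (c\<^sup>2 * s)"
    if "D \<noteq> 0" "c \<noteq> 0" for g T D Y a td c s :: complex
    using that by (simp add: field_simps power2_eq_square)
  have R: "(- (sg \<gamma> * tt (dd \<gamma>) p / dW) + z \<gamma> p * phi 0 \<alpha> p) * rs \<alpha> p u
    = (- ((sg \<alpha> * sg \<gamma>) * tt (dd \<gamma>) p) + (sg \<alpha> * sg \<alpha>) * z \<gamma> p * td / c) * (c\<^sup>2 * s)"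
    using alg[OF det_nz(2) nz] unfolding phi_def rs zp tp lf_simps add_0_right by this
  have "\<gamma> = \<alpha> \<or> \<gamma> = hh \<alpha> \<or> \<gamma> = vv \<alpha> \<or> \<gamma> = dd \<alpha>" by (rule chart_rel)
  then show ?thesis unfolding R using nz
    by (elim disjE) (simp_all add: tau_rel zp tp m field_simps power2_eq_square)
qed

end

lemma DERIV_ratio:
  fixes a b c :: complex
  assumes "a \<noteq> 0" "b \<noteq> 0" "c \<noteq> 0"
  shows "((\<lambda>s. ((a + s * a') / (b + s * b')) / ((a + s * a') / (c + s * c'))) has_field_derivative
     (c' / c - b' / b) * ((a / b) / (a / c))) (at 0)"
proof -
  have aff: "((\<lambda>s. a + s * a') has_field_derivative a') (at 0)" for a a' :: complex
    by (auto intro!: derivative_eq_intros)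
  have "a + 0 * a' \<noteq> 0" "b + 0 * b' \<noteq> 0" "c + 0 * c' \<noteq> 0" "(a + 0 * a') / (c + 0 * c') \<noteq> 0" using assms by auto
  from DERIV_divide[OF DERIV_divide[OF aff aff this(2)] DERIV_divide[OF aff aff this(3)] this(4)]
  show ?thesis
  proof (rule DERIV_cong)
    have 1: "a / b / (a / c) = c / b" using assms by simp
    have 2: "(a' * b - a * b') / (b * b) = a' / b - a * b' / (b * b)" using assms by (simp add: diff_divide_distrib)
    have 3: "(a' * c - a * c') / (c * c) = a' / c - a * c' / (c * c)" using assms by (simp add: diff_divide_distrib)
    have "(a' * b - a * b') / (b * b) * (a / c) - a / b * ((a' * c - a * c') / (c * c)) = (c' / c - b' / b) * (c / b) * (a / c * (a / c))"
      unfolding 2 3 using assms by (simp add: divide_simps) (simp add: algebra_simps)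
    then show "((a' * (b + 0 * b') - (a + 0 * a') * b') / ((b + 0 * b') * (b + 0 * b')) * ((a + 0 * a') / (c + 0 * c')) -
        (a + 0 * a') / (b + 0 * b') * ((a' * (c + 0 * c') - (a + 0 * a') * c') / ((c + 0 * c') * (c + 0 * c')))) /
        ((a + 0 * a') / (c + 0 * c') * ((a + 0 * a') / (c + 0 * c'))) = (c' / c - b' / b) * ((a / b) / (a / c))"
      unfolding 1 using assms by simp
  qed
qed

context ruled_curve
begin

lemma rs_regular_vec:
  assumes "\<And>i. reg d \<alpha> \<beta> (\<lambda>p. u p $ i)"
  shows "reg (d - 2) \<alpha> \<beta> (\<lambda>p. rs \<alpha> p (u p))" "reg (d - 2) \<alpha> \<beta> (\<lambda>p. rs \<beta> p (u p))"
proof -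
  have c: "reg (-2) \<alpha> \<beta> (\<lambda>p. rs \<gamma> p (axis i 1))" if "\<gamma> = \<alpha> \<or> \<gamma> = \<beta>" for i \<gamma>
    using that regular_restrict[OF rs_coeff_regular] by blast
  have "reg (d - 2) \<alpha> \<beta> (\<lambda>p. rs \<gamma> p (u p))" if "\<gamma> = \<alpha> \<or> \<gamma> = \<beta>" for \<gamma>
  proof -
    have "reg (-2 + d) \<alpha> \<beta> (\<lambda>p. \<Sum>i\<in>UNIV. rs \<gamma> p (axis i 1) * u p $ i)"
      by (intro regular_sum regular_mult assms c that)
    then have "reg (d - 2) \<alpha> \<beta> (\<lambda>p. \<Sum>i\<in>UNIV. rs \<gamma> p (axis i 1) * u p $ i)"
      by (rule regular_cast) simp
    then show ?thesis by (rule regular_cong) (rule rs_coeffs)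
  qed
  then show "reg (d - 2) \<alpha> \<beta> (\<lambda>p. rs \<alpha> p (u p))" "reg (d - 2) \<alpha> \<beta> (\<lambda>p. rs \<beta> p (u p))" by blast+
qed

section \<open>Kodaira-Spencer lifts and the explicit cocycle\<close>

definition vf :: "form \<Rightarrow> chart \<Rightarrow> vec4 \<Rightarrow> vec4" where "vf G \<alpha> p = (- G p) *s w \<alpha> p"

lemma vf_regular: "G \<in> Form 3 \<Longrightarrow> reg 1 \<alpha> \<alpha> (\<lambda>p. vf G \<alpha> p $ i)"
  using regular_uminus[OF regular_mult[OF regular_Form w_regular[of \<alpha> i], of G 3]] by (simp add: vf_def)

lemma vf_tangent:
  "p \<in> ov \<alpha> \<alpha> \<Longrightarrow> ddir (vf G \<alpha> p) q p = 0" "p \<in> ov \<alpha> \<alpha> \<Longrightarrow> ddir (vf G \<alpha> p) t p + G p = 0"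
  using ddir_w[where \<alpha> = \<alpha> and p = p] ddir_linear(3)[OF q_Form, of "- G p" "w \<alpha> p" p] ddir_linear(3)[OF t_Form, of "- G p" "w \<alpha> p" p]
  by (simp_all add: vf_def)

lemma KS_lift_vf: "G \<in> Form 3 \<Longrightarrow> KS_lift q t Z G (vf G)"
  unfolding KS_lift_def using vf_regular vf_tangent by blast

lemma lift_difference:
  assumes "p \<in> ov \<alpha> \<alpha>" "ddir u q p = 0" "ddir u t p + G p = 0"
  shows "u - vf G \<alpha> p \<in> tangent_cone q t p"
proof -
  have "ddir u t p = ddir (vf G \<alpha> p) t p"
    using vf_tangent(2)[OF assms(1), of G] assms(3) by (metis add_right_cancel)
  then show ?thesis
    using vf_tangent(1)[OF assms(1), of G] assms(2) by (simp add: tangent_cone_def ddir_linear[OF q_Form] ddir_linear[OF t_Form])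
qed

text \<open>The form \<open>phi * rs\<close> on the curve, extended to tangent vectors (u, G) of the
  family so that it vanishes on the lift of G over \<alpha>.\<close>

definition om :: "vec4 \<Rightarrow> chart \<Rightarrow> vec4 \<Rightarrow> vec4 \<Rightarrow> form \<Rightarrow> complex" where
  "om v \<alpha> p u G = phi v \<alpha> p * rs \<alpha> p (u - vf G \<alpha> p)"

text \<open>What is left of the logarithmic derivative at the lift of G over \<alpha> after
  subtracting the coboundary of \<open>om\<close>. It depends on G only and not on a vector
  u.\<close>

definition ee :: "vec4 \<Rightarrow> form \<Rightarrow> chart \<Rightarrow> chart \<Rightarrow> form" where
  "ee v G \<alpha> \<beta> p = dg \<alpha> \<beta> p (vf G \<alpha> p) + phi v \<beta> p * rs \<beta> p (vf G \<beta> p - vf G \<alpha> p)"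

text \<open>u differs from the lifts of G by vectors tangent to the curve; there \<open>dg\<close>
  is a coboundary and the residue does not depend on the chart.\<close>

lemma dg_decompose:
  assumes p: "p \<in> ov \<alpha> \<beta>" and u: "ddir u q p = 0" "ddir u t p + G p = 0"
  shows "dg \<alpha> \<beta> p u = ee v G \<alpha> \<beta> p + om v \<beta> p u G - om v \<alpha> p u G"
proof -
  let ?a = "vf G \<alpha> p" and ?b = "vf G \<beta> p"
  have T: "u - ?a \<in> tangent_cone q t p" "u - ?b \<in> tangent_cone q t p"
    using lift_difference[of p \<alpha> u G] lift_difference[of p \<beta> u G] u ov_nz(4,5)[OF p] by auto
  have "dg \<alpha> \<beta> p u = dg \<alpha> \<beta> p ?a + dg \<alpha> \<beta> p (u - ?a)" by (simp add: dg_linear)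
  also have "dg \<alpha> \<beta> p (u - ?a) = (phi v \<beta> p - phi v \<alpha> p) * rs \<alpha> p (u - ?a)" by (rule dg_phi[OF p T(1)])
  also have "(phi v \<beta> p - phi v \<alpha> p) * rs \<alpha> p (u - ?a) = phi v \<beta> p * rs \<beta> p (u - ?a) - phi v \<alpha> p * rs \<alpha> p (u - ?a)"
    using rs_overlap[OF p T(1)] by (simp add: left_diff_distrib)
  also have "rs \<beta> p (u - ?a) = rs \<beta> p (u - ?b) + rs \<beta> p (?b - ?a)" by (simp add: rs_linear)
  finally show ?thesis by (simp add: ee_def om_def algebra_simps)
qed

text \<open>On the quadric the product of the two mixed coordinates equals the product of those of
  \<alpha> and \<beta>, so each mixed coordinate is invertible on the overlap.\<close>

lemma cross_inverse_regular: "reg (-1) \<alpha> \<beta> (\<lambda>p. 1 / z (fst \<alpha>, snd \<beta>) p)" "reg (-1) \<alpha> \<beta> (\<lambda>p. 1 / z (fst \<beta>, snd \<alpha>) p)"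
proof -
  have prod: "z (fst \<alpha>, snd \<beta>) p * z (fst \<beta>, snd \<alpha>) p = z \<alpha> p * z \<beta> p" if "p \<in> ov \<alpha> \<beta>" for p
    using chart_rel[of \<beta> \<alpha>] cone_q[OF ov_nz(3)[OF that], of \<alpha>] by (auto simp: mult.commute)
  have *: "reg (-1) \<alpha> \<beta> (\<lambda>p. lf a p * ((1 / z \<alpha> p) * (1 / z \<beta> p)))" for a
    using regular_mult[OF regular_lf[of \<alpha> \<beta> a] regular_mult[OF regular_inverse(1)[of \<alpha> \<beta>] regular_inverse(2)[of \<alpha> \<beta>]]] by simp
  show "reg (-1) \<alpha> \<beta> (\<lambda>p. 1 / z (fst \<alpha>, snd \<beta>) p)"
  proof (rule regular_cong[OF *[of "Z (fst \<beta>, snd \<alpha>)"]])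
    fix p assume p: "p \<in> ov \<alpha> \<beta>"
    show "1 / z (fst \<alpha>, snd \<beta>) p = z (fst \<beta>, snd \<alpha>) p * ((1 / z \<alpha> p) * (1 / z \<beta> p))"
      using prod[OF p] cross_nonzero[OF p] ov_nz(1,2)[OF p] by (simp add: field_simps)
  qed
  show "reg (-1) \<alpha> \<beta> (\<lambda>p. 1 / z (fst \<beta>, snd \<alpha>) p)"
  proof (rule regular_cong[OF *[of "Z (fst \<alpha>, snd \<beta>)"]])
    fix p assume p: "p \<in> ov \<alpha> \<beta>"
    show "1 / z (fst \<beta>, snd \<alpha>) p = z (fst \<alpha>, snd \<beta>) p * ((1 / z \<alpha> p) * (1 / z \<beta> p))"
      using prod[OF p] cross_nonzero[OF p] ov_nz(1,2)[OF p] by (simp add: field_simps)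
  qed
qed

lemma dg_regular:
  assumes "\<And>i. reg 1 \<alpha> \<beta> (\<lambda>p. u p $ i)"
  shows "reg 0 \<alpha> \<beta> (\<lambda>p. dg \<alpha> \<beta> p (u p))"
  using regular_diff[OF regular_mult[OF lf_regular_vec[OF assms, of "Z (fst \<alpha>, snd \<beta>)"] cross_inverse_regular(1)]
    regular_mult[OF lf_regular_vec[OF assms, of "Z (fst \<beta>, snd \<alpha>)"] cross_inverse_regular(2)]]
  by (simp add: dg_def)

lemma ee_regular:
  assumes G: "G \<in> Form 3"
  shows "reg 0 \<alpha> \<beta> (ee v G \<alpha> \<beta>)"
proof -
  have va: "reg 1 \<alpha> \<beta> (\<lambda>p. vf G \<alpha> p $ i)" and vb: "reg 1 \<alpha> \<beta> (\<lambda>p. vf G \<beta> p $ i)" for i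
    using regular_restrict[OF vf_regular[OF G]] by blast+
  have "reg 1 \<alpha> \<beta> (\<lambda>p. (vf G \<beta> p - vf G \<alpha> p) $ i)" for i using regular_diff[OF vb va] by simp
  from rs_regular_vec(2)[OF this] have "reg (-1) \<alpha> \<beta> (\<lambda>p. rs \<beta> p (vf G \<beta> p - vf G \<alpha> p))" by simp
  from regular_mult[OF regular_restrict(2)[OF phi_regular] this]
  have "reg 0 \<alpha> \<beta> (\<lambda>p. phi v \<beta> p * rs \<beta> p (vf G \<beta> p - vf G \<alpha> p))" by simp
  from regular_add[OF dg_regular[OF va] this] show ?thesis by (simp add: ee_def[abs_def])
qed

lemma vf_linear: "vf (\<lambda>x. G x + H x) \<alpha> p = vf G \<alpha> p + vf H \<alpha> p" "vf (\<lambda>x. r * G x) \<alpha> p = r *s vf G \<alpha> p" "vf (\<lambda>_. 0) \<alpha> p = 0"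
  by (simp_all add: vf_def vec_eq_iff algebra_simps)

text \<open>Evaluate the decomposition of \<open>dg\<close> on the three overlaps at one common
  vector, the lift over \<alpha>: the terms \<open>om\<close> telescope and \<open>dg\<close> is
  additive.\<close>

lemma ee_cocycle: "cocycle_WO q t Z (ee v)"
proof -
  have add: "ee v (\<lambda>x. G x + H x) \<alpha> \<beta> p = ee v G \<alpha> \<beta> p + ee v H \<alpha> \<beta> p" for G H \<alpha> \<beta> p
    by (simp add: ee_def vf_linear dg_linear rs_linear algebra_simps)
  have scale: "ee v (\<lambda>x. r * G x) \<alpha> \<beta> p = r * ee v G \<alpha> \<beta> p" for r G \<alpha> \<beta> p
    by (simp add: ee_def vf_linear dg_linear rs_linear algebra_simps)
  have "ee v G \<alpha> \<gamma> p = ee v G \<alpha> \<beta> p + ee v G \<beta> \<gamma> p" if p: "p \<in> ov \<alpha> \<beta>" "p \<in> ov \<beta> \<gamma>" for G \<alpha> \<beta> \<gamma> p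
  proof -
    have pa: "p \<in> ov \<alpha> \<alpha>" "p \<in> ov \<alpha> \<gamma>" using p by (auto simp: ov_simps)
    note u = vf_tangent[OF pa(1), of G]
    show ?thesis
      using dg_decompose[where G = G and v = v, OF p(1) u] dg_decompose[where G = G and v = v, OF p(2) u] dg_decompose[where G = G and v = v, OF pa(2) u] dg_cocycle[OF p u(1)]
      by simp
  qed
  then show ?thesis unfolding cocycle_WO_def using add scale ee_regular by (intro conjI ballI allI) auto
qed

subsection \<open>The class on the fibre square\<close>

lemma biregular_left:
  assumes "reg d \<alpha> \<alpha> f"
  shows "biregular q t Z d 0 \<alpha> \<alpha>' (\<lambda>p p'. f p)"
proof -
  obtain N m P where P: "P \<in> Form m" "int m = d + 2 * int N" "\<And>p. p \<in> ov \<alpha> \<alpha> \<Longrightarrow> f p = P p / (z \<alpha> p * z \<alpha> p) ^ N"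
    using assms unfolding regular_def by blast
  have "(\<lambda>p p'. P p * 1) \<in> BiForm m 0" by (rule BiForm_product[OF P(1) Form_const])
  then show ?thesis unfolding biregular_def using P(2,3)
    by (intro exI[of _ "2 * N"] exI[of _ 0] exI[of _ m] bexI[of _ "\<lambda>p p'. P p * 1"]) (auto simp: power_mult power2_eq_square)
qed

lemma biregular_right:
  assumes "reg d \<alpha>' \<alpha>' f"
  shows "biregular q t Z 0 d \<alpha> \<alpha>' (\<lambda>p p'. f p')"
proof -
  obtain N m P where P: "P \<in> Form m" "int m = d + 2 * int N" "\<And>p. p \<in> ov \<alpha>' \<alpha>' \<Longrightarrow> f p = P p / (z \<alpha>' p * z \<alpha>' p) ^ N"
    using assms unfolding regular_def by blast
  have "(\<lambda>p p'. 1 * P p') \<in> BiForm 0 m" by (rule BiForm_product[OF Form_const P(1)])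
  then show ?thesis unfolding biregular_def using P(2,3)
    by (intro exI[of _ 0] exI[of _ "2 * N"] exI[of _ 0] exI[of _ m] bexI[of _ "\<lambda>p p'. 1 * P p'"]) (auto simp: power_mult power2_eq_square)
qed

lemma biregular_sum:
  assumes "reg 0 \<alpha> \<alpha> f" "reg 0 \<alpha>' \<alpha>' g"
  shows "biregular q t Z 0 0 \<alpha> \<alpha>' (\<lambda>p p'. f p + g p')"
proof -
  obtain N m P where P: "P \<in> Form m" "int m = 0 + 2 * int N" "\<And>p. p \<in> ov \<alpha> \<alpha> \<Longrightarrow> f p = P p / (z \<alpha> p * z \<alpha> p) ^ N"
    using assms(1) unfolding regular_def by blast
  obtain N' m' P' where P': "P' \<in> Form m'" "int m' = 0 + 2 * int N'" "\<And>p. p \<in> ov \<alpha>' \<alpha>' \<Longrightarrow> g p = P' p / (z \<alpha>' p * z \<alpha>' p) ^ N'"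
    using assms(2) unfolding regular_def by blast
  let ?B = "\<lambda>p p'. P p * (z \<alpha>' p' * z \<alpha>' p') ^ N' + (z \<alpha> p * z \<alpha> p) ^ N * P' p'"
  have m: "m = 2 * N" "m' = 2 * N'" using P(2) P'(2) by linarith+
  have e: "a ^ (2 * n) = (a * a) ^ n" for a :: complex and n by (simp add: power_mult power2_eq_square)
  have "?B \<in> BiForm m m'"
    using m by (intro BiForm_add BiForm_product P(1) P'(1)) (simp_all add: zz_power_Form)
  moreover have "f p + g p' = ?B p p' / (z \<alpha> p ^ (2 * N) * z \<alpha>' p' ^ (2 * N'))" if "p \<in> ov \<alpha> \<alpha>" "p' \<in> ov \<alpha>' \<alpha>'" for p p'
    unfolding P(3)[OF that(1)] P'(3)[OF that(2)] e using ov_nz(1)[OF that(1)] ov_nz(1)[OF that(2)]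
    by (simp add: add_frac_eq mult.commute)
  ultimately show ?thesis unfolding biregular_def using m
    by (intro exI[of _ "2 * N"] exI[of _ "2 * N'"] exI[of _ m] exI[of _ m'] bexI[of _ ?B]) auto
qed

lemma om_section:
  "section_sq q t Z \<kappa> (\<lambda>p p' (u, u', G). om v (fst \<kappa>) p u G + om v (snd \<kappa>) p' u' G)"
proof -
  \<comment> \<open>The coefficients of \<open>om\<close>: linear in u, and linear in G through the
    lift - G w.\<close>
  let ?r = "\<lambda>\<alpha> i p. phi v \<alpha> p * rs \<alpha> p (axis i 1)"
  let ?g = "\<lambda>\<alpha> G p. phi v \<alpha> p * (G p * rs \<alpha> p (w \<alpha> p))"
  have r: "reg (-1) \<alpha> \<alpha> (?r \<alpha> i)" for \<alpha> i
    using regular_mult[OF phi_regular rs_coeff_regular] by simp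
  have g: "reg 0 \<alpha> \<alpha> (?g \<alpha> G)" if "G \<in> Form 3" for \<alpha> G
  proof -
    have "reg (-2 - 2) \<alpha> \<alpha> (\<lambda>p. rs \<alpha> p (w \<alpha> p))" by (rule rs_regular_vec(1)[OF w_regular])
    from regular_mult[OF phi_regular regular_mult[OF regular_Form[OF that] this]] show ?thesis by simp
  qed
  have e: "om v \<alpha> p u G = (\<Sum>i\<in>UNIV. ?r \<alpha> i p * u $ i) + ?g \<alpha> G p" for \<alpha> p u G
  proof -
    have "rs \<alpha> p (u - vf G \<alpha> p) = rs \<alpha> p u + G p * rs \<alpha> p (w \<alpha> p)"
      using rs_linear(3)[of \<alpha> p "- G p" "w \<alpha> p"] by (simp add: vf_def rs_linear)
    then show ?thesis unfolding om_def by (subst (asm) rs_coeffs[of \<alpha> p u]) (simp add: distrib_left sum_distrib_left mult.assoc)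
  qed
  have om0: "om v \<alpha> p p (\<lambda>_. 0) = 0" "om v \<alpha> p 0 (\<lambda>_. 0) = 0" for \<alpha> p
    by (simp_all add: om_def vf_linear rs_linear)
  show ?thesis
    unfolding section_sq_def
  proof (rule exI[of _ "\<lambda>i p p'. ?r (fst \<kappa>) i p"], rule exI[of _ "\<lambda>i p p'. ?r (snd \<kappa>) i p'"],
      rule exI[of _ "\<lambda>G p p'. ?g (fst \<kappa>) G p + ?g (snd \<kappa>) G p'"], intro conjI allI ballI impI)
    fix i show "biregular q t Z (-1) 0 (fst \<kappa>) (snd \<kappa>) (\<lambda>p p'. ?r (fst \<kappa>) i p)" by (rule biregular_left[OF r])
    show "biregular q t Z 0 (-1) (fst \<kappa>) (snd \<kappa>) (\<lambda>p p'. ?r (snd \<kappa>) i p')" by (rule biregular_right[OF r])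
  next
    fix G assume "G \<in> Form 3"
    then show "biregular q t Z 0 0 (fst \<kappa>) (snd \<kappa>) (\<lambda>p p'. ?g (fst \<kappa>) G p + ?g (snd \<kappa>) G p')"
      by (intro biregular_sum g)
  qed ((auto simp: om0; fail) | (auto simp: e algebra_simps; fail))+
qed

lemma trans_gamma_deriv:
  assumes p: "p \<in> ov \<alpha> \<beta>"
  shows "((\<lambda>s. trans_gamma Z \<alpha> \<beta> (p + s *s u)) has_field_derivative dg \<alpha> \<beta> p u * trans_gamma Z \<alpha> \<beta> p) (at 0)"
    and "trans_gamma Z \<alpha> \<beta> p \<noteq> 0"
  using DERIV_ratio[OF ov_nz(1)[OF p] cross_nonzero(2)[OF p] cross_nonzero(1)[OF p], of "z \<alpha> u" "z (fst \<beta>, snd \<alpha>) u" "z (fst \<alpha>, snd \<beta>) u"]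
    ov_nz(1)[OF p] cross_nonzero[OF p]
  by (simp_all add: trans_gamma_def trans_L1_def trans_L2_def dg_def)

lemma dlog2_trans_D:
  assumes p: "p \<in> ov (fst \<kappa>) (fst \<nu>)" and p': "p' \<in> ov (snd \<kappa>) (snd \<nu>)"
  shows "dlog2 (trans_D Z \<kappa> \<nu>) p p' u u' = dg (fst \<kappa>) (fst \<nu>) p u + dg (snd \<kappa>) (snd \<nu>) p' u'"
proof -
  let ?g = "trans_gamma Z (fst \<kappa>) (fst \<nu>)" and ?h = "trans_gamma Z (snd \<kappa>) (snd \<nu>)"
  have "((\<lambda>s. trans_D Z \<kappa> \<nu> (p + s *s u) (p' + s *s u')) has_field_derivative
     (dg (fst \<kappa>) (fst \<nu>) p u + dg (snd \<kappa>) (snd \<nu>) p' u') * (?g p * ?h p')) (at 0)"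
    unfolding trans_D_def
    by (auto intro!: derivative_eq_intros trans_gamma_deriv(1)[OF p] trans_gamma_deriv(1)[OF p'] simp: algebra_simps)
  then have "deriv (\<lambda>s. trans_D Z \<kappa> \<nu> (p + s *s u) (p' + s *s u')) 0 = (dg (fst \<kappa>) (fst \<nu>) p u + dg (snd \<kappa>) (snd \<nu>) p' u') * (?g p * ?h p')"
    by (rule DERIV_imp_deriv)
  then show ?thesis using trans_gamma_deriv(2)[OF p] trans_gamma_deriv(2)[OF p'] by (simp add: dlog2_def trans_D_def)
qed

lemma ee_dolbeault: "dolbeault_class_is q t Z (ee v)"
  unfolding dolbeault_class_is_def
proof (intro exI conjI allI ballI)
  fix \<kappa> show "section_sq q t Z \<kappa> ((\<lambda>\<kappa> p p' (u, u', G). om v (fst \<kappa>) p u G + om v (snd \<kappa>) p' u' G) \<kappa>)" by (rule om_section)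
next
  fix \<kappa> \<nu> :: "chart \<times> chart" and p p' x
  assume p: "p \<in> ov (fst \<kappa>) (fst \<nu>)" and p': "p' \<in> ov (snd \<kappa>) (snd \<nu>)" and x: "x \<in> tangent_sq q t p p'"
  obtain u u' G where [simp]: "x = (u, u', G)" by (cases x)
  have u: "ddir u q p = 0" "ddir u t p + G p = 0" "ddir u' q p' = 0" "ddir u' t p' + G p' = 0"
    using x by (auto simp: tangent_sq_def)
  show "case x of (u, u', G) \<Rightarrow> dlog2 (trans_D Z \<kappa> \<nu>) p p' u u' = ee v G (fst \<kappa>) (fst \<nu>) p + ee v G (snd \<kappa>) (snd \<nu>) p' +
        (case (u, u', G) of (u, u', G) \<Rightarrow> om v (fst \<nu>) p u G + om v (snd \<nu>) p' u' G) -
        (case (u, u', G) of (u, u', G) \<Rightarrow> om v (fst \<kappa>) p u G + om v (snd \<kappa>) p' u' G)"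
    using dg_decompose[where G = G and v = v, OF p u(1,2)] dg_decompose[where G = G and v = v, OF p' u(3,4)] by (simp add: dlog2_trans_D[OF p p'])
qed

subsection \<open>Serre duality\<close>

lemma lf_W_expand: "(\<Sum>\<gamma>\<in>UNIV. lf a (W \<gamma>) * z \<gamma> p) = lf a p"
proof -
  have "lf a p = lf a (\<Sum>\<gamma>\<in>UNIV. z \<gamma> p *s W \<gamma>)" using W_expand[of p] by simp
  then show ?thesis by (simp add: mult.commute)
qed

text \<open>The polar form of q pairs the basis vector of a chart only with that of the opposite
  chart, with value \<open>sg\<close>.\<close>

lemma sharp_eq: "sharp q a = (\<Sum>\<gamma>\<in>UNIV. lf a (W \<gamma>) *s (sg \<gamma> *s W (dd \<gamma>)))"
proof (rule sharp_unique)
  fix p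
  have "ddir (W (dd \<gamma>)) q p = sg \<gamma> * z \<gamma> p" for \<gamma> using ddir_q[of "W (dd \<gamma>)" p \<gamma>] by (simp add: z_W)
  then have "ddir (\<Sum>\<gamma>\<in>UNIV. lf a (W \<gamma>) *s (sg \<gamma> *s W (dd \<gamma>))) q p = (\<Sum>\<gamma>\<in>UNIV. lf a (W \<gamma>) * (sg \<gamma> * sg \<gamma> * z \<gamma> p))"
    by (simp add: ddir_sum[OF q_Form] ddir_linear[OF q_Form] mult.assoc del: chart_simps(25))
  then show "ddir (\<Sum>\<gamma>\<in>UNIV. lf a (W \<gamma>) *s (sg \<gamma> *s W (dd \<gamma>))) q p = lf a p"
    by (simp add: lf_W_expand)
qed

lemma ddir_sharp_t: "ddir (sharp q a) t p = (\<Sum>\<gamma>\<in>UNIV. lf a (W \<gamma>) * (sg \<gamma> * tt (dd \<gamma>) p))"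
  by (simp add: sharp_eq ddir_sum[OF t_Form] ddir_linear[OF t_Form] tt_def mult.assoc)

text \<open>The representative \<sigma>(t / dW) + \<mu>(v), with v the same linear form as in
  \<open>phi v\<close>.\<close>

definition Dl :: "vec4 \<Rightarrow> vec4 \<Rightarrow> form" where
  "Dl v a p = (1 / dW) * ddir (sharp q a) t p + lf v p * lf a p"

text \<open>The extension of \<open>tau\<close> from the coordinates to all linear forms a: a
  regular substitute for a times a logarithmic derivative.\<close>

definition kap :: "vec4 \<Rightarrow> chart \<Rightarrow> vec4 \<Rightarrow> vec4 \<Rightarrow> complex" where
  "kap a \<alpha> p u = (\<Sum>\<gamma>\<in>UNIV. lf a (W \<gamma>) * tau \<gamma> \<alpha> p u)"

lemma tau_linear: "tau \<gamma> \<alpha> p (u - v) = tau \<gamma> \<alpha> p u - tau \<gamma> \<alpha> p v"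
  by (simp add: tau_def m_linear algebra_simps)

lemma kap_linear: "kap a \<alpha> p (u - v) = kap a \<alpha> p u - kap a \<alpha> p v"
  by (simp add: kap_def tau_linear right_diff_distrib sum_subtractf)

lemma kap_tangent:
  assumes p: "p \<in> ov \<alpha> \<alpha>" and u: "u \<in> tangent_cone q t p"
  shows "kap a \<alpha> p u = (- Dl v a p + lf a p * phi v \<alpha> p) * rs \<alpha> p u"
proof -
  have "kap a \<alpha> p u = (- (1 / dW) * (\<Sum>\<gamma>\<in>UNIV. lf a (W \<gamma>) * (sg \<gamma> * tt (dd \<gamma>) p)) + (\<Sum>\<gamma>\<in>UNIV. lf a (W \<gamma>) * z \<gamma> p) * phi 0 \<alpha> p) * rs \<alpha> p u"
    unfolding kap_def tau_tangent[OF p u] sum_distrib_left sum_distrib_right sum.distrib[symmetric]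
    by (intro sum.cong refl) (simp add: algebra_simps)
  then show ?thesis
    unfolding lf_W_expand ddir_sharp_t[symmetric] Dl_def phi_def by (simp add: algebra_simps)
qed

lemma kap_difference:
  assumes p: "p \<in> ov \<alpha> \<beta>" and u: "ddir u q p = 0"
  shows "kap a \<beta> p u - kap a \<alpha> p u = lf a p * dg \<alpha> \<beta> p u"
proof -
  have "kap a \<beta> p u - kap a \<alpha> p u = (\<Sum>\<gamma>\<in>UNIV. lf a (W \<gamma>) * (z \<gamma> p * dg \<alpha> \<beta> p u))"
    unfolding kap_def tau_difference[OF p u, symmetric] by (simp add: right_diff_distrib sum_subtractf)
  also have "\<dots> = lf a p * dg \<alpha> \<beta> p u"
    unfolding lf_W_expand[of a p, symmetric] by (simp add: sum_distrib_right mult.assoc)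
  finally show ?thesis .
qed

lemma kap_regular:
  assumes u: "\<And>i. reg 1 \<alpha> \<alpha> (\<lambda>p. u p $ i)"
  shows "reg 1 \<alpha> \<alpha> (\<lambda>p. kap a \<alpha> p (u p))"
proof -
  have zu: "reg 1 \<alpha> \<alpha> (\<lambda>p. z \<beta> (u p))" for \<beta> by (rule lf_regular_vec[OF u])
  have m: "reg 0 \<alpha> \<alpha> (\<lambda>p. m1 \<alpha> p (u p))" "reg 0 \<alpha> \<alpha> (\<lambda>p. m2 \<alpha> p (u p))"
    using regular_mult[OF regular_diff[OF regular_mult[OF zu[of "hh \<alpha>"] regular_lf[of _ _ "Z \<alpha>"]] regular_mult[OF zu[of \<alpha>] regular_lf[of _ _ "Z (hh \<alpha>)"]]] regular_inverse_power[of 2]]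
      regular_mult[OF regular_diff[OF regular_mult[OF zu[of "vv \<alpha>"] regular_lf[of _ _ "Z \<alpha>"]] regular_mult[OF zu[of \<alpha>] regular_lf[of _ _ "Z (vv \<alpha>)"]]] regular_inverse_power[of 2]]
    by (simp_all add: m1_def m2_def)
  have t1: "reg 1 \<alpha> \<alpha> (\<lambda>p. if P then m1 \<alpha> p (u p) * z \<beta> p else 0)" for P \<beta>
    using regular_mult[OF m(1) regular_lf] regular_zero by (cases P) simp_all
  have t2: "reg 1 \<alpha> \<alpha> (\<lambda>p. if P then m2 \<alpha> p (u p) * z \<beta> p else 0)" for P \<beta>
    using regular_mult[OF m(2) regular_lf] regular_zero by (cases P) simp_all
  show ?thesis unfolding kap_def tau_def by (intro regular_sum regular_scale regular_diff t1 t2)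
qed

text \<open>\<open>kap\<close> at the lifts is the cochain that relates the two cup products. Its
  coboundary is split into the change of lift, tangent to the curve, and the change of chart at a
  fixed lift; the terms with \<open>phi\<close> combine with \<open>dg\<close> to a multiple of
  \<open>ee\<close>.\<close>

lemma serre_ee:
  assumes p: "p \<in> ov \<alpha> \<beta>"
  shows "ee v G \<alpha> \<beta> p * lf a p - Dl v a p * rs \<alpha> p (vf G \<beta> p - vf G \<alpha> p) = kap a \<beta> p (vf G \<beta> p) - kap a \<alpha> p (vf G \<alpha> p)"
proof -
  let ?a = "vf G \<alpha> p" and ?b = "vf G \<beta> p"
  have pa: "p \<in> ov \<alpha> \<alpha>" "p \<in> ov \<beta> \<beta>" using ov_nz(4,5)[OF p] .
  have T: "?b - ?a \<in> tangent_cone q t p" using lift_difference[OF pa(1) vf_tangent[OF pa(2)]] .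
  have "kap a \<beta> p ?b - kap a \<alpha> p ?a = kap a \<beta> p (?b - ?a) + (kap a \<beta> p ?a - kap a \<alpha> p ?a)" by (simp add: kap_linear)
  also have "\<dots> = (- Dl v a p + lf a p * phi v \<beta> p) * rs \<beta> p (?b - ?a) + lf a p * dg \<alpha> \<beta> p ?a"
    by (simp only: kap_tangent[where v = v, OF pa(2) T] kap_difference[OF p vf_tangent(1)[OF pa(1)]])
  also have "\<dots> = ee v G \<alpha> \<beta> p * lf a p - Dl v a p * rs \<alpha> p (?b - ?a)"
    unfolding ee_def rs_overlap[OF p T] by (simp add: algebra_simps)
  finally show ?thesis by simp
qed

lemma one_form_rs:
  assumes "reg 1 \<alpha> \<alpha> f"
  shows "one_form q t Z \<alpha> (\<lambda>p u. f p * rs \<alpha> p u)"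
proof -
  have "reg (-1) \<alpha> \<alpha> (\<lambda>p. f p * rs \<alpha> p (axis i 1))" for i
    using regular_mult[OF assms rs_coeff_regular] by simp
  moreover have "f p * rs \<alpha> p u = (\<Sum>i\<in>UNIV. f p * rs \<alpha> p (axis i 1) * u $ i)" for p u
    using arg_cong[OF rs_coeffs[of \<alpha> p u], of "\<lambda>x. f p * x"] by (simp only: sum_distrib_left mult.assoc)
  moreover have "f p * rs \<alpha> p p = 0" for p by (simp add: rs_linear)
  ultimately show ?thesis unfolding one_form_def
    by (intro exI[of _ "\<lambda>i p. f p * rs \<alpha> p (axis i 1)"] conjI allI ballI; blast)
qed

lemma serre_matches_ee:
  assumes \<Delta>: "\<And>a p. p \<in> curve_cone q t \<Longrightarrow> \<Delta> a p = Dl v a p"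
  shows "serre_matches q t Z (ee v) \<Delta>"
  unfolding serre_matches_def
proof (intro allI ballI exI conjI)
  fix a G assume G: "G \<in> Form 3"
  show "KS_lift q t Z G (vf G)" by (rule KS_lift_vf[OF G])
  show "cohomologous_K q t Z (\<lambda>\<alpha> \<beta> p u. ee v G \<alpha> \<beta> p * (lf a p * residue_form q t p u))
       (\<lambda>\<alpha> \<beta> p u. \<Delta> a p * residue_form q t p (vf G \<beta> p - vf G \<alpha> p) * residue_form q t p u)"
    unfolding cohomologous_K_def
  proof (intro exI conjI allI ballI)
    fix \<alpha> show "one_form q t Z \<alpha> ((\<lambda>\<alpha> p u. kap a \<alpha> p (vf G \<alpha> p) * rs \<alpha> p u) \<alpha>)"
      by (intro one_form_rs kap_regular vf_regular G)
  next
    fix \<alpha> \<beta> p u assume p: "p \<in> ov \<alpha> \<beta>" and u: "u \<in> tangent_cone q t p"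
    have pa: "p \<in> ov \<alpha> \<alpha>" "p \<in> ov \<beta> \<beta>" using ov_nz(4,5)[OF p] .
    have T: "vf G \<beta> p - vf G \<alpha> p \<in> tangent_cone q t p" using lift_difference[OF pa(1) vf_tangent[OF pa(2)]] .
    have "(ee v G \<alpha> \<beta> p * lf a p - Dl v a p * rs \<alpha> p (vf G \<beta> p - vf G \<alpha> p)) * rs \<alpha> p u
      = kap a \<beta> p (vf G \<beta> p) * rs \<beta> p u - kap a \<alpha> p (vf G \<alpha> p) * rs \<alpha> p u"
      unfolding serre_ee[OF p] rs_overlap[OF p u] by (simp add: left_diff_distrib)
    then show "ee v G \<alpha> \<beta> p * (lf a p * residue_form q t p u) - \<Delta> a p * residue_form q t p (vf G \<beta> p - vf G \<alpha> p) * residue_form q t p u =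
      kap a \<beta> p (vf G \<beta> p) * rs \<beta> p u - kap a \<alpha> p (vf G \<alpha> p) * rs \<alpha> p u"
      unfolding residue_chart[OF pa(1) u] residue_chart[OF pa(1) T] \<Delta>[OF ov_nz(3)[OF p]] by (simp add: algebra_simps)
  qed
qed

lemma inf_invariant_memI:
  assumes "\<Delta> \<in> HomVS2" "\<And>a p. p \<in> curve_cone q t \<Longrightarrow> \<Delta> a p = Dl v a p"
  shows "\<Delta> \<in> inf_invariant q t Z"
  unfolding inf_invariant_def using assms ee_cocycle ee_dolbeault serre_matches_ee by blast

end

section \<open>Nondegeneracy of the pairing with cubics\<close>

lemma coeff_laurent_of_11:
  "lcoeff (laurent_of 1 1 g) (a, b) = (if 0 \<le> a \<and> 0 \<le> b then coeff (coeff g (nat b)) (nat a) else 0)"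
proof (cases "0 \<le> a \<and> 0 \<le> b")
  case True
  then show ?thesis using lookup_laurent_of[of 1 1 g "nat a" "nat b"] by simp
next
  case False
  have "(a, b) \<notin> lkeys (laurent_of 1 1 g)"
  proof
    assume "(a, b) \<in> lkeys (laurent_of 1 1 g)"
    from keys_laurent_of[OF this] False show False by auto
  qed
  then show ?thesis using False by (auto simp: in_keys_iff)
qed

lemma coeff_3_mult: "lcoeff (3 * f) k = 3 * lcoeff f k"
proof -
  have "(3 :: laurent) = 1 + (1 + 1)" by simp
  then have "3 * f = f + (f + f)" by (simp only: distrib_right mult_1_left)
  then show ?thesis by (simp only: lookup_add) simp
qed

lemma keys_laurent_of_bidegree:
  assumes "bidegree_le d g"
  shows "lkeys (laurent_of 1 1 g) \<subseteq> half_x i (int d)" "lkeys (laurent_of 1 1 g) \<subseteq> half_y i (int d)"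
proof -
  have "0 \<le> fst k \<and> fst k \<le> int d \<and> 0 \<le> snd k \<and> snd k \<le> int d" if k: "k \<in> lkeys (laurent_of 1 1 g)" for k
  proof -
    obtain a b where ab: "k = (1 * int a, 1 * int b)" "coeff (coeff g b) a \<noteq> 0" using keys_laurent_of[OF k] by blast
    have "coeff g b \<noteq> 0" using ab by auto
    then have "b \<le> d" using assms le_degree[of g b] by (auto simp: bidegree_le_def)
    moreover have "a \<le> d" using le_trans[OF le_degree[OF ab(2)]] assms by (simp add: bidegree_le_def)
    ultimately show ?thesis using ab by simp
  qed
  then show "lkeys (laurent_of 1 1 g) \<subseteq> half_x i (int d)" "lkeys (laurent_of 1 1 g) \<subseteq> half_y i (int d)"
    by (auto simp: half_x_def half_y_def)
qed

context ruled_curve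
begin

definition Tx :: laurent where "Tx = laurent_of 1 1 (dx (TP (0,0)))"
definition Ty :: laurent where "Ty = laurent_of 1 1 (pderiv (TP (0,0)))"

lemma coeff_Tx: "lcoeff Tx (a, b) = of_int (a + 1) * lcoeff TL (a + 1, b)"
proof (cases "0 \<le> a")
  case True
  then have "nat (a + 1) = Suc (nat a)" by linarith
  with True show ?thesis unfolding Tx_def TL_def coeff_laurent_of_11
    by (auto simp: coeff_pderiv of_nat_poly)
next
  case False
  then have "a = -1 \<or> \<not> 0 \<le> a + 1" by linarith
  then show ?thesis using False unfolding Tx_def TL_def coeff_laurent_of_11 by auto
qed

lemma coeff_Ty: "lcoeff Ty (a, b) = of_int (b + 1) * lcoeff TL (a, b + 1)"
proof (cases "0 \<le> b")
  case True
  then have "nat (b + 1) = Suc (nat b)" by linarith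
  with True show ?thesis unfolding Ty_def TL_def coeff_laurent_of_11
    by (auto simp: coeff_pderiv of_nat_poly)
next
  case False
  then have "b = -1 \<or> \<not> 0 \<le> b + 1" by linarith
  then show ?thesis using False unfolding Ty_def TL_def coeff_laurent_of_11 by auto
qed

text \<open>The normal bundle twisted by O(-2, 0) is O(1, 3), so modulo T the partial derivative of
  T should have x-degree at most 1 also at infinity.\<close>

lemma Bx_exists: "\<exists>B. TL dvd B - Tx \<and> (\<forall>i. lkeys B \<subseteq> half_y i 3) \<and> lkeys B \<subseteq> half_x j 1"
proof (cases "j = 0")
  case True
  have y: "lkeys Tx \<subseteq> half_y i 3" for i
    unfolding keys_subset_iff using coeff_outside[OF laurent.T_y] by (auto simp: coeff_Tx half_y_def)
  have "lkeys Tx \<subseteq> half_x 0 1"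
    unfolding Tx_def using keys_laurent_of by (fastforce simp: half_x_def)
  then show ?thesis using y True by (intro exI[of _ Tx]) simp
next
  case False
  \<comment> \<open>Subtracting (3 / x) T cancels the coefficient of x^2, the derivative of the x^3
    term. The new pole at x = 0 is harmless in a chart at infinity.\<close>
  define B where "B = Tx - 3 * (lmono (-1) 0 * TL)"
  have c: "lcoeff B (a, b) = (of_int (a + 1) - 3) * lcoeff TL (a + 1, b)" for a b
    by (simp add: B_def lookup_minus coeff_Tx coeff_mono_mult coeff_3_mult left_diff_distrib distrib_right)
  have "lkeys B \<subseteq> half_y i 3" for i
    unfolding keys_subset_iff using coeff_outside[OF laurent.T_y] by (auto simp: c half_y_def)
  moreover have "lkeys B \<subseteq> half_x j 1"
  proof -
    have "lcoeff B (a, b) = 0" if "a > 1" for a b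
    proof (cases "a = 2")
      case False
      then have "(a + 1, b) \<notin> half_x 1 3" using that by (auto simp: half_x_def)
      then show ?thesis using coeff_outside[OF laurent.T_x] by (simp add: c)
    qed (simp add: c)
    then show ?thesis unfolding keys_subset_iff using False by (auto simp: half_x_def)
  qed
  moreover have "TL dvd B - Tx" by (simp add: B_def)
  ultimately show ?thesis by blast
qed

lemma By_exists: "\<exists>B. TL dvd B - Ty \<and> (\<forall>i. lkeys B \<subseteq> half_x i 3) \<and> lkeys B \<subseteq> half_y j 1"
proof (cases "j = 0")
  case True
  have y: "lkeys Ty \<subseteq> half_x i 3" for i
    unfolding keys_subset_iff using coeff_outside[OF laurent.T_x] by (auto simp: coeff_Ty half_x_def)
  have "lkeys Ty \<subseteq> half_y 0 1"
    unfolding Ty_def using keys_laurent_of by (fastforce simp: half_y_def)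
  then show ?thesis using y True by (intro exI[of _ Ty]) simp
next
  case False
  define B where "B = Ty - 3 * (lmono 0 (-1) * TL)"
  have c: "lcoeff B (a, b) = (of_int (b + 1) - 3) * lcoeff TL (a, b + 1)" for a b
    by (simp add: B_def lookup_minus coeff_Ty coeff_mono_mult coeff_3_mult left_diff_distrib distrib_right)
  have "lkeys B \<subseteq> half_x i 3" for i
    unfolding keys_subset_iff using coeff_outside[OF laurent.T_x] by (auto simp: c half_x_def)
  moreover have "lkeys B \<subseteq> half_y j 1"
  proof -
    have "lcoeff B (a, b) = 0" if "b > 1" for a b
    proof (cases "b = 2")
      case False
      then have "(a, b + 1) \<notin> half_y 1 3" using that by (auto simp: half_y_def)
      then show ?thesis using coeff_outside[OF laurent.T_y] by (simp add: c)
    qed (simp add: c)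
    then show ?thesis unfolding keys_subset_iff using False by (auto simp: half_y_def)
  qed
  moreover have "TL dvd B - Ty" by (simp add: B_def)
  ultimately show ?thesis by blast
qed

text \<open>The x-component of the lift \<open>w\<close> in the coordinates of chart
  \<open>(0,0)\<close>. If x is inverted in \<alpha>, then dx = - x^2 d(1/x) gives the sign and the
  monomial; likewise for \<open>YL\<close> and y.\<close>

definition XL :: "chart \<Rightarrow> laurent" where
  "XL \<alpha> = (if fst \<alpha> = 0 then chart_laurent \<alpha> (-3) (-3) (fst (K \<alpha>)) else - (lmono 2 0 * chart_laurent \<alpha> (-3) (-3) (fst (K \<alpha>))))"
definition YL :: "chart \<Rightarrow> laurent" where
  "YL \<alpha> = (if snd \<alpha> = 0 then chart_laurent \<alpha> (-3) (-3) (snd (K \<alpha>)) else - (lmono 0 2 * chart_laurent \<alpha> (-3) (-3) (snd (K \<alpha>))))"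

lemma keys_lmono: "a \<le> d \<Longrightarrow> 0 \<le> a \<Longrightarrow> lkeys (lmono a b) \<subseteq> half_x i d" "b \<le> d \<Longrightarrow> 0 \<le> b \<Longrightarrow> lkeys (lmono a b) \<subseteq> half_y i d"
  by (auto simp: half_x_def half_y_def)

lemma keys_XL: "lkeys (XL \<alpha>) \<subseteq> half_x (fst \<alpha>) (-1) \<inter> half_y (snd \<alpha>) (-3)"
proof (cases "fst \<alpha> = 0")
  case True
  then show ?thesis using keys_chart_laurent[of \<alpha> "-3" "-3" "fst (K \<alpha>)"] by (simp add: XL_def half_x_def)
next
  case False
  have c: "lkeys (chart_laurent \<alpha> (-3) (-3) (fst (K \<alpha>))) \<subseteq> half_x (fst \<alpha>) (-3)" "lkeys (chart_laurent \<alpha> (-3) (-3) (fst (K \<alpha>))) \<subseteq> half_y (snd \<alpha>) (-3)"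
    using keys_chart_laurent[of \<alpha> "-3" "-3" "fst (K \<alpha>)"] by auto
  have "lkeys (XL \<alpha>) = lkeys (lmono 2 0 * chart_laurent \<alpha> (-3) (-3) (fst (K \<alpha>)))" using False by (simp add: XL_def)
  then show ?thesis
    using keys_mult_half(1)[OF keys_lmono(1)[of 2 2] c(1)] keys_mult_half(2)[OF keys_lmono(2)[of 0 0] c(2)] by simp
qed

lemma keys_YL: "lkeys (YL \<alpha>) \<subseteq> half_x (fst \<alpha>) (-3) \<inter> half_y (snd \<alpha>) (-1)"
proof (cases "snd \<alpha> = 0")
  case True
  then show ?thesis using keys_chart_laurent[of \<alpha> "-3" "-3" "snd (K \<alpha>)"] by (simp add: YL_def half_y_def)
next
  case False
  have c: "lkeys (chart_laurent \<alpha> (-3) (-3) (snd (K \<alpha>))) \<subseteq> half_x (fst \<alpha>) (-3)" "lkeys (chart_laurent \<alpha> (-3) (-3) (snd (K \<alpha>))) \<subseteq> half_y (snd \<alpha>) (-3)"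
    using keys_chart_laurent[of \<alpha> "-3" "-3" "snd (K \<alpha>)"] by auto
  have "lkeys (YL \<alpha>) = lkeys (lmono 0 2 * chart_laurent \<alpha> (-3) (-3) (snd (K \<alpha>)))" using False by (simp add: YL_def)
  then show ?thesis
    using keys_mult_half(1)[OF keys_lmono(1)[of 0 0] c(1)] keys_mult_half(2)[OF keys_lmono(2)[of 2 2] c(2)] by simp
qed

lemma m_w: "p \<in> ov \<alpha> \<alpha> \<Longrightarrow> m1 \<alpha> p (w \<alpha> p) = k1 \<alpha> p" "p \<in> ov \<alpha> \<alpha> \<Longrightarrow> m2 \<alpha> p (w \<alpha> p) = k2 \<alpha> p"
  using ov_nz(1)[of p \<alpha> \<alpha>] by (simp_all add: m1_def m2_def z_w power2_eq_square)

lemma m_base: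
  assumes p: "p \<in> ov (0,0) \<alpha>" and u: "ddir u q p = 0"
  shows "m1 (0,0) p u = (if fst \<alpha> = 0 then m1 \<alpha> p u else - (cx (0,0) p)\<^sup>2 * m1 \<alpha> p u)"
    "m2 (0,0) p u = (if snd \<alpha> = 0 then m2 \<alpha> p u else - (cy (0,0) p)\<^sup>2 * m2 \<alpha> p u)"
proof -
  note ma = m_adjacent[OF p u]
  have nz: "z (0,0) p \<noteq> 0" "z \<alpha> p \<noteq> 0" using p by (auto simp: ov_simps)
  have pp: "p \<in> ov (0,0) (0,0)" using ov_nz(4)[OF p] .
  note cc = chart_coords(1,2,3)[OF pp]
  have "\<alpha> = (0,0) \<or> \<alpha> = hh (0,0) \<or> \<alpha> = vv (0,0) \<or> \<alpha> = dd (0,0)" by (rule chart_rel)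
  then have "m1 (0,0) p u = (if fst \<alpha> = 0 then m1 \<alpha> p u else - (cx (0,0) p)\<^sup>2 * m1 \<alpha> p u) \<and>
    m2 (0,0) p u = (if snd \<alpha> = 0 then m2 \<alpha> p u else - (cy (0,0) p)\<^sup>2 * m2 \<alpha> p u)"
  proof (elim disjE)
    assume a: "\<alpha> = (0,0)"
    show ?thesis unfolding a by simp
  next
    assume a: "\<alpha> = hh (0,0)"
    have "cx (0,0) p \<noteq> 0" using nz a by auto
    moreover have "fst \<alpha> = 1" "snd \<alpha> = 0" using a by (simp_all add: hh_def)
    ultimately show ?thesis using ma(1)[OF a] by simp
  next
    assume a: "\<alpha> = vv (0,0)"
    have "cy (0,0) p \<noteq> 0" using nz a by auto
    moreover have "fst \<alpha> = 0" "snd \<alpha> = 1" using a by (simp_all add: vv_def)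
    ultimately show ?thesis using ma(2)[OF a] by simp
  next
    assume a: "\<alpha> = dd (0,0)"
    have "cx (0,0) p \<noteq> 0" "cy (0,0) p \<noteq> 0" using nz a cc(3) by auto
    moreover have "fst \<alpha> = 1" "snd \<alpha> = 1" using a by (simp_all add: dd_def)
    ultimately show ?thesis using ma(3)[OF a] by simp
  qed
  then show "m1 (0,0) p u = (if fst \<alpha> = 0 then m1 \<alpha> p u else - (cx (0,0) p)\<^sup>2 * m1 \<alpha> p u)"
    "m2 (0,0) p u = (if snd \<alpha> = 0 then m2 \<alpha> p u else - (cy (0,0) p)\<^sup>2 * m2 \<alpha> p u)" by blast+
qed

lemma lev_XL_YL:
  assumes xy: "x \<noteq> 0" "y \<noteq> 0" "t (ch (0,0) x y) = 0"
  shows "lev x y (XL \<alpha>) = m1 (0,0) (ch (0,0) x y) (w \<alpha> (ch (0,0) x y))"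
    "lev x y (YL \<alpha>) = m2 (0,0) (ch (0,0) x y) (w \<alpha> (ch (0,0) x y))"
proof -
  let ?p = "ch (0,0) x y"
  have p: "?p \<in> ov (0,0) \<alpha>" "?p \<in> ov \<alpha> \<alpha>" by (rule ch0_overlap[OF xy])+
  have "k1 \<alpha> p = z \<alpha> p powi (-3) * poly2 (fst (K \<alpha>)) (cx \<alpha> p) (cy \<alpha> p)" "k2 \<alpha> p = z \<alpha> p powi (-3) * poly2 (snd (K \<alpha>)) (cx \<alpha> p) (cy \<alpha> p)" for p
    by (simp_all add: k1_def k2_def power_int_minus divide_inverse)
  then have k: "lev x y (chart_laurent \<alpha> (-3) (-3) (fst (K \<alpha>))) = k1 \<alpha> ?p" "lev x y (chart_laurent \<alpha> (-3) (-3) (snd (K \<alpha>))) = k2 \<alpha> ?p"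
    using lev_chart_function[OF _ xy, of \<alpha> "k1 \<alpha>" "-3" "fst (K \<alpha>)"] lev_chart_function[OF _ xy, of \<alpha> "k2 \<alpha>" "-3" "snd (K \<alpha>)"] by blast+
  have c: "cx (0,0) ?p = x" "cy (0,0) ?p = y" by simp_all
  note mb = m_base[OF p(1) ddir_w(1)[of \<alpha> ?p], unfolded m_w[OF p(2)] c]
  show "lev x y (XL \<alpha>) = m1 (0,0) (ch (0,0) x y) (w \<alpha> (ch (0,0) x y))"
    "lev x y (YL \<alpha>) = m2 (0,0) (ch (0,0) x y) (w \<alpha> (ch (0,0) x y))"
    unfolding mb using xy by (simp_all add: XL_def YL_def k)
qed

lemma base_unit:
  assumes p: "p \<in> ov (0,0) \<alpha>"
  shows "f1 (0,0) p * m1 (0,0) p (w \<alpha> p) + f2 (0,0) p * m2 (0,0) p (w \<alpha> p) = 1"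
proof -
  have pc: "q p = 0" "t p = 0" "z (0,0) p \<noteq> 0" using p by (auto simp: ov_simps curve_cone_def)
  let ?u = "w \<alpha> p"
  have "ddir ?u t p = 1" by (rule ddir_w(2)[OF ov_nz(5)[OF p]])
  moreover have "ddir ?u t p = ddir ((z (0,0) ?u / z (0,0) p) *s p + m1 (0,0) p ?u *s xi1 (0,0) p + m2 (0,0) p ?u *s xi2 (0,0) p) t p"
    using tangent_quadric[OF pc(1,3) ddir_w(1)] by simp
  ultimately show ?thesis using ddir_euler[OF t_Form, of p] pc(2)
    by (simp add: ddir_linear[OF t_Form] ddir_xi mult.commute)
qed

text \<open>Two lifts differ by s (f2, -f1). The determinant of the two then equals s times the
  derivative of t along one lift, which is 1.\<close>

lemma base_residue:
  assumes p: "p \<in> ov (0,0) \<alpha>" "p \<in> ov (0,0) \<beta>" and z1: "z (0,0) p = 1"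
  shows "rs \<alpha> p (w \<beta> p - w \<alpha> p) = dW * (m1 (0,0) p (w \<beta> p) * m2 (0,0) p (w \<alpha> p) - m1 (0,0) p (w \<alpha> p) * m2 (0,0) p (w \<beta> p))"
proof -
  let ?u = "w \<beta> p - w \<alpha> p"
  have pa: "p \<in> ov \<alpha> \<alpha>" "p \<in> ov \<beta> \<beta>" "p \<in> ov (0,0) (0,0)" using ov_nz(4,5)[OF p(1)] ov_nz(5)[OF p(2)] by auto
  have T: "?u \<in> tangent_cone q t p"
    using ddir_w[where p = p] pa by (simp add: tangent_cone_def ddir_linear[OF q_Form] ddir_linear[OF t_Form])
  define s where "s = ss (0,0) p ?u"
  have "m1 (0,0) p ?u = s * f2 (0,0) p" "m2 (0,0) p ?u = - s * f1 (0,0) p"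
    using tangent_curve[OF pa(3) T] by (simp_all add: s_def)
  then have X: "m1 (0,0) p (w \<beta> p) = m1 (0,0) p (w \<alpha> p) + s * f2 (0,0) p"
    and Y: "m2 (0,0) p (w \<beta> p) = m2 (0,0) p (w \<alpha> p) - s * f1 (0,0) p"
    by (simp_all add: m_linear algebra_simps)
  have "m1 (0,0) p (w \<beta> p) * m2 (0,0) p (w \<alpha> p) - m1 (0,0) p (w \<alpha> p) * m2 (0,0) p (w \<beta> p)
    = s * (f1 (0,0) p * m1 (0,0) p (w \<alpha> p) + f2 (0,0) p * m2 (0,0) p (w \<alpha> p))"
    unfolding X Y by (simp add: algebra_simps)
  also have "\<dots> = s" using base_unit[OF p(1)] by simp
  finally have eq: "m1 (0,0) p (w \<beta> p) * m2 (0,0) p (w \<alpha> p) - m1 (0,0) p (w \<alpha> p) * m2 (0,0) p (w \<beta> p) = s" .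
  have "rs (0,0) p ?u = dW * s" by (simp add: rs_def s_def z1 sg_def)
  then show ?thesis unfolding eq rs_overlap[OF p(1) T, symmetric] .
qed

text \<open>x y is a single coordinate on the quadric. Using it min(a, b) times, the monomial has
  degree max(a, b) and is padded to degree 3 with the coordinate that is 1 on the chart.\<close>

lemma cubic_monomial:
  assumes "a \<le> 3" "b \<le> 3"
  shows "\<exists>G\<in>Form 3. \<forall>x y. G (ch (0,0) x y) = x ^ a * y ^ b"
proof -
  let ?k = "min a b"
  define G where "G p = z (dd (0,0)) p ^ ?k * (z (hh (0,0)) p ^ (a - ?k) * (z (vv (0,0)) p ^ (b - ?k) * z (0,0) p ^ (3 - max a b)))" for p
  have "G \<in> Form (?k * 1 + ((a - ?k) * 1 + ((b - ?k) * 1 + (3 - max a b) * 1)))"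
    unfolding G_def by (intro Form_mult Form_power lf_Form)
  then have "G \<in> Form 3" by (rule Form_cast) (use assms in auto)
  moreover have "G (ch (0,0) x y) = x ^ a * y ^ b" for x y
  proof (cases "a \<le> b")
    case True
    then show ?thesis by (simp add: G_def power_mult_distrib mult.assoc flip: power_add)
  next
    case False
    then show ?thesis by (simp add: G_def power_mult_distrib mult_ac flip: power_add)
  qed
  ultimately show ?thesis by blast
qed

text \<open>The statement about Laurent polynomials is applied to the restriction of E, with
  monomial cubics G. It yields that E vanishes on the whole quadric and not merely on the curve,
  hence is a multiple of q.\<close>

lemma Serre_nondegenerate:
  assumes E: "E \<in> Form 2"
    and triv: "\<And>G. G \<in> Form 3 \<Longrightarrow> \<exists>c. (\<forall>\<alpha>. reg 1 \<alpha> \<alpha> (c \<alpha>)) \<and>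
      (\<forall>\<alpha> \<beta>. \<forall>p\<in>ov \<alpha> \<beta>. E p * G p * rs \<alpha> p (w \<beta> p - w \<alpha> p) = c \<beta> p - c \<alpha> p)"
  shows "\<exists>s. \<forall>p. E p = s * q p"
proof -
  obtain g where g: "bidegree_le 2 g" "\<And>x y. E (ch (0,0) x y) = poly2 g x y"
    using Form_bilinear_poly[OF E] unfolding ch_def by blast
  define EL where "EL = laurent_of 1 1 g"
  have lev_E: "lev x y EL = E (ch (0,0) x y)" for x y by (simp add: EL_def lev_laurent_of g(2))
  have lev_T: "lev x y Tx = f1 (0,0) (ch (0,0) x y)" "lev x y Ty = f2 (0,0) (ch (0,0) x y)" for x y
    by (simp_all add: Tx_def Ty_def lev_laurent_of dx_TP dy_TP)
  have "EL = 0"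
  proof (rule laurent.cubic_pairing_nondegenerate[OF keys_XL keys_YL _ Bx_exists By_exists])
    fix \<alpha>
    show "TL dvd 1 - Tx * XL \<alpha> - Ty * YL \<alpha>"
    proof (rule TL_dvd)
      fix x y assume xy: "x \<noteq> 0" "y \<noteq> 0" "t (ch (0,0) x y) = 0"
      have "lev x y 1 = 1" using lev_single[of x y 0 1] by simp
      then show "lev x y (1 - Tx * XL \<alpha> - Ty * YL \<alpha>) = 0"
        using base_unit[OF ch0_overlap[OF xy], of \<alpha>] xy by (simp add: lev_XL_YL[OF xy] lev_T algebra_simps)
    qed
  next
    fix i show "lkeys EL \<subseteq> half_x i 2" "lkeys EL \<subseteq> half_y i 2"
      using keys_laurent_of_bidegree[OF g(1), of i] by (simp_all add: EL_def)
  next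
    fix a b :: int assume ab: "0 \<le> a" "a \<le> 3" "0 \<le> b" "b \<le> 3"
    have "nat a \<le> 3" "nat b \<le> 3" using ab by linarith+
    from cubic_monomial[OF this] obtain G where G: "G \<in> Form 3" "\<And>x y. G (ch (0,0) x y) = x ^ nat a * y ^ nat b" by blast
    obtain c where c: "\<And>\<alpha>. reg 1 \<alpha> \<alpha> (c \<alpha>)"
      "\<And>\<alpha> \<beta> p. p \<in> ov \<alpha> \<beta> \<Longrightarrow> E p * G p * rs \<alpha> p (w \<beta> p - w \<alpha> p) = c \<beta> p - c \<alpha> p"
      using triv[OF G(1)] by blast
    have "\<forall>\<alpha>. \<exists>g. \<forall>p\<in>ov \<alpha> \<alpha>. (1 / dW) * c \<alpha> p = z \<alpha> p powi 1 * poly2 g (cx \<alpha> p) (cy \<alpha> p)"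
      using regular_chart[OF regular_scale[OF c(1)]] by blast
    from choice[OF this] obtain h where "\<forall>\<alpha>. \<forall>p\<in>ov \<alpha> \<alpha>. (1 / dW) * c \<alpha> p = z \<alpha> p powi 1 * poly2 (h \<alpha>) (cx \<alpha> p) (cy \<alpha> p)" by blast
    then have h: "\<And>\<alpha> p. p \<in> ov \<alpha> \<alpha> \<Longrightarrow> (1 / dW) * c \<alpha> p = z \<alpha> p powi 1 * poly2 (h \<alpha>) (cx \<alpha> p) (cy \<alpha> p)" by blast
    define cL where "cL \<alpha> = chart_laurent \<alpha> 1 1 (h \<alpha>)" for \<alpha>
    have dvd: "TL dvd lmono a b * EL * (XL \<beta> * YL \<alpha> - XL \<alpha> * YL \<beta>) - (cL \<beta> - cL \<alpha>)" for \<alpha> \<beta>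
    proof (rule TL_dvd)
      fix x y assume xy: "x \<noteq> 0" "y \<noteq> 0" "t (ch (0,0) x y) = 0"
      let ?p = "ch (0,0) x y"
      have cc: "lev x y (cL \<alpha>) = (1 / dW) * c \<alpha> ?p" for \<alpha> unfolding cL_def by (rule lev_chart_function[OF h xy])
      have mono: "lev x y (lmono a b) = G ?p" using ab by (simp add: G(2) power_int_def)
      have r: "lev x y (XL \<beta> * YL \<alpha> - XL \<alpha> * YL \<beta>) = (1 / dW) * rs \<alpha> ?p (w \<beta> ?p - w \<alpha> ?p)"
        using base_residue[OF ch0_overlap[OF xy] ch0_overlap[OF xy], of \<alpha> \<beta>] det_nz(2) xy by (simp add: lev_XL_YL[OF xy])
      have "lev x y (lmono a b * EL * (XL \<beta> * YL \<alpha> - XL \<alpha> * YL \<beta>) - (cL \<beta> - cL \<alpha>))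
        = (1 / dW) * (E ?p * G ?p * rs \<alpha> ?p (w \<beta> ?p - w \<alpha> ?p) - (c \<beta> ?p - c \<alpha> ?p))"
        unfolding lev_diff lev_mult[OF xy(1,2)] mono lev_E cc r[unfolded lev_diff lev_mult[OF xy(1,2)]] by (simp add: algebra_simps)
      also have "\<dots> = 0" using c(2)[OF ch0_overlap[OF xy], of \<alpha> \<beta>] by simp
      finally show "lev x y (lmono a b * EL * (XL \<beta> * YL \<alpha> - XL \<alpha> * YL \<beta>) - (cL \<beta> - cL \<alpha>)) = 0" .
    qed
    show "\<exists>c. (\<forall>\<alpha>. lkeys (c \<alpha>) \<subseteq> half_x (fst \<alpha>) 1 \<inter> half_y (snd \<alpha>) 1) \<and>
        (\<forall>\<alpha> \<beta>. fst \<alpha> = fst \<beta> \<or> snd \<alpha> = snd \<beta> \<longrightarrow> TL dvd lmono a b * EL * (XL \<beta> * YL \<alpha> - XL \<alpha> * YL \<beta>) - (c \<beta> - c \<alpha>))"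
    proof (intro exI[of _ cL] conjI allI impI)
      fix \<alpha> show "lkeys (cL \<alpha>) \<subseteq> half_x (fst \<alpha>) 1 \<inter> half_y (snd \<alpha>) 1" unfolding cL_def by (rule keys_chart_laurent)
    qed (rule dvd)
  qed
  then have "g = 0"
    by (intro poly2_eqI) (metis EL_def lev_0 lev_laurent_of poly2_simps(5) power_int_1_right)
  then have "E (ch (0,0) x y) = 0" for x y by (simp add: g(2))
  then show ?thesis by (rule Form2_vanishing[OF E])
qed

section \<open>Every representative of the invariant has the expected form\<close>

lemma curve_nonempty: "\<exists>\<alpha> p. p \<in> ov \<alpha> \<alpha>"
proof -
  let ?\<alpha> = "(0,0) :: chart"
  \<comment> \<open>On the line x = 0 of the ruling the equation is a binary cubic and has a
    zero.\<close>
  have "poly (spec 0 (TP (vv ?\<alpha>))) y = y ^ 3 * poly (spec 0 (TP ?\<alpha>)) (1 / y)" if "y \<noteq> 0" for y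
    using that by (simp add: poly2_spec[symmetric] TP ch_vv Form_homogeneous[OF t_Form])
  then have "(\<exists>y. poly (spec 0 (TP ?\<alpha>)) y = 0) \<or> poly (spec 0 (TP (vv ?\<alpha>))) 0 = 0"
    by (rule binary_cubic_zero)
  then have "\<exists>\<alpha> y. t (ch \<alpha> 0 y) = 0" unfolding poly2_spec[symmetric] TP by blast
  then show ?thesis using ch_overlap by blast
qed

text \<open>A tangent vector field of the curve without zeros on the chart\<close>

definition zeta :: "chart \<Rightarrow> vec4 \<Rightarrow> vec4" where "zeta \<alpha> p = f2 \<alpha> p *s xi1 \<alpha> p - f1 \<alpha> p *s xi2 \<alpha> p"

lemma zeta_tangent: "zeta \<alpha> p \<in> tangent_cone q t p"
  by (simp add: zeta_def tangent_cone_def ddir_linear[OF q_Form] ddir_linear[OF t_Form] ddir_xi mult.commute)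

lemma zeta_rs:
  assumes "p \<in> ov \<alpha> \<alpha>"
  shows "rs \<alpha> p (zeta \<alpha> p) = sg \<alpha> * dW * (z \<alpha> p)\<^sup>2" "rs \<alpha> p (zeta \<alpha> p) \<noteq> 0"
proof -
  have nz: "z \<alpha> p \<noteq> 0" using ov_nz(1)[OF assms] .
  have "m1 \<alpha> p (zeta \<alpha> p) = f2 \<alpha> p" "m2 \<alpha> p (zeta \<alpha> p) = - f1 \<alpha> p"
    using nz by (simp_all add: m1_def m2_def zeta_def power2_eq_square)
  then have "ss \<alpha> p (zeta \<alpha> p) = 1" using k_unit[OF assms] by (simp add: ss_def algebra_simps)
  then show "rs \<alpha> p (zeta \<alpha> p) = sg \<alpha> * dW * (z \<alpha> p)\<^sup>2" by (simp add: rs_def)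
  then show "rs \<alpha> p (zeta \<alpha> p) \<noteq> 0" using nz det_nz by simp
qed

lemma zeta_regular: "reg 4 \<alpha> \<alpha> (\<lambda>p. zeta \<alpha> p $ i)"
  using regular_diff[OF regular_mult[OF regular_Form[OF f_Form(2)] xi_regular(1)] regular_mult[OF regular_Form[OF f_Form(1)] xi_regular(2)], of \<alpha> \<alpha> i \<alpha> i]
  by (simp add: zeta_def)

lemma tangent_curve_zeta:
  assumes p: "p \<in> ov \<alpha> \<alpha>" and u: "u \<in> tangent_cone q t p"
  shows "u = (z \<alpha> u / z \<alpha> p) *s p + ss \<alpha> p u *s zeta \<alpha> p"
proof -
  have "q p = 0" "z \<alpha> p \<noteq> 0" "ddir u q p = 0" using p u by (auto simp: ov_simps curve_cone_def tangent_cone_def)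
  from tangent_quadric[OF this] have "u = (z \<alpha> u / z \<alpha> p) *s p + (ss \<alpha> p u * f2 \<alpha> p) *s xi1 \<alpha> p + (- ss \<alpha> p u * f1 \<alpha> p) *s xi2 \<alpha> p"
    unfolding tangent_curve[OF p u] .
  then show ?thesis by (simp add: zeta_def vec_eq_iff algebra_simps)
qed

text \<open>A form that kills the Euler vector is determined by its value at the tangent field
  \<open>zeta\<close>. The residue of \<open>zeta\<close> is a unit on the chart, so the quotient of
  the two values is regular.\<close>

lemma form_coefficient:
  assumes A: "\<And>i::4. reg (-1) \<alpha> \<alpha> (A i)" and euler: "\<And>p. p \<in> ov \<alpha> \<alpha> \<Longrightarrow> (\<Sum>i\<in>UNIV. A i p * p $ i) = 0"
  shows "\<exists>l. reg 1 \<alpha> \<alpha> l \<and> (\<forall>p\<in>ov \<alpha> \<alpha>. \<forall>u\<in>tangent_cone q t p. (\<Sum>i\<in>UNIV. A i p * u $ i) = l p * rs \<alpha> p u)"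
proof -
  define l where "l p = (1 / (sg \<alpha> * dW)) * ((\<Sum>i\<in>UNIV. A i p * zeta \<alpha> p $ i) * (1 / z \<alpha> p ^ 2))" for p
  have "reg (-1 + 4 + - int 2) \<alpha> \<alpha> l"
    unfolding l_def[abs_def] by (intro regular_scale regular_mult regular_sum A zeta_regular regular_inverse_power)
  then have "reg 1 \<alpha> \<alpha> l" by simp
  moreover have "(\<Sum>i\<in>UNIV. A i p * u $ i) = l p * rs \<alpha> p u" if p: "p \<in> ov \<alpha> \<alpha>" and u: "u \<in> tangent_cone q t p" for p u
  proof -
    define c s where "c = z \<alpha> u / z \<alpha> p" and "s = ss \<alpha> p u"
    have e: "u = c *s p + s *s zeta \<alpha> p" unfolding c_def s_def by (rule tangent_curve_zeta[OF p u])
    have lz: "l p * (sg \<alpha> * dW * (z \<alpha> p)\<^sup>2) = (\<Sum>i\<in>UNIV. A i p * zeta \<alpha> p $ i)"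
      using ov_nz(1)[OF p] det_nz(2) by (simp add: l_def)
    have "(\<Sum>i\<in>UNIV. A i p * u $ i) = c * (\<Sum>i\<in>UNIV. A i p * p $ i) + s * (\<Sum>i\<in>UNIV. A i p * zeta \<alpha> p $ i)"
      unfolding e by (simp add: sum_distrib_left sum.distrib algebra_simps)
    also have "\<dots> = l p * rs \<alpha> p u"
      using euler[OF p] unfolding lz[symmetric] by (simp add: rs_def s_def)
    finally show ?thesis .
  qed
  ultimately show ?thesis by blast
qed

lemma one_form_coefficient:
  assumes "one_form q t Z \<alpha> \<theta>"
  shows "\<exists>l. reg 1 \<alpha> \<alpha> l \<and> (\<forall>p\<in>ov \<alpha> \<alpha>. \<forall>u\<in>tangent_cone q t p. \<theta> p u = l p * rs \<alpha> p u)"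
proof -
  obtain A where A: "\<And>i::4. reg (-1) \<alpha> \<alpha> (A i)" "\<And>p. p \<in> ov \<alpha> \<alpha> \<Longrightarrow> \<theta> p p = 0"
     "\<And>p u. p \<in> ov \<alpha> \<alpha> \<Longrightarrow> u \<in> tangent_cone q t p \<Longrightarrow> \<theta> p u = (\<Sum>i\<in>UNIV. A i p * u $ i)"
    using assms unfolding one_form_def by blast
  have "(\<Sum>i\<in>UNIV. A i p * p $ i) = 0" if "p \<in> ov \<alpha> \<alpha>" for p
    using A(2)[OF that] A(3)[OF that tangent_cone_linear(5)[OF ov_nz(3)[OF that]]] by simp
  from form_coefficient[OF A(1) this] show ?thesis using A(3) by auto
qed

lemma biregular_fix:
  assumes "biregular q t Z d d' \<alpha> \<alpha>' f" and p': "p' \<in> ov \<alpha>' \<alpha>'"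
  shows "reg d \<alpha> \<alpha> (\<lambda>p. f p p')"
proof -
  obtain N N' m m' P where P: "P \<in> BiForm m m'" "int m = d + int N"
    "\<And>p p'. p \<in> ov \<alpha> \<alpha> \<Longrightarrow> p' \<in> ov \<alpha>' \<alpha>' \<Longrightarrow> f p p' = P p p' / (z \<alpha> p ^ N * z \<alpha>' p' ^ N')"
    using assms(1) unfolding biregular_def by blast
  have "reg (int m) \<alpha> \<alpha> (\<lambda>p. P p p')" by (rule regular_Form[OF BiForm_fix[OF P(1)]])
  then have "reg (int m + - int N) \<alpha> \<alpha> (\<lambda>p. (1 / z \<alpha>' p' ^ N') * (P p p' * (1 / z \<alpha> p ^ N)))"
    by (intro regular_scale regular_mult regular_inverse_power)
  then have "reg d \<alpha> \<alpha> (\<lambda>p. (1 / z \<alpha>' p' ^ N') * (P p p' * (1 / z \<alpha> p ^ N)))"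
    by (rule regular_cast) (simp add: P(2))
  then show ?thesis by (rule regular_cong) (simp add: P(3)[OF _ p'])
qed

text \<open>With the second point fixed at p', the vector over it must still be tangent to the
  family over G; it is given the velocity of the Kodaira-Spencer lift there. What remains is a form
  along the curve, a regular multiple of the residue, and a function C depending on G.\<close>

lemma section_fix:
  assumes sec: "section_sq q t Z (\<alpha>, \<alpha>') \<omega>" and p': "p' \<in> ov \<alpha>' \<alpha>'"
  shows "\<exists>l C. reg 1 \<alpha> \<alpha> l \<and> (\<forall>G\<in>Form 3. reg 0 \<alpha> \<alpha> (C G)) \<and>
    (\<forall>p\<in>ov \<alpha> \<alpha>. \<forall>G\<in>Form 3. \<forall>u. ddir u q p = 0 \<longrightarrow> ddir u t p + G p = 0 \<longrightarrow>
       \<omega> p p' (u, vf G \<alpha>' p', G) = l p * rs \<alpha> p (u - vf G \<alpha> p) + C G p) \<and>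
    (\<forall>p\<in>ov \<alpha> \<alpha>. C (\<lambda>_. 0) p = 0)"
proof -
  obtain a b c where
    a: "\<And>i::4. biregular q t Z (- 1) 0 \<alpha> \<alpha>' (a i)" and
    b: "\<And>i::4. biregular q t Z 0 (- 1) \<alpha> \<alpha>' (b i)" and
    c: "\<And>G. G \<in> Form 3 \<Longrightarrow> biregular q t Z 0 0 \<alpha> \<alpha>' (c G)" and
    all: "\<forall>p\<in>ov \<alpha> \<alpha>. \<forall>p'\<in>ov \<alpha>' \<alpha>'.
        (\<forall>G\<in>Form 3. \<forall>H\<in>Form 3. c (\<lambda>x. G x + H x) p p' = c G p p' + c H p p') \<and>
        (\<forall>G\<in>Form 3. \<forall>r. c (\<lambda>x. r * G x) p p' = r * c G p p') \<and>
        \<omega> p p' (p, 0, \<lambda>_. 0) = 0 \<and> \<omega> p p' (0, p', \<lambda>_. 0) = 0 \<and>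
        (\<forall>(u, u', G)\<in>tangent_sq q t p p'. \<omega> p p' (u, u', G) =
           (\<Sum>i\<in>UNIV. a i p p' * u $ i) + (\<Sum>i\<in>UNIV. b i p p' * u' $ i) + c G p p')"
    using sec unfolding section_sq_def fst_conv snd_conv by blast
  have scale: "c (\<lambda>x. r * G x) p p' = r * c G p p'" if "p \<in> ov \<alpha> \<alpha>" "G \<in> Form 3" for p G r
    using all that p' by blast
  have om0: "\<omega> p p' (p, 0, \<lambda>_. 0) = 0" if "p \<in> ov \<alpha> \<alpha>" for p using all that p' by blast
  have om: "\<omega> p p' (u, u', G) = (\<Sum>i\<in>UNIV. a i p p' * u $ i) + (\<Sum>i\<in>UNIV. b i p p' * u' $ i) + c G p p'"
    if "p \<in> ov \<alpha> \<alpha>" "(u, u', G) \<in> tangent_sq q t p p'" for p u u' G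
    using all that p' by blast
  have c0: "c (\<lambda>_. 0) p p' = 0" if "p \<in> ov \<alpha> \<alpha>" for p
    using scale[OF that Form_zero, of 0] by simp
  have "(\<Sum>i\<in>UNIV. a i p p' * p $ i) = 0" if p: "p \<in> ov \<alpha> \<alpha>" for p
  proof -
    have "p \<in> tangent_cone q t p" using tangent_cone_linear(5)[OF ov_nz(3)[OF p]] .
    then have "(p, 0, \<lambda>_. 0) \<in> tangent_sq q t p p'" by (simp add: tangent_sq_def tangent_cone_def ddir_linear(4)[OF q_Form] ddir_linear(4)[OF t_Form])
    from om[OF p this] om0[OF p] c0[OF p] show ?thesis by simp
  qed
  from form_coefficient[OF biregular_fix[OF a p'] this] obtain l where
    l: "reg 1 \<alpha> \<alpha> l" "\<And>p u. p \<in> ov \<alpha> \<alpha> \<Longrightarrow> u \<in> tangent_cone q t p \<Longrightarrow> (\<Sum>i\<in>UNIV. a i p p' * u $ i) = l p * rs \<alpha> p u"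
    by blast
  define C where "C G p = (\<Sum>i\<in>UNIV. a i p p' * vf G \<alpha> p $ i) + (\<Sum>i\<in>UNIV. vf G \<alpha>' p' $ i * b i p p') + c G p p'" for G p
  have "reg 0 \<alpha> \<alpha> (C G)" if G: "G \<in> Form 3" for G
  proof -
    have "reg (-1 + 1) \<alpha> \<alpha> (\<lambda>p. \<Sum>i\<in>UNIV. a i p p' * vf G \<alpha> p $ i)"
      by (intro regular_sum regular_mult biregular_fix[OF a p'] vf_regular[OF G])
    moreover have "reg 0 \<alpha> \<alpha> (\<lambda>p. \<Sum>i\<in>UNIV. vf G \<alpha>' p' $ i * b i p p')"
      by (intro regular_sum regular_scale biregular_fix[OF b p'])
    ultimately show ?thesis unfolding C_def[abs_def]
      using regular_add[OF regular_add biregular_fix[OF c[OF G] p']] by simp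
  qed
  moreover have "\<omega> p p' (u, vf G \<alpha>' p', G) = l p * rs \<alpha> p (u - vf G \<alpha> p) + C G p"
    if p: "p \<in> ov \<alpha> \<alpha>" and G: "G \<in> Form 3" and u: "ddir u q p = 0" "ddir u t p + G p = 0" for p G u
  proof -
    have "(u, vf G \<alpha>' p', G) \<in> tangent_sq q t p p'" using u G vf_tangent[OF p', of G] by (simp add: tangent_sq_def)
    from om[OF p this] have "\<omega> p p' (u, vf G \<alpha>' p', G) = (\<Sum>i\<in>UNIV. a i p p' * (u - vf G \<alpha> p) $ i) + C G p"
      by (simp add: C_def right_diff_distrib sum_subtractf mult.commute)
    then show ?thesis using l(2)[OF p lift_difference[where G = G, OF p u]] by simp
  qed
  moreover have "C (\<lambda>_. 0) p = 0" if "p \<in> ov \<alpha> \<alpha>" for p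
    using c0[OF that] by (simp add: C_def vf_linear)
  ultimately show ?thesis using l(1) by blast
qed

lemma Dl_Form: "Dl v a \<in> Form 2"
proof -
  have "(\<lambda>p. lf v p * lf a p) \<in> Form 2" by (rule Form_cast[OF Form_mult[OF lf_Form lf_Form]]) simp
  moreover have "ddir (sharp q a) t \<in> Form 2" using ddir_Form[OF t_Form, of "sharp q a"] by simp
  ultimately show ?thesis unfolding Dl_def[abs_def] by (intro Form_add Form_scale)
qed

text \<open>The equation on C x C is restricted to the slice through a fixed point p0. For G = 0 it
  shows that the local forms are those of \<open>phi v\<close> for one linear form v; for general G
  it then shows that e and \<open>ee v\<close> differ by a coboundary.\<close>

lemma dolbeault_ee:
  assumes coc: "cocycle_WO q t Z e" and dol: "dolbeault_class_is q t Z e"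
  shows "\<exists>v lam. (\<forall>G\<in>Form 3. (\<forall>\<alpha>. reg 0 \<alpha> \<alpha> (lam G \<alpha>)) \<and>
     (\<forall>\<alpha> \<beta>. \<forall>p\<in>ov \<alpha> \<beta>. e G \<alpha> \<beta> p = ee v G \<alpha> \<beta> p + lam G \<alpha> p - lam G \<beta> p))"
proof -
  obtain \<alpha>0 p0 where p0: "p0 \<in> ov \<alpha>0 \<alpha>0" using curve_nonempty by blast
  obtain \<omega> where sec: "\<And>\<kappa>. section_sq q t Z \<kappa> (\<omega> \<kappa>)" and
    eq: "\<And>\<kappa> \<nu> p p' u u' G. p \<in> ov (fst \<kappa>) (fst \<nu>) \<Longrightarrow> p' \<in> ov (snd \<kappa>) (snd \<nu>) \<Longrightarrow> (u, u', G) \<in> tangent_sq q t p p' \<Longrightarrow>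
          dlog2 (trans_D Z \<kappa> \<nu>) p p' u u' = e G (fst \<kappa>) (fst \<nu>) p + e G (snd \<kappa>) (snd \<nu>) p' + \<omega> \<nu> p p' (u, u', G) - \<omega> \<kappa> p p' (u, u', G)"
    using dol unfolding dolbeault_class_is_def by blast
  have "\<forall>\<alpha>. \<exists>lC. reg 1 \<alpha> \<alpha> (fst lC) \<and> (\<forall>G\<in>Form 3. reg 0 \<alpha> \<alpha> (snd lC G)) \<and>
    (\<forall>p\<in>ov \<alpha> \<alpha>. \<forall>G\<in>Form 3. \<forall>u. ddir u q p = 0 \<longrightarrow> ddir u t p + G p = 0 \<longrightarrow>
       \<omega> (\<alpha>, \<alpha>0) p p0 (u, vf G \<alpha>0 p0, G) = fst lC p * rs \<alpha> p (u - vf G \<alpha> p) + snd lC G p) \<and>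
    (\<forall>p\<in>ov \<alpha> \<alpha>. snd lC (\<lambda>_. 0) p = 0)"
  proof
    fix \<alpha>
    from section_fix[OF sec p0, of \<alpha>] obtain l C where "reg 1 \<alpha> \<alpha> l \<and> (\<forall>G\<in>Form 3. reg 0 \<alpha> \<alpha> (C G)) \<and>
    (\<forall>p\<in>ov \<alpha> \<alpha>. \<forall>G\<in>Form 3. \<forall>u. ddir u q p = 0 \<longrightarrow> ddir u t p + G p = 0 \<longrightarrow>
       \<omega> (\<alpha>, \<alpha>0) p p0 (u, vf G \<alpha>0 p0, G) = l p * rs \<alpha> p (u - vf G \<alpha> p) + C G p) \<and>
    (\<forall>p\<in>ov \<alpha> \<alpha>. C (\<lambda>_. 0) p = 0)" by blast
    then show "\<exists>lC. reg 1 \<alpha> \<alpha> (fst lC) \<and> (\<forall>G\<in>Form 3. reg 0 \<alpha> \<alpha> (snd lC G)) \<and>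
    (\<forall>p\<in>ov \<alpha> \<alpha>. \<forall>G\<in>Form 3. \<forall>u. ddir u q p = 0 \<longrightarrow> ddir u t p + G p = 0 \<longrightarrow>
       \<omega> (\<alpha>, \<alpha>0) p p0 (u, vf G \<alpha>0 p0, G) = fst lC p * rs \<alpha> p (u - vf G \<alpha> p) + snd lC G p) \<and>
    (\<forall>p\<in>ov \<alpha> \<alpha>. snd lC (\<lambda>_. 0) p = 0)" by (intro exI[of _ "(l, C)"]) simp
  qed
  from choice[OF this] obtain lC where lC: "\<forall>\<alpha>. reg 1 \<alpha> \<alpha> (fst (lC \<alpha>)) \<and> (\<forall>G\<in>Form 3. reg 0 \<alpha> \<alpha> (snd (lC \<alpha>) G)) \<and>
    (\<forall>p\<in>ov \<alpha> \<alpha>. \<forall>G\<in>Form 3. \<forall>u. ddir u q p = 0 \<longrightarrow> ddir u t p + G p = 0 \<longrightarrow>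
       \<omega> (\<alpha>, \<alpha>0) p p0 (u, vf G \<alpha>0 p0, G) = fst (lC \<alpha>) p * rs \<alpha> p (u - vf G \<alpha> p) + snd (lC \<alpha>) G p) \<and>
    (\<forall>p\<in>ov \<alpha> \<alpha>. snd (lC \<alpha>) (\<lambda>_. 0) p = 0)" by blast
  define l where "l \<alpha> = fst (lC \<alpha>)" for \<alpha>
  define C where "C G \<alpha> = snd (lC \<alpha>) G" for G \<alpha>
  have l: "reg 1 \<alpha> \<alpha> (l \<alpha>)" for \<alpha> using lC unfolding l_def by blast
  have C: "reg 0 \<alpha> \<alpha> (C G \<alpha>)" if "G \<in> Form 3" for \<alpha> G using lC that unfolding C_def by blast
  have C0: "C (\<lambda>_. 0) \<alpha> p = 0" if "p \<in> ov \<alpha> \<alpha>" for \<alpha> p using lC that unfolding C_def by blast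
  have om: "\<omega> (\<alpha>, \<alpha>0) p p0 (u, vf G \<alpha>0 p0, G) = l \<alpha> p * rs \<alpha> p (u - vf G \<alpha> p) + C G \<alpha> p"
    if "p \<in> ov \<alpha> \<alpha>" "G \<in> Form 3" "ddir u q p = 0" "ddir u t p + G p = 0" for \<alpha> p G u
    using lC that unfolding l_def C_def by blast
  \<comment> \<open>In the second factor the chart does not change, so both the cocycle and the
    logarithmic derivative contribute zero there.\<close>
  have e00: "e G \<alpha>0 \<alpha>0 p0 = 0" if "G \<in> Form 3" for G
  proof -
    have "e G \<alpha>0 \<alpha>0 p0 = e G \<alpha>0 \<alpha>0 p0 + e G \<alpha>0 \<alpha>0 p0"
      using coc that p0 unfolding cocycle_WO_def by blast
    then show ?thesis by simp
  qed
  have single: "dg \<alpha> \<beta> p u = e G \<alpha> \<beta> p + (l \<beta> p * rs \<beta> p (u - vf G \<beta> p) + C G \<beta> p) - (l \<alpha> p * rs \<alpha> p (u - vf G \<alpha> p) + C G \<alpha> p)"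
    if p: "p \<in> ov \<alpha> \<beta>" and G: "G \<in> Form 3" and u: "ddir u q p = 0" "ddir u t p + G p = 0" for \<alpha> \<beta> p G u
  proof -
    have T: "(u, vf G \<alpha>0 p0, G) \<in> tangent_sq q t p p0" using u G vf_tangent[OF p0, of G] by (simp add: tangent_sq_def)
    have "dlog2 (trans_D Z (\<alpha>, \<alpha>0) (\<beta>, \<alpha>0)) p p0 u (vf G \<alpha>0 p0) = dg \<alpha> \<beta> p u + dg \<alpha>0 \<alpha>0 p0 (vf G \<alpha>0 p0)"
      using dlog2_trans_D[of p "(\<alpha>, \<alpha>0)" "(\<beta>, \<alpha>0)" p0] p p0 by simp
    also have "dg \<alpha>0 \<alpha>0 p0 (vf G \<alpha>0 p0) = 0" by (simp add: dg_def)
    finally show ?thesis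
      using eq[of p "(\<alpha>, \<alpha>0)" "(\<beta>, \<alpha>0)" p0 u "vf G \<alpha>0 p0" G] p p0 T
      unfolding fst_conv snd_conv e00[OF G] om[OF ov_nz(4)[OF p] G u] om[OF ov_nz(5)[OF p] G u] by simp
  qed
  have e0: "e (\<lambda>_. 0) \<alpha> \<beta> p = 0" if p: "p \<in> ov \<alpha> \<beta>" for \<alpha> \<beta> p
  proof -
    have "\<forall>G\<in>Form 3. \<forall>r. e (\<lambda>x. r * G x) \<alpha> \<beta> p = r * e G \<alpha> \<beta> p" using coc p unfolding cocycle_WO_def by blast
    from this[rule_format, OF Form_zero, of 0] show ?thesis by simp
  qed
  \<comment> \<open>On vectors tangent to the curve, with G = 0, both families of coefficients have
    coboundary \<open>dg\<close>. Hence their difference glues to a section of O(1), which is a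
    linear form.\<close>
  have glue: "l \<alpha> p - phi 0 \<alpha> p = l \<beta> p - phi 0 \<beta> p" if p: "p \<in> ov \<alpha> \<beta>" for \<alpha> \<beta> p
  proof -
    let ?u = "zeta \<alpha> p"
    have pa: "p \<in> ov \<alpha> \<alpha>" "p \<in> ov \<beta> \<beta>" using ov_nz(4,5)[OF p] .
    have u: "ddir ?u q p = 0" "ddir ?u t p + (\<lambda>_. 0) p = 0" using zeta_tangent by (simp_all add: tangent_cone_def)
    have "(phi 0 \<beta> p - phi 0 \<alpha> p) * rs \<alpha> p ?u = l \<beta> p * rs \<beta> p ?u - l \<alpha> p * rs \<alpha> p ?u"
      using single[OF p Form_zero u] dg_phi[OF p zeta_tangent, of \<alpha> 0] C0[OF pa(1)] C0[OF pa(2)] e0[OF p] by (simp add: vf_linear)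
    then have "((l \<alpha> p - phi 0 \<alpha> p) - (l \<beta> p - phi 0 \<beta> p)) * rs \<alpha> p ?u = 0"
      unfolding rs_overlap[OF p zeta_tangent, symmetric] by (simp add: algebra_simps)
    then show ?thesis using zeta_rs(2)[OF pa(1)] by simp
  qed
  have "\<exists>v. \<forall>\<alpha>. \<forall>p\<in>ov \<alpha> \<alpha>. l \<alpha> p - phi 0 \<alpha> p = lf v p"
    by (rule global_linear_form) (use l phi_regular regular_diff glue in blast)+
  then obtain v where "\<And>\<alpha> p. p \<in> ov \<alpha> \<alpha> \<Longrightarrow> l \<alpha> p - phi 0 \<alpha> p = lf v p" by blast
  then have v: "l \<alpha> p = phi v \<alpha> p" if "p \<in> ov \<alpha> \<alpha>" for \<alpha> p
    using that by (simp add: phi_def algebra_simps)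
  have "e G \<alpha> \<beta> p = ee v G \<alpha> \<beta> p + C G \<alpha> p - C G \<beta> p" if G: "G \<in> Form 3" and p: "p \<in> ov \<alpha> \<beta>" for G \<alpha> \<beta> p
  proof -
    have pa: "p \<in> ov \<alpha> \<alpha>" "p \<in> ov \<beta> \<beta>" using ov_nz(4,5)[OF p] .
    have "dg \<alpha> \<beta> p (vf G \<alpha> p) = e G \<alpha> \<beta> p + phi v \<beta> p * rs \<beta> p (vf G \<alpha> p - vf G \<beta> p) + C G \<beta> p - C G \<alpha> p"
      using single[where G = G, OF p G vf_tangent[where G = G, OF pa(1)]] v[OF pa(1)] v[OF pa(2)] by (simp add: rs_linear)
    then show ?thesis by (simp add: ee_def rs_linear algebra_simps)
  qed
  then show ?thesis using C by (intro exI[of _ v] exI[of _ C]) auto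
qed

text \<open>Comparing the Serre condition for \<Delta> with the one for \<open>Dl v\<close> shows
  that their difference has trivial product with the Kodaira-Spencer class of every cubic G, so
  nondegeneracy applies.\<close>

lemma inf_invariant_memD:
  assumes "\<Delta> \<in> inf_invariant q t Z"
  shows "\<exists>v s. \<forall>a p. \<Delta> a p = Dl v a p + s a * q p"
proof -
  obtain e where e: "cocycle_WO q t Z e" "dolbeault_class_is q t Z e" "serre_matches q t Z e \<Delta>" and \<Delta>: "\<Delta> \<in> HomVS2"
    using assms unfolding inf_invariant_def by blast
  obtain v lam where lam: "\<And>G \<alpha>. G \<in> Form 3 \<Longrightarrow> reg 0 \<alpha> \<alpha> (lam G \<alpha>)"
    "\<And>G \<alpha> \<beta> p. G \<in> Form 3 \<Longrightarrow> p \<in> ov \<alpha> \<beta> \<Longrightarrow> e G \<alpha> \<beta> p = ee v G \<alpha> \<beta> p + lam G \<alpha> p - lam G \<beta> p"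
    using dolbeault_ee[OF e(1,2)] by blast
  \<comment> \<open>v was obtained from e before a is chosen, so it is the same for all a and
    contributes exactly \<mu>(v).\<close>
  have "\<exists>s. \<forall>p. \<Delta> a p - Dl v a p = s * q p" for a
  proof (rule Serre_nondegenerate)
    have \<Delta>a: "\<Delta> a \<in> Form 2" using \<Delta> by (simp add: HomVS2_def)
    then show "(\<lambda>p. \<Delta> a p - Dl v a p) \<in> Form 2" by (intro Form_diff Dl_Form)
    fix G assume G: "G \<in> Form 3"
    from e(3)[unfolded serre_matches_def cohomologous_K_def, THEN spec[of _ a], THEN bspec, OF G]
    obtain v' \<theta> where KS: "KS_lift q t Z G v'" and \<theta>: "\<And>\<alpha>. one_form q t Z \<alpha> (\<theta> \<alpha>)" and
      coh: "\<And>\<alpha> \<beta> p u. p \<in> ov \<alpha> \<beta> \<Longrightarrow> u \<in> tangent_cone q t p \<Longrightarrow>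
        e G \<alpha> \<beta> p * (lf a p * residue_form q t p u) - \<Delta> a p * residue_form q t p (v' \<beta> p - v' \<alpha> p) * residue_form q t p u = \<theta> \<beta> p u - \<theta> \<alpha> p u"
      by blast
    have "\<forall>\<alpha>. \<exists>l. reg 1 \<alpha> \<alpha> l \<and> (\<forall>p\<in>ov \<alpha> \<alpha>. \<forall>u\<in>tangent_cone q t p. \<theta> \<alpha> p u = l p * rs \<alpha> p u)"
      using one_form_coefficient[OF \<theta>] by blast
    from choice[OF this] obtain T where T: "\<And>\<alpha>. reg 1 \<alpha> \<alpha> (T \<alpha>)"
      "\<And>\<alpha> p u. p \<in> ov \<alpha> \<alpha> \<Longrightarrow> u \<in> tangent_cone q t p \<Longrightarrow> \<theta> \<alpha> p u = T \<alpha> p * rs \<alpha> p u" by blast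
    have v'_reg: "reg 1 \<alpha> \<alpha> (\<lambda>p. v' \<alpha> p $ i)" and v'_tan: "p \<in> ov \<alpha> \<alpha> \<Longrightarrow> ddir (v' \<alpha> p) q p = 0 \<and> ddir (v' \<alpha> p) t p + G p = 0" for \<alpha> i p
      using KS unfolding KS_lift_def by blast+
    define d where "d \<alpha> p = v' \<alpha> p - vf G \<alpha> p" for \<alpha> p
    have d_tan: "d \<alpha> p \<in> tangent_cone q t p" if "p \<in> ov \<alpha> \<alpha>" for \<alpha> p
      unfolding d_def using lift_difference[OF that] v'_tan[OF that] by blast
    have "reg 1 \<alpha> \<alpha> (\<lambda>p. d \<alpha> p $ i)" for \<alpha> i
      unfolding d_def using regular_diff[OF v'_reg vf_regular[OF G]] by simp
    from rs_regular_vec(1)[OF this] have d_reg: "reg (-1) \<alpha> \<alpha> (\<lambda>p. rs \<alpha> p (d \<alpha> p))" for \<alpha> by simp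
    \<comment> \<open>The four terms: \<open>kap\<close> from the identity for \<open>ee\<close>,
      \<open>lam\<close> from replacing e by \<open>ee v\<close>, T from the given coboundary in K,
      and the last from replacing the lift v' by \<open>vf G\<close>.\<close>
    define c where "c \<alpha> p = - (kap a \<alpha> p (vf G \<alpha> p) - lam G \<alpha> p * lf a p - T \<alpha> p - \<Delta> a p * rs \<alpha> p (d \<alpha> p))" for \<alpha> p
    have "reg 1 \<alpha> \<alpha> (c \<alpha>)" for \<alpha>
    proof -
      have "reg (0 + 1) \<alpha> \<alpha> (\<lambda>p. lam G \<alpha> p * lf a p)" by (intro regular_mult lam G regular_lf)
      moreover have "reg (int 2 + -1) \<alpha> \<alpha> (\<lambda>p. \<Delta> a p * rs \<alpha> p (d \<alpha> p))" by (intro regular_mult regular_Form \<Delta>a d_reg)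
      ultimately show ?thesis unfolding c_def[abs_def]
        by (intro regular_uminus regular_diff kap_regular vf_regular G T(1)) simp_all
    qed
    moreover have "(\<Delta> a p - Dl v a p) * G p * rs \<alpha> p (w \<beta> p - w \<alpha> p) = c \<beta> p - c \<alpha> p" if p: "p \<in> ov \<alpha> \<beta>" for \<alpha> \<beta> p
    proof -
      have pa: "p \<in> ov \<alpha> \<alpha>" "p \<in> ov \<beta> \<beta>" using ov_nz(4,5)[OF p] .
      let ?u = "zeta \<alpha> p"
      have dd: "v' \<beta> p - v' \<alpha> p = (vf G \<beta> p - vf G \<alpha> p) + (d \<beta> p - d \<alpha> p)" by (simp add: d_def)
      have vt: "v' \<beta> p - v' \<alpha> p \<in> tangent_cone q t p"
        using v'_tan[OF pa(1)] v'_tan[OF pa(2)] by (simp add: tangent_cone_def ddir_linear[OF q_Form] ddir_linear[OF t_Form]) (metis add_right_cancel)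
      have "(e G \<alpha> \<beta> p * lf a p - \<Delta> a p * rs \<alpha> p (v' \<beta> p - v' \<alpha> p) - (T \<beta> p - T \<alpha> p)) * rs \<alpha> p ?u = 0"
        using coh[OF p zeta_tangent, of \<alpha>]
        unfolding residue_chart[OF pa(1) zeta_tangent] residue_chart[OF pa(1) vt] T(2)[OF pa(1) zeta_tangent] T(2)[OF pa(2) zeta_tangent] rs_overlap[OF p zeta_tangent, symmetric]
        by (simp add: algebra_simps)
      then have 1: "e G \<alpha> \<beta> p * lf a p - \<Delta> a p * rs \<alpha> p (v' \<beta> p - v' \<alpha> p) = T \<beta> p - T \<alpha> p"
        using zeta_rs(2)[OF pa(1)] by simp
      have 2: "rs \<alpha> p (v' \<beta> p - v' \<alpha> p) = rs \<alpha> p (vf G \<beta> p - vf G \<alpha> p) + rs \<beta> p (d \<beta> p) - rs \<alpha> p (d \<alpha> p)"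
        unfolding dd using rs_overlap[OF p d_tan[OF pa(2)]] by (simp add: rs_linear)
      have 3: "vf G \<beta> p - vf G \<alpha> p = (- G p) *s (w \<beta> p - w \<alpha> p)" by (simp add: vf_def vec_eq_iff algebra_simps)
      have 4: "rs \<alpha> p (vf G \<beta> p - vf G \<alpha> p) = - G p * rs \<alpha> p (w \<beta> p - w \<alpha> p)" unfolding 3 rs_linear(3) ..
      show ?thesis
        using 1 serre_ee[OF p, of v G a] unfolding 2 lam(2)[OF G p] 4 c_def by algebra
    qed
    ultimately show "\<exists>c. (\<forall>\<alpha>. reg 1 \<alpha> \<alpha> (c \<alpha>)) \<and> (\<forall>\<alpha> \<beta>. \<forall>p\<in>ov \<alpha> \<beta>. (\<Delta> a p - Dl v a p) * G p * rs \<alpha> p (w \<beta> p - w \<alpha> p) = c \<beta> p - c \<alpha> p)"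
      by blast
  qed
  then have "\<forall>a. \<exists>s. \<forall>p. \<Delta> a p - Dl v a p = s * q p" by blast
  from choice[OF this] obtain s where "\<forall>a p. \<Delta> a p - Dl v a p = s a * q p" by blast
  then have "\<forall>a p. \<Delta> a p = Dl v a p + s a * q p" by (simp add: algebra_simps)
  then show ?thesis by blast
qed

section \<open>The invariant in closed form and its dependence on the rulings\<close>

lemma inf_invariant_eq: "inf_invariant q t Z = I1_rel q `` {sig (\<lambda>p. (1 / dW) * t p)}"
proof -
  have D: "sig (\<lambda>p. (1 / dW) * t p) a p = (1 / dW) * ddir (sharp q a) t p" for a p
    by (simp only: sig_def ddir_scale[OF t_Form])
  have F: "sig (\<lambda>p. (1 / dW) * t p) \<in> HomVS2" by (rule sig_HomVS2[OF Form_scale[OF t_Form]])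
  show ?thesis
  proof (intro equalityI subsetI)
    fix \<Delta> assume \<Delta>: "\<Delta> \<in> inf_invariant q t Z"
    then obtain v s where e: "\<And>a p. \<Delta> a p = Dl v a p + s a * q p" using inf_invariant_memD by blast
    have "sig (\<lambda>p. (1 / dW) * t p) a p - \<Delta> a p = lf (- v) p * lf a p + (- s a) * q p" for a p
      unfolding D e Dl_def by (simp add: algebra_simps)
    moreover have "\<Delta> \<in> HomVS2" using \<Delta> by (simp add: inf_invariant_def)
    ultimately have "(sig (\<lambda>p. (1 / dW) * t p), \<Delta>) \<in> I1_rel q"
      using F by (intro I1_relI[where s="\<lambda>a. - s a"])
    then show "\<Delta> \<in> I1_rel q `` {sig (\<lambda>p. (1 / dW) * t p)}" by simp
  next
    fix \<Delta> assume "\<Delta> \<in> I1_rel q `` {sig (\<lambda>p. (1 / dW) * t p)}"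
    then have "\<Delta> \<in> HomVS2" and "\<exists>v s. \<forall>a p. sig (\<lambda>p. (1 / dW) * t p) a p - \<Delta> a p = lf v p * lf a p + s a * q p"
      by (auto simp: I1_rel_def)
    then obtain v s where e: "\<And>a p. sig (\<lambda>p. (1 / dW) * t p) a p - \<Delta> a p = lf v p * lf a p + s a * q p" by blast
    show "\<Delta> \<in> inf_invariant q t Z"
    proof (rule inf_invariant_memI[of _ "- v"])
      fix a p assume "p \<in> curve_cone q t"
      then have "q p = 0" by (simp add: curve_cone_def)
      then show "\<Delta> a p = Dl (- v) a p" using e[of a p] unfolding D Dl_def by (simp add: algebra_simps)
    qed fact
  qed
qed

lemma gram_det: "det (\<chi> i j. ddir (axis i 1) q (axis j 1) :: complex^4^4) = (det (chart_matrix Z))\<^sup>2"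
proof -
  \<comment> \<open>The Gram matrix of the polar form of q in the coordinates \<open>Z\<close>, in
    the order of \<open>chart_matrix\<close>; it is the same for every choice of
    \<open>Z\<close>.\<close>
  define J :: "complex^4^4" where "J = vector [vector [0,0,0,1], vector [0,0,-1,0], vector [0,-1,0,0], vector [1,0,0,0]]"
  have "(\<chi> i j. ddir (axis i 1) q (axis j 1)) = transpose (chart_matrix Z) ** J ** chart_matrix Z"
  proof -
    have "ddir (axis i 1) q (axis j 1) = (transpose (chart_matrix Z) ** J ** chart_matrix Z) $ i $ j" for i j
      using ddir_q[of "axis i 1" "axis j 1" "(0,0)"]
      by (simp add: matrix_matrix_mult_def transpose_def sum_4 J_def chart_matrix_def sg_def hh_def vv_def dd_def algebra_simps)
    then show ?thesis by (simp add: vec_eq_iff)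
  qed
  moreover have "det J = 1" by (simp add: J_def det_4)
  ultimately show ?thesis by (simp add: det_mul det_transpose power2_eq_square)
qed

end

lemma (in ruled_curve) ruling_change:
  assumes "ruled_curve q t Z'"
  shows "inf_invariant q t Z' \<in> {inf_invariant q t Z, uminus_I1 (inf_invariant q t Z)}"
proof -
  interpret Z': ruled_curve q t Z' by fact
  have "(det (chart_matrix Z))\<^sup>2 = (det (chart_matrix Z'))\<^sup>2" using gram_det Z'.gram_det by simp
  then consider "Z'.dW = dW" | "Z'.dW = - dW"
    by (auto simp: power2_eq_iff dW_def Z'.dW_def)
  then show ?thesis
  proof cases
    case 1
    then show ?thesis by (simp add: inf_invariant_eq Z'.inf_invariant_eq)
  next
    case 2
    have "sig (\<lambda>p. (1 / dW) * t p) \<in> HomVS2" by (rule sig_HomVS2[OF Form_scale[OF t_Form]])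
    moreover have "sig (\<lambda>p. (1 / - dW) * t p) = (\<lambda>a p. - sig (\<lambda>p. (1 / dW) * t p) a p)"
      unfolding sig_def ddir_scale[OF t_Form] by (simp add: fun_eq_iff ddir_scale[OF t_Form])
    ultimately show ?thesis unfolding inf_invariant_eq Z'.inf_invariant_eq 2 by (simp add: uminus_class)
  qed
qed

section \<open>A smooth example and the open set of all canonical pairs\<close>

lemma Fermat_canonical:
  "((\<lambda>p. \<Sum>i\<in>UNIV. p $ i * p $ i), (\<lambda>p. \<Sum>i\<in>UNIV. p $ i * (p $ i * p $ i))) \<in> canonical_pairs"
proof -
  let ?q = "\<lambda>p :: vec4. \<Sum>i\<in>UNIV. p $ i * p $ i" and ?t = "\<lambda>p :: vec4. \<Sum>i\<in>UNIV. p $ i * (p $ i * p $ i)"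
  have q: "?q \<in> Form 2"
    by (intro Form_sum) (rule Form_cast[OF Form_mult[OF Form_coord Form_coord]], simp)
  have t: "?t \<in> Form 3"
    by (intro Form_sum) (rule Form_cast[OF Form_mult[OF Form_coord Form_mult[OF Form_coord Form_coord]]], simp)
  have dq: "ddir u ?q p = (\<Sum>i\<in>UNIV. 2 * p $ i * u $ i)" for u p
    unfolding ddir_def by (rule DERIV_imp_deriv) (auto intro!: derivative_eq_intros sum.cong)
  have dt: "ddir u ?t p = (\<Sum>i\<in>UNIV. 3 * p $ i * p $ i * u $ i)" for u p
    unfolding ddir_def by (rule DERIV_imp_deriv) (auto intro!: derivative_eq_intros sum.cong)
  have ax: "(\<Sum>i\<in>UNIV. f i * axis j 1 $ i) = f j" for f :: "4 \<Rightarrow> complex" and j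
    by (simp add: axis_def if_distrib[of "\<lambda>x. _ * x"] cong: if_cong)
  have "smooth_quadric ?q" unfolding smooth_quadric_def
  proof (intro conjI allI impI q)
    fix p :: vec4 assume "p \<noteq> 0"
    then obtain j where "p $ j \<noteq> 0" by (auto simp: vec_eq_iff)
    then have "ddir (axis j 1) ?q p \<noteq> 0" unfolding dq ax by simp
    then show "\<exists>u. ddir u ?q p \<noteq> 0" by blast
  qed
  moreover have "a = 0 \<and> b = 0" if p: "p \<in> curve_cone ?q ?t" and ab: "\<forall>u. a * ddir u ?q p + b * ddir u ?t p = 0" for p a b
  proof -
    have p0: "p \<noteq> 0" and qp: "?q p = 0" using p by (auto simp: curve_cone_def)
    have e: "p $ j * (2 * a + 3 * b * p $ j) = 0" for j
      using ab[rule_format, of "axis j 1"] unfolding dq dt ax by (simp add: algebra_simps)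
    obtain j where j: "p $ j \<noteq> 0" using p0 by (auto simp: vec_eq_iff)
    have "b = 0"
    proof (rule ccontr)
      assume b: "b \<noteq> 0"
      \<comment> \<open>A dependency of the differentials forces every nonzero coordinate to equal
        c. Then q(p) is the number of nonzero coordinates times c^2, which is not zero.\<close>
      define c where "c = - 2 * a / (3 * b)"
      have "p $ i = 0 \<or> p $ i = c" for i
      proof (cases "p $ i = 0")
        case False
        then have "3 * b * p $ i = - 2 * a" using e[of i] by (simp add: eq_neg_iff_add_eq_0 add.commute)
        then have "p $ i = c" unfolding c_def using b by (metis mult_eq_0_iff nonzero_mult_div_cancel_left zero_neq_numeral)
        then show ?thesis ..
      qed simp
      then have v: "p $ i * p $ i = (if p $ i \<noteq> 0 then c * c else 0)" for i by auto
      have "?q p = of_nat (card {i. p $ i \<noteq> 0}) * (c * c)"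
        unfolding v by (simp add: sum.If_cases)
      moreover have "c \<noteq> 0" using j \<open>\<And>i. p $ i = 0 \<or> p $ i = c\<close> by metis
      moreover have "card {i. p $ i \<noteq> 0} \<noteq> 0" using j by auto
      ultimately show False using qp by simp
    qed
    then show ?thesis using e[of j] j by simp
  qed
  ultimately show ?thesis using t unfolding canonical_pairs_def by blast
qed

text \<open>The set is cut out by the constant polynomial 1, and saturation under projective
  equivalence is immediate.\<close>

lemma general_locus_all: "general_locus canonical_pairs"
  unfolding general_locus_def
proof (intro conjI)
  show "canonical_pairs \<noteq> {}" using Fermat_canonical by blast
  have "(\<lambda>_. 1) \<in> param_polys" by (rule param_polys.intros)
  then show "\<exists>S\<subseteq>param_polys. canonical_pairs = {x \<in> canonical_pairs. \<exists>\<Phi>\<in>S. \<Phi> x \<noteq> 0}"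
    by (intro exI[of _ "{\<lambda>_. 1}"]) auto
qed blast

theorem theorem1p2:
  shows "\<exists>U. general_locus U \<and>
    (\<forall>(q, t)\<in>U.
       bij_betw (proj_pi q) (I13 q) (H0OQ3 q) \<and>
       (\<forall>Z. ordered_rulings q Z \<longrightarrow>
          inf_invariant q t Z \<in> I1 q \<and>
          inf_invariant q t Z \<in> I13 q \<and>
          (\<exists>c. c \<noteq> 0 \<and> proj_pi q (inf_invariant q t Z) = cubic_class q (\<lambda>p. c * t p)) \<and>
          (\<forall>Z'. ordered_rulings q Z' \<longrightarrow>
             inf_invariant q t Z' \<in> {inf_invariant q t Z, uminus_I1 (inf_invariant q t Z)})))"
proof (intro exI[of _ canonical_pairs] conjI general_locus_all, clarify, intro conjI allI impI)
  fix q t assume pair: "(q, t) \<in> canonical_pairs"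
  then interpret quadric q by unfold_locales (simp add: canonical_pairs_def)
  show "bij_betw (proj_pi q) (I13 q) (H0OQ3 q)" by (rule bij_proj_pi)
  fix Z assume "ordered_rulings q Z"
  with pair interpret ruled_curve q t Z by unfold_locales
  have F: "(\<lambda>p. (1 / dW) * t p) \<in> Form 3" by (rule Form_scale[OF t_Form])
  have inv: "inf_invariant q t Z = sigma_map q (cubic_class q (\<lambda>p. (1 / dW) * t p))"
    unfolding inf_invariant_eq sigma_map_class[OF F] ..
  show "inf_invariant q t Z \<in> I1 q"
    unfolding inf_invariant_eq I1_def by (intro quotientI sig_HomVS2 F)
  show "inf_invariant q t Z \<in> I13 q"
    unfolding inv I13_def by (intro imageI H0OQ3_I F)
  \<comment> \<open>The constant 3 / dW is three times the determinant of the coordinate matrix,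
    hence nonzero.\<close>
  have "proj_pi q (inf_invariant q t Z) = cubic_class q (\<lambda>p. (3 / dW) * t p)"
    unfolding inv proj_sigma[OF F] by (simp add: mult.assoc[symmetric])
  then show "\<exists>c. c \<noteq> 0 \<and> proj_pi q (inf_invariant q t Z) = cubic_class q (\<lambda>p. c * t p)"
    using det_nz(2) by (intro exI[of _ "3 / dW"]) simp
  show "inf_invariant q t Z' \<in> {inf_invariant q t Z, uminus_I1 (inf_invariant q t Z)}" if "ordered_rulings q Z'" for Z'
    using that pair by (intro ruling_change) unfold_locales
qed

end
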